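(* (1) The map $W_1:\mathcal L_2(L^2(\mathbb R^n))\to L^2(\mathbb R^{2n},\mu'_\lambda)$ is a Stratonovich-Weyl correspondence for the triple $(G,\pi',\mathbb R^{2n})$. (2) The map $W_1':\mathcal L_2(L^2(\mathbb R^n))\to L^2(\mathcal O(\xi_0),\nu_\lambda)$ defined by $W_1'(A)=W_1(A)\circ(\psi\circ j)^{-1}$ is a Stratonovich-Weyl correspondence for the triple $(G,\pi',\mathcal O(\xi_0))$.
   Context: Stratonovich-Weyl correspondence: let $\pi$ be a unitary representation of a Lie group $G$ on a Hilbert space $\mathcal H$, $M$ a homogeneous $G$-space with $G$-invariant measure $\mu$. A Stratonovich-Weyl correspondence for $(G,\pi,M)$ is an isomorphism $W$ from a vector space of operators on $\mathcal H$ onto a space of (generalized) functions on $M$ such that: (i) $W$ maps the identity operator to the constant function $1$; (ii) $W(A^* )=\overline{W(A)}$; (iii) $W(\pi(g)A\pi(g)^{-1})(x)=W(A)(g^{-1}\cdot x)$; (iv) $\int_MW(A)(x)W(B)(x)\,d\mu(x)=\mathrm{Tr}(AB)$. Here operators are Hilbert-Schmidt ($\mathcal L_2$), functions are identified a.e., and (i) refers to the extension of the map to the identity operator through the integral formula below. Fix integers $n,m\ge 1$ and $\lambda>0$. For $z,w\in\mathbb C^n$ put $zw:=\sum_k z_kw_k$ (bilinear), $z^2:=zz$, $|z|^2=z\bar z$, and $\omega((z,w),(z',w')):=\tfrac i2(zw'-z'w)$. Let $\alpha_1,\dots,\alpha_n$ be linear forms on $\mathbb R^m$; $t\cdot z=(e^{i\alpha_1(t)}z_1,\dots,e^{i\alpha_n(t)}z_n)$;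 $t^{-1}$ means $-t$. The generalized diamond group $G$ is $\mathbb R^m\times\mathbb C^n\times\mathbb R$ with $(t,z,c)\cdot(t',z',c')=(t+t',\,z+t\cdot z',\,c+c'+\tfrac12\omega((z,\bar z),(t\cdot z',\overline{t\cdot z'})))$. It acts on $\mathbb C^n$ by $(t,z_0,c_0)\cdot z=t\cdot z+z_0$, and on $\mathbb R^{2n}$ by transporting this action through $j:\mathbb R^{2n}\to\mathbb C^n$, $j(x,y)=x+iy$. Its Lie algebra $\mathfrak g$ consists of $(t,u,c)\in\mathbb R^m\times\mathbb C^n\times\mathbb R$ (tangent space at the identity); $(s,v,d)\in(\mathbb R^m)^*\times\mathbb C^n\times\mathbb R$ denotes the element $(t,u,c)\mapsto\langle s,t\rangle+\omega((v,\bar v),(u,\bar u))+cd$ of $\mathfrak g^*$. $\mathcal F_\lambda$ is the Hilbert space of holomorphic $f$ on $\mathbb C^n$ with $\int_{\mathbb C^n}|f(z)|^2e^{-\lambda|z|^2/2}d\mu_\lambda(z)<\infty$, $d\mu_\lambda=(2\pi)^{-n}\lambda^n\,dx\,dy$, $z=x+iy$; $\mu'_\lambda$ is the multiple of Lebesgue measure on $\mathbb R^{2n}$ with $j_*(\mu'_\lambda)=\mu_\lambda$. Fix a unitary character $\chi$ of $\mathbb R^m$ with differential $d\chi$ at $0$. The unitary representation $\pi$ of $G$ on $\mathcal F_\lambda$ is $(\pi(t,z_0,c_0)f)(z)=\chi(t)\exp(i\lambda c_0+\tfrac\lambda2\bar z_0z-\tfrac\lambda4|z_0|^2)f(t^{-1}\cdot(z-z_0))$.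 The Bargmann transform is the unitary operator $\mathcal B:L^2(\mathbb R^n)\to\mathcal F_\lambda$, $(\mathcal B\phi)(z)=(\tfrac\lambda\pi)^{n/4}\int_{\mathbb R^n}\exp(-\tfrac\lambda4z^2+\lambda zx-\tfrac\lambda2x^2)\phi(x)\,dx$, and $\pi'(g)=\mathcal B^{-1}\pi(g)\mathcal B$ on $L^2(\mathbb R^n)$. For $A$ trace class on $L^2(\mathbb R^n)$, $W_1(A)(a,b)=\mathrm{Tr}(A\,\Omega_1(a,b))$, where $(\Omega_1(a,b)\phi)(x)=2^n\exp(2i\lambda b(a-x))\phi(2a-x)$. Equivalently (known), $W_1(A)(a,b)=W_0(\mathcal BA\mathcal B^{-1})(a+ib)$, and this relation extends $W_1$ to other operators, where for an operator $B$ on $\mathcal F_\lambda$ with kernel $k_B(z,w)=\langle Be_w,e_z\rangle$, $e_z(w)=\exp(\lambda\bar zw/2)$, $$W_0(B)(z)=2^n\int_{\mathbb C^n}k_B(z+w,z-w)\exp\left(\tfrac\lambda2(-z\bar z-w\bar w+z\bar w-\bar zw)\right)d\mu_\lambda(w)$$ whenever the integral converges absolutely; on Hilbert-Schmidt operators $W_0$ is the (known) unitary map onto $L^2(\mathbb C^n,\mu_\lambda)$ extending $W_0$ continuously from trace class operators. $\psi:\mathbb C^n\to\mathfrak g^*$ is $\psi(z)=(-i\,d\chi+\tfrac12\sum_k(1-\lambda|z_k|^2)\alpha_k,\,-\lambda z,\,\lambda)$, a bijection onto the coadjoint orbit $\mathcal O(\xi_0)$ of $\xi_0=\psi(0)$;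 $\nu_\lambda=\psi_*(\mu_\lambda)$, and $G$ acts on $\mathcal O(\xi_0)$ by the coadjoint action. *)

theory Defs
  imports "HOL-Analysis.Analysis" "HOL-Algebra.Group_Action"
begin

section \<open>Complex Hilbert spaces and their operators\<close>

text \<open>Inner products are linear in the first argument; the real inner product of the library
  is the real part.\<close>

class scaleC =
  fixes scaleC :: "complex \<Rightarrow> 'a \<Rightarrow> 'a"

class cinner =
  fixes cinner :: "'a \<Rightarrow> 'a \<Rightarrow> complex"

class chilbert_space = real_inner + complete_space + scaleC + cinner +
  assumes scaleC_add_right: "scaleC a (x + y) = scaleC a x + scaleC a y"
    and scaleC_add_left: "scaleC (a + b) x = scaleC a x + scaleC b x"
    and scaleC_scaleC: "scaleC a (scaleC b x) = scaleC (a * b) x"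
    and scaleR_scaleC: "scaleR r x = scaleC (complex_of_real r) x"
    and cinner_add_left: "cinner (x + y) z = cinner x z + cinner y z"
    and cinner_scaleC_left: "cinner (scaleC a x) y = a * cinner x y"
    and cinner_commute: "cinner x y = cnj (cinner y x)"
    and inner_cinner: "inner x y = Re (cinner x y)"

definition bounded_clinear :: "('h::chilbert_space \<Rightarrow> 'h) \<Rightarrow> bool" where
  "bounded_clinear A \<longleftrightarrow> bounded_linear A \<and> (\<forall>c x. A (scaleC c x) = scaleC c (A x))"

definition is_onb :: "'h::chilbert_space set \<Rightarrow> bool" where
  "is_onb E \<longleftrightarrow>
     (\<forall>e\<in>E. \<forall>f\<in>E. cinner e f = (if e = f then 1 else 0)) \<and>
     (\<forall>x. (\<forall>e\<in>E. cinner x e = 0) \<longrightarrow> x = 0)"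

text \<open>A fixed orthonormal basis. Trace and Hilbert-Schmidt norm are defined with respect to it;
  on the operators where they are used their values do not depend on this choice.\<close>

definition some_onb :: "'h::chilbert_space set" where
  "some_onb = (SOME E. is_onb E)"

definition hilbert_schmidt :: "('h::chilbert_space \<Rightarrow> 'h) \<Rightarrow> bool" where
  "hilbert_schmidt A \<longleftrightarrow>
     bounded_clinear A \<and> (\<exists>E. is_onb E \<and> (\<lambda>e. (norm (A e))\<^sup>2) summable_on E)"

definition hs_norm :: "('h::chilbert_space \<Rightarrow> 'h) \<Rightarrow> real" where
  "hs_norm A = sqrt (\<Sum>\<^sub>\<infinity>e\<in>some_onb. (norm (A e))\<^sup>2)"

text \<open>Schatten's definition: the trace class operators are the products of two Hilbert-Schmidt
  operators.\<close>

definition trace_class :: "('h::chilbert_space \<Rightarrow> 'h) \<Rightarrow> bool" where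
  "trace_class A \<longleftrightarrow> (\<exists>B C. hilbert_schmidt B \<and> hilbert_schmidt C \<and> A = B \<circ> C)"

definition trace :: "('h::chilbert_space \<Rightarrow> 'h) \<Rightarrow> complex" where
  "trace A = (\<Sum>\<^sub>\<infinity>e\<in>some_onb. cinner (A e) e)"

definition cadjoint :: "('h::chilbert_space \<Rightarrow> 'h) \<Rightarrow> 'h \<Rightarrow> 'h" where
  "cadjoint A = (THE B. \<forall>x y. cinner (A x) y = cinner x (B y))"

definition unitary_op :: "('h::chilbert_space \<Rightarrow> 'h) \<Rightarrow> bool" where
  "unitary_op U \<longleftrightarrow>
     bounded_clinear U \<and> bij U \<and> (\<forall>x y. cinner (U x) (U y) = cinner x y)"


section \<open>Square-integrable functions\<close>

definition sqint :: "'a measure \<Rightarrow> ('a \<Rightarrow> complex) set" where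
  "sqint M = {f \<in> borel_measurable M. integrable M (\<lambda>x. (cmod (f x))\<^sup>2)}"

lemma sqint_measurable: "f \<in> sqint M \<Longrightarrow> f \<in> borel_measurable M"
  by (simp add: sqint_def)

lemma sqint_scale: "f \<in> sqint M \<Longrightarrow> (\<lambda>x. c * f x) \<in> sqint M"
  by (auto simp: sqint_def norm_mult power_mult_distrib)

lemma cmod_add_sq_le: "(cmod (a + b))\<^sup>2 \<le> 2 * (cmod a)\<^sup>2 + 2 * (cmod b)\<^sup>2"
proof -
  have "(cmod (a + b))\<^sup>2 \<le> (cmod a + cmod b)\<^sup>2"
    by (intro power_mono norm_triangle_ineq) simp
  also have "\<dots> \<le> 2 * (cmod a)\<^sup>2 + 2 * (cmod b)\<^sup>2"
    using sum_squares_bound[of "cmod a" "cmod b"] by (simp add: power2_sum)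
  finally show ?thesis .
qed

lemma sqint_add:
  assumes "f \<in> sqint M" "g \<in> sqint M"
  shows "(\<lambda>x. f x + g x) \<in> sqint M"
proof -
  have [measurable]: "f \<in> borel_measurable M" "g \<in> borel_measurable M"
    using assms by (auto simp: sqint_def)
  have "integrable M (\<lambda>x. 2 * (cmod (f x))\<^sup>2 + 2 * (cmod (g x))\<^sup>2)"
    using assms by (auto simp: sqint_def)
  then have "integrable M (\<lambda>x. (cmod (f x + g x))\<^sup>2)"
    by (rule Bochner_Integration.integrable_bound) (auto simp: cmod_add_sq_le)
  then show ?thesis by (simp add: sqint_def)
qed

lemma sqint_uminus: "f \<in> sqint M \<Longrightarrow> (\<lambda>x. - f x) \<in> sqint M"
  using sqint_scale[of f M "-1"] by simp

lemma sqint_diff: "f \<in> sqint M \<Longrightarrow> g \<in> sqint M \<Longrightarrow> (\<lambda>x. f x - g x) \<in> sqint M"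
  using sqint_add[of f M "\<lambda>x. - g x"] sqint_uminus[of g M] by simp

lemma sqint_zero: "(\<lambda>x. 0) \<in> sqint M"
  by (simp add: sqint_def)

lemma sqint_mult_cnj_integrable:
  assumes "f \<in> sqint M" "g \<in> sqint M"
  shows "integrable M (\<lambda>x. f x * cnj (g x))"
proof -
  have [measurable]: "f \<in> borel_measurable M" "g \<in> borel_measurable M"
    using assms by (auto simp: sqint_def)
  have m: "(\<lambda>x. cnj (g x)) \<in> borel_measurable M"
    by (rule borel_measurable_continuous_on) (auto intro: continuous_intros)
  have "integrable M (\<lambda>x. (cmod (f x))\<^sup>2 + (cmod (g x))\<^sup>2)"
    using assms by (auto simp: sqint_def)
  moreover have "cmod (f x * cnj (g x)) \<le> (cmod (f x))\<^sup>2 + (cmod (g x))\<^sup>2" for x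
  proof -
    have "0 \<le> cmod (f x) * cmod (g x)" by simp
    then show ?thesis
      using sum_squares_bound[of "cmod (f x)" "cmod (g x)"] unfolding norm_mult complex_mod_cnj
      by linarith
  qed
  ultimately show ?thesis
    using m by (rule_tac Bochner_Integration.integrable_bound) (auto intro!: AE_I2 order_trans[OF _ abs_ge_self])
qed

definition l2rel :: "('a::euclidean_space \<Rightarrow> complex) \<Rightarrow> ('a \<Rightarrow> complex) \<Rightarrow> bool" where
  "l2rel f g \<longleftrightarrow> f \<in> sqint lborel \<and> g \<in> sqint lborel \<and> (AE x in lborel. f x = g x)"

lemma part_equivp_l2rel: "part_equivp (l2rel :: ('a::euclidean_space \<Rightarrow> complex) \<Rightarrow> _)"
proof (rule part_equivpI)
  show "\<exists>f::'a \<Rightarrow> complex. l2rel f f"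
    using sqint_zero by (auto simp: l2rel_def)
  show "symp (l2rel :: ('a \<Rightarrow> complex) \<Rightarrow> _)"
    by (rule sympI) (auto simp: l2rel_def elim: AE_mp)
  show "transp (l2rel :: ('a \<Rightarrow> complex) \<Rightarrow> _)"
  proof (rule transpI)
    fix f g h :: "'a \<Rightarrow> complex"
    assume a: "l2rel f g" "l2rel g h"
    have "AE x in lborel. f x = g x" "AE x in lborel. g x = h x"
      using a by (auto simp: l2rel_def)
    then have "AE x in lborel. f x = h x" by eventually_elim simp
    then show "l2rel f h" using a by (auto simp: l2rel_def)
  qed
qed

text \<open>The Hilbert space of square-integrable complex functions on a Euclidean space, with respect
  to Lebesgue measure, modulo almost everywhere equality.\<close>

quotient_type (overloaded) 'a L2 = "'a::euclidean_space \<Rightarrow> complex" / partial: l2rel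
  by (rule part_equivp_l2rel)

instantiation L2 :: (euclidean_space) "{real_inner, scaleC, cinner}"
begin

lift_definition zero_L2 :: "'a L2" is "\<lambda>x. 0"
  by (simp add: l2rel_def sqint_zero)

lift_definition plus_L2 :: "'a L2 \<Rightarrow> 'a L2 \<Rightarrow> 'a L2" is "\<lambda>f g x. f x + g x"
  unfolding l2rel_def by (auto intro: sqint_add)

lift_definition uminus_L2 :: "'a L2 \<Rightarrow> 'a L2" is "\<lambda>f x. - f x"
  unfolding l2rel_def by (auto intro: sqint_uminus)

lift_definition minus_L2 :: "'a L2 \<Rightarrow> 'a L2 \<Rightarrow> 'a L2" is "\<lambda>f g x. f x - g x"
  unfolding l2rel_def by (auto intro: sqint_diff)

lift_definition scaleC_L2 :: "complex \<Rightarrow> 'a L2 \<Rightarrow> 'a L2" is "\<lambda>c f x. c * f x"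
  unfolding l2rel_def by (auto intro: sqint_scale)

lift_definition cinner_L2 :: "'a L2 \<Rightarrow> 'a L2 \<Rightarrow> complex" is
  "\<lambda>f g. \<integral>x. f x * cnj (g x) \<partial>lborel"
proof -
  fix f f' g g' :: "'a \<Rightarrow> complex"
  assume r: "l2rel f f'" "l2rel g g'"
  have i: "integrable lborel (\<lambda>x. f x * cnj (g x))" "integrable lborel (\<lambda>x. f' x * cnj (g' x))"
    using r by (auto simp: l2rel_def intro: sqint_mult_cnj_integrable)
  have "AE x in lborel. f x = f' x" "AE x in lborel. g x = g' x"
    using r by (auto simp: l2rel_def)
  then have "AE x in lborel. f x * cnj (g x) = f' x * cnj (g' x)"
    by eventually_elim simp
  then show "(\<integral>x. f x * cnj (g x) \<partial>lborel) = (\<integral>x. f' x * cnj (g' x) \<partial>lborel)"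
    using i by (intro integral_cong_AE borel_measurable_integrable)
qed

definition scaleR_L2 :: "real \<Rightarrow> 'a L2 \<Rightarrow> 'a L2" where
  "scaleR_L2 r F = scaleC (complex_of_real r) F"

definition inner_L2 :: "'a L2 \<Rightarrow> 'a L2 \<Rightarrow> real" where
  "inner_L2 F G = Re (cinner F G)"

definition norm_L2 :: "'a L2 \<Rightarrow> real" where
  "norm_L2 F = sqrt (inner F F)"

definition sgn_L2 :: "'a L2 \<Rightarrow> 'a L2" where
  "sgn_L2 F = scaleR (inverse (norm F)) F"

definition dist_L2 :: "'a L2 \<Rightarrow> 'a L2 \<Rightarrow> real" where
  "dist_L2 F G = norm (F - G)"

definition uniformity_L2 :: "('a L2 \<times> 'a L2) filter" where
  "uniformity_L2 = (INF e\<in>{0<..}. principal {(F, G). dist F G < e})"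

definition open_L2 :: "'a L2 set \<Rightarrow> bool" where
  "open_L2 U \<longleftrightarrow> (\<forall>F\<in>U. eventually (\<lambda>(F', G). F' = F \<longrightarrow> G \<in> U) uniformity)"

lemma l2rel_refl: "l2rel f f \<longleftrightarrow> f \<in> sqint lborel"
  by (auto simp: l2rel_def)

lemma cinner_self_L2: "cinner (abs_L2 f) (abs_L2 f) = complex_of_real (\<integral>x. (cmod (f x))\<^sup>2 \<partial>lborel)"
  if "f \<in> sqint lborel"
proof -
  have "cinner (abs_L2 f) (abs_L2 f) = (\<integral>x. f x * cnj (f x) \<partial>lborel)"
    using that by (simp add: cinner_L2.abs_eq l2rel_refl)
  also have "\<dots> = (\<integral>x. complex_of_real ((cmod (f x))\<^sup>2) \<partial>lborel)"
    by (simp add: complex_mult_cnj cmod_power2)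
  also have "\<dots> = complex_of_real (\<integral>x. (cmod (f x))\<^sup>2 \<partial>lborel)"
    by (rule integral_complex_of_real)
  finally show ?thesis .
qed

lemma L2_cases:
  obtains f where "f \<in> sqint lborel" "F = abs_L2 f"
proof -
  obtain f where "l2rel f f" "F = abs_L2 f"
    by (metis Quotient_rep_reflp Quotient_L2 Quotient_abs_rep)
  then show ?thesis using that by (auto simp: l2rel_refl)
qed

lemma norm_sq_abs_L2: "(norm (abs_L2 f))\<^sup>2 = (\<integral>x. (cmod (f x))\<^sup>2 \<partial>lborel)" if "f \<in> sqint lborel"
  using that by (simp add: norm_L2_def inner_L2_def cinner_self_L2)


lemma scaleC_add_right_L2: "scaleC a (F + G) = scaleC a F + scaleC a (G :: 'a L2)"
  by transfer (auto simp: l2rel_def distrib_left intro!: sqint_add sqint_scale)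

lemma scaleC_add_left_L2: "scaleC (a + b) F = scaleC a F + scaleC b (F :: 'a L2)"
  by transfer (auto simp: l2rel_def distrib_right intro!: sqint_add sqint_scale)

lemma scaleC_scaleC_L2: "scaleC a (scaleC b F) = scaleC (a * b) (F :: 'a L2)"
  by transfer (auto simp: l2rel_def mult.assoc intro!: sqint_scale)

lemma cinner_add_left_L2: "cinner (F + G) H = cinner F H + cinner G (H :: 'a L2)"
  by transfer (simp add: l2rel_refl distrib_right Bochner_Integration.integral_add
      sqint_mult_cnj_integrable)

lemma cinner_scaleC_left_L2: "cinner (scaleC a F) G = a * cinner F (G :: 'a L2)"
  by transfer (simp add: l2rel_refl mult.assoc)

lemma cinner_commute_L2: "cinner F G = cnj (cinner G (F :: 'a L2))"
  by transfer (simp add: Bochner_Integration.integral_cnj[symmetric] mult.commute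
      del: Bochner_Integration.integral_cnj)

instance
proof
  fix F G H :: "'a L2" and r s :: real
  show "F + G + H = F + (G + H)"
    by transfer (auto simp: l2rel_def add.assoc intro!: sqint_add)
  show "F + G = G + F"
    by transfer (auto simp: l2rel_def add.commute intro!: sqint_add)
  show "0 + F = F"
    by transfer (auto simp: l2rel_def)
  show "- F + F = 0"
    by transfer (auto simp: l2rel_def sqint_zero)
  show "F - G = F + - G"
    by transfer (auto simp: l2rel_def intro!: sqint_diff)
  show "scaleR r (F + G) = scaleR r F + scaleR r G"
    by (simp add: scaleR_L2_def scaleC_add_right_L2)
  show "scaleR (r + s) F = scaleR r F + scaleR s F"
    by (simp add: scaleR_L2_def scaleC_add_left_L2)
  show "scaleR r (scaleR s F) = scaleR (r * s) F"
    by (simp add: scaleR_L2_def scaleC_scaleC_L2)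
  show "scaleR 1 F = F"
    unfolding scaleR_L2_def by transfer (auto simp: l2rel_def)
  show "sgn F = scaleR (inverse (norm F)) F"
    by (rule sgn_L2_def)
  show "dist F G = norm (F - G)"
    by (rule dist_L2_def)
  show "uniformity = (INF e\<in>{0<..}. principal {(F, G :: 'a L2). dist F G < e})"
    by (rule uniformity_L2_def)
  show "open U \<longleftrightarrow> (\<forall>F\<in>U. eventually (\<lambda>(F', G). F' = F \<longrightarrow> G \<in> U) uniformity)" for U :: "'a L2 set"
    by (rule open_L2_def)
  show "inner F G = inner G F"
    unfolding inner_L2_def by (subst cinner_commute_L2) simp
  show "inner (F + G) H = inner F H + inner G H"
    unfolding inner_L2_def by (simp add: cinner_add_left_L2)
  show "inner (scaleR r F) G = r * inner F G"
    unfolding inner_L2_def scaleR_L2_def by (simp add: cinner_scaleC_left_L2)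
  show "0 \<le> inner F F"
    by (cases F rule: L2_cases) (simp add: inner_L2_def cinner_self_L2)
  show "inner F F = 0 \<longleftrightarrow> F = 0"
  proof (cases F rule: L2_cases)
    case (1 f)
    have "inner F F = 0 \<longleftrightarrow> (\<integral>x. (cmod (f x))\<^sup>2 \<partial>lborel) = 0"
      using 1 by (simp add: inner_L2_def cinner_self_L2)
    also have "\<dots> \<longleftrightarrow> (AE x in lborel. (cmod (f x))\<^sup>2 = 0)"
      using 1 by (intro integral_nonneg_eq_0_iff_AE) (auto simp: sqint_def)
    also have "\<dots> \<longleftrightarrow> l2rel f (\<lambda>x. 0)"
      using 1 by (simp add: l2rel_def sqint_zero)
    also have "\<dots> \<longleftrightarrow> F = 0"
      using 1 Quotient_rel[OF Quotient_L2, of f "\<lambda>x. 0"]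
      by (simp add: zero_L2_def l2rel_refl sqint_zero)
    finally show ?thesis .
  qed
  show "norm F = sqrt (inner F F)"
    by (rule norm_L2_def)
qed

end

instance L2 :: (euclidean_space) complete_space
proof
  fix X :: "nat \<Rightarrow> 'a L2"
  assume "Cauchy X"
  define f where "f n = rep_L2 (X n)" for n
  have fs: "f n \<in> sqint lborel" and fX: "abs_L2 (f n) = X n" for n
    using Quotient_rep_reflp[OF Quotient_L2] Quotient_abs_rep[OF Quotient_L2]
    by (auto simp: f_def l2rel_refl)
  have fm [measurable]: "f n \<in> borel_measurable lborel" for n
    using fs by (rule sqint_measurable)
  have nd: "(\<integral>\<^sup>+x. ennreal ((cmod (f m x - f n x))\<^sup>2) \<partial>lborel) = ennreal ((dist (X m) (X n))\<^sup>2)" for m n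
  proof -
    have s: "(\<lambda>x. f m x - f n x) \<in> sqint lborel" by (intro sqint_diff fs)
    have "X m - X n = abs_L2 (\<lambda>x. f m x - f n x)"
      unfolding fX[symmetric] using fs by (simp add: minus_L2.abs_eq l2rel_refl)
    then have "(dist (X m) (X n))\<^sup>2 = (\<integral>x. (cmod (f m x - f n x))\<^sup>2 \<partial>lborel)"
      using norm_sq_abs_L2[OF s] by (simp add: dist_L2_def)
    then show ?thesis
      using s by (simp add: nn_integral_eq_integral sqint_def)
  qed
  have "\<exists>N. \<forall>m\<ge>N. \<forall>n\<ge>N. dist (X m) (X n) < (1/2)^k" for k :: nat
    using metric_CauchyD[OF \<open>Cauchy X\<close>, of "(1/2)^k"] by auto
  then obtain K where K: "\<And>k m n. K k \<le> m \<Longrightarrow> K k \<le> n \<Longrightarrow> dist (X m) (X n) < (1/2)^k"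
    by metis
  define r where "r k = (\<Sum>i\<le>k. K i)" for k
  have rK: "K k \<le> r n" if "k \<le> n" for k n
    unfolding r_def by (rule member_le_sum) (use that in auto)
  define h where "h k x = 2^k * (cmod (f (r (Suc k)) x - f (r k) x))\<^sup>2" for k :: nat and x
  have hm [measurable]: "h k \<in> borel_measurable lborel" for k
    unfolding h_def by measurable
  have h0: "0 \<le> h k x" for k x by (simp add: h_def)
  have hi: "(\<integral>\<^sup>+x. ennreal (h k x) \<partial>lborel) \<le> ennreal ((1/2)^k)" for k
  proof -
    have d: "dist (X (r (Suc k))) (X (r k)) \<le> (1/2)^k"
      using K[of k "r (Suc k)" "r k"] rK by (simp add: less_imp_le)
    have "(\<integral>\<^sup>+x. ennreal (h k x) \<partial>lborel)
        = ennreal (2^k) * (\<integral>\<^sup>+x. ennreal ((cmod (f (r (Suc k)) x - f (r k) x))\<^sup>2) \<partial>lborel)"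
      unfolding h_def by (subst nn_integral_cmult[symmetric]) (auto simp: ennreal_mult)
    also have "\<dots> = ennreal (2^k * (dist (X (r (Suc k))) (X (r k)))\<^sup>2)"
      by (simp add: nd ennreal_mult)
    also have "\<dots> \<le> ennreal (2^k * ((1/2)^k)\<^sup>2)"
      using d by (intro ennreal_leI mult_left_mono power_mono) (auto simp: dist_L2_def norm_L2_def
        intro!: order_trans[OF _ d])
    also have "2^k * ((1/2)^k)\<^sup>2 = (1/2 :: real)^k"
      by (simp add: power2_eq_square power_one_over)
    finally show ?thesis .
  qed
  have "(\<integral>\<^sup>+x. (\<Sum>k. ennreal (h k x)) \<partial>lborel) = (\<Sum>k. \<integral>\<^sup>+x. ennreal (h k x) \<partial>lborel)"
    by (rule nn_integral_suminf) simp
  also have "\<dots> \<le> (\<Sum>k. ennreal ((1/2)^k))"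
    by (intro suminf_le hi) auto
  also have "\<dots> = ennreal (\<Sum>k. (1/2)^k)"
    by (rule suminf_ennreal2) auto
  also have "\<dots> < \<infinity>" by simp
  finally have "(\<integral>\<^sup>+x. (\<Sum>k. ennreal (h k x)) \<partial>lborel) \<noteq> \<infinity>" by simp
  then have "AE x in lborel. (\<Sum>k. ennreal (h k x)) \<noteq> \<infinity>"
    by (intro nn_integral_PInf_AE) auto
  then have conv: "AE x in lborel. convergent (\<lambda>k. f (r k) x)"
  proof eventually_elim
    fix x :: 'a
    assume "(\<Sum>k. ennreal (h k x)) \<noteq> \<infinity>"
    then have sh: "summable (\<lambda>k. h k x)"
      using h0 by (intro summable_suminf_not_top) auto
    define C where "C = (\<Sum>k. h k x)"
    have "C \<ge> 0" unfolding C_def by (intro suminf_nonneg sh h0)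
    have le: "norm (f (r (Suc k)) x - f (r k) x) \<le> sqrt C * (sqrt (1/2))^k" for k
    proof -
      have "h k x \<le> C"
        unfolding C_def using sum_le_suminf[OF sh, of "{k}"] h0 by auto
      then have "(cmod (f (r (Suc k)) x - f (r k) x))\<^sup>2 \<le> C * (1/2)^k"
        by (simp add: h_def power_one_over field_simps)
      then have "cmod (f (r (Suc k)) x - f (r k) x) \<le> sqrt (C * (1/2)^k)"
        by (rule real_le_rsqrt)
      then show ?thesis by (simp add: real_sqrt_mult real_sqrt_power)
    qed
    have "summable (\<lambda>k. sqrt C * (sqrt (1/2))^k)"
      by (intro summable_mult summable_geometric) (simp add: real_sqrt_divide)
    then have "summable (\<lambda>k. f (r (Suc k)) x - f (r k) x)"
      by (rule summable_comparison_test') (rule le)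
    then have "convergent (\<lambda>n. \<Sum>k<n. f (r (Suc k)) x - f (r k) x)"
      by (simp add: summable_iff_convergent)
    then have "convergent (\<lambda>n. f (r n) x - f (r 0) x)"
      by (subst (asm) sum_lessThan_telescope[where f = "\<lambda>k. f (r k) x"])
    then have "convergent (\<lambda>n. (f (r n) x - f (r 0) x) + f (r 0) x)"
      by (intro convergent_add convergent_const)
    then show "convergent (\<lambda>k. f (r k) x)" by simp
  qed
  define g where "g x = lim (\<lambda>k. f (r k) x)" for x
  have gm [measurable]: "g \<in> borel_measurable lborel"
    unfolding g_def by (rule borel_measurable_lim_metric) simp
  have lim: "AE x in lborel. (\<lambda>k. f (r k) x) \<longlonglongrightarrow> g x"
    using conv by eventually_elim (simp add: g_def convergent_LIMSEQ_iff)
  have bd: "(\<integral>\<^sup>+x. ennreal ((cmod (f m x - g x))\<^sup>2) \<partial>lborel) \<le> ennreal (((1/2)^k)\<^sup>2)"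
    if "K k \<le> m" for k m
  proof -
    have "(\<integral>\<^sup>+x. ennreal ((cmod (f m x - g x))\<^sup>2) \<partial>lborel)
        = (\<integral>\<^sup>+x. liminf (\<lambda>n. ennreal ((cmod (f m x - f (r n) x))\<^sup>2)) \<partial>lborel)"
    proof (rule nn_integral_cong_AE)
      show "AE x in lborel. ennreal ((cmod (f m x - g x))\<^sup>2)
          = liminf (\<lambda>n. ennreal ((cmod (f m x - f (r n) x))\<^sup>2))"
        using lim
      proof eventually_elim
        fix x assume "(\<lambda>k. f (r k) x) \<longlonglongrightarrow> g x"
        then have "(\<lambda>n. ennreal ((cmod (f m x - f (r n) x))\<^sup>2)) \<longlonglongrightarrow> ennreal ((cmod (f m x - g x))\<^sup>2)"
          by (intro tendsto_intros)
        then show "ennreal ((cmod (f m x - g x))\<^sup>2)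
          = liminf (\<lambda>n. ennreal ((cmod (f m x - f (r n) x))\<^sup>2))"
          by (intro lim_imp_Liminf[symmetric]) simp_all
      qed
    qed
    also have "\<dots> \<le> liminf (\<lambda>n. \<integral>\<^sup>+x. ennreal ((cmod (f m x - f (r n) x))\<^sup>2) \<partial>lborel)"
      by (rule nn_integral_liminf) simp
    also have "\<dots> = liminf (\<lambda>n. ennreal ((dist (X m) (X (r n)))\<^sup>2))"
      by (simp add: nd)
    also have "\<dots> \<le> limsup (\<lambda>n. ennreal ((dist (X m) (X (r n)))\<^sup>2))"
      by (rule Liminf_le_Limsup) simp
    also have "\<dots> \<le> ennreal (((1/2)^k)\<^sup>2)"
    proof (rule Limsup_bounded)
      show "\<forall>\<^sub>F n in sequentially. ennreal ((dist (X m) (X (r n)))\<^sup>2) \<le> ennreal (((1/2)^k)\<^sup>2)"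
        using eventually_ge_at_top[of k]
      proof eventually_elim
        fix n assume "k \<le> n"
        then have "dist (X m) (X (r n)) \<le> (1/2)^k"
          using K[of k m "r n"] that rK by (simp add: less_imp_le)
        moreover have "0 \<le> dist (X m) (X (r n))"
          by (cases "X m - X (r n)" rule: L2_cases)
             (simp add: dist_L2_def norm_L2_def inner_L2_def cinner_self_L2)
        ultimately show "ennreal ((dist (X m) (X (r n)))\<^sup>2) \<le> ennreal (((1/2)^k)\<^sup>2)"
          by (intro ennreal_leI power_mono)
      qed
    qed
    finally show ?thesis .
  qed
  have ds: "(\<lambda>x. f m x - g x) \<in> sqint lborel" if "K 0 \<le> m" for m
  proof -
    have "integrable lborel (\<lambda>x. (cmod (f m x - g x))\<^sup>2)"
      by (rule integrableI_nonneg) (use bd[OF that] in \<open>auto simp: less_top[symmetric] top_unique\<close>)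
    then show ?thesis by (simp add: sqint_def)
  qed
  have gs: "g \<in> sqint lborel"
    using sqint_diff[OF fs ds[of "K 0"], of "K 0"] by simp
  have "X \<longlonglongrightarrow> abs_L2 g"
  proof (rule metric_LIMSEQ_I)
    fix e :: real
    assume "0 < e"
    then obtain k where k: "(1/2)^k < e"
      using real_arch_pow_inv[of e "1/2"] by auto
    have "dist (X m) (abs_L2 g) < e" if m: "max (K 0) (K k) \<le> m" for m
    proof -
      have s: "(\<lambda>x. f m x - g x) \<in> sqint lborel" using ds m by simp
      have "X m - abs_L2 g = abs_L2 (\<lambda>x. f m x - g x)"
        unfolding fX[symmetric] using fs gs by (simp add: minus_L2.abs_eq l2rel_refl)
      then have "(dist (X m) (abs_L2 g))\<^sup>2 = (\<integral>x. (cmod (f m x - g x))\<^sup>2 \<partial>lborel)"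
        using norm_sq_abs_L2[OF s] by (simp add: dist_L2_def)
      moreover have "ennreal (\<integral>x. (cmod (f m x - g x))\<^sup>2 \<partial>lborel) \<le> ennreal (((1/2)^k)\<^sup>2)"
        using bd[of k m] m s by (simp add: nn_integral_eq_integral sqint_def)
      ultimately have "(dist (X m) (abs_L2 g))\<^sup>2 \<le> ((1/2)^k)\<^sup>2"
        by (simp only: ennreal_le_iff zero_le_power2)
      then have "dist (X m) (abs_L2 g) \<le> (1/2)^k"
        by (rule power2_le_imp_le) simp
      then show ?thesis using k by simp
    qed
    then show "\<exists>N. \<forall>m\<ge>N. dist (X m) (abs_L2 g) < e" by blast
  qed
  then show "convergent X" by (rule convergentI)
qed

instance L2 :: (euclidean_space) chilbert_space
proof
  fix F G H :: "'a L2" and a b :: complex and r :: real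
  show "scaleR r F = scaleC (complex_of_real r) F" by (rule scaleR_L2_def)
  show "cinner F G = cnj (cinner G F)" by (rule cinner_commute_L2)
  show "inner F G = Re (cinner F G)" by (rule inner_L2_def)
qed (simp_all add: scaleC_add_right_L2 scaleC_add_left_L2 scaleC_scaleC_L2 cinner_add_left_L2
      cinner_scaleC_left_L2)

section \<open>Stratonovich-Weyl correspondences\<close>

definition topological_group :: "('g::topological_space, 'r) monoid_scheme \<Rightarrow> bool" where
  "topological_group G \<longleftrightarrow>
     group G \<and>
     continuous_on (carrier G \<times> carrier G) (\<lambda>(g, h). g \<otimes>\<^bsub>G\<^esub> h) \<and>
     continuous_on (carrier G) (\<lambda>g. inv\<^bsub>G\<^esub> g)"

definition unitary_representation ::
    "('g::topological_space, 'r) monoid_scheme \<Rightarrow> ('g \<Rightarrow> 'h::chilbert_space \<Rightarrow> 'h) \<Rightarrow> bool" where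
  "unitary_representation G \<rho> \<longleftrightarrow>
     (\<forall>g\<in>carrier G. unitary_op (\<rho> g)) \<and>
     (\<forall>g\<in>carrier G. \<forall>h\<in>carrier G. \<rho> (g \<otimes>\<^bsub>G\<^esub> h) = \<rho> g \<circ> \<rho> h) \<and>
     (\<forall>\<phi>. continuous_on (carrier G) (\<lambda>g. \<rho> g \<phi>))"

text \<open>The homogeneous space is the underlying space of the measure.\<close>

definition homogeneous_space_invariant_measure ::
    "('g::topological_space, 'r) monoid_scheme \<Rightarrow> ('g \<Rightarrow> 'x \<Rightarrow> 'x)
      \<Rightarrow> ('x::topological_space) measure \<Rightarrow> bool" where
  "homogeneous_space_invariant_measure G act M \<longleftrightarrow>
     transitive_action G (space M) act \<and>
     continuous_on (carrier G \<times> space M) (\<lambda>(g, x). act g x) \<and>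
     sets M = sets (restrict_space borel (space M)) \<and>
     (\<forall>g\<in>carrier G. distr M M (act g) = M)"

text \<open>Functions on the homogeneous space are representatives modulo almost everywhere equality.
  The first three conjuncts say what a triple of group, representation and space is, the next four
  that \<open>W\<close> is a linear isomorphism from the Hilbert-Schmidt operators onto the
  square-integrable functions, and the last four are the axioms proper. \<open>W\<close> is a map on all
  operators, because one axiom is about its value at the identity, which need not be
  Hilbert-Schmidt.\<close>

definition stratonovich_weyl ::
    "('g::topological_space, 'r) monoid_scheme \<Rightarrow> ('g \<Rightarrow> 'h::chilbert_space \<Rightarrow> 'h)
      \<Rightarrow> ('g \<Rightarrow> 'x \<Rightarrow> 'x) \<Rightarrow> ('x::topological_space) measure
      \<Rightarrow> (('h \<Rightarrow> 'h) \<Rightarrow> 'x \<Rightarrow> complex) \<Rightarrow> bool" where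
  "stratonovich_weyl G \<rho> act M W \<longleftrightarrow>
     topological_group G \<and>
     unitary_representation G \<rho> \<and>
     homogeneous_space_invariant_measure G act M \<and>

     (\<forall>A. hilbert_schmidt A \<longrightarrow> W A \<in> sqint M) \<and>
     (\<forall>A B a b. hilbert_schmidt A \<longrightarrow> hilbert_schmidt B \<longrightarrow>
        (AE x in M. W (\<lambda>\<phi>. scaleC a (A \<phi>) + scaleC b (B \<phi>)) x = a * W A x + b * W B x)) \<and>
     (\<forall>A B. hilbert_schmidt A \<longrightarrow> hilbert_schmidt B \<longrightarrow>
        (AE x in M. W A x = W B x) \<longrightarrow> A = B) \<and>
     (\<forall>F\<in>sqint M. \<exists>A. hilbert_schmidt A \<and> (AE x in M. W A x = F x)) \<and>

     (AE x in M. W id x = 1) \<and>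
     (\<forall>A. hilbert_schmidt A \<longrightarrow> (AE x in M. W (cadjoint A) x = cnj (W A x))) \<and>
     (\<forall>A. hilbert_schmidt A \<longrightarrow> (\<forall>g\<in>carrier G.
        AE x in M. W (\<rho> g \<circ> A \<circ> inv_into UNIV (\<rho> g)) x = W A (act (inv\<^bsub>G\<^esub> g) x))) \<and>
     (\<forall>A B. hilbert_schmidt A \<longrightarrow> hilbert_schmidt B \<longrightarrow>
        (\<integral>x. W A x * W B x \<partial>M) = trace (A \<circ> B))"


section \<open>The generalized diamond group\<close>

definition bil :: "complex^'n \<Rightarrow> complex^'n \<Rightarrow> complex" where
  "bil z w = (\<Sum>k\<in>UNIV. z $ k * w $ k)"

definition cnjv :: "complex^'n \<Rightarrow> complex^'n" where
  "cnjv z = (\<chi> k. cnj (z $ k))"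

definition cvec :: "real^'n \<Rightarrow> complex^'n" where
  "cvec x = (\<chi> k. complex_of_real (x $ k))"

definition omega :: "(complex^'n) \<times> (complex^'n) \<Rightarrow> (complex^'n) \<times> (complex^'n) \<Rightarrow> complex" where
  "omega = (\<lambda>(z, w) (z', w'). \<i> / 2 * (bil z w' - bil z' w))"

text \<open>The value of \<open>omega\<close> below is real, so \<open>Re\<close> is only a coercion.\<close>

definition omegaR :: "complex^'n \<Rightarrow> complex^'n \<Rightarrow> real" where
  "omegaR z z' = Re (omega (z, cnjv z) (z', cnjv z'))"

definition rot :: "('n::finite \<Rightarrow> real^'m \<Rightarrow> real) \<Rightarrow> real^'m \<Rightarrow> complex^'n \<Rightarrow> complex^'n" where
  "rot \<alpha> t z = (\<chi> k. exp (\<i> * complex_of_real (\<alpha> k t)) * z $ k)"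

type_synonym ('m, 'n) diamond = "(real^'m) \<times> (complex^'n) \<times> real"

definition diamond :: "('n::finite \<Rightarrow> real^'m \<Rightarrow> real) \<Rightarrow> ('m, 'n) diamond monoid" where
  "diamond \<alpha> =
     \<lparr>carrier = UNIV,
      mult = (\<lambda>(t, z, c) (t', z', c').
        (t + t', z + rot \<alpha> t z', c + c' + 1 / 2 * omegaR z (rot \<alpha> t z'))),
      one = (0, 0, 0)\<rparr>"

definition act_complex :: "('n::finite \<Rightarrow> real^'m \<Rightarrow> real) \<Rightarrow> ('m, 'n) diamond \<Rightarrow> complex^'n \<Rightarrow> complex^'n" where
  "act_complex \<alpha> = (\<lambda>(t, z0, c0) z. rot \<alpha> t z + z0)"

definition cplx :: "(real^'n) \<times> (real^'n) \<Rightarrow> complex^'n" where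
  "cplx = (\<lambda>(x, y). \<chi> k. Complex (x $ k) (y $ k))"

definition act_real ::
    "('n::finite \<Rightarrow> real^'m \<Rightarrow> real) \<Rightarrow> ('m, 'n) diamond \<Rightarrow> (real^'n) \<times> (real^'n) \<Rightarrow> (real^'n) \<times> (real^'n)" where
  "act_real \<alpha> g = inv_into UNIV cplx \<circ> act_complex \<alpha> g \<circ> cplx"

text \<open>The group is a vector space as a manifold, so its Lie algebra (the tangent space at the
  identity) is that vector space, and the adjoint action is the derivative of conjugation.\<close>

definition Ad :: "('n::finite \<Rightarrow> real^'m \<Rightarrow> real) \<Rightarrow> ('m, 'n) diamond \<Rightarrow> ('m, 'n) diamond \<Rightarrow> ('m, 'n) diamond" where
  "Ad \<alpha> g = frechet_derivative
     (\<lambda>h. g \<otimes>\<^bsub>diamond \<alpha>\<^esub> h \<otimes>\<^bsub>diamond \<alpha>\<^esub> inv\<^bsub>diamond \<alpha>\<^esub> g) (at \<one>\<^bsub>diamond \<alpha>\<^esub>)"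

type_synonym ('m, 'n) diamond_dual = "('m, 'n) diamond \<Rightarrow>\<^sub>L real"

definition coad ::
    "('n::finite \<Rightarrow> real^'m \<Rightarrow> real) \<Rightarrow> ('m, 'n) diamond \<Rightarrow> ('m, 'n) diamond_dual \<Rightarrow> ('m, 'n) diamond_dual" where
  "coad \<alpha> g \<xi> = Blinfun (\<lambda>X. blinfun_apply \<xi> (Ad \<alpha> (inv\<^bsub>diamond \<alpha>\<^esub> g) X))"

definition dual_elt :: "(real^'m \<Rightarrow> real) \<Rightarrow> complex^'n \<Rightarrow> real \<Rightarrow> ('m, 'n) diamond_dual" where
  "dual_elt s v d = Blinfun (\<lambda>(t, u, c). s t + omegaR v u + c * d)"

definition unitary_character :: "(real^'m \<Rightarrow> complex) \<Rightarrow> bool" where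
  "unitary_character \<kappa> \<longleftrightarrow>
     continuous_on UNIV \<kappa> \<and> (\<forall>s t. \<kappa> (s + t) = \<kappa> s * \<kappa> t) \<and> (\<forall>t. cmod (\<kappa> t) = 1)"

text \<open>The differential of a unitary character is purely imaginary, so that \<open>Re\<close> is only a
  coercion here.\<close>

definition psi ::
    "('n::finite \<Rightarrow> real^'m \<Rightarrow> real) \<Rightarrow> (real^'m \<Rightarrow> complex) \<Rightarrow> real \<Rightarrow> complex^'n \<Rightarrow> ('m, 'n) diamond_dual" where
  "psi \<alpha> \<kappa> lam z = dual_elt
     (\<lambda>t. Re (- \<i> * frechet_derivative \<kappa> (at 0) t)
          + 1 / 2 * (\<Sum>k\<in>UNIV. (1 - lam * (cmod (z $ k))\<^sup>2) * \<alpha> k t))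
     (- lam *\<^sub>R z) lam"

definition coadjoint_orbit ::
    "('n::finite \<Rightarrow> real^'m \<Rightarrow> real) \<Rightarrow> (real^'m \<Rightarrow> complex) \<Rightarrow> real \<Rightarrow> ('m, 'n) diamond_dual set" where
  "coadjoint_orbit \<alpha> \<kappa> lam = Group_Action.orbit (diamond \<alpha>) (coad \<alpha>) (psi \<alpha> \<kappa> lam 0)"

text \<open>Group actions in the library are by extensional functions.\<close>

definition act_orbit ::
    "('n::finite \<Rightarrow> real^'m \<Rightarrow> real) \<Rightarrow> (real^'m \<Rightarrow> complex) \<Rightarrow> real
      \<Rightarrow> ('m, 'n) diamond \<Rightarrow> ('m, 'n) diamond_dual \<Rightarrow> ('m, 'n) diamond_dual" where
  "act_orbit \<alpha> \<kappa> lam g = restrict (coad \<alpha> g) (coadjoint_orbit \<alpha> \<kappa> lam)"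


section \<open>Measures\<close>

definition mu :: "real \<Rightarrow> (complex^'n) measure" where
  "mu lam = density lborel (\<lambda>_. ennreal ((lam / (2 * pi)) ^ CARD('n)))"

text \<open>As \<open>mu\<close> is this multiple of \<open>dx dy\<close> at \<open>x + i y\<close>, its counterpart
  under \<open>cplx\<close> has the same constant.\<close>

definition mu_real :: "real \<Rightarrow> ((real^'n) \<times> (real^'n)) measure" where
  "mu_real lam = density lborel (\<lambda>_. ennreal ((lam / (2 * pi)) ^ CARD('n)))"

definition nu ::
    "('n::finite \<Rightarrow> real^'m \<Rightarrow> real) \<Rightarrow> (real^'m \<Rightarrow> complex) \<Rightarrow> real \<Rightarrow> ('m, 'n) diamond_dual measure" where
  "nu \<alpha> \<kappa> lam = distr (mu lam) (restrict_space borel (coadjoint_orbit \<alpha> \<kappa> lam)) (psi \<alpha> \<kappa> lam)"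


section \<open>Fock space, Bargmann transform and the representations\<close>

definition entire :: "(complex^'n \<Rightarrow> complex) \<Rightarrow> bool" where
  "entire f \<longleftrightarrow>
     (\<forall>z. \<exists>D. (f has_derivative D) (at z) \<and> (\<forall>c v. D (c *s v) = c * D v))"

definition fock :: "real \<Rightarrow> (complex^'n \<Rightarrow> complex) set" where
  "fock lam = {f. entire f \<and>
     integrable (mu lam) (\<lambda>z. (cmod (f z))\<^sup>2 * exp (- lam * (norm z)\<^sup>2 / 2))}"

definition fock_inner :: "real \<Rightarrow> (complex^'n \<Rightarrow> complex) \<Rightarrow> (complex^'n \<Rightarrow> complex) \<Rightarrow> complex" where
  "fock_inner lam f g =
     (\<integral>z. f z * cnj (g z) * complex_of_real (exp (- lam * (norm z)\<^sup>2 / 2)) \<partial>mu lam)"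

definition coherent :: "real \<Rightarrow> complex^'n \<Rightarrow> complex^'n \<Rightarrow> complex" where
  "coherent lam z w = exp (complex_of_real lam * bil (cnjv z) w / 2)"

definition fock_rep ::
    "('n::finite \<Rightarrow> real^'m \<Rightarrow> real) \<Rightarrow> (real^'m \<Rightarrow> complex) \<Rightarrow> real
      \<Rightarrow> ('m, 'n) diamond \<Rightarrow> (complex^'n \<Rightarrow> complex) \<Rightarrow> complex^'n \<Rightarrow> complex" where
  "fock_rep \<alpha> \<kappa> lam = (\<lambda>(t, z0, c0). \<lambda>f\<in>fock lam. \<lambda>z.
     \<kappa> t * exp (\<i> * complex_of_real (lam * c0) + complex_of_real (lam / 2) * bil (cnjv z0) z
                - complex_of_real (lam / 4 * (norm z0)\<^sup>2))
         * f (rot \<alpha> (- t) (z - z0)))"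

definition bargmann :: "real \<Rightarrow> (real^'n) L2 \<Rightarrow> complex^'n \<Rightarrow> complex" where
  "bargmann lam \<phi> z =
     complex_of_real ((lam / pi) powr (real CARD('n) / 4)) *
     (\<integral>x. exp (- complex_of_real (lam / 4) * bil z z + complex_of_real lam * bil z (cvec x)
                - complex_of_real (lam / 2 * (x \<bullet> x))) * rep_L2 \<phi> x \<partial>lborel)"

definition schrodinger_rep ::
    "('n::finite \<Rightarrow> real^'m \<Rightarrow> real) \<Rightarrow> (real^'m \<Rightarrow> complex) \<Rightarrow> real
      \<Rightarrow> ('m, 'n) diamond \<Rightarrow> (real^'n) L2 \<Rightarrow> (real^'n) L2" where
  "schrodinger_rep \<alpha> \<kappa> lam g = inv_into UNIV (bargmann lam) \<circ> fock_rep \<alpha> \<kappa> lam g \<circ> bargmann lam"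


section \<open>The Wigner-Weyl maps\<close>

definition Omega1 :: "real \<Rightarrow> (real^'n) \<times> (real^'n) \<Rightarrow> (real^'n) L2 \<Rightarrow> (real^'n) L2" where
  "Omega1 lam = (\<lambda>(a, b) \<phi>. abs_L2 (\<lambda>x.
     2 ^ CARD('n) * exp (2 * \<i> * complex_of_real (lam * (b \<bullet> (a - x)))) * rep_L2 \<phi> (2 *\<^sub>R a - x)))"

definition W1_trace_class ::
    "real \<Rightarrow> ((real^'n) L2 \<Rightarrow> (real^'n) L2) \<Rightarrow> (real^'n) \<times> (real^'n) \<Rightarrow> complex" where
  "W1_trace_class lam A p = trace (A \<circ> Omega1 lam p)"

text \<open>The extension, continuous from the Hilbert-Schmidt norm to the \<open>L\<^sup>2\<close> norm, from trace class to Hilbert-Schmidt operators; the chosen function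
  is unique up to almost everywhere equality.\<close>

definition W1_hilbert_schmidt ::
    "real \<Rightarrow> ((real^'n) L2 \<Rightarrow> (real^'n) L2) \<Rightarrow> (real^'n) \<times> (real^'n) \<Rightarrow> complex" where
  "W1_hilbert_schmidt lam A = (SOME F. F \<in> sqint (mu_real lam) \<and>
     (\<forall>X :: nat \<Rightarrow> (real^'n) L2 \<Rightarrow> (real^'n) L2. (\<forall>i. trace_class (X i)) \<longrightarrow>
        (\<lambda>i. hs_norm (\<lambda>\<phi>. X i \<phi> - A \<phi>)) \<longlonglongrightarrow> 0 \<longrightarrow>
        (\<lambda>i. \<integral>\<^sup>+p. ennreal ((cmod (W1_trace_class lam (X i) p - F p))\<^sup>2) \<partial>mu_real lam) \<longlonglongrightarrow> 0))"

definition fock_kernel ::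
    "real \<Rightarrow> ((complex^'n \<Rightarrow> complex) \<Rightarrow> complex^'n \<Rightarrow> complex) \<Rightarrow> complex^'n \<Rightarrow> complex^'n \<Rightarrow> complex" where
  "fock_kernel lam B z w = fock_inner lam (B (coherent lam w)) (coherent lam z)"

text \<open>The Bochner integral is absolutely convergent, and it is \<open>0\<close> if the function is not
  integrable.\<close>

definition W0 ::
    "real \<Rightarrow> ((complex^'n \<Rightarrow> complex) \<Rightarrow> complex^'n \<Rightarrow> complex) \<Rightarrow> complex^'n \<Rightarrow> complex" where
  "W0 lam B z = 2 ^ CARD('n) *
     (\<integral>w. fock_kernel lam B (z + w) (z - w) *
        exp (complex_of_real (lam / 2) *
          (- bil z (cnjv z) - bil w (cnjv w) + bil z (cnjv w) - bil (cnjv z) w)) \<partial>mu lam)"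

definition to_fock ::
    "real \<Rightarrow> ((real^'n) L2 \<Rightarrow> (real^'n) L2) \<Rightarrow> (complex^'n \<Rightarrow> complex) \<Rightarrow> complex^'n \<Rightarrow> complex" where
  "to_fock lam A = (\<lambda>f\<in>fock lam. bargmann lam (A (inv_into UNIV (bargmann lam) f)))"

text \<open>Outside the Hilbert-Schmidt class, in particular at the identity, the map is given by the
  integral formula.\<close>

definition W1 ::
    "real \<Rightarrow> ((real^'n) L2 \<Rightarrow> (real^'n) L2) \<Rightarrow> (real^'n) \<times> (real^'n) \<Rightarrow> complex" where
  "W1 lam A =
     (if trace_class A then W1_trace_class lam A
      else if hilbert_schmidt A then W1_hilbert_schmidt lam A
      else (\<lambda>p. W0 lam (to_fock lam A) (cplx p)))"

definition W1' ::
    "('n::finite \<Rightarrow> real^'m \<Rightarrow> real) \<Rightarrow> (real^'m \<Rightarrow> complex) \<Rightarrow> real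
      \<Rightarrow> ((real^'n) L2 \<Rightarrow> (real^'n) L2) \<Rightarrow> ('m, 'n) diamond_dual \<Rightarrow> complex" where
  "W1' \<alpha> \<kappa> lam A = W1 lam A \<circ> inv_into UNIV (psi \<alpha> \<kappa> lam \<circ> cplx)"

end

theory Submission
  imports Defs "HOL-Probability.Characteristic_Functions"
begin

text \<open>The coherent vectors, preimages under the Bargmann transform of the functions \<open>e\<^sub>z\<close>, form a
  total family in \<open>L\<^sup>2(\<real>\<^sup>n)\<close> by the uniqueness of Fourier transforms. The representation permutes them up to
  scalar factors and so do the operators \<open>\<Omega>\<^sub>1(a, b)\<close>, hence their Wigner functions
  \<open>p \<mapsto> \<langle>\<Omega>\<^sub>1(p) \<phi>, \<psi>\<rangle>\<close> are explicit Gaussians. For these one verifies by hand the orthogonality relation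
  \<open>\<langle>W(\<phi>, \<psi>), W(\<phi>', \<psi>')\<rangle> = (2\<pi>/\<lambda>)\<^sup>n \<langle>\<psi>', \<psi>\<rangle> \<langle>\<phi>, \<phi>'\<rangle>\<close> and the covariance under the group, and both extend to
  all vectors by linearity and continuity. Orthogonality makes the Wigner functions of an orthonormal
  basis an orthogonal basis of \<open>L\<^sup>2(\<real>\<^sup>2\<^sup>n)\<close>, so that \<open>W\<^sub>1\<close> is unitary; the trace formula is then Parseval's
  identity, and the value at the identity operator is a Gaussian integral. The second part is
  transport along the homeomorphism \<open>\<psi> \<circ> j\<close>, which is equivariant for the coadjoint action by
  differentiating the conjugation of the group at the identity.\<close>

section \<open>Complex Hilbert spaces\<close>

text \<open>\<open>W1\<close> is given by three unrelated formulas: a trace at each point, a limit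
  that a choice operator fixes only up to null sets, and an integral. The predicate
  \<open>is_symbol\<close> joins the first two: it describes a class F by its inner products with
  all Wigner functions, which must be the matrix coefficients of A. Since F and A determine each
  other, every almost everywhere identity between symbols reduces to comparing matrix coefficients.
  The identity operator is not Hilbert-Schmidt, so its value comes from the integral formula.
  Coherent vectors carry the computations because evaluating a Bargmann transform at z is the inner
  product with the coherent vector at z. Such values are continuous in the vector, and an identity
  between them can be checked on a total family. This also settles where \<open>inv_into\<close> of
  the Bargmann transform is meaningful: the operator that moves the coherent vectors is constructed
  first and then shown to intertwine, so the transformed functions are seen to lie in the range. The
  constant in the orthogonality relation is the inverse of the density of \<open>mu_real\<close>,
  whence unitarity for that measure.\<close>

instance chilbert_space \<subseteq> banach ..

lemma cinner_add_right: "cinner x (y + z) = cinner x y + cinner x (z :: 'h::chilbert_space)"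
  by (metis cinner_commute cinner_add_left complex_cnj_add)

lemma cinner_scaleC_right: "cinner x (scaleC a y) = cnj a * cinner x (y :: 'h::chilbert_space)"
  by (metis cinner_commute cinner_scaleC_left complex_cnj_mult)

lemma cinner_scaleR_left: "cinner (r *\<^sub>R x) y = of_real r * cinner x (y :: 'h::chilbert_space)"
  by (simp add: scaleR_scaleC cinner_scaleC_left)

lemma cinner_scaleR_right: "cinner x (r *\<^sub>R y) = of_real r * cinner x (y :: 'h::chilbert_space)"
  by (simp add: scaleR_scaleC cinner_scaleC_right)

lemma cinner_zero_left [simp]: "cinner 0 (y :: 'h::chilbert_space) = 0"
  by (metis add_0 add_cancel_right_right cinner_add_left)

lemma cinner_zero_right [simp]: "cinner (y :: 'h::chilbert_space) 0 = 0"
  by (metis cinner_commute cinner_zero_left complex_cnj_zero)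

lemma cinner_minus_left: "cinner (- x) y = - cinner x (y :: 'h::chilbert_space)"
  by (metis add.right_inverse add_eq_0_iff cinner_add_left cinner_zero_left)

lemma cinner_minus_right: "cinner x (- y) = - cinner x (y :: 'h::chilbert_space)"
  by (metis add.right_inverse add_eq_0_iff cinner_add_right cinner_zero_right)

lemma cinner_diff_left: "cinner (x - y) z = cinner x z - cinner y (z :: 'h::chilbert_space)"
  using cinner_add_left[of x "- y" z] by (simp add: cinner_minus_left)

lemma cinner_diff_right: "cinner x (y - z) = cinner x y - cinner x (z :: 'h::chilbert_space)"
  using cinner_add_right[of x y "- z"] by (simp add: cinner_minus_right)

lemma cinner_sum_left: "cinner (\<Sum>i\<in>F. f i) (y :: 'h::chilbert_space) = (\<Sum>i\<in>F. cinner (f i) y)"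
  by (induction F rule: infinite_finite_induct) (auto simp: cinner_add_left)

lemma cinner_sum_right: "cinner (y :: 'h::chilbert_space) (\<Sum>i\<in>F. f i) = (\<Sum>i\<in>F. cinner y (f i))"
  by (induction F rule: infinite_finite_induct) (auto simp: cinner_add_right)

lemma cinner_self: "cinner x x = complex_of_real ((norm (x :: 'h::chilbert_space))\<^sup>2)"
proof -
  have "cinner x x \<in> \<real>"
    using cinner_commute[of x x] by (metis Reals_cnj_iff)
  then show ?thesis
    by (metis complex_is_Real_iff complex_of_real_def complex_eq inner_cinner power2_norm_eq_inner
        Re_complex_of_real Im_complex_of_real)
qed

lemma norm_scaleC: "norm (scaleC a x) = cmod a * norm (x :: 'h::chilbert_space)"
proof -
  have "cinner (scaleC a x) (scaleC a x) = (a * cnj a) * cinner x x"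
    by (simp add: cinner_scaleC_left cinner_scaleC_right)
  then have "complex_of_real ((norm (scaleC a x))\<^sup>2) = complex_of_real ((cmod a * norm x)\<^sup>2)"
    by (simp add: cinner_self complex_norm_square[symmetric] power_mult_distrib)
  then have "(norm (scaleC a x))\<^sup>2 = (cmod a * norm x)\<^sup>2"
    using of_real_eq_iff by blast
  then show ?thesis by (simp add: power2_eq_iff_nonneg)
qed

lemma scaleC_one [simp]: "scaleC 1 x = (x :: 'h::chilbert_space)"
  using scaleR_scaleC[of 1 x] by simp

lemma scaleC_zero_left [simp]: "scaleC 0 x = (0 :: 'h::chilbert_space)"
  using scaleR_scaleC[of 0 x] by simp

lemma scaleC_zero_right [simp]: "scaleC a 0 = (0 :: 'h::chilbert_space)"
  using norm_scaleC[of a 0] by simp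

lemma scaleC_minus1: "scaleC (-1) x = - (x :: 'h::chilbert_space)"
  using scaleR_scaleC[of "-1" x] by simp

lemma bounded_linear_scaleC: "bounded_linear (scaleC a :: 'h::chilbert_space \<Rightarrow> 'h)"
  by (rule bounded_linear_intro[of _ "cmod a"])
     (auto simp: scaleC_add_right norm_scaleC scaleR_scaleC scaleC_scaleC mult.commute)

text \<open>Multiplying x by a unimodular phase turns the complex inner product into its modulus,
  and then the inequality for the real inner product applies.\<close>

lemma cinner_cauchy_schwarz: "cmod (cinner x y) \<le> norm x * norm (y :: 'h::chilbert_space)"
proof (cases "cinner x y = 0")
  case False
  define u where "u = cnj (cinner x y) / cmod (cinner x y)"
  have "complex_of_real (cmod (cinner x y)) = cinner (scaleC u x) y"
    using False by (simp add: u_def cinner_scaleC_left mult.commute complex_norm_square[symmetric]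
        power2_eq_square)
  then have "cmod (cinner x y) = inner (scaleC u x) y"
    by (metis Re_complex_of_real inner_cinner)
  also have "\<dots> \<le> norm (scaleC u x) * norm y" by (rule norm_cauchy_schwarz)
  also have "norm (scaleC u x) = norm x"
    using False by (simp add: norm_scaleC u_def norm_divide)
  finally show ?thesis .
qed simp

lemma bounded_linear_cinner_left: "bounded_linear (\<lambda>x. cinner x (y :: 'h::chilbert_space))"
  by (rule bounded_linear_intro[of _ "norm y"])
     (auto simp: cinner_add_left cinner_scaleR_left cinner_cauchy_schwarz scaleR_conv_of_real)

lemma bounded_linear_cinner_right: "bounded_linear (\<lambda>x. cinner (y :: 'h::chilbert_space) x)"
  by (rule bounded_linear_intro[of _ "norm y"])
     (auto simp: cinner_add_right cinner_scaleR_right cinner_cauchy_schwarz scaleR_conv_of_real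
        mult.commute[of _ "norm y"])

lemma cinner_eqI: "(\<And>z. cinner x z = cinner y z) \<Longrightarrow> x = (y :: 'h::chilbert_space)"
  by (metis cinner_diff_left cinner_self eq_iff_diff_eq_0 norm_eq_zero of_real_eq_0_iff power_eq_0_iff)

lemma cinner_eqI_right: "(\<And>z. cinner z x = cinner z y) \<Longrightarrow> x = (y :: 'h::chilbert_space)"
  by (metis cinner_commute cinner_eqI)

lemma bounded_clinear_bounded_linear: "bounded_clinear A \<Longrightarrow> bounded_linear A"
  by (simp add: bounded_clinear_def)

lemma bounded_clinear_scaleC: "bounded_clinear A \<Longrightarrow> A (scaleC c x) = scaleC c (A x)"
  by (simp add: bounded_clinear_def)

lemma bounded_clinear_add: "bounded_clinear A \<Longrightarrow> A (x + y) = A x + A y"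
  by (simp add: bounded_clinear_def linear_simps)

lemma bounded_clinear_comp: "bounded_clinear A \<Longrightarrow> bounded_clinear B \<Longrightarrow> bounded_clinear (A \<circ> B)"
  by (auto simp: bounded_clinear_def o_def intro: bounded_linear_compose)

lemma bounded_clinear_lincomb:
  assumes "bounded_clinear A" "bounded_clinear B"
  shows "bounded_clinear (\<lambda>\<phi>. scaleC a (A \<phi>) + scaleC b (B \<phi>))"
  using assms unfolding bounded_clinear_def
  by (auto simp: scaleC_add_right scaleC_scaleC mult.commute
      intro!: bounded_linear_add bounded_linear_compose[OF bounded_linear_scaleC])

subsection \<open>Orthonormal families\<close>

definition orthonormal_on :: "'i set \<Rightarrow> ('i \<Rightarrow> 'h::chilbert_space) \<Rightarrow> bool" where
  "orthonormal_on I v \<longleftrightarrow> (\<forall>i\<in>I. \<forall>j\<in>I. cinner (v i) (v j) = (if i = j then 1 else 0))"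

text \<open>Totality as a trivial orthogonal complement, which is what Fourier uniqueness delivers.
  Density of the span, which is how totality is exploited, is derived from it in
  \<open>total_induct\<close>.\<close>

definition total_family :: "'i set \<Rightarrow> ('i \<Rightarrow> 'h::chilbert_space) \<Rightarrow> bool" where
  "total_family I v \<longleftrightarrow> (\<forall>x. (\<forall>i\<in>I. cinner x (v i) = 0) \<longrightarrow> x = 0)"

lemma is_onb_iff: "is_onb E \<longleftrightarrow> orthonormal_on E (\<lambda>e. e) \<and> total_family E (\<lambda>e. e)"
  by (simp add: is_onb_def orthonormal_on_def total_family_def)

lemma total_familyD: "total_family I v \<Longrightarrow> (\<And>i. i \<in> I \<Longrightarrow> cinner x (v i) = cinner y (v i)) \<Longrightarrow> x = y"
  unfolding total_family_def by (metis cinner_diff_left eq_iff_diff_eq_0)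

lemma norm_sum_orthonormal:
  assumes "orthonormal_on I v" "finite F" "F \<subseteq> I"
  shows "(norm (\<Sum>i\<in>F. scaleC (c i) (v i)))\<^sup>2 = (\<Sum>i\<in>F. (cmod (c i))\<^sup>2)"
proof -
  have "complex_of_real ((norm (\<Sum>i\<in>F. scaleC (c i) (v i)))\<^sup>2)
      = (\<Sum>i\<in>F. \<Sum>j\<in>F. c i * cnj (c j) * cinner (v i) (v j))"
    unfolding cinner_self[symmetric]
    by (subst sum.swap) (simp add: cinner_sum_left cinner_sum_right cinner_scaleC_left
        cinner_scaleC_right mult.assoc sum_distrib_left mult.left_commute)
  also have "\<dots> = (\<Sum>i\<in>F. \<Sum>j\<in>F. if i = j then c i * cnj (c j) else 0)"
    using assms by (intro sum.cong refl) (auto simp: orthonormal_on_def subset_iff)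
  also have "\<dots> = complex_of_real (\<Sum>i\<in>F. (cmod (c i))\<^sup>2)"
    using assms(2) by (simp add: complex_norm_square del: of_real_power)
  finally show ?thesis using of_real_eq_iff by blast
qed

lemma bessel_finite:
  assumes "orthonormal_on I v" "finite F" "F \<subseteq> I"
  shows "(\<Sum>i\<in>F. (cmod (cinner x (v i)))\<^sup>2) \<le> (norm x)\<^sup>2"
proof -
  define p where "p = (\<Sum>i\<in>F. scaleC (cinner x (v i)) (v i))"
  have xp: "cinner x p = (\<Sum>i\<in>F. (cmod (cinner x (v i)))\<^sup>2)"
    by (simp add: p_def cinner_sum_right cinner_scaleC_right mult.commute
      complex_norm_square[symmetric])
  have pp: "(norm p)\<^sup>2 = (\<Sum>i\<in>F. (cmod (cinner x (v i)))\<^sup>2)"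
    unfolding p_def by (rule norm_sum_orthonormal[OF assms])
  have "0 \<le> (norm (x - p))\<^sup>2" by simp
  also have "(norm (x - p))\<^sup>2 = (norm x)\<^sup>2 + (norm p)\<^sup>2 - 2 * inner x p"
    by (simp add: power2_norm_eq_inner inner_diff inner_commute)
  also have "inner x p = (norm p)\<^sup>2"
    unfolding pp using xp by (simp add: inner_cinner)
  finally show ?thesis using pp by simp
qed

lemma bessel_summable:
  assumes "orthonormal_on I v"
  shows "(\<lambda>i. (cmod (cinner x (v i)))\<^sup>2) summable_on I"
  using bessel_finite[OF assms]
  by (intro nonneg_bdd_above_summable_on) (auto intro!: bdd_aboveI[of _ "(norm x)\<^sup>2"])

text \<open>By Pythagoras the squared distance of two nested partial sums is a finite sum of squared
  coefficients, so the net of partial sums is Cauchy and completeness supplies a limit.\<close>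

lemma summable_on_orthonormal:
  fixes v :: "'i \<Rightarrow> 'h::chilbert_space"
  assumes v: "orthonormal_on I v" and c: "(\<lambda>i. (cmod (c i))\<^sup>2) summable_on I"
  shows "(\<lambda>i. scaleC (c i) (v i)) summable_on I"
proof -
  let ?g = "\<lambda>i. (cmod (c i))\<^sup>2" and ?f = "\<lambda>i. scaleC (c i) (v i)"
  define S where "S = infsum ?g I"
  have "\<exists>P. eventually P (finite_subsets_at_top I) \<and>
          (\<forall>F F'. P F \<and> P F' \<longrightarrow> dist (sum ?f F) (sum ?f F') < e)" if "e > 0" for e
  proof -
    have "(?g has_sum S) I" using c by (simp add: S_def)
    moreover have "(e/4)\<^sup>2 > 0" using that by simp
    ultimately obtain F0 where F0: "finite F0" "F0 \<subseteq> I" "dist (sum ?g F0) S \<le> (e/4)\<^sup>2"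
      using has_sum_finite_approximation[where f = "?g" and \<epsilon> = "(e/4)\<^sup>2"] by metis
    have d: "dist (sum ?f F) (sum ?f F0) \<le> e / 4" if "finite F" "F0 \<subseteq> F" "F \<subseteq> I" for F
    proof -
      have "dist (sum ?f F) (sum ?f F0) = norm (sum ?f (F - F0))"
        unfolding dist_norm using that(1,2) by (subst sum_diff) auto
      also have "\<dots>\<^sup>2 = sum ?g (F - F0)"
        by (rule norm_sum_orthonormal[OF v]) (use that in auto)
      also have "\<dots> = sum ?g F - sum ?g F0" using that by (simp add: sum_diff)
      also have "sum ?g F \<le> S"
        unfolding S_def by (rule finite_sum_le_infsum) (use c that in auto)
      finally have "(dist (sum ?f F) (sum ?f F0))\<^sup>2 \<le> (e/4)\<^sup>2"
        using F0(3) by (simp add: dist_real_def abs_le_iff)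
      then show ?thesis using \<open>e > 0\<close> by (simp add: power2_le_iff_abs_le)
    qed
    have "dist (sum ?f F) (sum ?f F') < e"
      if F: "finite F \<and> F0 \<subseteq> F \<and> F \<subseteq> I" "finite F' \<and> F0 \<subseteq> F' \<and> F' \<subseteq> I" for F F'
    proof -
      have "dist (sum ?f F) (sum ?f F') \<le> e / 4 + e / 4"
        using F by (intro order_trans[OF dist_triangle2[of _ _ "sum ?f F0"] add_mono] d) auto
      then show ?thesis using \<open>e > 0\<close> by simp
    qed
    moreover have "eventually (\<lambda>F. finite F \<and> F0 \<subseteq> F \<and> F \<subseteq> I) (finite_subsets_at_top I)"
      using F0 by (auto simp: eventually_finite_subsets_at_top)
    ultimately show ?thesis
      by (intro exI[of _ "\<lambda>F. finite F \<and> F0 \<subseteq> F \<and> F \<subseteq> I"] conjI allI impI) auto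
  qed
  then have "cauchy_filter (filtermap (sum ?f) (finite_subsets_at_top I))"
    by (simp add: cauchy_filter_metric_filtermap)
  moreover have "complete (UNIV::'h set)"
    by (meson Cauchy_convergent UNIV_I complete_def convergent_def)
  ultimately obtain L where "(sum ?f \<longlongrightarrow> L) (finite_subsets_at_top I)"
    using complete_uniform[where S=UNIV] by (force simp add: filterlim_def)
  then show ?thesis using summable_on_def has_sum_def by blast
qed

lemma cinner_infsum_orthonormal:
  fixes v :: "'i \<Rightarrow> 'h::chilbert_space"
  assumes v: "orthonormal_on I v" and c: "(\<lambda>i. (cmod (c i))\<^sup>2) summable_on I" and k: "k \<in> I"
  shows "cinner (\<Sum>\<^sub>\<infinity>i\<in>I. scaleC (c i) (v i)) (v k) = c k"
proof -
  have "((\<lambda>i. cinner (scaleC (c i) (v i)) (v k)) has_sum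
      cinner (\<Sum>\<^sub>\<infinity>i\<in>I. scaleC (c i) (v i)) (v k)) I"
    by (intro has_sum_bounded_linear[OF bounded_linear_cinner_left] has_sum_infsum
      summable_on_orthonormal assms)
  moreover have "((\<lambda>i. cinner (scaleC (c i) (v i)) (v k)) has_sum c k) I"
    using v k by (intro has_sum_finite_neutralI[of "{k}"])
      (auto simp: orthonormal_on_def cinner_scaleC_left)
  ultimately show ?thesis by (rule has_sum_unique)
qed

text \<open>The series converges by Bessel and its sum has the same coefficients as x, so totality
  identifies the two.\<close>

lemma fourier_expansion:
  fixes v :: "'i \<Rightarrow> 'h::chilbert_space"
  assumes "orthonormal_on I v" "total_family I v"
  shows "((\<lambda>i. scaleC (cinner x (v i)) (v i)) has_sum x) I"
proof -
  have s: "(\<lambda>i. scaleC (cinner x (v i)) (v i)) summable_on I"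
    by (intro summable_on_orthonormal bessel_summable assms)
  have "(\<Sum>\<^sub>\<infinity>i\<in>I. scaleC (cinner x (v i)) (v i)) = x"
    by (rule total_familyD[OF assms(2)]) (rule cinner_infsum_orthonormal[OF assms(1) bessel_summable[OF assms(1)]])
  with s show ?thesis using has_sum_infsum by fastforce
qed

lemma parseval:
  fixes v :: "'i \<Rightarrow> 'h::chilbert_space"
  assumes "orthonormal_on I v" "total_family I v"
  shows "((\<lambda>i. cinner x (v i) * cnj (cinner y (v i))) has_sum cinner x y) I"
proof -
  have "cnj (cinner y (v i)) = cinner (v i) y" for i by (metis cinner_commute)
  with has_sum_bounded_linear[OF bounded_linear_cinner_left fourier_expansion[OF assms], of x y]
  show ?thesis by (simp only: cinner_scaleC_left)
qed

lemma parseval_norm: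
  fixes v :: "'i \<Rightarrow> 'h::chilbert_space"
  assumes "orthonormal_on I v" "total_family I v"
  shows "((\<lambda>i. (cmod (cinner x (v i)))\<^sup>2) has_sum (norm x)\<^sup>2) I"
proof -
  have "((\<lambda>i. complex_of_real ((cmod (cinner x (v i)))\<^sup>2)) has_sum complex_of_real ((norm x)\<^sup>2)) I"
    using parseval[OF assms, of x x]
    by (simp add: cinner_self complex_norm_square[symmetric] del: of_real_power)
  then show ?thesis using has_sum_of_real_iff by blast
qed

text \<open>Applied to the whole space this gives the existence of an orthonormal basis, applied to a
  closed subspace that contains a total family it gives the density of its span.\<close>

lemma maximal_orthonormal_subset:
  fixes V :: "'h::chilbert_space set"
  obtains E where "E \<subseteq> V" "orthonormal_on E (\<lambda>e. e)"
    "\<And>x. x \<in> V \<Longrightarrow> norm x = 1 \<Longrightarrow> \<exists>e\<in>E. cinner x e \<noteq> 0"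
proof -
  let ?A = "{E. E \<subseteq> V \<and> orthonormal_on E (\<lambda>e. e)}"
  have "\<exists>M\<in>?A. \<forall>X\<in>?A. M \<subseteq> X \<longrightarrow> X = M"
  proof (rule subset_Zorn')
    fix C assume C: "subset.chain ?A C"
    have "orthonormal_on (\<Union>C) (\<lambda>e. e)"
      unfolding orthonormal_on_def
    proof (intro ballI)
      fix e f assume "e \<in> \<Union>C" "f \<in> \<Union>C"
      then obtain X Y where XY: "X \<in> C" "e \<in> X" "Y \<in> C" "f \<in> Y" by blast
      then have "X \<subseteq> Y \<or> Y \<subseteq> X" using C by (auto simp: subset_chain_def)
      then obtain X where "X \<in> C" "e \<in> X" "f \<in> X" using XY by blast
      moreover have "X \<in> ?A" using C \<open>X \<in> C\<close> unfolding subset_chain_def by blast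
      ultimately show "cinner e f = (if e = f then 1 else 0)" by (auto simp: orthonormal_on_def)
    qed
    moreover have "X \<subseteq> V" if "X \<in> C" for X using C that unfolding subset_chain_def by blast
    ultimately show "\<Union>C \<in> ?A" by (simp add: Union_least)
  qed
  then obtain E where E0: "E \<in> ?A" and E1: "\<forall>X\<in>?A. E \<subseteq> X \<longrightarrow> X = E" by (elim bexE)
  then have E: "E \<subseteq> V" "orthonormal_on E (\<lambda>e. e)" by simp_all
  have max: "X = E" if "X \<subseteq> V" "orthonormal_on X (\<lambda>e. e)" "E \<subseteq> X" for X
    using E1 that by simp
  have "\<exists>e\<in>E. cinner x e \<noteq> 0" if x: "x \<in> V" "norm x = 1" for x
  proof (rule ccontr)
    assume "\<not> ?thesis"
    then have 0: "\<And>e. e \<in> E \<Longrightarrow> cinner x e = 0" by auto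
    then have "\<And>e. e \<in> E \<Longrightarrow> cinner e x = 0" by (metis cinner_commute complex_cnj_zero)
    then have "orthonormal_on (insert x E) (\<lambda>e. e)"
      using E(2) 0 x unfolding orthonormal_on_def
      by (metis (no_types, lifting) cinner_self insert_iff of_real_1 one_power2)
    then have "x \<in> E" using max[of "insert x E"] E x by auto
    then show False using 0[of x] x by (simp add: cinner_self)
  qed
  then show ?thesis using that E by blast
qed

lemma ex_is_onb: "\<exists>E :: 'h::chilbert_space set. is_onb E"
proof -
  obtain E :: "'h set" where E: "orthonormal_on E (\<lambda>e. e)"
    "\<And>x. norm x = 1 \<Longrightarrow> \<exists>e\<in>E. cinner x e \<noteq> 0"
    using maximal_orthonormal_subset[of UNIV] by (metis UNIV_I)
  have "total_family E (\<lambda>e. e)"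
    unfolding total_family_def
  proof (intro allI impI, rule ccontr)
    fix x assume x: "\<forall>e\<in>E. cinner x e = 0" "x \<noteq> 0"
    then show False using E(2)[of "sgn x"] by (auto simp: norm_sgn sgn_div_norm cinner_scaleR_left)
  qed
  then show ?thesis using E is_onb_iff by blast
qed

lemma is_onb_some_onb: "is_onb (some_onb :: 'h::chilbert_space set)"
  unfolding some_onb_def using ex_is_onb by (rule someI_ex)

lemma onb_orthonormal: "is_onb E \<Longrightarrow> orthonormal_on E (\<lambda>e. e)"
  and onb_total: "is_onb E \<Longrightarrow> total_family E (\<lambda>e. e)"
  by (auto simp: is_onb_iff)

text \<open>Density of the span in the form of an induction rule. The orthogonal projection
  \<open>p\<close> onto the closed subspace given by P fixes every \<open>v i\<close>, so the
  remainder \<open>x - p x\<close> is orthogonal to all of them and vanishes.\<close>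

lemma total_induct:
  fixes v :: "'i \<Rightarrow> 'h::chilbert_space"
  assumes v: "total_family I v" and cl: "closed {x. P x}" and 0: "P 0"
    and add: "\<And>x y. P x \<Longrightarrow> P y \<Longrightarrow> P (x + y)" and scale: "\<And>c x. P x \<Longrightarrow> P (scaleC c x)"
    and P: "\<And>i. i \<in> I \<Longrightarrow> P (v i)"
  shows "P x"
proof -
  obtain E where E: "E \<subseteq> {x. P x}" "orthonormal_on E (\<lambda>e. e)"
    "\<And>x. P x \<Longrightarrow> norm x = 1 \<Longrightarrow> \<exists>e\<in>E. cinner x e \<noteq> 0"
    using maximal_orthonormal_subset[of "{x. P x}"] by (metis mem_Collect_eq)
  define p where "p x = (\<Sum>\<^sub>\<infinity>e\<in>E. scaleC (cinner x e) e)" for x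
  have pP: "P (p x)" for x
  proof -
    have "((\<lambda>e. scaleC (cinner x e) e) has_sum p x) E"
      unfolding p_def by (intro has_sum_infsum summable_on_orthonormal bessel_summable E)
    then have lim: "(sum (\<lambda>e. scaleC (cinner x e) e) \<longlongrightarrow> p x) (finite_subsets_at_top E)"
      by (simp add: has_sum_def)
    have P': "P (\<Sum>e\<in>F. scaleC (cinner x e) e)" if "F \<subseteq> E" for F
      using that by (induction F rule: infinite_finite_induct) (use E(1) in \<open>auto intro: 0 add scale\<close>)
    show ?thesis
      using Lim_in_closed_set[OF cl _ _ lim] P' by (simp add: eventually_finite_subsets_at_top_weakI)
  qed
  have po: "cinner (x - p x) e = 0" if "e \<in> E" for x e
    unfolding p_def cinner_diff_left
    using cinner_infsum_orthonormal[OF E(2) bessel_summable[OF E(2)] that] by simp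
  have diff: "P (x - y)" if "P x" "P y" for x y
    using add[OF that(1) scale[OF that(2), of "-1"]] by (simp add: scaleC_minus1)
  \<comment> \<open>Otherwise the normalized remainder would be a unit vector of the subspace
    orthogonal to E, against the maximality of E.\<close>
  have pe: "p x = x" if "P x" for x
  proof (rule ccontr)
    assume "p x \<noteq> x"
    moreover have "P (sgn (x - p x))"
      using scale[OF diff[OF that pP[of x]], of "complex_of_real (inverse (norm (x - p x)))"]
      by (simp add: sgn_div_norm scaleR_scaleC)
    moreover have "cinner (sgn (x - p x)) e = 0" if "e \<in> E" for e
      using po[OF that] by (simp add: sgn_div_norm cinner_scaleR_left)
    ultimately show False using E(3)[of "sgn (x - p x)"] by (auto simp: norm_sgn)
  qed
  have "x = p x"
  proof (rule total_familyD[OF v])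
    fix i assume "i \<in> I"
    then have vi: "p (v i) = v i" using pe P by blast
    have "((\<lambda>e. scaleC (cinner (v i) e) e) has_sum p (v i)) E"
      unfolding p_def by (intro has_sum_infsum summable_on_orthonormal bessel_summable E)
    from has_sum_bounded_linear[OF bounded_linear_cinner_right[of "x - p x"] this]
    have "((\<lambda>e. 0) has_sum cinner (x - p x) (v i)) E"
      unfolding vi by (rule has_sum_cong[THEN iffD1, rotated]) (simp add: cinner_scaleC_right po)
    then have "cinner (x - p x) (v i) = 0" by (metis has_sum_0_simp has_sum_unique)
    then show "cinner x (v i) = cinner (p x) (v i)" by (simp add: cinner_diff_left)
  qed
  then show ?thesis using pP by metis
qed

lemma total_linear_eq:
  fixes v :: "'i \<Rightarrow> 'h::chilbert_space" and f g :: "'h \<Rightarrow> complex"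
  assumes "total_family I v" and "bounded_linear f" "bounded_linear g"
    and "\<And>c x. f (scaleC c x) = c * f x" "\<And>c x. g (scaleC c x) = c * g x"
    and "\<And>i. i \<in> I \<Longrightarrow> f (v i) = g (v i)"
  shows "f x = g x"
proof (rule total_induct[OF assms(1)])
  interpret f: bounded_linear f by fact
  interpret g: bounded_linear g by fact
  show "closed {x. f x = g x}"
    by (intro closed_Collect_eq f.continuous_on g.continuous_on continuous_on_id)
  show "f (x + y) = g (x + y)" if "f x = g x" "f y = g y" for x y
    using that by (simp add: f.add g.add)
  show "f 0 = g 0" by (simp add: f.zero g.zero)
qed (use assms in auto)

subsection \<open>Riesz representation, adjoints and isometries\<close>

text \<open>The representing vector must have the coefficients \<open>cnj (l e)\<close> in an
  orthonormal basis; the work lies in showing that these are square summable.\<close>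

lemma riesz:
  fixes l :: "'h::chilbert_space \<Rightarrow> complex"
  assumes l: "bounded_linear l" and lC: "\<And>c x. l (scaleC c x) = c * l x"
  obtains y where "\<And>x. l x = cinner x y"
proof -
  obtain E :: "'h set" where E: "is_onb E" using ex_is_onb by blast
  note o = onb_orthonormal[OF E]
  interpret bounded_linear l by fact
  obtain K where K: "\<And>x. norm (l x) \<le> norm x * K" "0 \<le> K" using nonneg_bounded by blast
  \<comment> \<open>Testing l on the vector v with the expected coefficients gives
    \<open>s \<le> K * sqrt s\<close>, and hence a bound independent of F.\<close>
  have b: "(\<Sum>e\<in>F. (cmod (l e))\<^sup>2) \<le> K\<^sup>2" if F: "finite F" "F \<subseteq> E" for F
  proof -
    define v where "v = (\<Sum>e\<in>F. scaleC (cnj (l e)) e)"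
    define s where "s = (\<Sum>e\<in>F. (cmod (l e))\<^sup>2)"
    have s0: "s \<ge> 0" unfolding s_def by (intro sum_nonneg) auto
    have "(norm v)\<^sup>2 = s"
      unfolding v_def s_def using norm_sum_orthonormal[OF o F, of "\<lambda>e. cnj (l e)"] by simp
    then have nv: "norm v = sqrt s" by (metis norm_ge_zero real_sqrt_unique)
    have "l v = complex_of_real s"
      unfolding v_def s_def by (simp add: sum lC complex_norm_square mult.commute del: of_real_power)
    then have "s \<le> sqrt s * K" using K(1)[of v] s0 nv by simp
    then have "s = 0 \<or> sqrt s \<le> K"
      using s0 real_sqrt_mult_self[of s] mult_left_le_imp_le[of "sqrt s" "sqrt s" K]
      by (cases "s = 0") auto
    then show ?thesis
      using K(2) s0 unfolding s_def[symmetric]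
      by (metis power_mono real_sqrt_ge_0_iff real_sqrt_pow2 zero_le_power2)
  qed
  have sm: "(\<lambda>e. (cmod (cnj (l e)))\<^sup>2) summable_on E"
    using b by (intro nonneg_bdd_above_summable_on) (auto intro!: bdd_aboveI[of _ "K\<^sup>2"])
  define y where "y = (\<Sum>\<^sub>\<infinity>e\<in>E. scaleC (cnj (l e)) e)"
  have "l x = cinner x y" for x
  proof (rule total_linear_eq[OF onb_total[OF E] l bounded_linear_cinner_left[of y]])
    fix e assume "e \<in> E"
    then have "cinner y e = cnj (l e)"
      unfolding y_def by (rule cinner_infsum_orthonormal[OF o sm])
    then show "l e = cinner e y" by (subst cinner_commute) simp
  qed (auto simp: lC cinner_scaleC_left)
  then show ?thesis using that by blast
qed

text \<open>For fixed x the conjugate of \<open>s x\<close> is a bounded linear functional, and its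
  Riesz vector is taken as the image of x.\<close>

lemma ex_sesquilinear_operator:
  fixes s :: "'h::chilbert_space \<Rightarrow> 'k::chilbert_space \<Rightarrow> complex"
  assumes s1: "\<And>x x' y. s (x + x') y = s x y + s x' y" "\<And>c x y. s (scaleC c x) y = c * s x y"
    and s2: "\<And>x y y'. s x (y + y') = s x y + s x y'" "\<And>c x y. s x (scaleC c y) = cnj c * s x y"
    and K: "\<And>x y. cmod (s x y) \<le> K * norm x * norm y" "K \<ge> 0"
  obtains A where "\<And>x y. s x y = cinner (A x) y" "\<And>x. norm (A x) \<le> K * norm x"
    "\<And>x y. A (x + y) = A x + A y" "\<And>c x. A (scaleC c x) = scaleC c (A x)" "bounded_linear A"
proof -
  have "\<exists>a. \<forall>y. s x y = cinner a y" for x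
  proof -
    have "bounded_linear (\<lambda>y. cnj (s x y))"
      using K by (intro bounded_linear_intro[of _ "K * norm x"])
        (auto simp: s2 scaleR_scaleC scaleR_conv_of_real mult.commute mult.left_commute)
    then obtain a where "\<And>y. cnj (s x y) = cinner y a"
      by (rule riesz) (auto simp: s2)
    then have "s x y = cinner a y" for y by (metis cinner_commute complex_cnj_cnj)
    then show ?thesis by blast
  qed
  then obtain A where A: "\<And>x y. s x y = cinner (A x) y" by metis
  have n: "norm (A x) \<le> K * norm x" for x
  proof (cases "A x = 0")
    case False
    have "(norm (A x))\<^sup>2 = cmod (s x (A x))"
      by (simp add: A cinner_self norm_power)
    also have "\<dots> \<le> K * norm x * norm (A x)" by (rule K)
    finally show ?thesis using False by (simp add: power2_eq_square)
  qed (use K in auto)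
  have add: "A (x + y) = A x + A y" for x y
    by (rule cinner_eqI) (simp add: A[symmetric] s1 cinner_add_left)
  have sc: "A (scaleC c x) = scaleC c (A x)" for x c
    by (rule cinner_eqI) (simp add: A[symmetric] s1 cinner_scaleC_left)
  have "bounded_linear A"
    using n by (intro bounded_linear_intro[of _ K]) (auto simp: add sc scaleR_scaleC mult.commute)
  with that A n add sc show ?thesis by blast
qed

lemma cadjoint_unique:
  assumes "\<And>x y. cinner (A x) y = cinner x (B y)"
  shows "cadjoint A = B"
  unfolding cadjoint_def
proof (rule the_equality)
  show "\<forall>x y. cinner (A x) y = cinner x (B y)" using assms by blast
  show "C = B" if "\<forall>x y. cinner (A x) y = cinner x (C y)" for C
    using that assms by (intro ext cinner_eqI_right) metis
qed

lemma
  fixes A :: "'h::chilbert_space \<Rightarrow> 'h"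
  assumes A: "bounded_clinear A"
  shows cadjoint: "cinner (A x) y = cinner x (cadjoint A y)"
    and bounded_clinear_cadjoint: "bounded_clinear (cadjoint A)"
proof -
  interpret bounded_linear A using A by (rule bounded_clinear_bounded_linear)
  obtain K where K: "\<And>x. norm (A x) \<le> norm x * K" "0 \<le> K" using nonneg_bounded by blast
  obtain B where B: "\<And>x y. cinner x (A y) = cinner (B x) y" "\<And>x y. B (x + y) = B x + B y"
    "\<And>c x. B (scaleC c x) = scaleC c (B x)" "bounded_linear B"
  proof (rule ex_sesquilinear_operator[of "\<lambda>x y. cinner x (A y)" K])
    show "cmod (cinner x (A y)) \<le> K * norm x * norm y" for x y
      using cinner_cauchy_schwarz[of x "A y"] mult_left_mono[OF K(1)[of y], of "norm x"]
      by (simp add: mult_ac)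
  qed (auto simp: cinner_add_left cinner_add_right cinner_scaleC_left cinner_scaleC_right add
      bounded_clinear_scaleC[OF A] K)
  have AB: "cinner (A x) y = cinner x (B y)" for x y by (metis B(1) cinner_commute)
  have "cadjoint A = B" by (rule cadjoint_unique) (rule AB)
  then show "cinner (A x) y = cinner x (cadjoint A y)" "bounded_clinear (cadjoint A)"
    using AB B by (auto simp: bounded_clinear_def)
qed

lemma cadjoint_left:
  "bounded_clinear A \<Longrightarrow> cinner (cadjoint A x) y = cinner x (A (y :: 'h::chilbert_space))"
  by (metis cadjoint cinner_commute)

lemma cadjoint_cadjoint: "bounded_clinear A \<Longrightarrow> cadjoint (cadjoint A) = A"
  by (rule cadjoint_unique) (rule cadjoint_left)

lemma cinner_polarization:
  "cinner x y = complex_of_real (((norm (x + y))\<^sup>2 - (norm x)\<^sup>2 - (norm y)\<^sup>2) / 2)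
     + \<i> * complex_of_real (((norm (x + scaleC \<i> y))\<^sup>2 - (norm x)\<^sup>2 - (norm y)\<^sup>2) / 2)"
  for x y :: "'h::chilbert_space"
proof -
  have R: "Re (cinner x y) = ((norm (x + y))\<^sup>2 - (norm x)\<^sup>2 - (norm y)\<^sup>2) / 2" for y :: 'h
    unfolding inner_cinner[symmetric]
    by (simp add: power2_norm_eq_inner inner_add inner_commute)
  have "Im (cinner x y) = Re (cinner x (scaleC \<i> y))" by (simp add: cinner_scaleC_right)
  also have "\<dots> = ((norm (x + scaleC \<i> y))\<^sup>2 - (norm x)\<^sup>2 - (norm y)\<^sup>2) / 2"
    unfolding R by (simp add: norm_scaleC)
  finally show ?thesis by (intro complex_eqI) (simp_all add: R)
qed

text \<open>Gram matrices that agree up to the factor K allow \<open>v i \<mapsto> w i\<close> to be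
  extended. The extension is built as a graph: T is the closed span of the pairs in the product
  space. On T the norms of the two components are proportional, which makes T single valued and its
  domain closed.\<close>

lemma isometry_extension:
  fixes v :: "'i \<Rightarrow> 'h::chilbert_space" and w :: "'i \<Rightarrow> 'k::chilbert_space"
  assumes v: "total_family I v" and "K > 0"
    and vw: "\<And>i j. i \<in> I \<Longrightarrow> j \<in> I \<Longrightarrow> cinner (w i) (w j) = complex_of_real K * cinner (v i) (v j)"
  obtains U where "\<And>i. i \<in> I \<Longrightarrow> U (v i) = w i" "\<And>x y. cinner (U x) (U y) = complex_of_real K * cinner x y"
    "\<And>x y. U (x + y) = U x + U y" "\<And>c x. U (scaleC c x) = scaleC c (U x)"
    "bounded_linear U"
proof -
  \<comment> \<open>\<open>span\<close> is the real span, so complex multiples are put among the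
    generators by hand.\<close>
  define G where "G = {(scaleC c (v i), scaleC c (w i)) | c i. i \<in> I}"
  define T where "T = closure (span G)"
  have T0: "subspace T" 
    unfolding T_def subspace_def
  proof (intro conjI ballI allI)
    show "0 \<in> closure (span G)" using closure_subset span_0 by blast
    show "x + y \<in> closure (span G)" if xy: "x \<in> closure (span G)" "y \<in> closure (span G)" for x y
    proof -
      obtain X Y where "\<And>n. X n \<in> span G" "X \<longlonglongrightarrow> x" "\<And>n. Y n \<in> span G" "Y \<longlonglongrightarrow> y"
        using xy unfolding closure_sequential by blast
      then show ?thesis
        unfolding closure_sequential
        by (intro exI[of _ "\<lambda>n. X n + Y n"] conjI allI span_add tendsto_add)
    qed
    show "c *\<^sub>R x \<in> closure (span G)" if xy: "x \<in> closure (span G)" for x c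
    proof -
      obtain X where "\<And>n. X n \<in> span G" "X \<longlonglongrightarrow> x"
        using xy unfolding closure_sequential by blast
      then show ?thesis
        unfolding closure_sequential
        by (intro exI[of _ "\<lambda>n. c *\<^sub>R X n"] conjI allI span_scale tendsto_intros)
    qed
  qed
  have spC: "(scaleC c (fst p), scaleC c (snd p)) \<in> span G" if "p \<in> span G" for p c
    using that
  proof (induction rule: span_induct_alt)
    case base
    then show ?case by (simp add: zero_prod_def[symmetric] span_zero)
  next
    case (step r x y)
    have "r *\<^sub>R (scaleC c (fst x), scaleC c (snd x)) \<in> span G"
      using step(1) by (intro span_scale span_base) (force simp: G_def scaleC_scaleC)
    from span_add[OF this step(2)] show ?case
      by (simp add: scaleC_add_right scaleR_scaleC scaleC_scaleC mult.commute)
  qed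
  have TC: "(scaleC c x, scaleC c y) \<in> T" if "(x, y) \<in> T" for x y c
  proof -
    let ?m = "\<lambda>p::'h\<times>'k. (scaleC c (fst p), scaleC c (snd p))"
    have "continuous_on (closure (span G)) ?m"
      by (intro continuous_intros bounded_linear.continuous_on[OF bounded_linear_scaleC])
    then have "?m ` closure (span G) \<subseteq> T"
      by (rule image_closure_subset) (use spC closure_subset[of "span G"] in \<open>auto simp: T_def\<close>)
    then show ?thesis using that by (force simp: T_def)
  qed
  have nG: "norm (snd p) = sqrt K * norm (fst p)" if "p \<in> span G" for p
  proof -
    have *: "cinner (snd p) (snd q) = complex_of_real K * cinner (fst p) (fst q)"
      if "p \<in> span G" "q \<in> span G" for p q
      using that(1)
    proof (induction rule: span_induct_alt)
      case (step r x y)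
      have "cinner (snd x) (snd q) = complex_of_real K * cinner (fst x) (fst q)"
        using that(2)
      proof (induction rule: span_induct_alt)
        case (step r' x' y')
        then show ?case using \<open>x \<in> G\<close>
          by (auto simp: G_def cinner_scaleC_left cinner_scaleC_right cinner_add_right
              cinner_scaleR_right vw algebra_simps)
      qed simp
      then show ?case
        using step by (simp add: cinner_add_left cinner_scaleR_left algebra_simps)
    qed simp
    have "complex_of_real ((norm (snd p))\<^sup>2) = complex_of_real (K * (norm (fst p))\<^sup>2)"
      using *[OF that that] by (simp add: cinner_self)
    then have "(norm (snd p))\<^sup>2 = (sqrt K * norm (fst p))\<^sup>2"
      using \<open>K > 0\<close> by (simp only: of_real_eq_iff power_mult_distrib) simp
    then show ?thesis using \<open>K > 0\<close> by (simp add: power2_eq_iff_nonneg)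
  qed
  have nT: "norm y = sqrt K * norm x" if "(x, y) \<in> T" for x y
  proof -
    have "closed {p::'h\<times>'k. norm (snd p) = sqrt K * norm (fst p)}"
      by (intro closed_Collect_eq continuous_intros)
    then have "T \<subseteq> {p. norm (snd p) = sqrt K * norm (fst p)}"
      unfolding T_def using nG by (intro closure_minimal) auto
    then show ?thesis using that by auto
  qed
  have sub: "(x - x', y - y') \<in> T" if "(x, y) \<in> T" "(x', y') \<in> T" for x x' y y'
    using subspace_diff[OF T0 that] by simp
  \<comment> \<open>The domain of T is a complex subspace containing a total family. It is closed
    because proportional norms make the images of a convergent sequence Cauchy.\<close>
  have ex: "\<exists>y. (x, y) \<in> T" for x
  proof (rule total_induct[OF v])
    show "closed {x. \<exists>y. (x, y) \<in> T}"
      unfolding closed_sequential_limits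
    proof (intro allI impI, elim conjE)
      fix X x assume "\<forall>n. X n \<in> {x. \<exists>y. (x, y) \<in> T}" and lim: "X \<longlonglongrightarrow> x"
      then obtain Y where Y: "\<And>n. (X n, Y n) \<in> T" by (simp, metis)
      have "Cauchy X" using lim by (rule LIMSEQ_imp_Cauchy)
      have "Cauchy Y"
      proof (rule metric_CauchyI)
        fix e :: real assume "e > 0"
        then have "e / sqrt K > 0" using \<open>K > 0\<close> by simp
        then obtain M where "\<And>m n. m \<ge> M \<Longrightarrow> n \<ge> M \<Longrightarrow> dist (X m) (X n) < e / sqrt K"
          using metric_CauchyD[OF \<open>Cauchy X\<close>] by metis
        moreover have "dist (Y m) (Y n) = sqrt K * dist (X m) (X n)" for m n
          unfolding dist_norm by (rule nT[OF sub[OF Y Y]])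
        ultimately show "\<exists>M. \<forall>m\<ge>M. \<forall>n\<ge>M. dist (Y m) (Y n) < e"
          using \<open>K > 0\<close> by (auto simp: field_simps intro!: exI[of _ M])
      qed
      then obtain y where "Y \<longlonglongrightarrow> y" using Cauchy_convergent convergent_def by blast
      then have "(\<lambda>n. (X n, Y n)) \<longlonglongrightarrow> (x, y)" by (intro tendsto_Pair lim)
      then have "(x, y) \<in> T"
        using closed_sequentially[OF closed_closure[of "span G"], of "\<lambda>n. (X n, Y n)"] Y
        unfolding T_def by blast
      then show "x \<in> {x. \<exists>y. (x, y) \<in> T}" by blast
    qed
    show "\<exists>y. (0, y) \<in> T" using subspace_0[OF T0] by (auto simp: zero_prod_def)
    show "\<exists>z. (x + y, z) \<in> T" if "\<exists>z. (x, z) \<in> T" "\<exists>z. (y, z) \<in> T" for x y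
      using that subspace_add[OF T0] by fastforce
    show "\<exists>z. (scaleC c x, z) \<in> T" if "\<exists>z. (x, z) \<in> T" for c x
      using that TC by blast
    show "\<exists>y. (v i, y) \<in> T" if "i \<in> I" for i
    proof -
      have "(scaleC 1 (v i), scaleC 1 (w i)) \<in> G" using that unfolding G_def by blast
      then show ?thesis unfolding T_def using closure_subset span_base by fastforce
    qed
  qed
  then obtain U where U: "\<And>x. (x, U x) \<in> T" by metis
  have uni: "y = U x" if "(x, y) \<in> T" for x y
    using nT[OF sub[OF that U[of x]]] by simp
  have Uv: "U (v i) = w i" if "i \<in> I" for i
  proof -
    have "(scaleC 1 (v i), scaleC 1 (w i)) \<in> G" using that unfolding G_def by blast
    then have "(v i, w i) \<in> T" unfolding T_def using closure_subset span_base by fastforce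
    then show ?thesis using uni by metis
  qed
  have add: "U (x + y) = U x + U y" for x y
    using uni[of "x + y" "U x + U y"] subspace_add[OF T0 U U, of x y] by simp
  have sc: "U (scaleC c x) = scaleC c (U x)" for c x
    using uni[OF TC[OF U]] by simp
  have n: "norm (U x) = sqrt K * norm x" for x by (rule nT[OF U])
  have "cinner (U x) (U y) = complex_of_real K * cinner x y" for x y
    unfolding cinner_polarization[of "U x"] cinner_polarization[of x]
      sc[symmetric] add[symmetric] n using \<open>K > 0\<close> by (simp add: power_mult_distrib algebra_simps
        diff_divide_distrib add_divide_distrib)
  moreover have "bounded_linear U"
    by (rule bounded_linear_intro[of _ "sqrt K"]) (auto simp: add sc n scaleR_scaleC)
  ultimately show ?thesis using that Uv add sc by blast
qed

section \<open>Lebesgue measure\<close>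

lemma has_bochner_integral_lborel_plus:
  fixes f :: "'a::euclidean_space \<Rightarrow> 'b::{banach, second_countable_topology}"
  assumes "has_bochner_integral lborel f I"
  shows "has_bochner_integral lborel (\<lambda>x. f (a + x)) I"
proof -
  have [measurable]: "f \<in> borel_measurable borel"
    using has_bochner_integral_integrable[OF integrable.intros[OF assms]] assms
    by (auto simp: has_bochner_integral_iff)
  have "has_bochner_integral (distr lborel borel (\<lambda>x. a + x)) f I"
    using assms by (simp add: lborel_distr_plus)
  then show ?thesis
    by (simp add: has_bochner_integral_iff integrable_distr_eq integral_distr)
qed

lemma lborel_distr_reflect: "distr lborel borel (\<lambda>x::'a::euclidean_space. a - x) = lborel"
  using lborel_affine[of "-1" a] by (simp add: density_1)

lemma nn_integral_lborel_plus:
  fixes f :: "'a::euclidean_space \<Rightarrow> ennreal"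
  assumes [measurable]: "f \<in> borel_measurable borel"
  shows "(\<integral>\<^sup>+x. f (a + x) \<partial>lborel) = (\<integral>\<^sup>+x. f x \<partial>lborel)"
proof -
  have "(\<integral>\<^sup>+x. f x \<partial>lborel) = (\<integral>\<^sup>+x. f x \<partial>distr lborel borel (\<lambda>x. a + x))"
    by (simp add: lborel_distr_plus)
  then show ?thesis by (simp add: nn_integral_distr)
qed

lemma nn_integral_lborel_reflect:
  fixes f :: "'a::euclidean_space \<Rightarrow> ennreal"
  assumes [measurable]: "f \<in> borel_measurable borel"
  shows "(\<integral>\<^sup>+x. f (a - x) \<partial>lborel) = (\<integral>\<^sup>+x. f x \<partial>lborel)"
proof -
  have "(\<integral>\<^sup>+x. f x \<partial>lborel) = (\<integral>\<^sup>+x. f x \<partial>distr lborel borel (\<lambda>x. a - x))"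
    by (simp add: lborel_distr_reflect)
  then show ?thesis by (simp add: nn_integral_distr)
qed

lemma integral_lborel_affine:
  fixes f :: "'a::euclidean_space \<Rightarrow> 'b::{banach, second_countable_topology}"
  assumes [measurable]: "f \<in> borel_measurable borel" and "c \<noteq> 0"
  shows "(\<integral>x. f x \<partial>lborel) = \<bar>c\<bar> ^ DIM('a) *\<^sub>R (\<integral>x. f (a + c *\<^sub>R x) \<partial>lborel)"
  by (subst lborel_affine[OF assms(2), of a])
     (simp add: integral_density integral_distr)

text \<open>The uniqueness of Haar measure, normalized on the unit balls.\<close>

lemma lborel_distr_isometry:
  fixes T :: "'a::euclidean_space \<Rightarrow> 'b::euclidean_space"
  assumes T: "linear T" "surj T" and n: "\<And>x. norm (T x) = norm x" and d: "DIM('a) = DIM('b)"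
  shows "distr lborel borel T = lborel"
proof (rule measure_eqI)
  show "sets (distr lborel borel T) = sets lborel" by simp
  fix A assume "A \<in> sets (distr lborel borel T)"
  then have [measurable]: "A \<in> sets borel" by simp
  have Tm [measurable]: "T \<in> borel_measurable borel"
    by (intro borel_measurable_continuous_onI linear_continuous_on) (simp add: linear_conv_bounded_linear[symmetric] T)
  define B where "B = (ball 0 1 :: 'b set)"
  have [measurable]: "B \<in> sets borel" by (simp add: B_def)
  let ?I = "\<lambda>S x. indicator S x :: ennreal"
  have iT: "(\<integral>\<^sup>+x. ?I S (T x) \<partial>lborel) = emeasure lborel (T -` S)" if "S \<in> sets borel" for S
  proof -
    have "(\<lambda>x. ?I S (T x)) = ?I (T -` S)" by (auto simp: indicator_def)
    then show ?thesis using measurable_sets_borel[OF Tm that] by simp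
  qed
  have TB: "emeasure lborel (T -` B) = emeasure lborel B"
  proof -
    have "T -` B = ball 0 1" by (auto simp: B_def n)
    then show ?thesis by (simp add: B_def emeasure_ball d)
  qed
  have vB: "emeasure lborel B \<noteq> 0" "emeasure lborel B \<noteq> \<infinity>"
    unfolding B_def by (auto simp: emeasure_ball unit_ball_vol_pos)
      (use unit_ball_vol_pos[of "DIM('b)"] in \<open>simp add: not_less[symmetric]\<close>)
  \<comment> \<open>The double integral of \<open>?I A (T x) * ?I B (T x + y)\<close> is evaluated
    in both orders. Integrating over y first gives the left side; shifting x by a preimage of -y
    moves the sum from B to A and gives the same product with A and B exchanged.\<close>
  have "emeasure lborel B * emeasure lborel (T -` A)
      = (\<integral>\<^sup>+x. ?I A (T x) * (\<integral>\<^sup>+y. ?I B y \<partial>lborel) \<partial>lborel)"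
    by (simp add: nn_integral_multc nn_integral_cmult iT mult.commute)
  also have "\<dots> = (\<integral>\<^sup>+x. (\<integral>\<^sup>+y. ?I A (T x) * ?I B (T x + y) \<partial>lborel) \<partial>lborel)"
    by (intro nn_integral_cong) (simp add: nn_integral_cmult nn_integral_lborel_plus[of "?I B" "T _"])
  also have "\<dots> = (\<integral>\<^sup>+y. (\<integral>\<^sup>+x. ?I A (T x) * ?I B (T x + y) \<partial>lborel) \<partial>lborel)"
    by (rule lborel_pair.Fubini'[symmetric]) measurable
  also have "\<dots> = (\<integral>\<^sup>+y. (\<integral>\<^sup>+x. ?I A (T x - y) * ?I B (T x) \<partial>lborel) \<partial>lborel)"
  proof (rule nn_integral_cong)
    fix y
    obtain a where a: "T a = - y" using T(2) by (metis surjD)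
    have "(\<integral>\<^sup>+x. ?I A (T x) * ?I B (T x + y) \<partial>lborel)
        = (\<integral>\<^sup>+x. ?I A (T (a + x)) * ?I B (T (a + x) + y) \<partial>lborel)"
      by (rule nn_integral_lborel_plus[symmetric]) measurable
    then show "(\<integral>\<^sup>+x. ?I A (T x) * ?I B (T x + y) \<partial>lborel) = (\<integral>\<^sup>+x. ?I A (T x - y) * ?I B (T x) \<partial>lborel)"
      by (simp add: linear_add[OF T(1)] a)
  qed
  also have "\<dots> = (\<integral>\<^sup>+x. (\<integral>\<^sup>+y. ?I A (T x - y) * ?I B (T x) \<partial>lborel) \<partial>lborel)"
    by (rule lborel_pair.Fubini') measurable
  also have "\<dots> = (\<integral>\<^sup>+x. emeasure lborel A * ?I B (T x) \<partial>lborel)"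
    by (intro nn_integral_cong) (simp add: nn_integral_multc nn_integral_lborel_reflect[of "?I A"])
  also have "\<dots> = emeasure lborel A * emeasure lborel (T -` B)"
    by (simp add: nn_integral_cmult iT)
  finally have "emeasure lborel B * emeasure lborel (T -` A) = emeasure lborel B * emeasure lborel A"
    by (simp add: TB mult.commute)
  then have "emeasure lborel (T -` A) = emeasure lborel A"
    using vB by (simp add: ennreal_mult_cancel_left)
  then show "emeasure (distr lborel borel T) A = emeasure lborel A"
    by (simp add: emeasure_distr)
qed

section \<open>Gaussian functions\<close>

text \<open>The characteristic function of the standard normal distribution after the substitution
  by \<open>sqrt (2 * c) * x\<close>, which turns its exponent into -c x^2; the frequency t becomes
  s.\<close>

lemma has_bochner_integral_gauss_1:
  assumes c: "c > 0"
  shows "has_bochner_integral lborel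
    (\<lambda>x::real. exp (complex_of_real (- c * x\<^sup>2) + \<i> * complex_of_real (t * x)))
    (complex_of_real (sqrt (pi / c) * exp (- t\<^sup>2 / (4 * c))))"
proof -
  define s where "s = t / sqrt (2 * c)"
  have sc: "sqrt (2 * c) > 0" using c by simp
  have i: "integrable lborel std_normal_density"
    using integrable_normal_moment_nz_1[of 1 0] integrable_std_normal_moment[of 0] by simp
  have "char std_normal_distribution s = complex_of_real (exp (- s\<^sup>2 / 2))"
    by (simp add: char_std_normal_distribution)
  then have "(\<integral>x. std_normal_density x *\<^sub>R iexp (s * x) \<partial>lborel) = complex_of_real (exp (- s\<^sup>2 / 2))"
    unfolding char_def by (subst (asm) integral_density) auto
  moreover have "integrable lborel (\<lambda>x. std_normal_density x *\<^sub>R iexp (s * x))"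
    by (rule Bochner_Integration.integrable_bound[OF i]) auto
  ultimately have "has_bochner_integral lborel (\<lambda>x. std_normal_density x *\<^sub>R iexp (s * x))
      (complex_of_real (exp (- s\<^sup>2 / 2)))"
    by (simp add: has_bochner_integral_iff)
  then have "has_bochner_integral lborel (\<lambda>x. std_normal_density (0 + sqrt (2 * c) * x) *\<^sub>R iexp (s * (0 + sqrt (2 * c) * x)))
      (complex_of_real (exp (- s\<^sup>2 / 2)) /\<^sub>R \<bar>sqrt (2 * c)\<bar>)"
    using sc by (subst (asm) lborel_has_bochner_integral_real_affine_iff[where c="sqrt (2*c)" and t=0]) auto
  then have "has_bochner_integral lborel (\<lambda>x. complex_of_real (sqrt (2 * pi)) * (std_normal_density (0 + sqrt (2 * c) * x) *\<^sub>R iexp (s * (0 + sqrt (2 * c) * x))))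
      (complex_of_real (sqrt (2 * pi)) * (complex_of_real (exp (- s\<^sup>2 / 2)) /\<^sub>R \<bar>sqrt (2 * c)\<bar>))"
    by (rule has_bochner_integral_mult_right)
  moreover have "complex_of_real (sqrt (2 * pi)) * (std_normal_density (0 + sqrt (2 * c) * x) *\<^sub>R iexp (s * (0 + sqrt (2 * c) * x)))
     = exp (complex_of_real (- c * x\<^sup>2) + \<i> * complex_of_real (t * x))" for x
  proof -
    have "sqrt (2 * pi) * std_normal_density (sqrt (2 * c) * x) = exp (- c * x\<^sup>2)"
      using c by (simp add: std_normal_density_def power_mult_distrib)
    then have "complex_of_real (sqrt (2 * pi)) * complex_of_real (std_normal_density (sqrt (2 * c) * x))
        = exp (complex_of_real (- c * x\<^sup>2))"
      by (simp only: exp_of_real of_real_mult[symmetric])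
    moreover have "s * (sqrt (2 * c) * x) = t * x" using sc by (simp add: s_def)
    ultimately show ?thesis
      by (simp only: add_0 scaleR_conv_of_real exp_add mult.assoc[symmetric])
  qed
  moreover have "complex_of_real (sqrt (2 * pi)) * (complex_of_real (exp (- s\<^sup>2 / 2)) /\<^sub>R \<bar>sqrt (2 * c)\<bar>)
      = complex_of_real (sqrt (pi / c) * exp (- t\<^sup>2 / (4 * c)))"
  proof -
    have "s\<^sup>2 / 2 = t\<^sup>2 / (4 * c)" using c by (simp add: s_def power_divide)
    moreover have "sqrt (2 * pi) / sqrt (2 * c) = sqrt (pi / c)" by (simp add: real_sqrt_divide real_sqrt_mult)
    ultimately show ?thesis
      using sc by (simp add: scaleR_conv_of_real field_simps flip: of_real_mult)
  qed
  ultimately show ?thesis by (simp only:)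
qed

text \<open>The complex linear coefficient p + i q is kept as two vectors of the underlying space,
  so that one integral formula serves the configuration space, the real phase space and
  \<open>complex^'n\<close>.\<close>

definition gauss :: "real \<Rightarrow> 'a \<Rightarrow> 'a \<Rightarrow> 'a::euclidean_space \<Rightarrow> complex" where
  "gauss c p q x = exp (complex_of_real (- c * (x \<bullet> x) + p \<bullet> x) + \<i> * complex_of_real (q \<bullet> x))"

lemma borel_measurable_gauss [measurable]: "gauss c p q \<in> borel_measurable borel"
  unfolding gauss_def by (intro borel_measurable_continuous_onI continuous_intros)

lemma gauss_mult: "gauss c p q x * gauss c' p' q' x = gauss (c + c') (p + p') (q + q') x"
  by (simp add: gauss_def inner_add_left algebra_simps flip: exp_add)

lemma cnj_gauss: "cnj (gauss c p q x) = gauss c p (- q) x"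
  by (simp add: gauss_def exp_cnj)

lemma cmod_gauss_square: "complex_of_real ((cmod (gauss c p q x))\<^sup>2) = gauss (2 * c) (2 *\<^sub>R p) 0 x"
  unfolding complex_norm_square cnj_gauss gauss_mult by (simp add: scaleR_2)

lemma has_bochner_integral_gauss:
  fixes p q :: "'a::euclidean_space"
  assumes c: "c > 0"
  shows "has_bochner_integral lborel (gauss c p q)
    (complex_of_real (sqrt (pi / c) ^ DIM('a)) *
      exp (complex_of_real ((p \<bullet> p - q \<bullet> q) / (4 * c)) + \<i> * complex_of_real (p \<bullet> q / (2 * c))))"
proof -
  \<comment> \<open>Without a real linear term the integrand is a product over the
    coordinates.\<close>
  have 0: "has_bochner_integral lborel (gauss c 0 q)
    (complex_of_real (sqrt (pi / c) ^ DIM('a) * exp (- (q \<bullet> q) / (4 * c))))" for q :: 'a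
  proof -
    interpret product_sigma_finite "\<lambda>b::'a. lborel :: real measure" ..
    let ?f = "\<lambda>b x. exp (complex_of_real (- c * x\<^sup>2) + \<i> * complex_of_real ((q \<bullet> b) * x))"
    have i: "integrable lborel (?f b)" and I: "integral\<^sup>L lborel (?f b) =
      complex_of_real (sqrt (pi / c) * exp (- (q \<bullet> b)\<^sup>2 / (4 * c)))" for b
      using has_bochner_integral_gauss_1[OF c, of "q \<bullet> b"] by (auto simp: has_bochner_integral_iff)
    let ?e = "\<lambda>f. \<Sum>b\<in>Basis. f b *\<^sub>R b :: 'a"
    have e [measurable]: "?e \<in> borel_measurable (\<Pi>\<^sub>M b\<in>Basis. lborel)" by measurable
    have g: "gauss c 0 q (?e f) = (\<Prod>b\<in>Basis. ?f b (f b))" for f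
    proof -
      have "?e f \<bullet> ?e f = (\<Sum>b\<in>Basis. (f b)\<^sup>2)"
        by (subst euclidean_inner) (simp add: power2_eq_square)
      moreover have "q \<bullet> ?e f = (\<Sum>b\<in>Basis. (q \<bullet> b) * f b)"
        by (simp add: inner_sum_right mult.commute)
      ultimately show ?thesis
        by (simp add: gauss_def sum_distrib_left sum.distrib exp_sum[symmetric] sum_negf sum_subtractf)
    qed
    have L: "(lborel :: 'a measure) = distr (\<Pi>\<^sub>M b\<in>Basis. lborel) borel ?e" by (rule lborel_eq)
    have "integrable (\<Pi>\<^sub>M b\<in>Basis. lborel) (\<lambda>f. \<Prod>b\<in>(Basis::'a set). ?f b (f b))"
      by (rule product_integrable_prod) (rule finite_Basis, rule i)
    moreover have "(\<integral>f. (\<Prod>b\<in>(Basis::'a set). ?f b (f b)) \<partial>(\<Pi>\<^sub>M b\<in>Basis. lborel))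
        = (\<Prod>b\<in>(Basis::'a set). complex_of_real (sqrt (pi / c) * exp (- (q \<bullet> b)\<^sup>2 / (4 * c))))"
      by (subst product_integral_prod) (rule finite_Basis, rule i, simp only: I)
    moreover have "(\<Prod>b\<in>(Basis::'a set). complex_of_real (sqrt (pi / c) * exp (- (q \<bullet> b)\<^sup>2 / (4 * c))))
        = complex_of_real (sqrt (pi / c) ^ DIM('a) * exp (- (q \<bullet> q) / (4 * c)))"
      by (subst euclidean_inner[of q q]) (simp add: prod.distrib exp_sum[symmetric] sum_negf
          sum_divide_distrib power2_eq_square flip: of_real_prod)
    ultimately show ?thesis
      by (subst L) (simp add: has_bochner_integral_iff integrable_distr_eq integral_distr g)
  qed
  \<comment> \<open>Completing the square: this shift produces the real linear term p.\<close>
  define a where "a = - ((1 / (2 * c)) *\<^sub>R p)"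
  have e: "exp (complex_of_real ((p \<bullet> p) / (4 * c)) + \<i> * complex_of_real (p \<bullet> q / (2 * c))) * gauss c 0 q (a + x)
     = gauss c p q x" for x
  proof -
    have 1: "- c * ((a + x) \<bullet> (a + x)) = - c * (x \<bullet> x) + p \<bullet> x - (p \<bullet> p) / (4 * c)"
      using c by (simp add: a_def inner_diff inner_commute field_simps)
    have 2: "q \<bullet> (a + x) = q \<bullet> x - p \<bullet> q / (2 * c)"
      using c by (simp add: a_def inner_diff_right inner_commute field_simps)
    show ?thesis
      unfolding gauss_def exp_add[symmetric] 1 2 by (simp add: algebra_simps)
  qed
  from has_bochner_integral_mult_right[OF has_bochner_integral_lborel_plus[OF 0[of q], of a]]
  have "has_bochner_integral lborel (\<lambda>x. gauss c p q x)
     (exp (complex_of_real ((p \<bullet> p) / (4 * c)) + \<i> * complex_of_real (p \<bullet> q / (2 * c))) *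
       complex_of_real (sqrt (pi / c) ^ DIM('a) * exp (- (q \<bullet> q) / (4 * c))))"
    unfolding e[symmetric] by auto
  moreover have "exp (complex_of_real ((p \<bullet> p) / (4 * c)) + \<i> * complex_of_real (p \<bullet> q / (2 * c))) *
       complex_of_real (sqrt (pi / c) ^ DIM('a) * exp (- (q \<bullet> q) / (4 * c)))
     = complex_of_real (sqrt (pi / c) ^ DIM('a)) *
      exp (complex_of_real ((p \<bullet> p - q \<bullet> q) / (4 * c)) + \<i> * complex_of_real (p \<bullet> q / (2 * c)))"
  proof -
    have "exp (complex_of_real ((p \<bullet> p) / (4 * c)) + \<i> * complex_of_real (p \<bullet> q / (2 * c))) *
        exp (complex_of_real (- (q \<bullet> q) / (4 * c)))
      = exp (complex_of_real ((p \<bullet> p - q \<bullet> q) / (4 * c)) + \<i> * complex_of_real (p \<bullet> q / (2 * c)))"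
      unfolding exp_add[symmetric] by (rule arg_cong[of _ _ exp]) (simp add: diff_divide_distrib)
    then show ?thesis
      by (simp only: of_real_mult exp_of_real[symmetric] mult.left_commute[of "exp _" "of_real (_ ^ _)"])
  qed
  ultimately show ?thesis by (simp only:)
qed

lemma sqint_gauss: "c > 0 \<Longrightarrow> gauss c p q \<in> sqint (lborel :: 'a::euclidean_space measure)"
proof -
  assume "c > 0"
  then have "integrable lborel (gauss (2 * c) (2 *\<^sub>R p) 0 :: 'a \<Rightarrow> complex)"
    using has_bochner_integral_gauss[of "2 * c"] by (auto simp: has_bochner_integral_iff)
  then have "integrable lborel (\<lambda>x. complex_of_real ((cmod (gauss c p q x))\<^sup>2))"
    unfolding cmod_gauss_square .
  then have "integrable lborel (\<lambda>x. (cmod (gauss c p q x))\<^sup>2)"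
    using integrable_Re by force
  then show ?thesis by (simp add: sqint_def)
qed

lemma cinner_abs_L2:
  "f \<in> sqint lborel \<Longrightarrow> g \<in> sqint lborel \<Longrightarrow> cinner (abs_L2 f) (abs_L2 g) = (\<integral>x. f x * cnj (g x) \<partial>lborel)"
  by (simp add: cinner_L2.abs_eq l2rel_refl)

lemma cinner_gauss:
  fixes p q p' q' :: "'a::euclidean_space"
  assumes c: "c > 0"
  shows "cinner (abs_L2 (gauss c p q)) (abs_L2 (gauss c p' q')) =
    complex_of_real (sqrt (pi / (2 * c)) ^ DIM('a)) *
      exp (complex_of_real (((p + p') \<bullet> (p + p') - (q - q') \<bullet> (q - q')) / (8 * c))
        + \<i> * complex_of_real ((p + p') \<bullet> (q - q') / (4 * c)))"
proof -
  have "cinner (abs_L2 (gauss c p q)) (abs_L2 (gauss c p' q')) = (\<integral>x. gauss (2 * c) (p + p') (q - q') x \<partial>lborel)"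
    using c by (simp add: cinner_abs_L2 sqint_gauss cnj_gauss gauss_mult)
  then show ?thesis
    using has_bochner_integral_gauss[of "2 * c" "p + p'" "q - q'"] c
    by (simp add: has_bochner_integral_iff)
qed

subsection \<open>Uniqueness of Fourier transforms\<close>

text \<open>The positive and negative parts of f are densities of two measures that agree on boxes,
  a generator stable under intersections. So the parts agree almost everywhere, and as they are
  never both positive, they vanish there.\<close>

lemma AE_zero_if_box_integrals_zero_real:
  fixes f :: "'a::euclidean_space \<Rightarrow> real"
  assumes f: "integrable lborel f" and z: "\<And>a b. (\<integral>x. f x * indicator (box a b) x \<partial>lborel) = 0"
  shows "AE x in lborel. f x = 0"
proof -
  have [measurable]: "f \<in> borel_measurable borel" using f by auto
  let ?P = "\<lambda>x. max 0 (f x)" and ?N = "\<lambda>x. max 0 (- f x)"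
  have Pi: "integrable lborel ?P" "integrable lborel ?N" using f by auto
  define M where "M = density lborel (\<lambda>x. ennreal (?P x))"
  define N where "N = density lborel (\<lambda>x. ennreal (?N x))"
  have ip: "integrable lborel (\<lambda>x. ?P x * indicator S x)" "integrable lborel (\<lambda>x. ?N x * indicator S x)"
    if [measurable]: "S \<in> sets borel" for S
    using Pi by (auto intro!: integrable_real_mult_indicator)
  have em: "emeasure M S = ennreal (\<integral>x. ?P x * indicator S x \<partial>lborel)"
      "emeasure N S = ennreal (\<integral>x. ?N x * indicator S x \<partial>lborel)"
    if [measurable]: "S \<in> sets borel" for S
    unfolding M_def N_def using ip[OF that]
    by (auto simp: emeasure_density ennreal_indicator[symmetric] ennreal_mult''[symmetric]
      simp del: ennreal_indicator intro!: nn_integral_eq_integral)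
  have bx: "emeasure M (box a b) = emeasure N (box a b)" for a b
  proof -
    have "(\<integral>x. ?P x * indicator (box a b) x \<partial>lborel) - (\<integral>x. ?N x * indicator (box a b) x \<partial>lborel)
       = (\<integral>x. ?P x * indicator (box a b) x - ?N x * indicator (box a b) x \<partial>lborel)"
      by (rule Bochner_Integration.integral_diff[symmetric]) (auto intro!: ip)
    also have "\<dots> = (\<integral>x. f x * indicator (box a b) x \<partial>lborel)"
      by (intro Bochner_Integration.integral_cong) (auto simp: max_def indicator_def)
    finally show ?thesis using z[of a b] by (simp add: em)
  qed
  have "M = N"
  proof (rule measure_eqI_generator_eq)
    let ?E = "range (\<lambda>(a, b). box a b::'a set)"
    show "Int_stable ?E" by (auto simp: Int_stable_def box_Int_box)
    show "?E \<subseteq> Pow UNIV" "sets M = sigma_sets UNIV ?E" "sets N = sigma_sets UNIV ?E"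
      by (simp_all add: M_def N_def borel_eq_box)
    let ?A = "\<lambda>n::nat. box (- (real n *\<^sub>R One)) (real n *\<^sub>R One) :: 'a set"
    show "range ?A \<subseteq> ?E" "(\<Union>i. ?A i) = UNIV" unfolding UN_box_eq_UNIV by auto
    show "emeasure M (?A i) \<noteq> \<infinity>" for i by (simp add: em)
    show "emeasure M X = emeasure N X" if "X \<in> ?E" for X using that bx by auto
  qed
  then have "AE x in lborel. ennreal (?P x) = ennreal (?N x)"
    unfolding M_def N_def by (subst (asm) sigma_finite_measure.density_unique_iff[OF sigma_finite_lborel]) auto
  then show ?thesis by eventually_elim (auto simp: max_def split: if_splits)
qed

lemma AE_zero_if_box_integrals_zero:
  fixes f :: "'a::euclidean_space \<Rightarrow> complex"
  assumes f: "integrable lborel f" and z: "\<And>a b. (\<integral>x. f x * indicator (box a b) x \<partial>lborel) = 0"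
  shows "AE x in lborel. f x = 0"
proof -
  have i: "integrable lborel (\<lambda>x. f x * indicator (box a b) x)" for a b
  proof -
    have "(\<lambda>x. indicator (box a b) x *\<^sub>R f x) = (\<lambda>x. f x * indicator (box a b) x)"
      by (auto simp: indicator_def)
    then show ?thesis using integrable_mult_indicator[OF _ f, of "box a b"] by simp
  qed
  have ind: "Re (f x * indicator (box a b) x) = Re (f x) * indicator (box a b) x"
    "Im (f x * indicator (box a b) x) = Im (f x) * indicator (box a b) x" for x a b
    by (auto simp: indicator_def)
  have "AE x in lborel. Re (f x) = 0"
  proof (rule AE_zero_if_box_integrals_zero_real)
    show "(\<integral>x. Re (f x) * indicator (box a b) x \<partial>lborel) = 0" for a b
      using integral_Re[OF i[of a b]] z[of a b] unfolding ind by simp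
  qed (use f in auto)
  moreover have "AE x in lborel. Im (f x) = 0"
  proof (rule AE_zero_if_box_integrals_zero_real)
    show "(\<integral>x. Im (f x) * indicator (box a b) x \<partial>lborel) = 0" for a b
      using integral_Im[OF i[of a b]] z[of a b] unfolding ind by simp
  qed (use f in auto)
  ultimately show ?thesis by eventually_elim (simp add: complex_eq_iff)
qed

lemma Fubini_lborel_product:
  fixes f :: "'a::euclidean_space \<Rightarrow> complex" and g :: "'b::euclidean_space \<Rightarrow> complex"
  assumes f: "integrable lborel f" and g: "integrable lborel g"
    and h [measurable]: "case_prod h \<in> borel_measurable (borel \<Otimes>\<^sub>M borel)" and h1: "\<And>x y. cmod (h x y) \<le> 1"
  shows "(\<integral>x. f x * (\<integral>y. g y * h x y \<partial>lborel) \<partial>lborel) = (\<integral>y. g y * (\<integral>x. f x * h x y \<partial>lborel) \<partial>lborel)"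
proof -
  have [measurable]: "f \<in> borel_measurable borel" "g \<in> borel_measurable borel" using f g by auto
  have [measurable]: "(\<lambda>p. h (fst p) (snd p)) \<in> borel_measurable (lborel \<Otimes>\<^sub>M lborel)"
    using h by (simp add: split_beta' cong: measurable_cong_sets)
  have hx: "(\<lambda>y. h x y) \<in> borel_measurable borel" for x
    using measurable_compose[OF _ h, of "\<lambda>y. (x, y)" borel] by simp
  have int: "integrable (lborel \<Otimes>\<^sub>M lborel) (\<lambda>(x, y). f x * (g y * h x y))"
  proof (rule Bochner_Integration.integrable_bound)
    show "integrable (lborel \<Otimes>\<^sub>M lborel) (\<lambda>(x, y). f x * g y)"
      by (rule lborel_pair.Fubini_integrable) (use f g in \<open>auto simp: split_beta' norm_mult\<close>)
    show "AE p in lborel \<Otimes>\<^sub>M lborel. norm (case p of (x, y) \<Rightarrow> f x * (g y * h x y))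
        \<le> norm (case p of (x, y) \<Rightarrow> f x * g y)"
      using h1 by (auto simp: norm_mult intro!: AE_I2 mult_left_mono mult_left_le)
  qed (simp add: split_beta')
  have "(\<integral>x. f x * (\<integral>y. g y * h x y \<partial>lborel) \<partial>lborel) = (\<integral>x. (\<integral>y. f x * (g y * h x y) \<partial>lborel) \<partial>lborel)"
    by simp
  also have "\<dots> = (\<integral>y. (\<integral>x. f x * (g y * h x y) \<partial>lborel) \<partial>lborel)"
    by (rule lborel_pair.Fubini_integral[symmetric, OF int])
  also have "\<dots> = (\<integral>y. g y * (\<integral>x. f x * h x y \<partial>lborel) \<partial>lborel)"
    by (simp only: mult.left_commute[of "f _" "g _"] integral_mult_right_zero)
  finally show ?thesis .
qed

text \<open>The transform determines the integrals against Gaussians, these determine the integrals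
  against convolutions of Gaussians with indicators of boxes, and narrow Gaussians approximate
  the identity.\<close>

lemma fourier_unique:
  fixes f :: "'a::euclidean_space \<Rightarrow> complex"
  assumes f: "integrable lborel f"
    and z: "\<And>q. (\<integral>x. f x * exp (\<i> * complex_of_real (q \<bullet> x)) \<partial>lborel) = 0"
  shows "AE x in lborel. f x = 0"
proof (rule AE_zero_if_box_integrals_zero[OF f])
  fix a b :: 'a
  have [measurable]: "f \<in> borel_measurable borel" using f by auto
  have gi: "integrable lborel (gauss c p q :: 'a \<Rightarrow> complex)" if "c > 0" for c p q
    using has_bochner_integral_gauss[OF that] by (auto simp: has_bochner_integral_iff)
  \<comment> \<open>A translated Gaussian with parameter s is a superposition of characters with a
    Gaussian weight of parameter 1/(4s), so Fubini carries the hypothesis over to it.\<close>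
  have z1: "(\<integral>x. f x * gauss s 0 0 (x - y) \<partial>lborel) = 0" if s: "s > 0" for s y
  proof -
    define C where "C = complex_of_real (sqrt (pi * (4 * s)) ^ DIM('a))"
    have C: "C \<noteq> 0" using s by (simp add: C_def)
    have e: "(\<integral>t. gauss (1 / (4 * s)) 0 (- y) t * exp (\<i> * complex_of_real (x \<bullet> t)) \<partial>lborel) = C * gauss s 0 0 (x - y)" for x
    proof -
      have *: "gauss (1 / (4 * s)) 0 (- y) t * exp (\<i> * complex_of_real (x \<bullet> t)) = gauss (1 / (4 * s)) 0 (x - y) t" for t
        by (simp add: gauss_def inner_diff_left algebra_simps flip: exp_add)
      have "gauss s 0 0 (x - y) = exp (complex_of_real (- (s * ((x - y) \<bullet> (x - y)))))"
        by (simp add: gauss_def)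
      then show ?thesis
        unfolding * using has_bochner_integral_gauss[of "1 / (4 * s)" 0 "x - y"] s
        by (simp add: has_bochner_integral_iff C_def mult.commute)
    qed
    have "C * (\<integral>x. f x * gauss s 0 0 (x - y) \<partial>lborel)
       = (\<integral>x. f x * (\<integral>t. gauss (1 / (4 * s)) 0 (- y) t * exp (\<i> * complex_of_real (x \<bullet> t)) \<partial>lborel) \<partial>lborel)"
      unfolding e by (simp add: mult.left_commute)
    also have "\<dots> = (\<integral>t. gauss (1 / (4 * s)) 0 (- y) t * (\<integral>x. f x * exp (\<i> * complex_of_real (x \<bullet> t)) \<partial>lborel) \<partial>lborel)"
      using s by (intro Fubini_lborel_product f gi) (auto simp: split_beta')
    also have "\<dots> = 0" using z by (simp add: inner_commute)
    finally show ?thesis using C by simp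
  qed
  define B where "B = box a b"
  have [measurable]: "B \<in> sets borel" by (simp add: B_def)
  \<comment> \<open>The convolution of the indicator with a narrow Gaussian, after rescaling the
    variable: the Gaussian is fixed and the width sits in the argument of the indicator, which
    allows dominated convergence.\<close>
  define H where "H k x = (\<integral>u. gauss 1 0 0 u * indicator B (x + (1 / real (Suc k)) *\<^sub>R u) \<partial>lborel)" for k and x :: 'a
  have fH: "(\<integral>x. f x * H k x \<partial>lborel) = 0" for k
  proof -
    define s where "s = (real (Suc k))\<^sup>2"
    have s: "s > 0" by (simp add: s_def)
    define C where "C = complex_of_real ((real (Suc k)) ^ DIM('a))"
    have C: "C \<noteq> 0" by (simp add: C_def del: of_nat_Suc)
    have h: "H k x = C * (\<integral>y. indicator B y * gauss s 0 0 (x - y) \<partial>lborel)" for x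
    proof -
      have "(\<integral>y. indicator B y * gauss s 0 0 (x - y) \<partial>lborel)
         = \<bar>1 / real (Suc k)\<bar> ^ DIM('a) *\<^sub>R (\<integral>u. indicator B (x + (1 / real (Suc k)) *\<^sub>R u) * gauss s 0 0 (x - (x + (1 / real (Suc k)) *\<^sub>R u)) \<partial>lborel)"
        by (rule integral_lborel_affine) auto
      also have "(\<lambda>u::'a. gauss s 0 0 (x - (x + (1 / real (Suc k)) *\<^sub>R u))) = gauss 1 0 0"
        by (rule ext) (simp add: gauss_def s_def power2_eq_square del: of_nat_Suc)
      finally show ?thesis
        by (simp add: H_def C_def scaleR_conv_of_real mult.commute power_one_over field_simps
            del: of_nat_Suc)
    qed
    have iB: "integrable lborel (indicator B :: 'a \<Rightarrow> complex)"
    proof -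
      have "integrable lborel (\<lambda>x. complex_of_real (indicator B x))"
        unfolding B_def by (intro integrable_of_real integrable_real_indicator) (auto simp: emeasure_lborel_box_eq)
      also have "(\<lambda>x. complex_of_real (indicator B x)) = indicator B" by (auto simp: indicator_def)
      finally show ?thesis .
    qed
    have "(\<integral>x. f x * H k x \<partial>lborel) = C * (\<integral>x. f x * (\<integral>y. indicator B y * gauss s 0 0 (x - y) \<partial>lborel) \<partial>lborel)"
      by (simp add: h mult.left_commute)
    also have "(\<integral>x. f x * (\<integral>y. indicator B y * gauss s 0 0 (x - y) \<partial>lborel) \<partial>lborel)
       = (\<integral>y. indicator B y * (\<integral>x. f x * gauss s 0 0 (x - y) \<partial>lborel) \<partial>lborel)"
    proof (rule Fubini_lborel_product[OF f iB])
      show "cmod (gauss s 0 0 (x - y)) \<le> 1" for x y :: 'a using s by (simp add: gauss_def)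
    qed (simp add: split_beta')
    also have "\<dots> = 0" using z1[OF s] by simp
    finally show ?thesis by simp
  qed
  define P where "P = complex_of_real (sqrt pi ^ DIM('a))"
  have P: "(\<integral>u. gauss 1 0 0 (u::'a) \<partial>lborel) = P" and "P \<noteq> 0"
    using has_bochner_integral_gauss[of 1 0 "0::'a"] by (auto simp: has_bochner_integral_iff P_def)
  have i0: "integrable lborel (\<lambda>u::'a. cmod (gauss 1 0 0 u))" using gi[of 1 0 0] by simp
  \<comment> \<open>The indicator of a box is locally constant off its boundary, and the boundary is
    a null set by \<open>nul\<close>.\<close>
  have limH: "(\<lambda>k. H k x) \<longlonglongrightarrow> P * indicator B x" if "x \<notin> cbox a b - box a b" for x
  proof -
    have "(\<lambda>k. H k x) \<longlonglongrightarrow> (\<integral>u. gauss 1 0 0 (u::'a) * indicator B x \<partial>lborel)"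
      unfolding H_def
    proof (rule integral_dominated_convergence[OF _ _ i0])
      show "AE u in lborel. (\<lambda>k. gauss 1 0 0 u * (indicator B (x + (1 / real (Suc k)) *\<^sub>R u) :: complex))
         \<longlonglongrightarrow> gauss 1 0 0 u * indicator B x"
      proof (intro AE_I2 tendsto_intros)
        fix u :: 'a
        have "(\<lambda>k. x + (1 / real (Suc k)) *\<^sub>R u) \<longlonglongrightarrow> x + 0 *\<^sub>R u"
          by (intro tendsto_intros LIMSEQ_Suc[OF lim_1_over_n])
        then have lim: "(\<lambda>k. x + (1 / real (Suc k)) *\<^sub>R u) \<longlonglongrightarrow> x" by simp
        have "\<forall>\<^sub>F k in sequentially. (indicator B (x + (1 / real (Suc k)) *\<^sub>R u) :: complex) = indicator B x"
        proof (cases "x \<in> box a b")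
          case True
          from topological_tendstoD[OF lim open_box True] True show ?thesis
            by (auto simp: B_def elim: eventually_mono)
        next
          case False
          then have "x \<in> - cbox a b" using that by auto
          from topological_tendstoD[OF lim _ this] have "\<forall>\<^sub>F k in sequentially. x + (1 / real (Suc k)) *\<^sub>R u \<in> - cbox a b"
            by (simp add: closed_cbox open_Compl)
          then show ?thesis
            by eventually_elim (use False box_subset_cbox[of a b] in \<open>auto simp: B_def indicator_def\<close>)
        qed
        then show "(\<lambda>k. (indicator B (x + (1 / real (Suc k)) *\<^sub>R u) :: complex)) \<longlonglongrightarrow> indicator B x"
          by (rule tendsto_eventually)
      qed
    qed (auto simp: norm_mult indicator_def)
    then show ?thesis by (simp add: P)
  qed
  have nul: "AE x in lborel. x \<notin> cbox a b - box a b"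
  proof (rule AE_not_in)
    have "emeasure lborel (cbox a b - box a b) = emeasure lborel (cbox a b) - emeasure lborel (box a b)"
      by (intro emeasure_Diff) (auto simp: emeasure_lborel_box_eq box_subset_cbox)
    also have "\<dots> = 0" by (simp add: emeasure_lborel_box_eq emeasure_lborel_cbox_eq)
    finally show "cbox a b - box a b \<in> null_sets lborel" by auto
  qed
  have Hm [measurable]: "H k \<in> borel_measurable borel" for k
    unfolding H_def by measurable
  have Hb: "cmod (H k x) \<le> (\<integral>u. cmod (gauss 1 0 0 (u::'a)) \<partial>lborel)" for k x
    unfolding H_def by (intro integral_norm_bound[THEN order_trans] integral_mono integrable_norm
        Bochner_Integration.integrable_bound[OF i0]) (auto simp: norm_mult indicator_def)
  have "(\<lambda>k. \<integral>x. f x * H k x \<partial>lborel) \<longlonglongrightarrow> (\<integral>x. f x * (P * indicator B x) \<partial>lborel)"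
  proof (rule integral_dominated_convergence[where w = "\<lambda>x. cmod (f x) * (\<integral>u. cmod (gauss 1 0 0 (u::'a)) \<partial>lborel)"])
    show "integrable lborel (\<lambda>x. cmod (f x) * (\<integral>u. cmod (gauss 1 0 0 (u::'a)) \<partial>lborel))" using f by simp
    show "AE x in lborel. (\<lambda>k. f x * H k x) \<longlonglongrightarrow> f x * (P * indicator B x)"
      using nul by eventually_elim (intro tendsto_intros limH)
    show "AE x in lborel. norm (f x * H k x) \<le> cmod (f x) * (\<integral>u. cmod (gauss 1 0 0 (u::'a)) \<partial>lborel)" for k
      using Hb by (auto simp: norm_mult intro!: AE_I2 mult_left_mono)
  qed auto
  then have "(\<integral>x. f x * (P * indicator B x) \<partial>lborel) = 0"
    unfolding fH by (simp add: LIMSEQ_const_iff)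
  then have "P * (\<integral>x. f x * indicator B x \<partial>lborel) = 0"
    by (simp add: mult.left_commute)
  then show "(\<integral>x. f x * indicator (box a b) x \<partial>lborel) = 0" using \<open>P \<noteq> 0\<close> by (simp add: B_def)
qed

section \<open>Classes and representatives of square-integrable functions, and totality of the
  Gaussians\<close>

lemma abs_L2_eq_iff:
  "f \<in> sqint lborel \<Longrightarrow> g \<in> sqint lborel \<Longrightarrow> abs_L2 f = abs_L2 g \<longleftrightarrow> (AE x in lborel. f x = g x)"
  using Quotient_rel[OF Quotient_L2, of f g] by (auto simp: l2rel_def)

lemma rep_L2_sqint: "rep_L2 F \<in> sqint lborel"
  using Quotient_rep_reflp[OF Quotient_L2, of F] by (simp add: l2rel_def)

lemma abs_rep_L2 [simp]: "abs_L2 (rep_L2 F) = F"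
  by (rule Quotient_abs_rep[OF Quotient_L2])

lemma AE_rep_abs_L2: "f \<in> sqint lborel \<Longrightarrow> AE x in lborel. rep_L2 (abs_L2 f) x = f x"
  using abs_L2_eq_iff[OF rep_L2_sqint, of f "abs_L2 f"] by simp

lemma abs_L2_add: "f \<in> sqint lborel \<Longrightarrow> g \<in> sqint lborel \<Longrightarrow> abs_L2 (\<lambda>x. f x + g x) = abs_L2 f + abs_L2 g"
  by (simp add: plus_L2.abs_eq l2rel_refl)

lemma abs_L2_diff: "f \<in> sqint lborel \<Longrightarrow> g \<in> sqint lborel \<Longrightarrow> abs_L2 (\<lambda>x. f x - g x) = abs_L2 f - abs_L2 g"
  by (simp add: minus_L2.abs_eq l2rel_refl)

lemma abs_L2_scaleC: "f \<in> sqint lborel \<Longrightarrow> abs_L2 (\<lambda>x. c * f x) = scaleC c (abs_L2 f)"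
  by (simp add: scaleC_L2.abs_eq l2rel_refl)

text \<open>The Gaussians with p = 0 suffice: inner products with them form the Fourier transform of
  f times a fixed Gaussian, an integrable function with the same zeros as f.\<close>

lemma total_gauss:
  assumes c: "c > 0"
  shows "total_family UNIV (\<lambda>(p, q). abs_L2 (gauss c p q) :: 'a::euclidean_space L2)"
  unfolding total_family_def
proof (intro allI impI)
  fix F :: "'a L2"
  assume z: "\<forall>i\<in>UNIV. cinner F (case i of (p, q) \<Rightarrow> abs_L2 (gauss c p q)) = 0"
  define f where "f = rep_L2 F"
  have f: "f \<in> sqint lborel" and F: "F = abs_L2 f" by (auto simp: f_def rep_L2_sqint)
  have z': "(\<integral>x. f x * cnj (gauss c 0 (- q) x) \<partial>lborel) = 0" for q
    using z[rule_format, of "(0, - q)"] f c by (simp add: F cinner_abs_L2 sqint_gauss)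
  have "AE x in lborel. f x * gauss c 0 0 x = 0"
  proof (rule fourier_unique)
    show "integrable lborel (\<lambda>x. f x * gauss c 0 0 x)"
      using sqint_mult_cnj_integrable[OF f sqint_gauss[OF c, of 0 0]] by (simp add: cnj_gauss)
    have *: "f x * gauss c 0 0 x * exp (\<i> * complex_of_real (q \<bullet> x)) = f x * cnj (gauss c 0 (- q) x)" for x q
      unfolding cnj_gauss by (simp add: gauss_def mult.assoc flip: exp_add)
    show "(\<integral>x. f x * gauss c 0 0 x * exp (\<i> * complex_of_real (q \<bullet> x)) \<partial>lborel) = 0" for q
      unfolding * by (rule z')
  qed
  then have "AE x in lborel. f x = 0" by eventually_elim (simp add: gauss_def)
  then show "F = 0"
    unfolding F zero_L2_def using abs_L2_eq_iff[OF f sqint_zero] by simp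
qed

subsection \<open>Pointwise limits\<close>

text \<open>By Fatou the distance of \<open>f m\<close> to g is at most its distance to F, so g is
  square-integrable and both are limits of the same sequence. This identifies an abstract limit with
  concrete point values.\<close>

lemma L2_pointwise_limit:
  fixes f :: "nat \<Rightarrow> 'a::euclidean_space \<Rightarrow> complex"
  assumes f: "\<And>n. f n \<in> sqint lborel" and F: "(\<lambda>n. abs_L2 (f n)) \<longlonglongrightarrow> F"
    and g: "\<And>x. (\<lambda>n. f n x) \<longlonglongrightarrow> g x"
  shows "g \<in> sqint lborel" "abs_L2 g = F"
proof -
  have [measurable]: "f n \<in> borel_measurable borel" for n using f[of n] by (simp add: sqint_def)
  have gm [measurable]: "g \<in> borel_measurable borel"
    by (rule borel_measurable_LIMSEQ_metric[of f]) (auto intro: g)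
  have d: "(\<integral>\<^sup>+x. ennreal ((cmod (f m x - g x))\<^sup>2) \<partial>lborel) \<le> ennreal ((norm (abs_L2 (f m) - F))\<^sup>2)" for m
  proof -
    have e: "(\<integral>\<^sup>+x. ennreal ((cmod (f m x - f n x))\<^sup>2) \<partial>lborel) = ennreal ((norm (abs_L2 (f m) - abs_L2 (f n)))\<^sup>2)" for n
    proof -
      have s: "(\<lambda>x. f m x - f n x) \<in> sqint lborel" by (intro sqint_diff f)
      then show ?thesis
        using norm_sq_abs_L2[OF s] abs_L2_diff[OF f f, of m n]
        by (simp add: sqint_def nn_integral_eq_integral)
    qed
    have "(\<integral>\<^sup>+x. ennreal ((cmod (f m x - g x))\<^sup>2) \<partial>lborel)
        = (\<integral>\<^sup>+x. liminf (\<lambda>n. ennreal ((cmod (f m x - f n x))\<^sup>2)) \<partial>lborel)"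
    proof (intro nn_integral_cong)
      fix x
      have "(\<lambda>n. ennreal ((cmod (f m x - f n x))\<^sup>2)) \<longlonglongrightarrow> ennreal ((cmod (f m x - g x))\<^sup>2)"
        by (intro tendsto_intros g)
      then show "ennreal ((cmod (f m x - g x))\<^sup>2) = liminf (\<lambda>n. ennreal ((cmod (f m x - f n x))\<^sup>2))"
        by (intro lim_imp_Liminf[symmetric]) simp_all
    qed
    also have "\<dots> \<le> liminf (\<lambda>n. \<integral>\<^sup>+x. ennreal ((cmod (f m x - f n x))\<^sup>2) \<partial>lborel)"
      by (rule nn_integral_liminf) simp
    also have "\<dots> = ennreal ((norm (abs_L2 (f m) - F))\<^sup>2)"
      unfolding e by (intro lim_imp_Liminf tendsto_intros F) simp
    finally show ?thesis .
  qed
  have s: "(\<lambda>x. f m x - g x) \<in> sqint lborel" for m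
  proof -
    have "integrable lborel (\<lambda>x. (cmod (f m x - g x))\<^sup>2)"
      by (rule integrableI_nonneg) (use d[of m] in \<open>auto simp: less_top[symmetric] top_unique\<close>)
    then show ?thesis by (simp add: sqint_def)
  qed
  show gs: "g \<in> sqint lborel" using sqint_diff[OF f s[of 0], of 0] by simp
  have n: "norm (abs_L2 (f m) - abs_L2 g) \<le> norm (abs_L2 (f m) - F)" for m
  proof -
    have "(norm (abs_L2 (f m) - abs_L2 g))\<^sup>2 \<le> (norm (abs_L2 (f m) - F))\<^sup>2"
      using d[of m] norm_sq_abs_L2[OF s[of m]] abs_L2_diff[OF f gs, of m] s[of m]
      by (simp add: nn_integral_eq_integral sqint_def)
    then show ?thesis by (rule power2_le_imp_le) simp
  qed
  have "(\<lambda>m. abs_L2 (f m) - F) \<longlonglongrightarrow> 0" using F by (simp add: LIM_zero)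
  then have "(\<lambda>m. abs_L2 (f m) - abs_L2 g) \<longlonglongrightarrow> 0"
    by (rule Lim_null_comparison[OF always_eventually, rotated, OF tendsto_norm_zero]) (use n in auto)
  then have "(\<lambda>m. abs_L2 (f m)) \<longlonglongrightarrow> abs_L2 g" by (simp add: LIM_zero_iff)
  then show "abs_L2 g = F" using F LIMSEQ_unique by blast
qed

text \<open>For transforms whose values at each point are continuous in the vector. The Gram matrix
  on a total family yields an abstract isometry U, and \<open>L2_pointwise_limit\<close> shows that
  \<open>T x\<close> represents \<open>U x\<close>.\<close>

lemma pointwise_isometry:
  fixes T :: "'h::chilbert_space \<Rightarrow> 'a::euclidean_space \<Rightarrow> complex" and v :: "'i \<Rightarrow> 'h"
  assumes v: "total_family I v" and K: "K > 0"
    and T1: "\<And>x y p. T (x + y) p = T x p + T y p" and T2: "\<And>c x p. T (scaleC c x) p = c * T x p"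
    and T3: "\<And>X x p. X \<longlonglongrightarrow> x \<Longrightarrow> (\<lambda>n. T (X n) p) \<longlonglongrightarrow> T x p"
    and Tv: "\<And>i. i \<in> I \<Longrightarrow> T (v i) \<in> sqint lborel"
      "\<And>i j. i \<in> I \<Longrightarrow> j \<in> I \<Longrightarrow>
        cinner (abs_L2 (T (v i))) (abs_L2 (T (v j))) = complex_of_real K * cinner (v i) (v j)"
  shows "T x \<in> sqint lborel" "cinner (abs_L2 (T x)) (abs_L2 (T y)) = complex_of_real K * cinner x y"
proof -
  obtain U where U: "\<And>i. i \<in> I \<Longrightarrow> U (v i) = abs_L2 (T (v i))"
    "\<And>x y. cinner (U x) (U y) = complex_of_real K * cinner x y"
    "\<And>x y. U (x + y) = U x + U y" "\<And>c x. U (scaleC c x) = scaleC c (U x)" "bounded_linear U"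
    using isometry_extension[OF v K, of "\<lambda>i. abs_L2 (T (v i))"] Tv(2) by metis
  have *: "T x \<in> sqint lborel \<and> abs_L2 (T x) = U x" for x
  proof (rule total_induct[OF v])
    show "closed {x. T x \<in> sqint lborel \<and> abs_L2 (T x) = U x}"
      unfolding closed_sequential_limits
    proof (intro allI impI, elim conjE)
      fix X x assume X: "\<forall>n. X n \<in> {x. T x \<in> sqint lborel \<and> abs_L2 (T x) = U x}" "X \<longlonglongrightarrow> x"
      have "(\<lambda>n. abs_L2 (T (X n))) \<longlonglongrightarrow> U x"
        using X bounded_linear.tendsto[OF U(5) X(2)] by simp
      from L2_pointwise_limit[OF _ this T3[OF X(2)]] X(1)
      show "x \<in> {x. T x \<in> sqint lborel \<and> abs_L2 (T x) = U x}" by blast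
    qed
    have "T 0 = (\<lambda>p. 0)" using T2[of 0 0] by (intro ext) simp
    then show "T 0 \<in> sqint lborel \<and> abs_L2 (T 0) = U 0"
      using linear_simps(3)[OF U(5)] by (simp add: sqint_zero zero_L2_def)
    show "T (x + y) \<in> sqint lborel \<and> abs_L2 (T (x + y)) = U (x + y)"
      if "T x \<in> sqint lborel \<and> abs_L2 (T x) = U x" "T y \<in> sqint lborel \<and> abs_L2 (T y) = U y" for x y
    proof -
      have "T (x + y) = (\<lambda>p. T x p + T y p)" by (intro ext T1)
      then show ?thesis using that by (simp add: sqint_add abs_L2_add U(3))
    qed
    show "T (scaleC c x) \<in> sqint lborel \<and> abs_L2 (T (scaleC c x)) = U (scaleC c x)"
      if "T x \<in> sqint lborel \<and> abs_L2 (T x) = U x" for c x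
    proof -
      have "T (scaleC c x) = (\<lambda>p. c * T x p)" by (intro ext T2)
      then show ?thesis using that by (simp add: sqint_scale abs_L2_scaleC U(4))
    qed
  qed (simp add: Tv(1) U(1))
  then show "T x \<in> sqint lborel" "cinner (abs_L2 (T x)) (abs_L2 (T y)) = complex_of_real K * cinner x y"
    using U(2) by simp_all
qed

section \<open>Bilinear forms and rotations\<close>

definition re_vec :: "complex^'n \<Rightarrow> real^'n" where "re_vec z = (\<chi> k. Re (z $ k))"
definition im_vec :: "complex^'n \<Rightarrow> real^'n" where "im_vec z = (\<chi> k. Im (z $ k))"

lemma re_vec_nth [simp]: "re_vec z $ k = Re (z $ k)" by (simp add: re_vec_def)
lemma im_vec_nth [simp]: "im_vec z $ k = Im (z $ k)" by (simp add: im_vec_def)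
lemma cnjv_nth [simp]: "cnjv z $ k = cnj (z $ k)" by (simp add: cnjv_def)
lemma cvec_nth [simp]: "cvec x $ k = complex_of_real (x $ k)" by (simp add: cvec_def)
lemma rot_nth [simp]: "rot \<alpha> t z $ k = exp (\<i> * complex_of_real (\<alpha> k t)) * z $ k" by (simp add: rot_def)

lemma scaleR_nth_complex [simp]: "(r *\<^sub>R z) $ k = complex_of_real r * (z :: complex^'n) $ k"
  by (subst vector_scaleR_component) (rule scaleR_conv_of_real)

lemma cnjv_simps [simp]:
  "cnjv (z + w) = cnjv z + cnjv w" "cnjv (z - w) = cnjv z - cnjv w" "cnjv (- z) = - cnjv z"
  "cnjv (cnjv z) = z" "cnjv 0 = 0"
  by (simp_all add: vec_eq_iff)

lemma bil_simps:
  "bil (z + z') w = bil z w + bil z' w" "bil z (w + w') = bil z w + bil z w'"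
  "bil (z - z') w = bil z w - bil z' w" "bil z (w - w') = bil z w - bil z w'"
  "bil (- z) w = - bil z w" "bil z (- w) = - bil z w" "bil 0 w = 0" "bil z 0 = 0"
  by (simp_all add: bil_def algebra_simps sum.distrib sum_subtractf sum_negf)

lemma bil_scale: "bil (c *s z) w = c * bil z w" "bil z (c *s w) = c * bil z w"
  "bil (r *\<^sub>R z) w = complex_of_real r * bil z w" "bil z (r *\<^sub>R w) = complex_of_real r * bil z w"
  by (simp_all add: bil_def sum_distrib_left mult_ac del: vector_scaleR_component)

lemma bil_commute: "bil z w = bil w z"
  by (simp add: bil_def mult.commute)

lemma cnj_bil: "cnj (bil z w) = bil (cnjv z) (cnjv w)"
  by (simp add: bil_def)

lemma Re_bil_cnjv: "Re (bil (cnjv z) w) = z \<bullet> w"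
  by (simp add: bil_def inner_vec_def inner_complex_def)

lemma bil_cnjv_self: "bil (cnjv z) z = complex_of_real ((norm z)\<^sup>2)"
proof -
  have "cnj (bil (cnjv z) z) = bil (cnjv z) z" by (simp add: cnj_bil bil_commute)
  then have "bil (cnjv z) z = complex_of_real (Re (bil (cnjv z) z))"
    by (metis Reals_cnj_iff of_real_Re)
  then show ?thesis by (simp add: Re_bil_cnjv power2_norm_eq_inner)
qed

lemma bil_cvec: "bil z (cvec x) = complex_of_real (re_vec z \<bullet> x) + \<i> * complex_of_real (im_vec z \<bullet> x)"
  by (rule complex_eqI) (simp_all add: bil_def inner_vec_def)

lemma bil_self: "bil z z = complex_of_real (re_vec z \<bullet> re_vec z - im_vec z \<bullet> im_vec z)
    + \<i> * complex_of_real (2 * (re_vec z \<bullet> im_vec z))"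
  by (rule complex_eqI) (simp_all add: bil_def inner_vec_def sum_subtractf sum_distrib_left mult_ac
      flip: mult_2)

text \<open>The two terms of the symplectic form are complex conjugate at such arguments, so only an
  imaginary part survives.\<close>

lemma omegaR_eq: "omegaR z u = Im (bil (cnjv z) u)"
proof -
  have "bil z (cnjv u) = cnj (bil (cnjv z) u)" "bil u (cnjv z) = bil (cnjv z) u"
    by (simp_all add: cnj_bil bil_commute)
  then show ?thesis by (simp add: omegaR_def omega_def)
qed

lemma i_omegaR: "\<i> * complex_of_real (omegaR z u) = (bil (cnjv z) u - bil (cnjv u) z) / 2"
proof -
  have "bil (cnjv u) z = cnj (bil (cnjv z) u)" by (simp add: cnj_bil bil_commute)
  then show ?thesis by (simp add: omegaR_eq complex_eq_iff)
qed

lemma continuous_on_bil [continuous_intros]: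
  "continuous_on S f \<Longrightarrow> continuous_on S g \<Longrightarrow> continuous_on S (\<lambda>x. bil (f x) (g x))"
  unfolding bil_def by (intro continuous_intros)

lemma continuous_on_cnjv [continuous_intros]:
  "continuous_on S f \<Longrightarrow> continuous_on S (\<lambda>x. cnjv (f x))"
  unfolding cnjv_def by (intro continuous_intros)

lemma norm_re_vec_le: "norm (re_vec z) \<le> norm z" and norm_im_vec_le: "norm (im_vec z) \<le> norm z"
  unfolding norm_vec_def
  by (intro L2_set_mono; simp add: abs_Re_le_cmod abs_Im_le_cmod)+

lemma cmod_bil_cvec_le: "cmod (bil h (cvec x)) \<le> 2 * (norm h * norm x)"
proof -
  have "cmod (bil h (cvec x)) \<le> \<bar>re_vec h \<bullet> x\<bar> + \<bar>im_vec h \<bullet> x\<bar>"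
    unfolding bil_cvec by (rule order_trans[OF norm_triangle_ineq]) (simp add: norm_mult)
  also have "\<dots> \<le> norm (re_vec h) * norm x + norm (im_vec h) * norm x"
    by (intro add_mono Cauchy_Schwarz_ineq2)
  also have "\<dots> \<le> norm h * norm x + norm h * norm x"
    by (intro add_mono mult_right_mono norm_re_vec_le norm_im_vec_le) auto
  finally show ?thesis unfolding mult_2 .
qed

lemma rot_simps [simp]:
  "rot \<alpha> t (z + w) = rot \<alpha> t z + rot \<alpha> t w" "rot \<alpha> t (z - w) = rot \<alpha> t z - rot \<alpha> t w"
  "rot \<alpha> t (- z) = - rot \<alpha> t z" "rot \<alpha> t 0 = 0"
  by (simp_all add: vec_eq_iff algebra_simps)

lemma rot_scaleR: "rot \<alpha> t (r *\<^sub>R z) = r *\<^sub>R rot \<alpha> t z"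
  by (simp add: vec_eq_iff)

lemma bil_cnjv_rot [simp]: "bil (cnjv (rot \<alpha> t z)) (rot \<alpha> t w) = bil (cnjv z) w"
proof -
  have "cnj (exp (\<i> * complex_of_real r)) * exp (\<i> * complex_of_real r) = 1" for r
    by (simp add: exp_cnj flip: exp_add)
  then show ?thesis
    by (simp add: bil_def mult_ac)
qed

lemma norm_rot [simp]: "norm (rot \<alpha> t z) = norm z"
  using bil_cnjv_self[of "rot \<alpha> t z"] bil_cnjv_self[of z]
  by (metis bil_cnjv_rot norm_ge_zero of_real_eq_iff power2_eq_imp_eq)

context
  fixes \<alpha> :: "'n::finite \<Rightarrow> real^'m::finite \<Rightarrow> real"
  assumes \<alpha>: "\<And>k. linear (\<alpha> k)"
begin

lemma rot_add: "rot \<alpha> (s + t) z = rot \<alpha> s (rot \<alpha> t z)"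
  by (simp add: vec_eq_iff linear_add[OF \<alpha>] distrib_left exp_add mult.assoc)

lemma rot_zero [simp]: "rot \<alpha> 0 z = z"
  by (simp add: vec_eq_iff linear_0[OF \<alpha>])

lemma rot_minus [simp]: "rot \<alpha> (- t) (rot \<alpha> t z) = z" "rot \<alpha> t (rot \<alpha> (- t) z) = z"
  by (simp_all add: rot_add[symmetric])

lemma bil_cnjv_rot_left: "bil (cnjv (rot \<alpha> t z)) w = bil (cnjv z) (rot \<alpha> (- t) w)"
  using bil_cnjv_rot[of \<alpha> t z "rot \<alpha> (- t) w"] by simp

lemma continuous_on_rot [continuous_intros]:
  "continuous_on S f \<Longrightarrow> continuous_on S g \<Longrightarrow> continuous_on S (\<lambda>x. rot \<alpha> (f x) (g x))"
proof -
  assume f: "continuous_on S f" and g: "continuous_on S g"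
  have "continuous_on S (\<lambda>x. \<alpha> k (f x))" for k
    using continuous_on_compose2[OF linear_continuous_on[OF linear_conv_bounded_linear[THEN iffD1, OF \<alpha>]] f]
    by auto
  then show ?thesis unfolding rot_def by (intro continuous_intros g)
qed

lemma linear_rot: "linear (rot \<alpha> t)"
  by (rule linearI) (simp_all add: rot_scaleR)

end

section \<open>Coherent vectors and the Bargmann transform\<close>

text \<open>The complex conjugate of the Bargmann kernel at w, so that the inner product with this
  vector evaluates the Bargmann transform at w.\<close>

definition cohvec :: "real \<Rightarrow> complex^'n \<Rightarrow> (real^'n) L2" where
  "cohvec lam w = scaleC (complex_of_real ((lam / pi) powr (real CARD('n) / 4))
       * exp (- complex_of_real (lam / 4) * bil (cnjv w) (cnjv w)))
     (abs_L2 (gauss (lam / 2) (lam *\<^sub>R re_vec w) (- (lam *\<^sub>R im_vec w))))"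

context
  fixes lam :: real
  assumes lam: "lam > 0"
begin

lemma bargmann_eq_cinner: "bargmann lam \<phi> z = cinner \<phi> (cohvec lam (z::complex^'n))"
proof -
  let ?g = "gauss (lam / 2) (lam *\<^sub>R re_vec z) (- (lam *\<^sub>R im_vec z)) :: real^'n \<Rightarrow> complex"
  have g: "exp (- complex_of_real (lam / 4) * bil z z + complex_of_real lam * bil z (cvec x)
      - complex_of_real (lam / 2 * (x \<bullet> x))) = exp (- complex_of_real (lam / 4) * bil z z) * cnj (?g x)" for x
    unfolding cnj_gauss by (simp add: gauss_def bil_cvec algebra_simps flip: exp_add)
  have "cinner \<phi> (cohvec lam z) = complex_of_real ((lam / pi) powr (real CARD('n) / 4))
       * exp (- complex_of_real (lam / 4) * bil z z) * (\<integral>x. rep_L2 \<phi> x * cnj (?g x) \<partial>lborel)"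
    using cinner_abs_L2[OF rep_L2_sqint[of \<phi>] sqint_gauss[of "lam / 2"]] lam
    by (simp add: cohvec_def cinner_scaleC_right exp_cnj cnj_bil)
  moreover have "(\<integral>x. exp (- complex_of_real (lam / 4) * bil z z) * cnj (?g x) * rep_L2 \<phi> x \<partial>lborel)
      = exp (- complex_of_real (lam / 4) * bil z z) * (\<integral>x. rep_L2 \<phi> x * cnj (?g x) \<partial>lborel)"
    by (subst integral_mult_right_zero[symmetric]) (simp only: mult_ac)
  ultimately show ?thesis
    unfolding bargmann_def g by (simp only: mult.assoc)
qed

text \<open>The reproducing kernel of the Fock space. The Gaussian integral contributes lam/4 times
  the square of u, the prefactors of the two vectors cancel the pure squares, and the cross term
  remains.\<close>

lemma cinner_cohvec:
  "cinner (cohvec lam w) (cohvec lam v) = exp (complex_of_real (lam / 2) * bil (cnjv w) (v::complex^'n))"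
proof -
  define u where "u = cnjv w + v"
  have ru: "lam *\<^sub>R re_vec w + lam *\<^sub>R re_vec v = lam *\<^sub>R re_vec u"
    and iu: "- (lam *\<^sub>R im_vec w) - - (lam *\<^sub>R im_vec v) = lam *\<^sub>R im_vec u"
    by (simp_all add: u_def vec_eq_iff algebra_simps)
  have C: "complex_of_real ((lam / pi) powr (real CARD('n) / 4)) * complex_of_real ((lam / pi) powr (real CARD('n) / 4))
      * complex_of_real (sqrt (pi / lam) ^ CARD('n)) = 1"
  proof -
    have "(lam / pi) powr (real CARD('n) / 4) * (lam / pi) powr (real CARD('n) / 4) * sqrt (pi / lam) ^ CARD('n)
       = (lam / pi) powr (real CARD('n) / 2) * (pi / lam) powr (real CARD('n) / 2)"
      using lam by (simp add: powr_half_sqrt[symmetric] powr_powr powr_realpow[symmetric] flip: powr_add)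
    also have "\<dots> = 1" using lam by (simp add: powr_mult[symmetric])
    finally show ?thesis by (simp only: of_real_mult[symmetric]) simp
  qed
  have e: "complex_of_real (((lam *\<^sub>R re_vec u) \<bullet> (lam *\<^sub>R re_vec u) - (lam *\<^sub>R im_vec u) \<bullet> (lam *\<^sub>R im_vec u)) / (8 * (lam / 2)))
      + \<i> * complex_of_real ((lam *\<^sub>R re_vec u) \<bullet> (lam *\<^sub>R im_vec u) / (4 * (lam / 2)))
    = complex_of_real (lam / 4) * bil u u"
    unfolding bil_self using lam by (simp add: field_simps)
  have "cinner (cohvec lam w) (cohvec lam v) =
      (complex_of_real ((lam / pi) powr (real CARD('n) / 4)) * complex_of_real ((lam / pi) powr (real CARD('n) / 4))
      * complex_of_real (sqrt (pi / lam) ^ CARD('n))) *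
      (exp (- complex_of_real (lam / 4) * bil (cnjv w) (cnjv w)) * exp (- complex_of_real (lam / 4) * bil v v)
       * exp (complex_of_real (lam / 4) * bil u u))"
    unfolding cohvec_def cinner_scaleC_left cinner_scaleC_right
    using lam by (subst cinner_gauss) (simp_all only: ru iu e, simp_all add: exp_cnj cnj_bil mult_ac)
  also have "\<dots> = exp (complex_of_real (lam / 2) * bil (cnjv w) v)"
    unfolding C exp_add[symmetric] u_def
    by (simp add: bil_simps bil_commute[of v "cnjv w"] algebra_simps)
  finally show ?thesis .
qed

lemma bargmann_cohvec: "bargmann lam (cohvec lam w) = coherent lam w"
  by (rule ext) (simp add: bargmann_eq_cinner cinner_cohvec coherent_def)

text \<open>With w = (p - i q)/lam each Gaussian of parameter lam/2 is a multiple of a coherent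
  vector, which reduces the claim to \<open>total_gauss\<close>.\<close>

lemma total_cohvec: "total_family UNIV (cohvec lam :: complex^'n \<Rightarrow> _)"
  unfolding total_family_def
proof (intro allI impI)
  fix F :: "(real^'n) L2"
  assume z: "\<forall>w\<in>UNIV. cinner F (cohvec lam w) = 0"
  have "cinner F (abs_L2 (gauss (lam / 2) p q)) = 0" for p q
  proof -
    define w :: "complex^'n" where "w = (\<chi> k. Complex (p $ k / lam) (- q $ k / lam))"
    have "lam *\<^sub>R re_vec w = p" "- (lam *\<^sub>R im_vec w) = q"
      using lam by (simp_all add: w_def vec_eq_iff)
    then show ?thesis using z[rule_format, of w] lam by (simp add: cohvec_def cinner_scaleC_right)
  qed
  then show "F = 0"
    using total_familyD[OF total_gauss[where 'a="real^'n", of "lam / 2"], of F 0] lam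
    by (auto simp: split_beta)
qed

text \<open>The squared distance of two coherent vectors is a combination of values of the
  reproducing kernel, hence continuous.\<close>

lemma continuous_on_cohvec: "continuous_on UNIV (cohvec lam :: complex^'n \<Rightarrow> _)"
proof (rule continuous_at_imp_continuous_on, intro ballI)
  fix w :: "complex^'n"
  have e: "(norm (cohvec lam v - cohvec lam w))\<^sup>2 =
     Re (exp (complex_of_real (lam / 2) * bil (cnjv v) v) - exp (complex_of_real (lam / 2) * bil (cnjv v) w)
      - exp (complex_of_real (lam / 2) * bil (cnjv w) v) + exp (complex_of_real (lam / 2) * bil (cnjv w) w))" for v
  proof -
    have "(norm (cohvec lam v - cohvec lam w))\<^sup>2 = Re (cinner (cohvec lam v - cohvec lam w) (cohvec lam v - cohvec lam w))"
      by (simp add: cinner_self)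
    then show ?thesis by (simp only: cinner_diff_left cinner_diff_right cinner_cohvec) simp
  qed
  have "continuous_on UNIV (\<lambda>v. (norm (cohvec lam v - cohvec lam w))\<^sup>2)"
    unfolding e by (intro continuous_intros)
  then have "continuous_on UNIV (\<lambda>v. sqrt ((norm (cohvec lam v - cohvec lam w))\<^sup>2))"
    by (rule continuous_on_real_sqrt)
  then have "continuous_on UNIV (\<lambda>v. norm (cohvec lam v - cohvec lam w))"
    by (simp only: real_sqrt_abs abs_norm_cancel)
  then have "isCont (\<lambda>v. norm (cohvec lam v - cohvec lam w)) w"
    using continuous_on_eq_continuous_at[OF open_UNIV] by blast
  then have "((\<lambda>v. norm (cohvec lam v - cohvec lam w)) \<longlongrightarrow> 0) (at w)"
    by (simp add: isCont_def)
  then show "isCont (cohvec lam) w"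
    unfolding isCont_def by (simp add: tendsto_norm_zero_iff LIM_zero_iff)
qed

lemma inj_bargmann: "inj (bargmann lam :: (real^'n) L2 \<Rightarrow> _)"
proof (rule injI)
  fix \<phi> \<psi> :: "(real^'n) L2"
  assume e: "bargmann lam \<phi> = bargmann lam \<psi>"
  show "\<phi> = \<psi>"
    by (rule total_familyD[OF total_cohvec]) (metis bargmann_eq_cinner e)
qed

subsection \<open>The Bargmann transform is an isometry into the Fock space\<close>

text \<open>Absorbing the square root of the Fock weight turns the Fock norm into a plain
  \<open>L2\<close> norm, and \<open>pointwise_isometry\<close> applies: the weighted transforms of
  coherent vectors are Gaussians whose Gram matrix is a multiple of the reproducing kernel.\<close>

lemma sqint_bargmann_weighted:
  "(\<lambda>z. bargmann lam \<phi> z * complex_of_real (exp (- lam / 4 * (norm z)\<^sup>2))) \<in> sqint (lborel :: (complex^'n) measure)"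
    (is "?T \<phi> \<in> _")
  and cinner_bargmann_weighted:
  "cinner (abs_L2 (\<lambda>z. bargmann lam \<phi> z * complex_of_real (exp (- lam / 4 * (norm z)\<^sup>2))))
      (abs_L2 (\<lambda>z::complex^'n. bargmann lam \<psi> z * complex_of_real (exp (- lam / 4 * (norm z)\<^sup>2))))
    = complex_of_real ((2 * pi / lam) ^ CARD('n)) * cinner \<phi> \<psi>"
proof -
  \<comment> \<open>The real inner product with i w is the imaginary part of the Hermitian form, so
    w and \<open>?i w\<close> supply the two linear coefficients of the Gaussian below.\<close>
  let ?i = "\<lambda>w::complex^'n. \<i> *s w"
  have ii: "?i w \<bullet> z = Im (bil (cnjv w) z)" for w z :: "complex^'n"
    by (simp add: bil_def inner_vec_def inner_complex_def)
  have Tv: "?T (cohvec lam w) = gauss (lam / 4) ((lam / 2) *\<^sub>R w) ((lam / 2) *\<^sub>R ?i w)" for w :: "complex^'n"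
  proof
    fix z :: "complex^'n"
    have "bil (cnjv w) z = complex_of_real (w \<bullet> z) + \<i> * complex_of_real (?i w \<bullet> z)"
      by (simp add: ii complex_eq_iff Re_bil_cnjv)
    then show "?T (cohvec lam w) z = gauss (lam / 4) ((lam / 2) *\<^sub>R w) ((lam / 2) *\<^sub>R ?i w) z"
      by (simp add: bargmann_cohvec coherent_def gauss_def power2_norm_eq_inner exp_of_real[symmetric]
          algebra_simps add_divide_distrib flip: exp_add)
  qed
  have K: "(2 * pi / lam) ^ CARD('n) > 0" using lam by simp
  have ip: "complex_of_real ((((lam / 2) *\<^sub>R w + (lam / 2) *\<^sub>R v) \<bullet> ((lam / 2) *\<^sub>R w + (lam / 2) *\<^sub>R v)
        - ((lam / 2) *\<^sub>R ?i w - (lam / 2) *\<^sub>R ?i v) \<bullet> ((lam / 2) *\<^sub>R ?i w - (lam / 2) *\<^sub>R ?i v)) / (8 * (lam / 4)))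
        + \<i> * complex_of_real (((lam / 2) *\<^sub>R w + (lam / 2) *\<^sub>R v) \<bullet> ((lam / 2) *\<^sub>R ?i w - (lam / 2) *\<^sub>R ?i v) / (4 * (lam / 4)))
      = complex_of_real (lam / 2) * bil (cnjv w) v" for w v :: "complex^'n"
  proof -
    have n: "?i w \<bullet> ?i v = w \<bullet> v" for w v :: "complex^'n"
      by (simp add: inner_vec_def inner_complex_def add.commute)
    have "w \<bullet> ?i w = 0" for w :: "complex^'n"
      using ii[of w w] by (simp add: bil_cnjv_self inner_commute)
    moreover have "v \<bullet> ?i w = Im (bil (cnjv w) v)" using ii[of w v] by (simp add: inner_commute)
    moreover have "w \<bullet> ?i v = - Im (bil (cnjv w) v)"
    proof -
      have "w \<bullet> ?i v = Im (cnj (bil (cnjv w) v))"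
        using ii[of v w] by (simp add: inner_commute cnj_bil bil_commute)
      then show ?thesis by simp
    qed
    ultimately have 2: "((lam / 2) *\<^sub>R w + (lam / 2) *\<^sub>R v) \<bullet> ((lam / 2) *\<^sub>R ?i w - (lam / 2) *\<^sub>R ?i v)
       = lam\<^sup>2 / 2 * Im (bil (cnjv w) v)"
      by (simp add: inner_add_left inner_diff_right power2_eq_square algebra_simps)
    have 1: "((lam / 2) *\<^sub>R w + (lam / 2) *\<^sub>R v) \<bullet> ((lam / 2) *\<^sub>R w + (lam / 2) *\<^sub>R v)
        - ((lam / 2) *\<^sub>R ?i w - (lam / 2) *\<^sub>R ?i v) \<bullet> ((lam / 2) *\<^sub>R ?i w - (lam / 2) *\<^sub>R ?i v)
       = lam\<^sup>2 * Re (bil (cnjv w) v)"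
      unfolding Re_bil_cnjv
      by (simp add: inner_add inner_diff n power2_eq_square inner_commute algebra_simps)
    show ?thesis
      unfolding 1 2 using lam by (intro complex_eqI) (simp_all add: power2_eq_square)
  qed
  have Tc: "cinner (abs_L2 (?T (cohvec lam w))) (abs_L2 (?T (cohvec lam v)))
      = complex_of_real ((2 * pi / lam) ^ CARD('n)) * cinner (cohvec lam w) (cohvec lam v)" for w v :: "complex^'n"
  proof -
    have "sqrt (pi / (2 * (lam / 4))) ^ DIM(complex^'n) = (2 * pi / lam) ^ CARD('n)"
    proof -
      have "DIM(complex^'n) = 2 * CARD('n)" by simp
      then show ?thesis using lam by (simp only: power_mult) (simp add: mult.commute)
    qed
    then show ?thesis
      unfolding Tv cinner_cohvec using lam by (subst cinner_gauss) (simp, subst ip, simp only:)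
  qed
  have cl: "?T (x + y) p = ?T x p + ?T y p" "?T (scaleC c x) p = c * ?T x p" for x y c p
    by (simp_all add: bargmann_eq_cinner cinner_add_left cinner_scaleC_left algebra_simps)
  have lim: "(\<lambda>n. ?T (X n) p) \<longlonglongrightarrow> ?T x p" if "X \<longlonglongrightarrow> x" for X x p
    unfolding bargmann_eq_cinner
    by (intro tendsto_intros bounded_linear.tendsto[OF bounded_linear_cinner_left] that)
  have s: "?T (cohvec lam w) \<in> sqint lborel" for w
    unfolding Tv using lam by (intro sqint_gauss) simp
  show "?T \<phi> \<in> sqint lborel"
    by (rule pointwise_isometry(1)[OF total_cohvec K, of ?T]) (use cl lim s Tc in auto)
  show "cinner (abs_L2 (?T \<phi>)) (abs_L2 (?T \<psi>)) = complex_of_real ((2 * pi / lam) ^ CARD('n)) * cinner \<phi> \<psi>"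
    by (rule pointwise_isometry(2)[OF total_cohvec K, of ?T]) (use cl lim s Tc in auto)
qed

lemma has_derivative_quadratic_remainder:
  fixes f :: "'a::euclidean_space \<Rightarrow> 'b::real_normed_vector"
  assumes D: "linear D" and r: "\<And>h. norm h \<le> 1 \<Longrightarrow> norm (f (z + h) - f z - D h) \<le> K * (norm h)\<^sup>2"
  shows "(f has_derivative D) (at z)"
  unfolding has_derivative_at
proof
  show "bounded_linear D" using D linear_conv_bounded_linear by blast
  show "(\<lambda>h. norm (f (z + h) - f z - D h) / norm h) \<midarrow>0\<rightarrow> 0"
  proof (rule tendsto_sandwich[OF _ _ tendsto_const])
    show "\<forall>\<^sub>F h in at 0. 0 \<le> norm (f (z + h) - f z - D h) / norm h" by simp
    have "\<forall>\<^sub>F h in at (0::'a). norm h < 1"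
      unfolding eventually_at by (intro exI[of _ 1]) auto
    then show "\<forall>\<^sub>F h in at 0. norm (f (z + h) - f z - D h) / norm h \<le> K * norm h"
    proof eventually_elim
      case (elim h)
      then show ?case
        using r[of h] by (cases "h = 0") (auto simp: divide_le_eq power2_eq_square mult.assoc)
    qed
    have "((\<lambda>h::'a. K * norm h) \<longlongrightarrow> K * norm (0::'a)) (at 0)" by (intro tendsto_intros)
    then show "((\<lambda>h::'a. K * norm h) \<longlongrightarrow> 0) (at 0)" by simp
  qed
qed

text \<open>The power is bounded by an exponential, and half of the Gaussian decay is spent on the
  linear growth.\<close>

lemma power2_exp_gauss_le:
  fixes r a :: real
  assumes r: "r \<ge> 0"
  shows "r\<^sup>2 * exp (a * r - lam / 2 * r\<^sup>2) \<le> 2 * exp ((a + 1)\<^sup>2 / lam) * exp (- lam / 4 * r\<^sup>2)"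
proof -
  have "r\<^sup>2 \<le> 2 * exp r" using exp_lower_Taylor_quadratic[OF r] r by simp
  then have "r\<^sup>2 * exp (a * r - lam / 2 * r\<^sup>2) \<le> 2 * exp r * exp (a * r - lam / 2 * r\<^sup>2)"
    by (intro mult_right_mono) auto
  also have "\<dots> = 2 * exp ((a + 1) * r - lam / 2 * r\<^sup>2)"
    by (simp add: algebra_simps flip: exp_add)
  also have "\<dots> \<le> 2 * exp ((a + 1)\<^sup>2 / lam - lam / 4 * r\<^sup>2)"
  proof -
    \<comment> \<open>Expanding this square bounds (a + 1) r by (a + 1)^2/lam + lam/4 r^2.\<close>
    have "0 \<le> ((a + 1) / sqrt lam - sqrt lam / 2 * r)\<^sup>2" by simp
    also have "\<dots> = (a + 1)\<^sup>2 / lam - (a + 1) * r + lam / 4 * r\<^sup>2"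
      using lam by (simp add: power2_diff power_divide power_mult_distrib)
    finally show ?thesis by (simp add: algebra_simps)
  qed
  finally show ?thesis by (simp add: mult.assoc flip: exp_add)
qed

text \<open>Differentiation under the integral sign: the second order remainder of the exponential is
  dominated by a Gaussian.\<close>

lemma has_derivative_gauss_integral:
  fixes z :: "complex^'n" and \<phi> :: "real^'n \<Rightarrow> complex"
  assumes \<phi>: "\<phi> \<in> sqint lborel"
  shows "\<exists>D. ((\<lambda>z. \<integral>x. gauss (lam / 2) (lam *\<^sub>R re_vec z) (lam *\<^sub>R im_vec z) x * \<phi> x \<partial>lborel) has_derivative D) (at z)
    \<and> (\<forall>c v. D (c *s v) = c * D v)"
proof -
  let ?G = "\<lambda>z x. gauss (lam / 2) (lam *\<^sub>R re_vec z) (lam *\<^sub>R im_vec z) x"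
  have [measurable]: "\<phi> \<in> borel_measurable borel" using \<phi> by (simp add: sqint_def)
  have [measurable]: "(\<lambda>x. bil h (cvec x)) \<in> borel_measurable borel" for h :: "complex^'n"
    unfolding bil_cvec by measurable
  have Gadd: "?G (z + h) x = ?G z x * exp (complex_of_real lam * bil h (cvec x))" for h x
    by (simp add: gauss_def bil_cvec re_vec_def im_vec_def inner_vec_def algebra_simps sum.distrib
        sum_distrib_left flip: exp_add)
  have int: "integrable lborel (\<lambda>x. gauss (lam / 4) p q x * \<phi> x)" for p q
    using sqint_mult_cnj_integrable[OF \<phi> sqint_gauss[of "lam / 4" p "- q"]] lam
    by (simp add: cnj_gauss mult.commute)
  have int': "integrable lborel (\<lambda>x. gauss (lam / 2) p q x * \<phi> x)" for p q
    using sqint_mult_cnj_integrable[OF \<phi> sqint_gauss[of "lam / 2" p "- q"]] lam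
    by (simp add: cnj_gauss mult.commute)
  \<comment> \<open>The first summand bounds the growth of the kernel at z, the second the factor
    from the remainder of the exponential for increments of norm at most 1.\<close>
  define a where "a = lam * norm z + 2 * lam"
  define C where "C = 2 * exp ((a + 1)\<^sup>2 / lam)"
  define M where "M x = C * cmod (gauss (lam / 4) 0 0 x * \<phi> x)" for x
  have M: "integrable lborel M" unfolding M_def using int[of 0 0] by simp
  have M0: "M x \<ge> 0" for x by (simp add: M_def C_def)
  have dom: "(norm x)\<^sup>2 * exp (2 * lam * norm x) * cmod (?G z x * \<phi> x) \<le> M x" for x
  proof -
    have "cmod (?G z x) = exp (lam * (re_vec z \<bullet> x) - lam / 2 * (norm x)\<^sup>2)"
      by (simp add: gauss_def power2_norm_eq_inner)
    also have "\<dots> \<le> exp (lam * (norm z * norm x) - lam / 2 * (norm x)\<^sup>2)"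
      using lam norm_cauchy_schwarz[of "re_vec z" x] norm_re_vec_le[of z]
      by (simp add: order_trans[OF _ mult_right_mono])
    finally have "(norm x)\<^sup>2 * exp (2 * lam * norm x) * cmod (?G z x)
        \<le> (norm x)\<^sup>2 * exp (2 * lam * norm x) * exp (lam * (norm z * norm x) - lam / 2 * (norm x)\<^sup>2)"
      by (intro mult_left_mono) auto
    also have "\<dots> = (norm x)\<^sup>2 * exp (a * norm x - lam / 2 * (norm x)\<^sup>2)"
      by (simp add: a_def algebra_simps flip: exp_add)
    also have "\<dots> \<le> C * exp (- lam / 4 * (norm x)\<^sup>2)"
      unfolding C_def by (rule power2_exp_gauss_le) simp
    also have "exp (- lam / 4 * (norm x)\<^sup>2) = cmod (gauss (lam / 4) 0 0 x)"
      by (simp add: gauss_def power2_norm_eq_inner)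
    finally show ?thesis
      unfolding M_def norm_mult by (simp add: mult.assoc[symmetric] mult_right_mono)
  qed
  define D where "D h = (\<integral>x. complex_of_real lam * bil h (cvec x) * (?G z x * \<phi> x) \<partial>lborel)" for h
  have Di: "integrable lborel (\<lambda>x. complex_of_real lam * bil h (cvec x) * (?G z x * \<phi> x))" for h
  proof (rule Bochner_Integration.integrable_bound)
    show "integrable lborel (\<lambda>x. 2 * lam * norm h * (cmod (?G z x * \<phi> x) + M x))"
      using int' M by (intro integrable_mult_right Bochner_Integration.integrable_add integrable_norm)
    show "AE x in lborel. norm (complex_of_real lam * bil h (cvec x) * (?G z x * \<phi> x))
        \<le> norm (2 * lam * norm h * (cmod (?G z x * \<phi> x) + M x))"
    proof (rule AE_I2)
      fix x :: "real^'n"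
      \<comment> \<open>The linear growth of the derivative is covered by two integrable majorants:
        the kernel itself in the unit ball, and M outside by \<open>dom\<close>.\<close>
      have "norm x \<le> 1 + (norm x)\<^sup>2 * exp (2 * lam * norm x)"
      proof (cases "norm x \<le> 1")
        case False
        then have "norm x \<le> (norm x)\<^sup>2" by (intro self_le_power) auto
        then have "norm x * 1 \<le> (norm x)\<^sup>2 * exp (2 * lam * norm x)"
          using lam by (intro mult_mono) auto
        then show ?thesis by simp
      qed (simp add: add_increasing2)
      then have "norm x * cmod (?G z x * \<phi> x) \<le> (1 + (norm x)\<^sup>2 * exp (2 * lam * norm x)) * cmod (?G z x * \<phi> x)"
        by (rule mult_right_mono) simp
      also have "\<dots> \<le> cmod (?G z x * \<phi> x) + M x" using dom[of x] by (simp add: distrib_right)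
      finally have 1: "norm x * cmod (?G z x * \<phi> x) \<le> cmod (?G z x * \<phi> x) + M x" .
      have "norm (complex_of_real lam * bil h (cvec x) * (?G z x * \<phi> x))
          \<le> lam * (2 * (norm h * norm x)) * cmod (?G z x * \<phi> x)"
        unfolding norm_mult using lam cmod_bil_cvec_le[of h x]
        by (intro mult_mono) (auto simp: norm_mult)
      also have "\<dots> = 2 * lam * norm h * (norm x * cmod (?G z x * \<phi> x))" by simp
      also have "\<dots> \<le> 2 * lam * norm h * (cmod (?G z x * \<phi> x) + M x)"
        using lam by (intro mult_left_mono 1) auto
      finally show "norm (complex_of_real lam * bil h (cvec x) * (?G z x * \<phi> x))
        \<le> norm (2 * lam * norm h * (cmod (?G z x * \<phi> x) + M x))"
        using lam M0 by (simp add: abs_mult)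
    qed
  qed measurable
  have Dadd: "D (h + h') = D h + D h'" for h h'
  proof -
    have "D (h + h') = (\<integral>x. complex_of_real lam * bil h (cvec x) * (?G z x * \<phi> x)
        + complex_of_real lam * bil h' (cvec x) * (?G z x * \<phi> x) \<partial>lborel)"
      unfolding D_def by (simp add: bil_simps algebra_simps)
    then show ?thesis unfolding D_def by (simp only: Bochner_Integration.integral_add[OF Di Di])
  qed
  have DC: "D (c *s h) = c * D h" for c h
  proof -
    have "D (c *s h) = (\<integral>x. c * (complex_of_real lam * bil h (cvec x) * (?G z x * \<phi> x)) \<partial>lborel)"
      unfolding D_def by (simp add: bil_scale mult_ac)
    then show ?thesis unfolding D_def by (simp only: integral_mult_right_zero)
  qed
  have Dl: "linear D"
  proof (rule linearI)
    show "D (r *\<^sub>R h) = r *\<^sub>R D h" for r h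
    proof -
      have "r *\<^sub>R h = complex_of_real r *s h" by (simp add: vec_eq_iff del: vector_scaleR_component)
      then show ?thesis using DC by (simp add: scaleR_conv_of_real)
    qed
  qed (rule Dadd)
  have "((\<lambda>z. \<integral>x. ?G z x * \<phi> x \<partial>lborel) has_derivative D) (at z)"
  proof (rule has_derivative_quadratic_remainder[OF Dl])
    fix h :: "complex^'n" assume h: "norm h \<le> 1"
    let ?b = "\<lambda>x. complex_of_real lam * bil h (cvec x)"
    have "(\<integral>x. ?G (z + h) x * \<phi> x \<partial>lborel) - (\<integral>x. ?G z x * \<phi> x \<partial>lborel) - D h
       = (\<integral>x. ?G (z + h) x * \<phi> x - ?G z x * \<phi> x - ?b x * (?G z x * \<phi> x) \<partial>lborel)"
      unfolding D_def using int' Di by (simp add: Bochner_Integration.integral_diff)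
    also have "norm \<dots> \<le> (\<integral>x. (norm h)\<^sup>2 * (4 * lam\<^sup>2) * M x \<partial>lborel)"
    proof (rule Bochner_Integration.integral_norm_bound_integral)
      show "integrable lborel (\<lambda>x. ?G (z + h) x * \<phi> x - ?G z x * \<phi> x - ?b x * (?G z x * \<phi> x))"
        by (intro Bochner_Integration.integrable_diff int' Di)
      show "integrable lborel (\<lambda>x. (norm h)\<^sup>2 * (4 * lam\<^sup>2) * M x)"
        by (intro integrable_mult_right M)
      fix x :: "real^'n"
      have b: "cmod (?b x) \<le> 2 * lam * (norm h * norm x)"
        using lam cmod_bil_cvec_le[of h x] by (simp add: norm_mult)
      have b2: "cmod (?b x) \<le> 2 * lam * norm x"
        using b lam h mult_left_le_one_le[of "norm x" "norm h"]
        by (smt (verit) mult_left_mono norm_ge_zero)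
      have "cmod (exp (?b x) - (\<Sum>k\<le>1. (?b x) ^ k / fact k)) \<le> exp \<bar>Re (?b x)\<bar> * cmod (?b x) ^ Suc 1 / fact 1"
        by (rule Taylor_exp)
      then have "cmod (exp (?b x) - 1 - ?b x) \<le> exp \<bar>Re (?b x)\<bar> * (cmod (?b x))\<^sup>2"
        by (simp add: power2_eq_square diff_diff_eq)
      also have "\<dots> \<le> exp (2 * lam * norm x) * (2 * lam * (norm h * norm x))\<^sup>2"
        using b b2 abs_Re_le_cmod[of "?b x"] by (intro mult_mono power_mono) auto
      finally have t: "cmod (exp (?b x) - 1 - ?b x) \<le> exp (2 * lam * norm x) * (2 * lam * (norm h * norm x))\<^sup>2" .
      have "?G (z + h) x * \<phi> x - ?G z x * \<phi> x - ?b x * (?G z x * \<phi> x) = (exp (?b x) - 1 - ?b x) * (?G z x * \<phi> x)"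
        unfolding Gadd by (simp add: algebra_simps)
      then have "norm (?G (z + h) x * \<phi> x - ?G z x * \<phi> x - ?b x * (?G z x * \<phi> x))
          = cmod (exp (?b x) - 1 - ?b x) * cmod (?G z x * \<phi> x)"
        by (simp only: norm_mult)
      also have "\<dots> \<le> exp (2 * lam * norm x) * (2 * lam * (norm h * norm x))\<^sup>2 * cmod (?G z x * \<phi> x)"
        by (rule mult_right_mono[OF t norm_ge_zero])
      also have "\<dots> = (norm h)\<^sup>2 * (4 * lam\<^sup>2) * ((norm x)\<^sup>2 * exp (2 * lam * norm x) * cmod (?G z x * \<phi> x))"
        by (simp add: power_mult_distrib mult_ac)
      also have "\<dots> \<le> (norm h)\<^sup>2 * (4 * lam\<^sup>2) * M x"
        by (intro mult_left_mono dom) auto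
      finally show "norm (?G (z + h) x * \<phi> x - ?G z x * \<phi> x - ?b x * (?G z x * \<phi> x)) \<le> (norm h)\<^sup>2 * (4 * lam\<^sup>2) * M x" .
    qed
    also have "\<dots> = (4 * lam\<^sup>2 * (\<integral>x. M x \<partial>lborel)) * (norm h)\<^sup>2" by simp
    finally show "norm ((\<integral>x. ?G (z + h) x * \<phi> x \<partial>lborel) - (\<integral>x. ?G z x * \<phi> x \<partial>lborel) - D h)
      \<le> (4 * lam\<^sup>2 * (\<integral>x. M x \<partial>lborel)) * (norm h)\<^sup>2" .
  qed
  then show ?thesis using DC by blast
qed

lemma entire_bargmann: "entire (bargmann lam (\<phi> :: (real^'n) L2))"
  unfolding entire_def
proof
  fix z :: "complex^'n"
  let ?g = "\<lambda>z. \<integral>x. gauss (lam / 2) (lam *\<^sub>R re_vec z) (lam *\<^sub>R im_vec z) x * rep_L2 \<phi> x \<partial>lborel"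
  let ?C = "complex_of_real ((lam / pi) powr (real CARD('n) / 4))"
  let ?e = "\<lambda>z::complex^'n. exp (- complex_of_real (lam / 4) * bil z z)"
  obtain D where D: "(?g has_derivative D) (at z)" "\<And>c v. D (c *s v) = c * D v"
    using has_derivative_gauss_integral[OF rep_L2_sqint] by blast
  have b: "bargmann lam \<phi> = (\<lambda>z. ?C * (?e z * ?g z))"
  proof
    fix z :: "complex^'n"
    have "exp (- complex_of_real (lam / 4) * bil z z + complex_of_real lam * bil z (cvec x)
      - complex_of_real (lam / 2 * (x \<bullet> x))) * rep_L2 \<phi> x
      = ?e z * (gauss (lam / 2) (lam *\<^sub>R re_vec z) (lam *\<^sub>R im_vec z) x * rep_L2 \<phi> x)" for x
      by (simp add: gauss_def bil_cvec algebra_simps flip: exp_add)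
    then show "bargmann lam \<phi> z = ?C * (?e z * ?g z)"
      unfolding bargmann_def by (simp only: integral_mult_right_zero)
  qed
  have bl: "((\<lambda>z::complex^'n. bil z z) has_derivative (\<lambda>h. 2 * bil z h)) (at z)"
    unfolding bil_def
    by (auto intro!: derivative_eq_intros bounded_linear.has_derivative[OF bounded_linear_vec_nth]
        simp: sum_distrib_left mult_ac)
  have "((\<lambda>z. ?C * (?e z * ?g z)) has_derivative
      (\<lambda>h. ?C * (?e z * D h + ?e z * (- complex_of_real (lam / 4) * (2 * bil z h)) * ?g z))) (at z)"
  proof (intro has_derivative_mult_right has_derivative_mult D(1))
    have "((\<lambda>z. - complex_of_real (lam / 4) * bil z z) has_derivative
        (\<lambda>h. - complex_of_real (lam / 4) * (2 * bil z h))) (at z)"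
      by (intro has_derivative_mult_right bl)
    from has_derivative_compose[OF this, of exp "\<lambda>h. ?e z * h"]
    show "(?e has_derivative (\<lambda>h. ?e z * (- complex_of_real (lam / 4) * (2 * bil z h)))) (at z)"
      using DERIV_exp[of "- complex_of_real (lam / 4) * bil z z"] by (simp add: has_field_derivative_def)
  qed
  moreover have "?C * (?e z * D (c *s v) + ?e z * (- complex_of_real (lam / 4) * (2 * bil z (c *s v))) * ?g z)
    = c * (?C * (?e z * D v + ?e z * (- complex_of_real (lam / 4) * (2 * bil z v)) * ?g z))" for c v
    by (simp add: D(2) bil_scale algebra_simps)
  ultimately show "\<exists>D. (bargmann lam \<phi> has_derivative D) (at z) \<and> (\<forall>c v. D (c *s v) = c * D v)"
    unfolding b by blast
qed

lemma bargmann_in_fock: "bargmann lam (\<phi> :: (real^'n) L2) \<in> fock lam"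
proof -
  have "integrable lborel (\<lambda>z. (cmod (bargmann lam \<phi> z * complex_of_real (exp (- lam / 4 * (norm (z::complex^'n))\<^sup>2))))\<^sup>2)"
    using sqint_bargmann_weighted[of \<phi>] by (simp add: sqint_def)
  moreover have "(cmod (bargmann lam \<phi> z * complex_of_real (exp (- lam / 4 * (norm z)\<^sup>2))))\<^sup>2
     = (cmod (bargmann lam \<phi> z))\<^sup>2 * exp (- lam * (norm z)\<^sup>2 / 2)" for z :: "complex^'n"
    by (simp add: norm_mult power_mult_distrib exp_double[symmetric])
  ultimately have i: "integrable lborel (\<lambda>z::complex^'n. (cmod (bargmann lam \<phi> z))\<^sup>2 * exp (- lam * (norm z)\<^sup>2 / 2))"
    by simp
  then have "integrable (mu lam) (\<lambda>z::complex^'n. (cmod (bargmann lam \<phi> z))\<^sup>2 * exp (- lam * (norm z)\<^sup>2 / 2))"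
    unfolding mu_def using lam by (subst integrable_density) auto
  then show ?thesis using entire_bargmann by (simp add: fock_def)
qed

text \<open>The density of \<open>mu\<close> cancels the constant of the isometry, so the Fock inner
  product is that of the coherent vectors. It yields the kernel of the identity operator
  later.\<close>

lemma fock_inner_coherent:
  "fock_inner lam (coherent lam w) (coherent lam v) = exp (complex_of_real (lam / 2) * bil (cnjv w) (v::complex^'n))"
proof -
  let ?T = "\<lambda>\<phi> z. bargmann lam \<phi> z * complex_of_real (exp (- lam / 4 * (norm (z::complex^'n))\<^sup>2))"
  let ?K = "(2 * pi / lam) ^ CARD('n)"
  have K: "(lam / (2 * pi)) ^ CARD('n) * ?K = 1" using lam by (simp flip: power_mult_distrib)
  have "coherent lam w z * cnj (coherent lam v z) * complex_of_real (exp (- lam * (norm z)\<^sup>2 / 2))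
      = ?T (cohvec lam w) z * cnj (?T (cohvec lam v) z)" for z
    by (simp add: bargmann_cohvec mult_ac flip: exp_add of_real_mult)
  then have "fock_inner lam (coherent lam w) (coherent lam v)
      = (\<integral>z. ?T (cohvec lam w) z * cnj (?T (cohvec lam v) z) \<partial>mu lam)"
    by (simp add: fock_inner_def)
  also have "\<dots> = (lam / (2 * pi)) ^ CARD('n) *\<^sub>R (\<integral>z. ?T (cohvec lam w) z * cnj (?T (cohvec lam v) z) \<partial>lborel)"
  proof -
    have "(\<lambda>z. ?T (cohvec lam w) z * cnj (?T (cohvec lam v) z)) \<in> borel_measurable lborel"
      by (rule borel_measurable_integrable[OF sqint_mult_cnj_integrable]) (rule sqint_bargmann_weighted)+
    then show ?thesis unfolding mu_def using lam by (subst integral_density) auto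
  qed
  also have "(\<integral>z. ?T (cohvec lam w) z * cnj (?T (cohvec lam v) z) \<partial>lborel)
      = complex_of_real ?K * cinner (cohvec lam w) (cohvec lam v)"
    using cinner_bargmann_weighted[of "cohvec lam w" "cohvec lam v"]
    by (simp only: cinner_abs_L2[OF sqint_bargmann_weighted sqint_bargmann_weighted])
  finally show ?thesis
    using K unfolding cinner_cohvec scaleR_conv_of_real mult.assoc[symmetric] of_real_mult[symmetric] by simp
qed

end

section \<open>The generalized diamond group\<close>

lemma omegaR_simps:
  "omegaR (z + z') u = omegaR z u + omegaR z' u" "omegaR z (u + u') = omegaR z u + omegaR z u'"
  "omegaR (z - z') u = omegaR z u - omegaR z' u" "omegaR z (u - u') = omegaR z u - omegaR z u'"
  "omegaR (- z) u = - omegaR z u" "omegaR z (- u) = - omegaR z u"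
  "omegaR 0 u = 0" "omegaR z 0 = 0" "omegaR z z = 0"
  "omegaR (r *\<^sub>R z) u = r * omegaR z u" "omegaR z (r *\<^sub>R u) = r * omegaR z u"
proof -
  have "cnjv (r *\<^sub>R z) = r *\<^sub>R cnjv z" by (simp add: vec_eq_iff del: vector_scaleR_component)
  then show "omegaR (r *\<^sub>R z) u = r * omegaR z u" "omegaR z (r *\<^sub>R u) = r * omegaR z u"
    by (simp_all add: omegaR_eq bil_scale)
qed (simp_all add: omegaR_eq bil_simps bil_cnjv_self)

lemma omegaR_commute: "omegaR z u = - omegaR u z"
proof -
  have "0 = omegaR (z + u) (z + u)" by (simp only: omegaR_simps)
  also have "\<dots> = omegaR z u + omegaR u z" by (simp only: omegaR_simps(1,2)) (simp add: omegaR_simps)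
  finally show ?thesis by simp
qed

lemma omegaR_rot: "omegaR (rot \<alpha> t z) (rot \<alpha> t u) = omegaR z u"
  by (simp add: omegaR_eq)

lemma continuous_on_omegaR [continuous_intros]:
  "continuous_on S f \<Longrightarrow> continuous_on S g \<Longrightarrow> continuous_on S (\<lambda>x. omegaR (f x) (g x))"
  unfolding omegaR_eq by (intro continuous_intros)

lemma diamond_simps [simp]:
  "carrier (diamond \<alpha>) = UNIV" "\<one>\<^bsub>diamond \<alpha>\<^esub> = (0, 0, 0)"
  "(t, z, c) \<otimes>\<^bsub>diamond \<alpha>\<^esub> (t', z', c') = (t + t', z + rot \<alpha> t z', c + c' + 1 / 2 * omegaR z (rot \<alpha> t z'))"
  by (simp_all add: diamond_def)

lemma act_complex_simp [simp]: "act_complex \<alpha> (t, z0, c0) z = rot \<alpha> t z + z0"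
  by (simp add: act_complex_def)

section \<open>Transitive actions, and the identification of the real with the complex phase
  space\<close>

text \<open>Each group element acts bijectively because the inverse element undoes it; the rest of
  the library notion is bookkeeping in the group of permutations.\<close>

lemma transitive_actionI:
  fixes G (structure)
  assumes "group G"
    and ext: "\<And>g. g \<in> carrier G \<Longrightarrow> \<phi> g \<in> extensional E"
    and cl: "\<And>g x. g \<in> carrier G \<Longrightarrow> x \<in> E \<Longrightarrow> \<phi> g x \<in> E"
    and one: "\<And>x. x \<in> E \<Longrightarrow> \<phi> \<one> x = x"
    and mult: "\<And>g h x. g \<in> carrier G \<Longrightarrow> h \<in> carrier G \<Longrightarrow> x \<in> E \<Longrightarrow> \<phi> (g \<otimes> h) x = \<phi> g (\<phi> h x)"
    and tr: "\<And>x y. x \<in> E \<Longrightarrow> y \<in> E \<Longrightarrow> \<exists>g\<in>carrier G. \<phi> g x = y"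
  shows "transitive_action G E \<phi>"
proof -
  interpret group G by fact
  have bij: "\<phi> g \<in> Bij E" if g: "g \<in> carrier G" for g
  proof -
    have "bij_betw (\<phi> g) E E"
      by (rule bij_betw_byWitness[of _ "\<phi> (inv g)"])
        (use g cl one mult[OF g inv_closed[OF g]] mult[OF inv_closed[OF g] g] in \<open>auto simp: r_inv l_inv\<close>)
    then show ?thesis using ext[OF g] by (simp add: Bij_def)
  qed
  have "\<phi> (g \<otimes> h) = \<phi> g \<otimes>\<^bsub>BijGroup E\<^esub> \<phi> h" if "g \<in> carrier G" "h \<in> carrier G" for g h
  proof -
    have "\<phi> (g \<otimes> h) = compose E (\<phi> g) (\<phi> h)"
      by (rule extensionalityI[of _ E]) (use that ext mult in \<open>auto simp: compose_def\<close>)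
    then show ?thesis using bij that by (simp add: BijGroup_def)
  qed
  then have "group_hom G (BijGroup E) \<phi>"
  proof -
    have "carrier (BijGroup E) = Bij E" by (simp add: BijGroup_def)
    then show ?thesis
      using bij by (simp add: group_hom_def group_hom_axioms_def hom_def group_BijGroup \<open>group G\<close>
          \<open>\<And>g h. _ \<Longrightarrow> _ \<Longrightarrow> \<phi> (g \<otimes> h) = _\<close> Pi_def)
  qed
  then show ?thesis
    by (simp add: transitive_action_def group_action_def transitive_action_axioms_def tr)
qed

lemma distr_density_const:
  fixes T :: "'a::euclidean_space \<Rightarrow> 'b::euclidean_space"
  assumes "distr lborel borel T = lborel" and [measurable]: "T \<in> borel_measurable borel"
  shows "distr (density lborel (\<lambda>_. c)) (density lborel (\<lambda>_. c)) T = density lborel (\<lambda>_. c)"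
proof -
  have "density (distr lborel borel T) (\<lambda>_. c) = distr (density lborel (\<lambda>_. c)) borel T"
    by (rule density_distr) auto
  then show ?thesis unfolding assms by (simp cong: distr_cong)
qed

lemma cplx_nth [simp]: "cplx p $ k = Complex (fst p $ k) (snd p $ k)"
  by (simp add: cplx_def split_beta)

lemma cplx_inverse [simp]: "cplx (re_vec z, im_vec z) = z" "re_vec (cplx p) = fst p" "im_vec (cplx p) = snd p"
  by (simp_all add: vec_eq_iff)

lemma bij_cplx: "bij cplx"
  by (rule bij_betw_byWitness[of _ "\<lambda>z. (re_vec z, im_vec z)"]) auto

lemma inv_cplx: "inv_into UNIV cplx z = (re_vec z, im_vec z)"
  by (rule inv_f_eq) (auto simp: bij_is_inj[OF bij_cplx])

lemma linear_cplx: "linear cplx"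
  by (rule linearI) (simp_all add: vec_eq_iff complex_eq_iff)

lemma linear_inv_cplx: "linear (\<lambda>z. (re_vec z, im_vec z))"
  by (rule linearI) (simp_all add: vec_eq_iff)

lemma norm_cplx: "norm (cplx p) = norm (p :: (real^'n) \<times> (real^'n))"
proof -
  have "(norm (cplx p))\<^sup>2 = (norm p)\<^sup>2"
    by (cases p) (simp add: power2_norm_eq_inner inner_vec_def inner_prod_def sum.distrib inner_complex_def)
  then show ?thesis by simp
qed

lemma continuous_on_cplx [continuous_intros]: "continuous_on S f \<Longrightarrow> continuous_on S (\<lambda>x. cplx (f x))"
  using continuous_on_compose2[OF linear_continuous_on[OF linear_conv_bounded_linear[THEN iffD1, OF linear_cplx]]]
  by blast

lemma continuous_on_re_im_vec [continuous_intros]: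
  "continuous_on S f \<Longrightarrow> continuous_on S (\<lambda>x. re_vec (f x))"
  "continuous_on S f \<Longrightarrow> continuous_on S (\<lambda>x. im_vec (f x))"
  unfolding re_vec_def im_vec_def by (intro continuous_intros; assumption)+

text \<open>\<open>cplx\<close> is a linear bijection preserving norms, hence preserves Lebesgue
  measure, and both measures carry the same constant density.\<close>

lemma distr_mu_real_cplx: "distr (mu_real lam) borel cplx = (mu lam :: (complex^'n) measure)"
proof -
  have "distr lborel borel cplx = (lborel :: (complex^'n) measure)"
    by (rule lborel_distr_isometry[OF linear_cplx bij_is_surj[OF bij_cplx] norm_cplx]) simp
  moreover have "cplx \<in> borel_measurable borel"
    by (intro borel_measurable_continuous_onI continuous_intros)
  ultimately show ?thesis
    using distr_density_const[of cplx "ennreal ((lam / (2 * pi)) ^ CARD('n))"]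
    unfolding mu_def mu_real_def by (simp cong: distr_cong)
qed

context
  fixes \<alpha> :: "'n::finite \<Rightarrow> real^'m::finite \<Rightarrow> real"
  assumes \<alpha>: "\<And>k. linear (\<alpha> k)"
begin

lemma group_diamond: "group (diamond \<alpha>)"
proof (rule groupI)
  fix x y z :: "('m, 'n) diamond"
  show "x \<otimes>\<^bsub>diamond \<alpha>\<^esub> y \<otimes>\<^bsub>diamond \<alpha>\<^esub> z = x \<otimes>\<^bsub>diamond \<alpha>\<^esub> (y \<otimes>\<^bsub>diamond \<alpha>\<^esub> z)"
    by (cases x, cases y, cases z) (simp add: rot_add[OF \<alpha>] omegaR_simps omegaR_rot field_simps)
  show "\<one>\<^bsub>diamond \<alpha>\<^esub> \<otimes>\<^bsub>diamond \<alpha>\<^esub> x = x"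
    by (cases x) (simp add: rot_zero[OF \<alpha>] omegaR_simps)
  show "\<exists>y\<in>carrier (diamond \<alpha>). y \<otimes>\<^bsub>diamond \<alpha>\<^esub> x = \<one>\<^bsub>diamond \<alpha>\<^esub>"
    by (cases x, rule bexI[of _ "(- fst x, - rot \<alpha> (- fst x) (fst (snd x)), - snd (snd x))"])
      (simp_all add: omegaR_simps)
qed simp_all

lemma inv_diamond [simp]: "inv\<^bsub>diamond \<alpha>\<^esub> (t, z, c) = (- t, - rot \<alpha> (- t) z, - c)"
proof -
  interpret group "diamond \<alpha>" by (rule group_diamond)
  show ?thesis
    by (rule inv_equality) (simp_all add: omegaR_simps)
qed

lemma topological_group_diamond: "topological_group (diamond \<alpha>)"
  unfolding topological_group_def
proof (intro conjI group_diamond)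
  have "(\<lambda>(g, h). g \<otimes>\<^bsub>diamond \<alpha>\<^esub> h) = (\<lambda>p :: ('m, 'n) diamond \<times> ('m, 'n) diamond. (fst (fst p) + fst (snd p),
      fst (snd (fst p)) + rot \<alpha> (fst (fst p)) (fst (snd (snd p))), snd (snd (fst p)) + snd (snd (snd p))
      + 1 / 2 * omegaR (fst (snd (fst p))) (rot \<alpha> (fst (fst p)) (fst (snd (snd p))))))"
    by (auto simp: fun_eq_iff)
  then show "continuous_on (carrier (diamond \<alpha>) \<times> carrier (diamond \<alpha>)) (\<lambda>(g, h). g \<otimes>\<^bsub>diamond \<alpha>\<^esub> h)"
    by (simp only:) (intro continuous_intros continuous_on_rot[OF \<alpha>])
  have "(\<lambda>g. inv\<^bsub>diamond \<alpha>\<^esub> g) = (\<lambda>g. (- fst g, - rot \<alpha> (- fst g) (fst (snd g)), - snd (snd g)))"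
    by (auto simp: fun_eq_iff)
  then show "continuous_on (carrier (diamond \<alpha>)) (\<lambda>g. inv\<^bsub>diamond \<alpha>\<^esub> g)"
    by (simp only:) (intro continuous_intros continuous_on_rot[OF \<alpha>])
qed

subsection \<open>The action on the plane\<close>

lemma act_complex_mult: "act_complex \<alpha> (g \<otimes>\<^bsub>diamond \<alpha>\<^esub> h) z = act_complex \<alpha> g (act_complex \<alpha> h z)"
  by (cases g, cases h) (simp add: rot_add[OF \<alpha>])

lemma act_complex_inv [simp]:
  "act_complex \<alpha> (inv\<^bsub>diamond \<alpha>\<^esub> g) (act_complex \<alpha> g z) = z"
  "act_complex \<alpha> g (act_complex \<alpha> (inv\<^bsub>diamond \<alpha>\<^esub> g) z) = z"
  by (cases g; simp add: rot_minus[OF \<alpha>])+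

lemma cplx_act_real [simp]: "cplx (act_real \<alpha> g p) = act_complex \<alpha> g (cplx p)"
  by (simp add: act_real_def inv_cplx)

lemma act_real_eq: "act_real \<alpha> g p = (re_vec (act_complex \<alpha> g (cplx p)), im_vec (act_complex \<alpha> g (cplx p)))"
  by (simp add: act_real_def inv_cplx)

lemma continuous_on_act_complex [continuous_intros]:
  "continuous_on S f \<Longrightarrow> continuous_on S g \<Longrightarrow> continuous_on S (\<lambda>x. act_complex \<alpha> (f x) (g x))"
  unfolding act_complex_def split_beta by (intro continuous_intros continuous_on_rot[OF \<alpha>])

text \<open>In real coordinates a group element acts by a linear isometry followed by a
  translation.\<close>

lemma distr_lborel_act_real: "distr lborel borel (act_real \<alpha> g) = lborel"
proof -
  obtain t z0 c0 where g: "g = (t, z0, c0)" by (cases g)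
  let ?L = "\<lambda>p. (re_vec (rot \<alpha> t (cplx p)), im_vec (rot \<alpha> t (cplx p)))"
  let ?b = "(re_vec z0, im_vec z0)"
  have L: "linear ?L"
    using linear_compose[OF linear_compose[OF linear_cplx linear_rot[OF \<alpha>]] linear_inv_cplx]
    by (simp add: o_def)
  have "distr lborel borel ?L = lborel"
  proof (rule lborel_distr_isometry[OF L])
    show "surj ?L"
      by (rule surjI[of _ "\<lambda>p. (re_vec (rot \<alpha> (- t) (cplx p)), im_vec (rot \<alpha> (- t) (cplx p)))"])
        (simp add: rot_minus[OF \<alpha>])
    show "norm (?L p) = norm p" for p
      by (subst norm_cplx[symmetric]) (simp add: norm_cplx)
  qed simp
  moreover have "?L \<in> borel_measurable borel"
    by (intro borel_measurable_continuous_onI continuous_intros continuous_on_rot[OF \<alpha>])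
  moreover have "act_real \<alpha> g = (+) ?b \<circ> ?L"
    by (rule ext) (simp add: act_real_eq g vec_eq_iff)
  ultimately show ?thesis
    using distr_distr[of "(+) ?b" borel borel ?L lborel] lborel_distr_plus[of ?b] by simp
qed

lemma borel_measurable_act_real [measurable]: "act_real \<alpha> g \<in> borel_measurable borel"
  unfolding act_real_eq[abs_def] by (intro borel_measurable_continuous_onI continuous_intros)

lemma homogeneous_space_act_real:
  "homogeneous_space_invariant_measure (diamond \<alpha>) (act_real \<alpha>) (mu_real lam)"
  unfolding homogeneous_space_invariant_measure_def
proof (intro conjI ballI)
  show "transitive_action (diamond \<alpha>) (space (mu_real lam)) (act_real \<alpha>)"
  proof (rule transitive_actionI[OF group_diamond])
    fix x y :: "(real^'n) \<times> (real^'n)"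
    have "act_real \<alpha> (0, cplx y - cplx x, 0) x = y"
      by (simp add: act_real_eq rot_zero[OF \<alpha>])
    then show "\<exists>g\<in>carrier (diamond \<alpha>). act_real \<alpha> g x = y" by (intro bexI) auto
  qed (simp_all add: mu_real_def, simp_all add: act_real_eq act_complex_mult rot_zero[OF \<alpha>] extensional_def)
  have "(\<lambda>(g, x). act_real \<alpha> g x) = (\<lambda>p. act_real \<alpha> (fst p) (snd p))" by auto
  then show "continuous_on (carrier (diamond \<alpha>) \<times> space (mu_real lam)) (\<lambda>(g, x). act_real \<alpha> g x)"
    by (simp only:) (unfold act_real_eq, intro continuous_intros)
  show "sets (mu_real lam) = sets (restrict_space borel (space (mu_real lam)))"
    by (simp add: mu_real_def)
  show "distr (mu_real lam) (mu_real lam) (act_real \<alpha> g) = mu_real lam" for g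
    unfolding mu_real_def by (rule distr_density_const[OF distr_lborel_act_real]) measurable
qed

end

section \<open>The representation\<close>

lemma bounded_clinear_eqI:
  fixes A B :: "'h::chilbert_space \<Rightarrow> 'h"
  assumes v: "total_family I v" and A: "bounded_clinear A" and B: "bounded_clinear B"
    and AB: "\<And>i. i \<in> I \<Longrightarrow> A (v i) = B (v i)"
  shows "A = B"
proof (intro ext cinner_eqI)
  fix x z
  show "cinner (A x) z = cinner (B x) z"
    by (rule total_linear_eq[OF v, of "\<lambda>x. cinner (A x) z"])
      (use A B AB in \<open>auto simp: bounded_clinear_scaleC cinner_scaleC_left
        intro!: bounded_linear_compose[OF bounded_linear_cinner_left] bounded_clinear_bounded_linear\<close>)
qed

lemma continuous_on_scaleC [continuous_intros]:
  fixes g :: "'a::topological_space \<Rightarrow> 'h::chilbert_space"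
  assumes "continuous_on S f" "continuous_on S g"
  shows "continuous_on S (\<lambda>x. scaleC (f x) (g x))"
proof -
  have "bounded_bilinear (scaleC :: complex \<Rightarrow> 'h \<Rightarrow> 'h)"
    by standard (auto simp: scaleC_add_left scaleC_add_right scaleR_scaleC scaleC_scaleC norm_scaleC
        scaleR_conv_of_real mult.commute intro!: exI[of _ 1])
  then show ?thesis using assms by (rule bounded_bilinear.continuous_on)
qed

text \<open>The representation multiplies the coherent vector at \<open>w\<close> by this factor and moves it to the
  coherent vector at the image of \<open>w\<close> under the group element.\<close>

definition rep_factor ::
  "('n::finite \<Rightarrow> real^'m \<Rightarrow> real) \<Rightarrow> (real^'m \<Rightarrow> complex) \<Rightarrow> real \<Rightarrow> ('m, 'n) diamond \<Rightarrow> complex^'n \<Rightarrow> complex" where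
  "rep_factor \<alpha> \<kappa> lam = (\<lambda>(t, z0, c0) w. \<kappa> t * exp (\<i> * complex_of_real (lam * c0)
      - complex_of_real (lam / 4) * bil (cnjv z0) z0
      - complex_of_real (lam / 2) * bil (cnjv (rot \<alpha> t w)) z0))"

context
  fixes \<alpha> :: "'n::finite \<Rightarrow> real^'m::finite \<Rightarrow> real" and \<kappa> :: "real^'m \<Rightarrow> complex" and lam :: real
  assumes \<alpha>: "\<And>k. linear (\<alpha> k)" and \<kappa>: "unitary_character \<kappa>" and lam: "lam > 0"
begin

lemma character_simps:
  "\<kappa> (s + t) = \<kappa> s * \<kappa> t" "\<kappa> t * cnj (\<kappa> t) = 1" "\<kappa> 0 = 1"
proof -
  show m: "\<kappa> (s + t) = \<kappa> s * \<kappa> t" for s t using \<kappa> by (simp add: unitary_character_def)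
  have n: "cmod (\<kappa> t) = 1" for t using \<kappa> by (simp add: unitary_character_def)
  show "\<kappa> t * cnj (\<kappa> t) = 1" using complex_norm_square[of "\<kappa> t"] n[of t] by simp
  have "\<kappa> 0 \<noteq> 0" using n[of 0] by auto
  then show "\<kappa> 0 = 1" using m[of 0 0] by simp
qed

text \<open>The cocycle identity that makes the representation multiplicative on coherent
  vectors.\<close>

lemma rep_factor_mult:
  "rep_factor \<alpha> \<kappa> lam (g \<otimes>\<^bsub>diamond \<alpha>\<^esub> h) w = rep_factor \<alpha> \<kappa> lam h w * rep_factor \<alpha> \<kappa> lam g (act_complex \<alpha> h w)"
proof -
  obtain t z c t' z' c' where gh: "g = (t, z, c)" "h = (t', z', c')" by (metis prod_cases3)
  let ?u = "rot \<alpha> t z'" and ?W = "rot \<alpha> t (rot \<alpha> t' w)"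
  \<comment> \<open>The twist of the group law is the antisymmetric cross term. Added to the
    symmetric cross terms of the square of \<open>z + ?u\<close> it leaves a single one, which
    shifts the argument from \<open>?W\<close> to \<open>?W + ?u\<close>.\<close>
  have 1: "\<i> * complex_of_real (lam * (c + c' + 1 / 2 * omegaR z ?u))
     = \<i> * complex_of_real (lam * c) + \<i> * complex_of_real (lam * c')
       + complex_of_real (lam / 4) * (bil (cnjv z) ?u - bil (cnjv ?u) z)"
  proof -
    have "\<i> * complex_of_real (lam * (c + c' + 1 / 2 * omegaR z ?u)) = \<i> * complex_of_real (lam * c)
       + \<i> * complex_of_real (lam * c') + complex_of_real (lam / 2) * (\<i> * complex_of_real (omegaR z ?u))"
      by (simp add: algebra_simps)
    then show ?thesis unfolding i_omegaR by simp
  qed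
  have "rep_factor \<alpha> \<kappa> lam (g \<otimes>\<^bsub>diamond \<alpha>\<^esub> h) w = \<kappa> t * \<kappa> t' * exp (
      \<i> * complex_of_real (lam * (c + c' + 1 / 2 * omegaR z ?u))
      - complex_of_real (lam / 4) * bil (cnjv (z + ?u)) (z + ?u) - complex_of_real (lam / 2) * bil (cnjv ?W) (z + ?u))"
    by (simp add: gh rep_factor_def character_simps rot_add[OF \<alpha>])
  also have "\<i> * complex_of_real (lam * (c + c' + 1 / 2 * omegaR z ?u))
      - complex_of_real (lam / 4) * bil (cnjv (z + ?u)) (z + ?u) - complex_of_real (lam / 2) * bil (cnjv ?W) (z + ?u)
    = (\<i> * complex_of_real (lam * c') - complex_of_real (lam / 4) * bil (cnjv z') z'
        - complex_of_real (lam / 2) * bil (cnjv (rot \<alpha> t' w)) z')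
      + (\<i> * complex_of_real (lam * c) - complex_of_real (lam / 4) * bil (cnjv z) z
        - complex_of_real (lam / 2) * bil (cnjv (?W + ?u)) z)"
    unfolding 1 by (simp add: bil_simps algebra_simps)
  finally have 2: "rep_factor \<alpha> \<kappa> lam (g \<otimes>\<^bsub>diamond \<alpha>\<^esub> h) w = \<kappa> t * \<kappa> t' * exp (
      (\<i> * complex_of_real (lam * c') - complex_of_real (lam / 4) * bil (cnjv z') z'
        - complex_of_real (lam / 2) * bil (cnjv (rot \<alpha> t' w)) z')
      + (\<i> * complex_of_real (lam * c) - complex_of_real (lam / 4) * bil (cnjv z) z
        - complex_of_real (lam / 2) * bil (cnjv (?W + ?u)) z))" .
  have "rep_factor \<alpha> \<kappa> lam h w = \<kappa> t' * exp (\<i> * complex_of_real (lam * c')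
      - complex_of_real (lam / 4) * bil (cnjv z') z' - complex_of_real (lam / 2) * bil (cnjv (rot \<alpha> t' w)) z')"
    by (simp add: gh rep_factor_def)
  moreover have "rep_factor \<alpha> \<kappa> lam g (act_complex \<alpha> h w) = \<kappa> t * exp (\<i> * complex_of_real (lam * c)
      - complex_of_real (lam / 4) * bil (cnjv z) z - complex_of_real (lam / 2) * bil (cnjv (?W + ?u)) z)"
    by (simp add: gh rep_factor_def)
  ultimately show ?thesis
    unfolding 2 exp_add by (simp only: mult_ac)
qed

lemma rep_factor_one: "rep_factor \<alpha> \<kappa> lam (0, 0, 0) w = 1"
  by (simp add: rep_factor_def character_simps bil_simps)

lemma continuous_on_rep_factor: "continuous_on UNIV (\<lambda>g. rep_factor \<alpha> \<kappa> lam g w)"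
proof -
  have k: "continuous_on UNIV (\<lambda>g::('m,'n) diamond. \<kappa> (fst g))"
    using \<kappa> by (intro continuous_on_compose2[of UNIV \<kappa> UNIV fst] continuous_on_fst continuous_on_id)
      (auto simp: unitary_character_def)
  show ?thesis
    unfolding rep_factor_def split_beta by (intro continuous_intros k continuous_on_rot[OF \<alpha>])
qed

text \<open>Moving and rescaling the coherent vectors preserves their Gram matrix; this is the
  hypothesis of \<open>isometry_extension\<close> with K = 1.\<close>

lemma rep_factor_unitary:
  "rep_factor \<alpha> \<kappa> lam g w * cnj (rep_factor \<alpha> \<kappa> lam g v) *
     exp (complex_of_real (lam / 2) * bil (cnjv (act_complex \<alpha> g w)) (act_complex \<alpha> g v))
   = exp (complex_of_real (lam / 2) * bil (cnjv w) v)"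
proof -
  obtain t z0 c0 where g: "g = (t, z0, c0)" by (metis prod_cases3)
  have "cnj (bil (cnjv z0) z0) = bil (cnjv z0) z0" by (simp add: bil_cnjv_self)
  moreover have "cnj (bil (cnjv (rot \<alpha> t v)) z0) = bil (cnjv z0) (rot \<alpha> t v)" by (simp add: cnj_bil bil_commute)
  ultimately have "rep_factor \<alpha> \<kappa> lam g w * cnj (rep_factor \<alpha> \<kappa> lam g v) *
     exp (complex_of_real (lam / 2) * bil (cnjv (act_complex \<alpha> g w)) (act_complex \<alpha> g v))
    = (\<kappa> t * cnj (\<kappa> t)) * (exp (\<i> * complex_of_real (lam * c0)
      - complex_of_real (lam / 4) * bil (cnjv z0) z0 - complex_of_real (lam / 2) * bil (cnjv (rot \<alpha> t w)) z0)
      * exp (- (\<i> * complex_of_real (lam * c0)) - complex_of_real (lam / 4) * bil (cnjv z0) z0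
          - complex_of_real (lam / 2) * bil (cnjv z0) (rot \<alpha> t v))
      * exp (complex_of_real (lam / 2) * bil (cnjv (rot \<alpha> t w + z0)) (rot \<alpha> t v + z0)))"
    by (simp add: g rep_factor_def exp_cnj mult_ac)
  also have "\<dots> = exp (complex_of_real (lam / 2) * bil (cnjv w) v)"
    unfolding character_simps exp_add[symmetric] by (simp add: bil_simps algebra_simps)
  finally show ?thesis .
qed

lemma fock_rep_coherent:
  "fock_rep \<alpha> \<kappa> lam g (coherent lam w) z = rep_factor \<alpha> \<kappa> lam g w * coherent lam (act_complex \<alpha> g w) z"
proof -
  obtain t z0 c0 where g: "g = (t, z0, c0)" by (metis prod_cases3)
  have 1: "coherent lam w \<in> fock lam" using bargmann_in_fock[OF lam] bargmann_cohvec[OF lam] by metis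
  have 2: "complex_of_real (lam / 4 * (norm z0)\<^sup>2) = complex_of_real (lam / 4) * bil (cnjv z0) z0"
    by (simp add: bil_cnjv_self)
  have 3: "bil (cnjv w) (rot \<alpha> (- t) (z - z0)) = bil (cnjv (rot \<alpha> t w)) z - bil (cnjv (rot \<alpha> t w)) z0"
    by (simp only: bil_cnjv_rot_left[OF \<alpha>, symmetric] bil_simps)
  show ?thesis
    unfolding g fock_rep_def prod.case restrict_apply'[OF 1] rep_factor_def coherent_def 2 3 act_complex_simp
    by (simp add: bil_simps mult.assoc algebra_simps add_divide_distrib diff_divide_distrib flip: exp_add)
qed

text \<open>\<open>schrodinger_rep\<close> applies \<open>inv_into\<close> to a function that must
  first be known to be a Bargmann transform. The isometry U defined on coherent vectors intertwines
  \<open>fock_rep\<close> with the Bargmann transform, which proves this and identifies U with the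
  representation.\<close>

lemma
  shows schrodinger_rep_cohvec:
      "schrodinger_rep \<alpha> \<kappa> lam g (cohvec lam w) = scaleC (rep_factor \<alpha> \<kappa> lam g w) (cohvec lam (act_complex \<alpha> g w))"
    and cinner_schrodinger_rep:
      "cinner (schrodinger_rep \<alpha> \<kappa> lam g x) (schrodinger_rep \<alpha> \<kappa> lam g y) = cinner x y"
    and bounded_clinear_schrodinger_rep: "bounded_clinear (schrodinger_rep \<alpha> \<kappa> lam g)"
proof -
  let ?w = "\<lambda>w. scaleC (rep_factor \<alpha> \<kappa> lam g w) (cohvec lam (act_complex \<alpha> g w))"
  have "cinner (?w w) (?w v) = complex_of_real 1 * cinner (cohvec lam w) (cohvec lam v)" for w v
    using rep_factor_unitary[of g w v]
    by (simp add: cinner_scaleC_left cinner_scaleC_right cinner_cohvec[OF lam] mult_ac)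
  then obtain U where U: "\<And>w. U (cohvec lam w) = ?w w" "\<And>x y. cinner (U x) (U y) = complex_of_real 1 * cinner x y"
    "\<And>x y. U (x + y) = U x + U y" "\<And>c x. U (scaleC c x) = scaleC c (U x)" "bounded_linear U"
    using isometry_extension[OF total_cohvec[OF lam], of 1 ?w] by (metis UNIV_I zero_less_one)
  have "bargmann lam (U \<phi>) = fock_rep \<alpha> \<kappa> lam g (bargmann lam \<phi>)" for \<phi>
  proof
    fix z
    obtain t z0 c0 where g: "g = (t, z0, c0)" by (metis prod_cases3)
    define f where "f = \<kappa> t * exp (\<i> * complex_of_real (lam * c0) + complex_of_real (lam / 2) * bil (cnjv z0) z
                - complex_of_real (lam / 4 * (norm z0)\<^sup>2))"
    define z' where "z' = rot \<alpha> (- t) (z - z0)"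
    have F: "fock_rep \<alpha> \<kappa> lam g (bargmann lam \<phi>) z = f * cinner \<phi> (cohvec lam z')" for \<phi>
      using bargmann_in_fock[OF lam, of \<phi>] bargmann_eq_cinner[OF lam, of \<phi> z']
      by (simp add: fock_rep_def g f_def z'_def)
    \<comment> \<open>At a fixed point z both sides are continuous linear functionals of \<phi>, so
      coherent vectors decide.\<close>
    have "cinner (U \<phi>) (cohvec lam z) = f * cinner \<phi> (cohvec lam z')"
    proof (rule total_linear_eq[OF total_cohvec[OF lam], of "\<lambda>\<phi>. cinner (U \<phi>) (cohvec lam z)"])
      show "bounded_linear (\<lambda>\<phi>. cinner (U \<phi>) (cohvec lam z))"
        by (rule bounded_linear_compose[OF bounded_linear_cinner_left U(5)])
      show "bounded_linear (\<lambda>\<phi>. f * cinner \<phi> (cohvec lam z'))"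
        by (rule bounded_linear_compose[OF bounded_linear_mult_right bounded_linear_cinner_left])
      show "cinner (U (cohvec lam w)) (cohvec lam z) = f * cinner (cohvec lam w) (cohvec lam z')" for w
      proof -
        have "f * cinner (cohvec lam w) (cohvec lam z') = rep_factor \<alpha> \<kappa> lam g w * coherent lam (act_complex \<alpha> g w) z"
          using fock_rep_coherent[of g w z] F[of "cohvec lam w"] by (simp add: bargmann_cohvec[OF lam])
        then show ?thesis
          by (simp add: U(1) cinner_scaleC_left cinner_cohvec[OF lam] coherent_def)
      qed
    qed (simp_all add: U(4) cinner_scaleC_left)
    then show "bargmann lam (U \<phi>) z = fock_rep \<alpha> \<kappa> lam g (bargmann lam \<phi>) z"
      unfolding F bargmann_eq_cinner[OF lam] .
  qed
  \<comment> \<open>The function is in the range of the injective Bargmann transform, where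
    \<open>inv_into\<close> is a genuine inverse.\<close>
  then have "schrodinger_rep \<alpha> \<kappa> lam g = U"
    by (intro ext) (simp add: schrodinger_rep_def inv_f_f[OF inj_bargmann[OF lam]] flip: \<open>\<And>\<phi>. bargmann lam (U \<phi>) = _\<close>)
  then show "schrodinger_rep \<alpha> \<kappa> lam g (cohvec lam w) = ?w w"
    "cinner (schrodinger_rep \<alpha> \<kappa> lam g x) (schrodinger_rep \<alpha> \<kappa> lam g y) = cinner x y"
    "bounded_clinear (schrodinger_rep \<alpha> \<kappa> lam g)"
    using U by (simp_all add: bounded_clinear_def)
qed

lemma schrodinger_rep_mult:
  "schrodinger_rep \<alpha> \<kappa> lam (g \<otimes>\<^bsub>diamond \<alpha>\<^esub> h) = schrodinger_rep \<alpha> \<kappa> lam g \<circ> schrodinger_rep \<alpha> \<kappa> lam h"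
  by (rule bounded_clinear_eqI[OF total_cohvec[OF lam]])
    (auto simp: schrodinger_rep_cohvec bounded_clinear_scaleC[OF bounded_clinear_schrodinger_rep]
      rep_factor_mult act_complex_mult[OF \<alpha>] scaleC_scaleC
      intro!: bounded_clinear_comp bounded_clinear_schrodinger_rep)

lemma schrodinger_rep_one: "schrodinger_rep \<alpha> \<kappa> lam (0, 0, 0) = id"
proof (rule bounded_clinear_eqI[OF total_cohvec[OF lam] bounded_clinear_schrodinger_rep])
  show "bounded_clinear (id :: (real^'n) L2 \<Rightarrow> _)"
    by (simp add: bounded_clinear_def id_def bounded_linear_ident)
qed (simp add: schrodinger_rep_cohvec rep_factor_one rot_zero[OF \<alpha>])

lemma schrodinger_rep_inv:
  "schrodinger_rep \<alpha> \<kappa> lam g \<circ> schrodinger_rep \<alpha> \<kappa> lam (inv\<^bsub>diamond \<alpha>\<^esub> g) = id"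
  "schrodinger_rep \<alpha> \<kappa> lam (inv\<^bsub>diamond \<alpha>\<^esub> g) \<circ> schrodinger_rep \<alpha> \<kappa> lam g = id"
proof -
  interpret group "diamond \<alpha>" by (rule group_diamond[OF \<alpha>])
  show "schrodinger_rep \<alpha> \<kappa> lam g \<circ> schrodinger_rep \<alpha> \<kappa> lam (inv\<^bsub>diamond \<alpha>\<^esub> g) = id"
    "schrodinger_rep \<alpha> \<kappa> lam (inv\<^bsub>diamond \<alpha>\<^esub> g) \<circ> schrodinger_rep \<alpha> \<kappa> lam g = id"
    unfolding schrodinger_rep_mult[symmetric] using r_inv[of g] l_inv[of g] schrodinger_rep_one by simp_all
qed

lemma bij_schrodinger_rep: "bij (schrodinger_rep \<alpha> \<kappa> lam g)"
  using o_bij[OF schrodinger_rep_inv(2) schrodinger_rep_inv(1)] .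

lemma inv_schrodinger_rep: "inv_into UNIV (schrodinger_rep \<alpha> \<kappa> lam g) = schrodinger_rep \<alpha> \<kappa> lam (inv\<^bsub>diamond \<alpha>\<^esub> g)"
  by (rule inv_unique_comp[OF schrodinger_rep_inv])

lemma unitary_op_schrodinger_rep: "unitary_op (schrodinger_rep \<alpha> \<kappa> lam g)"
  by (simp add: unitary_op_def bounded_clinear_schrodinger_rep bij_schrodinger_rep cinner_schrodinger_rep)

text \<open>On coherent vectors continuity is explicit. It passes to limits because the operators
  are isometries, so that convergence of vectors is uniform in g.\<close>

lemma continuous_on_schrodinger_rep: "continuous_on UNIV (\<lambda>g. schrodinger_rep \<alpha> \<kappa> lam g \<phi>)"
proof (rule total_induct[OF total_cohvec[OF lam], where x = \<phi>])
  let ?S = "schrodinger_rep \<alpha> \<kappa> lam"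
  note bl = bounded_clinear_bounded_linear[OF bounded_clinear_schrodinger_rep]
  have d: "dist (?S g x) (?S g y) = dist x y" for g x y
  proof -
    have "norm (?S g x) = norm x" for x
    proof -
      have "complex_of_real ((norm (?S g x))\<^sup>2) = complex_of_real ((norm x)\<^sup>2)"
        unfolding cinner_self[symmetric] by (rule cinner_schrodinger_rep)
      then have "(norm (?S g x))\<^sup>2 = (norm x)\<^sup>2" using of_real_eq_iff by blast
      then show ?thesis by simp
    qed
    then show ?thesis
      unfolding dist_norm linear_simps(2)[OF bl, symmetric] by blast
  qed
  show "closed {x. continuous_on UNIV (\<lambda>g. ?S g x)}"
    unfolding closed_sequential_limits
  proof (intro allI impI, elim conjE)
    fix X x assume X: "\<forall>n. X n \<in> {x. continuous_on UNIV (\<lambda>g. ?S g x)}" "X \<longlonglongrightarrow> x"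
    have "continuous_on UNIV (\<lambda>g. ?S g x)"
    proof (rule uniform_limit_theorem)
      show "\<forall>\<^sub>F n in sequentially. continuous_on UNIV (\<lambda>g. ?S g (X n))" using X(1) by simp
      show "uniform_limit UNIV (\<lambda>n g. ?S g (X n)) (\<lambda>g. ?S g x) sequentially"
        unfolding uniform_limit_iff d using X(2) by (simp add: tendsto_iff)
    qed simp
    then show "x \<in> {x. continuous_on UNIV (\<lambda>g. ?S g x)}" by simp
  qed
  show "continuous_on UNIV (\<lambda>g. ?S g 0)"
    by (simp add: linear_simps(3)[OF bl])
  show "continuous_on UNIV (\<lambda>g. ?S g (x + y))"
    if "continuous_on UNIV (\<lambda>g. ?S g x)" "continuous_on UNIV (\<lambda>g. ?S g y)" for x y
    using that by (simp add: bounded_clinear_add[OF bounded_clinear_schrodinger_rep] continuous_on_add)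
  show "continuous_on UNIV (\<lambda>g. ?S g (scaleC c x))" if "continuous_on UNIV (\<lambda>g. ?S g x)" for c x
    using that unfolding bounded_clinear_scaleC[OF bounded_clinear_schrodinger_rep] by (intro continuous_intros)
  show "continuous_on UNIV (\<lambda>g. ?S g (cohvec lam w))" for w
    unfolding schrodinger_rep_cohvec
    by (intro continuous_intros continuous_on_rep_factor continuous_on_compose2[OF continuous_on_cohvec[OF lam]]
        continuous_on_act_complex[OF \<alpha>]) auto
qed

lemma unitary_representation_schrodinger: "unitary_representation (diamond \<alpha>) (schrodinger_rep \<alpha> \<kappa> lam)"
  unfolding unitary_representation_def
  by (simp add: unitary_op_schrodinger_rep schrodinger_rep_mult continuous_on_schrodinger_rep)

end

section \<open>Hilbert-Schmidt operators\<close>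

text \<open>Tonelli for sums: a finite subset of the product lies in a finite rectangle, whose sum
  is at most S.\<close>

lemma has_sum_product_nonneg:
  fixes f :: "'a \<Rightarrow> 'b \<Rightarrow> real"
  assumes f0: "\<And>x y. 0 \<le> f x y" and f: "\<And>x. x \<in> A \<Longrightarrow> ((\<lambda>y. f x y) has_sum g x) B" and g: "(g has_sum S) A"
  shows "((\<lambda>(x, y). f x y) has_sum S) (A \<times> B)"
proof (rule has_sum_SigmaI[where g = g])
  have g0: "0 \<le> g x" if "x \<in> A" for x using has_sum_nonneg[OF f[OF that]] f0 by blast
  show "(\<lambda>(x, y). f x y) summable_on A \<times> B"
  proof (rule nonneg_bdd_above_summable_on)
    show "bdd_above (sum (\<lambda>(x, y). f x y) ` {F. F \<subseteq> A \<times> B \<and> finite F})"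
    proof (rule bdd_aboveI[of _ S], safe)
      fix F assume F: "F \<subseteq> A \<times> B" "finite F"
      have "sum (\<lambda>(x, y). f x y) F \<le> sum (\<lambda>(x, y). f x y) (fst ` F \<times> snd ` F)"
        using F f0 by (intro sum_mono2) force+
      also have "\<dots> = (\<Sum>x\<in>fst ` F. \<Sum>y\<in>snd ` F. f x y)" by (simp add: sum.cartesian_product)
      also have "\<dots> \<le> (\<Sum>x\<in>fst ` F. g x)"
        using F f0 by (intro sum_mono finite_sum_le_has_sum[OF f]) auto
      also have "\<dots> \<le> S"
        using F g0 by (intro finite_sum_le_has_sum[OF g]) auto
      finally show "sum (\<lambda>(x, y). f x y) F \<le> S" .
    qed
  qed (use f0 in auto)
qed (use f g in auto)

lemma bounded_clinear_matrix_has_sum: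
  assumes E: "is_onb E" and "((\<lambda>f. (norm (A f))\<^sup>2) has_sum S) F"
  shows "((\<lambda>(f, e). (cmod (cinner (A f) e))\<^sup>2) has_sum S) (F \<times> E)"
  by (rule has_sum_product_nonneg[OF _ parseval_norm[OF onb_orthonormal[OF E] onb_total[OF E]] assms(2)]) simp

text \<open>Both sides sum the squared moduli of the same matrix entries, once by rows and once by
  columns. The two bases are unrelated, which gives independence of the basis.\<close>

lemma hilbert_schmidt_cadjoint_has_sum:
  assumes A: "bounded_clinear A" and E: "is_onb E" "is_onb F" and s: "((\<lambda>e. (norm (A e))\<^sup>2) has_sum S) E"
  shows "((\<lambda>f. (norm (cadjoint A f))\<^sup>2) has_sum S) F"
proof (rule has_sum_SigmaD)
  have "((\<lambda>(f, e). (cmod (cinner (A e) f))\<^sup>2) has_sum S) (F \<times> E)"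
    using bounded_clinear_matrix_has_sum[OF E(2) s] by (subst (asm) has_sum_swap) simp
  then show "((\<lambda>(f, e). (cmod (cinner (A e) f))\<^sup>2) has_sum S) (F \<times> E)" .
  fix f
  have "cmod (cinner (A e) f) = cmod (cinner (cadjoint A f) e)" for e
    unfolding cadjoint[OF A] by (subst cinner_commute) simp
  then show "((\<lambda>e. case (f, e) of (f, e) \<Rightarrow> (cmod (cinner (A e) f))\<^sup>2) has_sum (norm (cadjoint A f))\<^sup>2) E"
    using parseval_norm[OF onb_orthonormal[OF E(1)] onb_total[OF E(1)], of "cadjoint A f"] by simp
qed

text \<open>Passing to the adjoint and back carries the sum from the basis provided by the
  definition to \<open>some_onb\<close> and from there to an arbitrary basis.\<close>

lemma hs_norm_has_sum:
  assumes A: "hilbert_schmidt A" and E: "is_onb E"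
  shows "((\<lambda>e. (norm (A e))\<^sup>2) has_sum (hs_norm A)\<^sup>2) E"
proof -
  obtain E0 where E0: "is_onb E0" "(\<lambda>e. (norm (A e))\<^sup>2) summable_on E0" and b: "bounded_clinear A"
    using A by (auto simp: hilbert_schmidt_def)
  define S where "S = (\<Sum>\<^sub>\<infinity>e\<in>E0. (norm (A e))\<^sup>2)"
  have "((\<lambda>e. (norm (A e))\<^sup>2) has_sum S) E0" using E0(2) by (simp add: S_def)
  then have "((\<lambda>f. (norm (cadjoint A f))\<^sup>2) has_sum S) some_onb"
    by (rule hilbert_schmidt_cadjoint_has_sum[OF b E0(1) is_onb_some_onb])
  then have *: "((\<lambda>e. (norm (A e))\<^sup>2) has_sum S) F" if "is_onb F" for F
    using hilbert_schmidt_cadjoint_has_sum[OF bounded_clinear_cadjoint[OF b] is_onb_some_onb that]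
    by (simp add: cadjoint_cadjoint[OF b])
  have "S \<ge> 0" unfolding S_def by (rule infsum_nonneg) simp
  moreover have "hs_norm A = sqrt S"
    unfolding hs_norm_def using infsumI[OF *[OF is_onb_some_onb]] by simp
  ultimately show ?thesis using *[OF E] by simp
qed

lemma hilbert_schmidt_bounded_clinear: "hilbert_schmidt A \<Longrightarrow> bounded_clinear A"
  by (simp add: hilbert_schmidt_def)

lemma hilbert_schmidtI:
  "bounded_clinear A \<Longrightarrow> is_onb E \<Longrightarrow> (\<lambda>e. (norm (A e))\<^sup>2) summable_on E \<Longrightarrow> hilbert_schmidt A"
  by (auto simp: hilbert_schmidt_def)

lemma hilbert_schmidt_cadjoint:
  assumes "hilbert_schmidt A"
  shows "hilbert_schmidt (cadjoint A)"
  using hilbert_schmidt_cadjoint_has_sum[OF hilbert_schmidt_bounded_clinear[OF assms] is_onb_some_onb is_onb_some_onb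
      hs_norm_has_sum[OF assms is_onb_some_onb]]
  by (intro hilbert_schmidtI[OF bounded_clinear_cadjoint is_onb_some_onb])
    (auto simp: hilbert_schmidt_bounded_clinear[OF assms] intro: has_sum_imp_summable)

lemma hilbert_schmidt_summable:
  "hilbert_schmidt A \<Longrightarrow> is_onb E \<Longrightarrow> (\<lambda>e. (norm (A e))\<^sup>2) summable_on E"
  using hs_norm_has_sum has_sum_imp_summable by blast

lemma hilbert_schmidt_lincomb:
  assumes A: "hilbert_schmidt A" and B: "hilbert_schmidt B"
  shows "hilbert_schmidt (\<lambda>\<phi>. scaleC a (A \<phi>) + scaleC b (B \<phi>))"
proof (rule hilbert_schmidtI[OF _ is_onb_some_onb])
  show "bounded_clinear (\<lambda>\<phi>. scaleC a (A \<phi>) + scaleC b (B \<phi>))"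
    by (intro bounded_clinear_lincomb hilbert_schmidt_bounded_clinear A B)
  show "(\<lambda>e. (norm (scaleC a (A e) + scaleC b (B e)))\<^sup>2) summable_on some_onb"
  proof (rule summable_on_comparison_test)
    show "(\<lambda>e. 2 * (cmod a)\<^sup>2 * (norm (A e))\<^sup>2 + 2 * (cmod b)\<^sup>2 * (norm (B e))\<^sup>2) summable_on some_onb"
      by (intro summable_on_add summable_on_cmult_right hilbert_schmidt_summable A B is_onb_some_onb)
    fix e
    have "(norm (scaleC a (A e) + scaleC b (B e)))\<^sup>2 \<le> (cmod a * norm (A e) + cmod b * norm (B e))\<^sup>2"
      using norm_triangle_ineq[of "scaleC a (A e)" "scaleC b (B e)"] by (intro power_mono) (auto simp: norm_scaleC)
    also have "\<dots> \<le> 2 * (cmod a)\<^sup>2 * (norm (A e))\<^sup>2 + 2 * (cmod b)\<^sup>2 * (norm (B e))\<^sup>2"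
      using sum_squares_bound[of "cmod a * norm (A e)" "cmod b * norm (B e)"]
      by (simp add: power2_sum power_mult_distrib)
    finally show "(norm (scaleC a (A e) + scaleC b (B e)))\<^sup>2
      \<le> 2 * (cmod a)\<^sup>2 * (norm (A e))\<^sup>2 + 2 * (cmod b)\<^sup>2 * (norm (B e))\<^sup>2" .
  qed simp
qed

lemma hilbert_schmidt_comp_left:
  assumes B: "bounded_clinear B" and A: "hilbert_schmidt A"
  shows "hilbert_schmidt (B \<circ> A)"
proof (rule hilbert_schmidtI[OF _ is_onb_some_onb])
  show "bounded_clinear (B \<circ> A)" by (intro bounded_clinear_comp hilbert_schmidt_bounded_clinear A B)
  obtain K where K: "\<And>x. norm (B x) \<le> norm x * K"
    using bounded_linear.bounded[OF bounded_clinear_bounded_linear[OF B]] by blast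
  show "(\<lambda>e. (norm ((B \<circ> A) e))\<^sup>2) summable_on some_onb"
  proof (rule summable_on_comparison_test)
    show "(\<lambda>e. K\<^sup>2 * (norm (A e))\<^sup>2) summable_on some_onb"
      by (intro summable_on_cmult_right hilbert_schmidt_summable A is_onb_some_onb)
    show "(norm ((B \<circ> A) e))\<^sup>2 \<le> K\<^sup>2 * (norm (A e))\<^sup>2" for e
      using power_mono[OF K[of "A e"], of 2] by (simp add: power_mult_distrib mult.commute)
  qed simp
qed

lemma hilbert_schmidt_comp_right:
  assumes A: "hilbert_schmidt A" and B: "bounded_clinear B"
  shows "hilbert_schmidt (A \<circ> B)"
proof -
  note bA = hilbert_schmidt_bounded_clinear[OF A]
  have "hilbert_schmidt (cadjoint (cadjoint B \<circ> cadjoint A))"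
    by (intro hilbert_schmidt_cadjoint hilbert_schmidt_comp_left bounded_clinear_cadjoint A B)
  also have "cadjoint (cadjoint B \<circ> cadjoint A) = A \<circ> B"
    by (rule cadjoint_unique) (simp add: cadjoint_left[OF bA] cadjoint_left[OF B])
  finally show ?thesis .
qed

lemma trace_class_hilbert_schmidt: "trace_class A \<Longrightarrow> hilbert_schmidt A"
  unfolding trace_class_def using hilbert_schmidt_comp_left hilbert_schmidt_bounded_clinear by blast

text \<open>Both sums equal the absolutely convergent double sum of the products of the matrix entries.\<close>

lemma trace_hilbert_schmidt_swap:
  fixes X Y :: "'h::chilbert_space \<Rightarrow> 'h"
  assumes X: "hilbert_schmidt X" and Y: "hilbert_schmidt Y" and E: "is_onb E"
  obtains t where "((\<lambda>e. cinner (X (Y e)) e) has_sum t) E" "((\<lambda>e. cinner (Y (X e)) e) has_sum t) E"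
proof -
  note bX = hilbert_schmidt_bounded_clinear[OF X] and bY = hilbert_schmidt_bounded_clinear[OF Y]
  let ?m = "\<lambda>(e, f). cinner (Y e) f * cinner (X f) e"
  have s: "?m summable_on (E \<times> E)"
  proof (rule abs_summable_summable, rule summable_on_comparison_test)
    have sX: "(\<lambda>(e, f). (cmod (cinner (X e) f))\<^sup>2) summable_on (E \<times> E)"
      and sY: "(\<lambda>(e, f). (cmod (cinner (Y e) f))\<^sup>2) summable_on (E \<times> E)"
      using bounded_clinear_matrix_has_sum[OF E hs_norm_has_sum[OF _ E]] X Y has_sum_imp_summable by blast+
    have "(\<lambda>(e, f). (cmod (cinner (X f) e))\<^sup>2) summable_on (E \<times> E)"
      using sX by (subst (asm) summable_on_swap) simp
    with sY show "(\<lambda>(e, f). (cmod (cinner (Y e) f))\<^sup>2 + (cmod (cinner (X f) e))\<^sup>2) summable_on (E \<times> E)"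
      unfolding split_beta by (intro summable_on_add)
    show "norm (?m p) \<le> (case p of (e, f) \<Rightarrow> (cmod (cinner (Y e) f))\<^sup>2 + (cmod (cinner (X f) e))\<^sup>2)" for p
    proof (cases p)
      case (Pair e f)
      have "0 \<le> cmod (cinner (Y e) f) * cmod (cinner (X f) e)" by simp
      then have "cmod (cinner (Y e) f) * cmod (cinner (X f) e)
          \<le> (cmod (cinner (Y e) f))\<^sup>2 + (cmod (cinner (X f) e))\<^sup>2"
        using sum_squares_bound[of "cmod (cinner (Y e) f)" "cmod (cinner (X f) e)"] by linarith
      then show ?thesis by (simp add: Pair norm_mult)
    qed
  qed simp
  define t where "t = infsum ?m (E \<times> E)"
  have t: "(?m has_sum t) (E \<times> E)" using s by (simp add: t_def)
  note pv = parseval[OF onb_orthonormal[OF E] onb_total[OF E]]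
  have "((\<lambda>e. cinner (X (Y e)) e) has_sum t) E"
  proof (rule has_sum_SigmaD[OF t])
    fix e
    have "cinner (X f) e = cnj (cinner (cadjoint X e) f)" for f
      by (metis cadjoint[OF bX] cinner_commute)
    then show "((\<lambda>f. ?m (e, f)) has_sum cinner (X (Y e)) e) E"
      using pv[of "Y e" "cadjoint X e"] by (simp add: cadjoint[OF bX])
  qed
  moreover have "((\<lambda>f. cinner (Y (X f)) f) has_sum t) E"
  proof (rule has_sum_SigmaD)
    show "((\<lambda>(f, e). cinner (Y e) f * cinner (X f) e) has_sum t) (E \<times> E)"
      using t by (subst (asm) has_sum_swap) simp
    fix f
    have "cinner (Y e) f = cnj (cinner (cadjoint Y f) e)" for e
      by (metis cadjoint[OF bY] cinner_commute)
    then show "((\<lambda>e. case (f, e) of (f, e) \<Rightarrow> cinner (Y e) f * cinner (X f) e) has_sum cinner (Y (X f)) f) E"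
      using pv[of "X f" "cadjoint Y f"] by (simp add: cadjoint[OF bY] mult.commute)
  qed
  ultimately show ?thesis using that by blast
qed

section \<open>Approximation of Hilbert-Schmidt operators by cutting off\<close>

definition onb_proj :: "'h set \<Rightarrow> 'h::chilbert_space \<Rightarrow> 'h" where
  "onb_proj F x = (\<Sum>f\<in>F. scaleC (cinner x f) f)"

lemma onb_proj_basis:
  assumes "is_onb E" "finite F" "F \<subseteq> E" "e \<in> E"
  shows "onb_proj F e = (if e \<in> F then e else 0)"
proof -
  have "onb_proj F e = (\<Sum>f\<in>F. if e = f then f else 0)"
    unfolding onb_proj_def using assms by (intro sum.cong refl) (auto simp: is_onb_def subset_iff)
  then show ?thesis using assms(2) by simp
qed

lemma hilbert_schmidt_onb_proj:
  fixes E :: "'h::chilbert_space set"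
  assumes E: "is_onb E" "finite F" "F \<subseteq> E"
  shows "hilbert_schmidt (onb_proj F)"
proof (rule hilbert_schmidtI[OF _ E(1)])
  have "bounded_linear (onb_proj F)"
    unfolding onb_proj_def
  proof (rule bounded_linear_sum)
    fix f :: 'h
    show "bounded_linear (\<lambda>x. scaleC (cinner x f) f)"
      by (rule bounded_linear_intro[of _ "norm f * norm f"])
        (auto simp: cinner_add_left scaleC_add_left cinner_scaleC_left scaleR_scaleC scaleC_scaleC norm_scaleC
          intro: order_trans[OF mult_right_mono[OF cinner_cauchy_schwarz]])
  qed
  then show "bounded_clinear (onb_proj F)"
    unfolding bounded_clinear_def
    by (simp add: onb_proj_def cinner_scaleC_left scaleC_scaleC[symmetric]
        linear_sum[OF bounded_linear.linear[OF bounded_linear_scaleC]])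
  have "(\<lambda>e. (norm (onb_proj F e))\<^sup>2) summable_on F" using E(2) by simp
  then show "(\<lambda>e. (norm (onb_proj F e))\<^sup>2) summable_on E"
    by (rule summable_on_cong_neutral[THEN iffD1, rotated -1]) (use E onb_proj_basis[OF E] in auto)
qed

text \<open>A is composed with projections onto finitely many basis vectors. Each composition is a
  product of two Hilbert-Schmidt operators, and its error is a tail of the series for the
  Hilbert-Schmidt norm.\<close>

lemma trace_class_approximation:
  assumes A: "hilbert_schmidt A"
  obtains X where "\<And>i. trace_class (X i)" "(\<lambda>i. hs_norm (\<lambda>\<phi>. X i \<phi> - A \<phi>)) \<longlonglongrightarrow> 0"
proof -
  let ?E = "some_onb :: 'a set"
  note E = is_onb_some_onb[where 'h='a]
  note bl = bounded_clinear_bounded_linear[OF hilbert_schmidt_bounded_clinear[OF A]]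
  define S where "S = (hs_norm A)\<^sup>2"
  have S: "((\<lambda>e. (norm (A e))\<^sup>2) has_sum S) ?E" unfolding S_def by (rule hs_norm_has_sum[OF A E])
  have "\<exists>F. finite F \<and> F \<subseteq> ?E \<and> dist (\<Sum>e\<in>F. (norm (A e))\<^sup>2) S \<le> 1 / real (Suc i)" for i
    by (rule has_sum_finite_approximation[OF S]) simp
  then obtain F where F: "\<And>i. finite (F i)" "\<And>i. F i \<subseteq> ?E"
    "\<And>i. dist (\<Sum>e\<in>F i. (norm (A e))\<^sup>2) S \<le> 1 / real (Suc i)" by metis
  define X where "X i = A \<circ> onb_proj (F i)" for i
  have tc: "trace_class (X i)" for i
    unfolding trace_class_def X_def using hilbert_schmidt_onb_proj[OF E F(1,2)] A by blast
  have n: "hs_norm (\<lambda>\<phi>. X i \<phi> - A \<phi>) \<le> sqrt (1 / real (Suc i))" for i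
  proof -
    have "((\<lambda>e. (norm (A e))\<^sup>2) has_sum (S - (\<Sum>e\<in>F i. (norm (A e))\<^sup>2))) (?E - F i)"
      by (rule has_sum_Diff[OF S]) (use F in auto)
    then have "((\<lambda>e. (norm (X i e - A e))\<^sup>2) has_sum (S - (\<Sum>e\<in>F i. (norm (A e))\<^sup>2))) ?E"
      by (rule has_sum_cong_neutral[THEN iffD1, rotated -1])
        (use onb_proj_basis[OF E F(1,2)] linear_simps(3)[OF bl] in \<open>auto simp: X_def\<close>)
    then have "hs_norm (\<lambda>\<phi>. X i \<phi> - A \<phi>) = sqrt (S - (\<Sum>e\<in>F i. (norm (A e))\<^sup>2))"
      unfolding hs_norm_def by (simp add: infsumI)
    then show ?thesis using F(3)[of i] by (simp add: dist_real_def abs_le_iff)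
  qed
  have "(\<lambda>i. hs_norm (\<lambda>\<phi>. X i \<phi> - A \<phi>)) \<longlonglongrightarrow> 0"
  proof (rule tendsto_sandwich[OF _ _ tendsto_const])
    show "\<forall>\<^sub>F i in sequentially. 0 \<le> hs_norm (\<lambda>\<phi>. X i \<phi> - A \<phi>)"
      by (simp add: hs_norm_def infsum_nonneg)
    show "\<forall>\<^sub>F i in sequentially. hs_norm (\<lambda>\<phi>. X i \<phi> - A \<phi>) \<le> sqrt (1 / real (Suc i))" using n by simp
    have "(\<lambda>i. sqrt (1 / real (Suc i))) \<longlonglongrightarrow> sqrt 0"
      by (intro tendsto_real_sqrt LIMSEQ_Suc[OF lim_1_over_n])
    then show "(\<lambda>i. sqrt (1 / real (Suc i))) \<longlonglongrightarrow> 0" by simp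
  qed
  with tc show ?thesis by (rule that)
qed

text \<open>The error depends on the majorant g only, so finite sets chosen for g work
  simultaneously for every series dominated by it.\<close>

lemma has_sum_finite_remainder:
  fixes h :: "'i \<Rightarrow> 'b::banach"
  assumes h: "(h has_sum H) E" and g: "(g has_sum S) E" and hg: "\<And>i. i \<in> E \<Longrightarrow> norm (h i) \<le> C * g i"
    and F: "finite F" "F \<subseteq> E"
  shows "norm (H - sum h F) \<le> C * (S - sum g F)"
proof (rule norm_infsum_le)
  show "(h has_sum (H - sum h F)) (E - F)" by (rule has_sum_Diff[OF h]) (use F in auto)
  show "((\<lambda>i. C * g i) has_sum (C * (S - sum g F))) (E - F)"
    by (intro has_sum_cmult_right has_sum_Diff[OF g]) (use F in auto)
qed (use hg in auto)

section \<open>The Wigner functions of rank one operators\<close>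

lemma integral_lborel_reflect:
  fixes f :: "'a::euclidean_space \<Rightarrow> 'b::{banach, second_countable_topology}"
  assumes [measurable]: "f \<in> borel_measurable borel"
  shows "(\<integral>x. f (a - x) \<partial>lborel) = (\<integral>x. f x \<partial>lborel)"
    and "integrable lborel (\<lambda>x. f (a - x)) \<longleftrightarrow> integrable lborel f"
proof -
  have "(\<integral>x. f x \<partial>distr lborel borel (\<lambda>x. a - x)) = (\<integral>x. f (a - x) \<partial>lborel)"
    by (rule integral_distr) auto
  then show "(\<integral>x. f (a - x) \<partial>lborel) = (\<integral>x. f x \<partial>lborel)" by (simp add: lborel_distr_reflect)
  have "integrable (distr lborel borel (\<lambda>x. a - x)) f \<longleftrightarrow> integrable lborel (\<lambda>x. f (a - x))"
    by (rule integrable_distr_eq) auto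
  then show "integrable lborel (\<lambda>x. f (a - x)) \<longleftrightarrow> integrable lborel f" by (simp add: lborel_distr_reflect)
qed

section \<open>Reflection operators on phase space\<close>

text \<open>The action of \<open>Omega1\<close> on functions, free of the representative that
  \<open>rep_L2\<close> selects.\<close>

definition reflect_fun :: "real \<Rightarrow> (real^'n) \<times> (real^'n) \<Rightarrow> (real^'n \<Rightarrow> complex) \<Rightarrow> real^'n \<Rightarrow> complex" where
  "reflect_fun lam p f x = 2 ^ CARD('n) * exp (2 * \<i> * complex_of_real (lam * (snd p \<bullet> (fst p - x)))) * f (2 *\<^sub>R fst p - x)"

lemma cmod_reflect_fun: "cmod (reflect_fun lam p f x) = 2 ^ CARD('n) * cmod (f (2 *\<^sub>R fst p - x))"
  for p :: "(real^'n) \<times> (real^'n)"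
proof -
  have "cmod (exp (2 * \<i> * complex_of_real r)) = 1" for r by (simp add: mult.assoc norm_exp_i_times mult.left_commute[of 2])
  then show ?thesis unfolding reflect_fun_def norm_mult by (simp add: norm_power)
qed

lemma sqint_reflect_fun:
  assumes f: "f \<in> sqint lborel"
  shows "reflect_fun lam p f \<in> sqint lborel"
proof -
  have [measurable]: "f \<in> borel_measurable borel" using f by (simp add: sqint_def)
  have "reflect_fun lam p f \<in> borel_measurable borel"
    unfolding reflect_fun_def[abs_def] by measurable
  moreover have "integrable lborel (\<lambda>x. (cmod (reflect_fun lam p f x))\<^sup>2)"
    unfolding cmod_reflect_fun power_mult_distrib
    using f integral_lborel_reflect(2)[of "\<lambda>x. (cmod (f x))\<^sup>2" "2 *\<^sub>R fst p"] by (simp add: sqint_def)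
  ultimately show ?thesis by (simp add: sqint_def)
qed

text \<open>The selected representative differs from f on a null set, and the reflection maps null
  sets to null sets.\<close>

lemma Omega1_abs_L2:
  fixes f :: "real^'n \<Rightarrow> complex"
  assumes f: "f \<in> sqint lborel"
  shows "Omega1 lam p (abs_L2 f) = abs_L2 (reflect_fun lam p f)"
proof -
  let ?r = "rep_L2 (abs_L2 f)"
  have r: "?r \<in> sqint lborel" by (rule rep_L2_sqint)
  have [measurable]: "f \<in> borel_measurable borel" "?r \<in> borel_measurable borel"
    using f r by (simp_all add: sqint_def)
  have "Omega1 lam p (abs_L2 f) = abs_L2 (reflect_fun lam p ?r)"
    by (simp add: Omega1_def reflect_fun_def[abs_def] split_beta)
  also have "\<dots> = abs_L2 (reflect_fun lam p f)"
    unfolding abs_L2_eq_iff[OF sqint_reflect_fun[OF r] sqint_reflect_fun[OF f]]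
  proof -
    have "AE x in distr lborel borel (\<lambda>x. 2 *\<^sub>R fst p - x). ?r x = f x"
      by (subst lborel_distr_reflect) (rule AE_rep_abs_L2[OF f])
    then have "AE x in lborel. ?r (2 *\<^sub>R fst p - x) = f (2 *\<^sub>R fst p - x)"
      by (subst (asm) AE_distr_iff) auto
    then show "AE x in lborel. reflect_fun lam p ?r x = reflect_fun lam p f x"
      by eventually_elim (simp add: reflect_fun_def)
  qed
  finally show ?thesis .
qed

lemma Omega1_add: "Omega1 lam p (x + y) = Omega1 lam p x + Omega1 lam p y"
proof (cases x rule: L2_cases, cases y rule: L2_cases)
  fix f g assume fg: "f \<in> sqint lborel" "x = abs_L2 f" "g \<in> sqint lborel" "y = abs_L2 g"
  have "reflect_fun lam p (\<lambda>x. f x + g x) = (\<lambda>x. reflect_fun lam p f x + reflect_fun lam p g x)"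
    by (simp add: reflect_fun_def fun_eq_iff distrib_left)
  then show ?thesis
    using fg by (simp add: abs_L2_add[symmetric] Omega1_abs_L2 sqint_add sqint_reflect_fun)
qed

lemma Omega1_scaleC: "Omega1 lam p (scaleC c x) = scaleC c (Omega1 lam p x)"
proof (cases x rule: L2_cases)
  fix f assume f: "f \<in> sqint lborel" "x = abs_L2 f"
  have "reflect_fun lam p (\<lambda>x. c * f x) = (\<lambda>x. c * reflect_fun lam p f x)"
    by (simp add: reflect_fun_def fun_eq_iff mult_ac)
  then show ?thesis
    using f by (simp add: abs_L2_scaleC[symmetric] Omega1_abs_L2 sqint_scale sqint_reflect_fun)
qed

lemma norm_Omega1: "norm (Omega1 lam p x) = 2 ^ CARD('n) * norm (x :: (real^'n) L2)"
proof (cases x rule: L2_cases)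
  fix f assume f: "f \<in> sqint lborel" "x = abs_L2 f"
  then have [measurable]: "f \<in> borel_measurable borel" by (simp add: sqint_def)
  have "(norm (Omega1 lam p x))\<^sup>2 = (2 ^ CARD('n))\<^sup>2 * (norm x)\<^sup>2"
    unfolding f Omega1_abs_L2[OF f(1)] norm_sq_abs_L2[OF sqint_reflect_fun[OF f(1)]] norm_sq_abs_L2[OF f(1)]
      cmod_reflect_fun power_mult_distrib
    using integral_lborel_reflect(1)[of "\<lambda>x. (cmod (f x))\<^sup>2" "2 *\<^sub>R fst p"] by simp
  then have "(norm (Omega1 lam p x))\<^sup>2 = (2 ^ CARD('n) * norm x)\<^sup>2" by (simp only: power_mult_distrib)
  then show ?thesis by (simp add: power2_eq_iff_nonneg)
qed

lemma bounded_clinear_Omega1: "bounded_clinear (Omega1 lam p)"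
  unfolding bounded_clinear_def
  by (intro conjI bounded_linear_intro[of _ "2 ^ CARD('a)"])
    (auto simp: Omega1_add Omega1_scaleC scaleR_scaleC norm_Omega1 mult.commute)

text \<open>The substitution by the reflection itself, x to 2a - x, turns the phase into its
  conjugate.\<close>

lemma cinner_Omega1: "cinner (Omega1 lam p x) y = cinner x (Omega1 lam p y)"
proof (cases x rule: L2_cases, cases y rule: L2_cases)
  fix f g assume fg: "f \<in> sqint lborel" "x = abs_L2 f" "g \<in> sqint lborel" "y = abs_L2 g"
  then have [measurable]: "f \<in> borel_measurable borel" "g \<in> borel_measurable borel" by (simp_all add: sqint_def)
  have m [measurable]: "(\<lambda>x. f x * cnj (reflect_fun lam p g x)) \<in> borel_measurable borel"
    using borel_measurable_integrable[OF sqint_mult_cnj_integrable[OF fg(1) sqint_reflect_fun[OF fg(3)]]] by simp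
  have "reflect_fun lam p f x * cnj (g x) = f (2 *\<^sub>R fst p - x) * cnj (reflect_fun lam p g (2 *\<^sub>R fst p - x))" for x
  proof -
    have "cnj (exp (2 * \<i> * complex_of_real (lam * (snd p \<bullet> (fst p - (2 *\<^sub>R fst p - x))))))
       = exp (2 * \<i> * complex_of_real (lam * (snd p \<bullet> (fst p - x))))"
      by (simp add: exp_cnj inner_diff_right algebra_simps)
    then show ?thesis by (simp add: reflect_fun_def mult_ac)
  qed
  then show "cinner (Omega1 lam p x) y = cinner x (Omega1 lam p y)"
    using integral_lborel_reflect(1)[OF m, of "2 *\<^sub>R fst p"]
    by (simp add: fg Omega1_abs_L2 cinner_abs_L2 sqint_reflect_fun)
qed

text \<open>The Wigner function of the rank one operator \<open>\<chi> \<mapsto> \<langle>\<chi>, \<psi>\<rangle> \<phi>\<close>.\<close>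

definition wigner :: "real \<Rightarrow> (real^'n) L2 \<Rightarrow> (real^'n) L2 \<Rightarrow> (real^'n) \<times> (real^'n) \<Rightarrow> complex" where
  "wigner lam \<phi> \<psi> p = cinner (Omega1 lam p \<phi>) \<psi>"

lemma cnj_wigner: "cnj (wigner lam \<phi> \<psi> p) = wigner lam \<psi> \<phi> p"
  unfolding wigner_def by (metis cinner_Omega1 cinner_commute)

lemma wigner_simps:
  "wigner lam (\<phi> + \<phi>') \<psi> p = wigner lam \<phi> \<psi> p + wigner lam \<phi>' \<psi> p"
  "wigner lam \<phi> (\<psi> + \<psi>') p = wigner lam \<phi> \<psi> p + wigner lam \<phi> \<psi>' p"
  "wigner lam (scaleC c \<phi>) \<psi> p = c * wigner lam \<phi> \<psi> p"
  "wigner lam \<phi> (scaleC c \<psi>) p = cnj c * wigner lam \<phi> \<psi> p"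
  by (simp_all add: wigner_def Omega1_add Omega1_scaleC cinner_add_left cinner_add_right cinner_scaleC_left
      cinner_scaleC_right)

lemma bounded_linear_wigner: "bounded_linear (\<lambda>\<phi>. wigner lam \<phi> \<psi> p)"
  unfolding wigner_def
  by (rule bounded_linear_compose[OF bounded_linear_cinner_left
        bounded_clinear_bounded_linear[OF bounded_clinear_Omega1]])

lemma cmod_wigner_le: "cmod (wigner lam \<phi> \<psi> p) \<le> 2 ^ CARD('n) * (norm \<phi> * norm (\<psi> :: (real^'n) L2))"
  using cinner_cauchy_schwarz[of "Omega1 lam p \<phi>" \<psi>] by (simp add: wigner_def norm_Omega1 mult.assoc)

lemma bil_cvec_cvec: "complex_of_real (x \<bullet> y) = bil (cvec x) (cvec y)"
  by (simp add: bil_def inner_vec_def)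

lemma cplx_eq_cvec:
  "cplx p = cvec (fst p) + \<i> *s cvec (snd p)" "cnjv (cplx p) = cvec (fst p) - \<i> *s cvec (snd p)"
  by (simp_all add: vec_eq_iff complex_eq_iff)

lemma sqint_cnj: "f \<in> sqint M \<Longrightarrow> (\<lambda>x. cnj (f x)) \<in> sqint M"
proof -
  assume f: "f \<in> sqint M"
  then have [measurable]: "f \<in> borel_measurable M" by (simp add: sqint_def)
  have "(\<lambda>x. cnj (f x)) \<in> borel_measurable M"
    by (rule borel_measurable_continuous_on) (auto intro: continuous_intros)
  then show ?thesis using f by (simp add: sqint_def)
qed

lemma cinner_abs_L2_cnj:
  "f \<in> sqint lborel \<Longrightarrow> g \<in> sqint lborel \<Longrightarrow>
    cinner (abs_L2 (\<lambda>x. cnj (f x))) (abs_L2 (\<lambda>x. cnj (g x))) = cnj (cinner (abs_L2 f) (abs_L2 g))"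
  by (simp add: cinner_abs_L2 sqint_cnj flip: Bochner_Integration.integral_cnj)

abbreviation (input) vol :: "real \<Rightarrow> nat \<Rightarrow> real" where
  "vol lam n \<equiv> (2 * pi / lam) ^ n"

section \<open>Wigner functions of coherent vectors and their orthogonality relation\<close>

context
  fixes lam :: real
  assumes lam: "lam > 0"
begin

text \<open>Up to the factor 2^n the operator is the parity about the phase space point p, so the
  label w goes to its reflection 2p - w; the scalar comes from comparing exponents.\<close>

lemma Omega1_cohvec:
  fixes w :: "complex^'n"
  shows "Omega1 lam p (cohvec lam w) = scaleC (2 ^ CARD('n) *
      exp (complex_of_real lam * (bil (cnjv w) (cplx p) - bil (cnjv (cplx p)) (cplx p)))) (cohvec lam (2 *\<^sub>R cplx p - w))"
proof -
  obtain a b where p: "p = (a, b)" by (cases p)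
  let ?g = "\<lambda>w::complex^'n. gauss (lam / 2) (lam *\<^sub>R re_vec w) (- (lam *\<^sub>R im_vec w))"
  let ?u = "2 *\<^sub>R cplx p - w"
  let ?C = "complex_of_real ((lam / pi) powr (real CARD('n) / 4))"
  let ?k = "2 ^ CARD('n) * exp (complex_of_real lam * (2 * bil (cnjv w) (cvec a) - 2 * bil (cvec a) (cvec a)
      + 2 * \<i> * bil (cvec a) (cvec b)))"
  have g: "?g w x = exp (complex_of_real lam * (bil (cnjv w) (cvec x) - bil (cvec x) (cvec x) / 2))" for w x
  proof -
    have "re_vec (cnjv w) = re_vec w" "im_vec (cnjv w) = - im_vec w" by (simp_all add: vec_eq_iff)
    then have *: "bil (cnjv w) (cvec x) = complex_of_real (re_vec w \<bullet> x) - \<i> * complex_of_real (im_vec w \<bullet> x)"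
      unfolding bil_cvec by simp
    show ?thesis unfolding gauss_def bil_cvec_cvec[symmetric] * by (simp add: algebra_simps)
  qed
  have cv: "cvec (2 *\<^sub>R a - x) = 2 *s cvec a - cvec x" for x :: "real^'n" by (simp add: vec_eq_iff)
  have cu: "cnjv ?u = 2 *s cvec a - 2 *s (\<i> *s cvec b) - cnjv w"
    by (simp add: p vec_eq_iff complex_eq_iff)
  have r: "reflect_fun lam p (?g w) = (\<lambda>x. ?k * ?g ?u x)"
  proof
    fix x
    have e: "2 * \<i> * complex_of_real (lam * (b \<bullet> (a - x))) = complex_of_real lam * (2 * \<i> * (bil (cvec a) (cvec b) - bil (cvec b) (cvec x)))"
      by (simp add: inner_diff_right bil_cvec_cvec[symmetric] inner_commute algebra_simps)
    show "reflect_fun lam p (?g w) x = ?k * ?g ?u x"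
      unfolding reflect_fun_def g p fst_conv snd_conv e cv cu[unfolded p]
      by (simp add: mult.assoc bil_simps bil_scale bil_commute[of "cvec x" "cvec a"] algebra_simps
          add_divide_distrib diff_divide_distrib flip: exp_add)
  qed
  have G: "?g w \<in> sqint lborel" for w using lam by (intro sqint_gauss) simp
  have "Omega1 lam p (cohvec lam w) = scaleC (?C * exp (- complex_of_real (lam / 4) * bil (cnjv w) (cnjv w)) * ?k) (abs_L2 (?g ?u))"
    by (simp add: cohvec_def Omega1_scaleC Omega1_abs_L2[OF G] r abs_L2_scaleC[OF G] scaleC_scaleC)
  also have "?C * exp (- complex_of_real (lam / 4) * bil (cnjv w) (cnjv w)) * ?k =
     2 ^ CARD('n) * exp (complex_of_real lam * (bil (cnjv w) (cplx p) - bil (cnjv (cplx p)) (cplx p)))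
      * (?C * exp (- complex_of_real (lam / 4) * bil (cnjv ?u) (cnjv ?u)))"
    unfolding cu cplx_eq_cvec(2) unfolding cplx_eq_cvec(1) p fst_conv snd_conv
    by (simp add: mult.assoc mult.left_commute[of "exp _"] bil_simps bil_scale
        bil_commute[of "cvec a" "cnjv w"] bil_commute[of "cvec b" "cnjv w"]
        bil_commute[of "cvec b" "cvec a"] algebra_simps add_divide_distrib diff_divide_distrib flip: exp_add)
  finally show ?thesis by (simp add: cohvec_def scaleC_scaleC)
qed

text \<open>Written through the differences of p to the labels, which a group element only rotates.
  Covariance is read off this form.\<close>

lemma wigner_cohvec:
  fixes w v :: "complex^'n"
  shows "wigner lam (cohvec lam w) (cohvec lam v) p = 2 ^ CARD('n) * exp (complex_of_real (lam / 2) * bil (cnjv w) v)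
      * exp (- complex_of_real lam * bil (cnjv (cplx p - w)) (cplx p - v))"
proof -
  have "cnjv (2 *\<^sub>R cplx p - w) = 2 *s cnjv (cplx p) - cnjv w"
    by (simp add: vec_eq_iff del: vector_scaleR_component)
  then show ?thesis
    unfolding wigner_def Omega1_cohvec cinner_scaleC_left cinner_cohvec[OF lam]
    by (simp add: mult.assoc bil_simps bil_scale algebra_simps add_divide_distrib diff_divide_distrib flip: exp_add)
qed

text \<open>The form used for integration: a Gaussian in the real coordinates of p, with complex
  linear coefficients given by the sum and the difference of \<open>cnjv w\<close> and v.\<close>

lemma wigner_cohvec_gauss:
  fixes w v :: "complex^'n"
  shows "wigner lam (cohvec lam w) (cohvec lam v) = (\<lambda>p. 2 ^ CARD('n) * exp (- complex_of_real (lam / 2) * bil (cnjv w) v)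
      * gauss lam (lam *\<^sub>R re_vec (cnjv w + v), - (lam *\<^sub>R im_vec (cnjv w - v)))
          (lam *\<^sub>R im_vec (cnjv w + v), lam *\<^sub>R re_vec (cnjv w - v)) p)"
proof
  fix p :: "(real^'n) \<times> (real^'n)"
  obtain a b where p: "p = (a, b)" by (cases p)
  have 1: "bil (cnjv w + v) (cvec a) + \<i> * bil (cnjv w - v) (cvec b) =
     complex_of_real (re_vec (cnjv w + v) \<bullet> a - im_vec (cnjv w - v) \<bullet> b)
     + \<i> * complex_of_real (im_vec (cnjv w + v) \<bullet> a + re_vec (cnjv w - v) \<bullet> b)"
    unfolding bil_cvec by (simp add: algebra_simps)
  have 2: "gauss lam (lam *\<^sub>R re_vec (cnjv w + v), - (lam *\<^sub>R im_vec (cnjv w - v)))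
          (lam *\<^sub>R im_vec (cnjv w + v), lam *\<^sub>R re_vec (cnjv w - v)) p
     = exp (complex_of_real lam * (- (bil (cvec a) (cvec a) + bil (cvec b) (cvec b)) +
         (bil (cnjv w + v) (cvec a) + \<i> * bil (cnjv w - v) (cvec b))))"
    unfolding 1 by (simp add: p gauss_def bil_cvec_cvec[symmetric] algebra_simps)
  show "wigner lam (cohvec lam w) (cohvec lam v) p = 2 ^ CARD('n) * exp (- complex_of_real (lam / 2) * bil (cnjv w) v)
      * gauss lam (lam *\<^sub>R re_vec (cnjv w + v), - (lam *\<^sub>R im_vec (cnjv w - v)))
          (lam *\<^sub>R im_vec (cnjv w + v), lam *\<^sub>R re_vec (cnjv w - v)) p"
    unfolding 2 wigner_cohvec cnjv_simps cplx_eq_cvec(2) unfolding cplx_eq_cvec(1)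
    by (simp add: p mult.assoc bil_simps bil_scale bil_commute[of _ v] bil_commute[of "cvec b" "cvec a"]
       algebra_simps add_divide_distrib diff_divide_distrib flip: exp_add)
qed

lemma sqint_wigner_cohvec: "wigner lam (cohvec lam w) (cohvec lam v) \<in> sqint lborel"
  unfolding wigner_cohvec_gauss using lam by (intro sqint_scale sqint_gauss)

lemma cinner_wigner_cohvec:
  fixes w v w' v' :: "complex^'n"
  shows "cinner (abs_L2 (wigner lam (cohvec lam w) (cohvec lam v))) (abs_L2 (wigner lam (cohvec lam w') (cohvec lam v')))
    = complex_of_real (vol lam CARD('n)) * cinner (cohvec lam v') (cohvec lam v) * cinner (cohvec lam w) (cohvec lam w')"
proof -
  \<comment> \<open>X and Y are the complex linear coefficients, in the position and the momentum
    variable, of the product of the first function with the conjugate of the second. The Gaussian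
    integral depends on them through \<open>bil X X + bil Y Y\<close>.\<close>
  define X where "X = lam *\<^sub>R ((cnjv w + v) + cnjv (cnjv w' + v'))"
  define Y where "Y = lam *\<^sub>R (\<i> *s ((cnjv w - v) - cnjv (cnjv w' - v')))"
  have r: "(lam *\<^sub>R re_vec (cnjv w + v), - (lam *\<^sub>R im_vec (cnjv w - v)))
      + (lam *\<^sub>R re_vec (cnjv w' + v'), - (lam *\<^sub>R im_vec (cnjv w' - v'))) = (re_vec X, re_vec Y)"
    and i: "(lam *\<^sub>R im_vec (cnjv w + v), lam *\<^sub>R re_vec (cnjv w - v))
      - (lam *\<^sub>R im_vec (cnjv w' + v'), lam *\<^sub>R re_vec (cnjv w' - v')) = (im_vec X, im_vec Y)"
    by (simp_all add: X_def Y_def vec_eq_iff algebra_simps)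
  have e: "complex_of_real (((re_vec X, re_vec Y) \<bullet> (re_vec X, re_vec Y) - (im_vec X, im_vec Y) \<bullet> (im_vec X, im_vec Y)) / (8 * lam))
     + \<i> * complex_of_real ((re_vec X, re_vec Y) \<bullet> (im_vec X, im_vec Y) / (4 * lam))
     = (bil X X + bil Y Y) / complex_of_real (8 * lam)"
    unfolding bil_self using lam by (simp add: field_simps)
  have XY: "(bil X X + bil Y Y) / complex_of_real (8 * lam)
     = complex_of_real (lam / 2) * bil (v + w') (cnjv w + cnjv v')"
    unfolding X_def Y_def using lam
    by (simp add: bil_scale bil_simps bil_commute[of v "cnjv w"] bil_commute[of w' "cnjv w"]
        bil_commute[of "cnjv v'" "cnjv w"] bil_commute[of w' v] bil_commute[of "cnjv v'" v]
        bil_commute[of "cnjv v'" w'] field_simps)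
  have gi: "cinner (abs_L2 (gauss lam (lam *\<^sub>R re_vec (cnjv w + v), - (lam *\<^sub>R im_vec (cnjv w - v)))
          (lam *\<^sub>R im_vec (cnjv w + v), lam *\<^sub>R re_vec (cnjv w - v))))
      (abs_L2 (gauss lam (lam *\<^sub>R re_vec (cnjv w' + v'), - (lam *\<^sub>R im_vec (cnjv w' - v')))
          (lam *\<^sub>R im_vec (cnjv w' + v'), lam *\<^sub>R re_vec (cnjv w' - v'))))
     = complex_of_real (sqrt (pi / (2 * lam)) ^ DIM((real^'n) \<times> (real^'n)))
       * exp (complex_of_real (lam / 2) * bil (v + w') (cnjv w + cnjv v'))"
    unfolding cinner_gauss[OF lam] r i e XY ..
  \<comment> \<open>Each Wigner function brings a factor 2^n, and the Gaussian integral in dimension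
    2n brings (pi/(2 lam))^n.\<close>
  have c: "2 ^ CARD('n) * 2 ^ CARD('n) * sqrt (pi / (2 * lam)) ^ DIM((real^'n) \<times> (real^'n)) = vol lam CARD('n)"
  proof -
    have "DIM((real^'n) \<times> (real^'n)) = 2 * CARD('n)" by simp
    then have "sqrt (pi / (2 * lam)) ^ DIM((real^'n) \<times> (real^'n)) = (pi / (2 * lam)) ^ CARD('n)"
      using lam by (simp only: power_mult) simp
    then show ?thesis by (simp flip: power_mult_distrib)
  qed
  have "cinner (abs_L2 (wigner lam (cohvec lam w) (cohvec lam v))) (abs_L2 (wigner lam (cohvec lam w') (cohvec lam v')))
     = complex_of_real (2 ^ CARD('n) * 2 ^ CARD('n) * sqrt (pi / (2 * lam)) ^ DIM((real^'n) \<times> (real^'n)))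
       * (exp (- complex_of_real (lam / 2) * bil (cnjv w) v) * cnj (exp (- complex_of_real (lam / 2) * bil (cnjv w') v'))
        * exp (complex_of_real (lam / 2) * bil (v + w') (cnjv w + cnjv v')))"
    unfolding wigner_cohvec_gauss abs_L2_scaleC[OF sqint_gauss[OF lam]] cinner_scaleC_left cinner_scaleC_right gi
    by (simp add: mult_ac)
  also have "exp (- complex_of_real (lam / 2) * bil (cnjv w) v) * cnj (exp (- complex_of_real (lam / 2) * bil (cnjv w') v'))
        * exp (complex_of_real (lam / 2) * bil (v + w') (cnjv w + cnjv v'))
     = cinner (cohvec lam v') (cohvec lam v) * cinner (cohvec lam w) (cohvec lam w')"
    unfolding cinner_cohvec[OF lam]
    by (simp add: exp_cnj cnj_bil bil_simps bil_commute[of v] bil_commute[of w'] algebra_simps add_divide_distrib flip: exp_add)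
  finally show ?thesis unfolding c by (simp add: mult.assoc)
qed

lemma total_wigner_cohvec:
  "total_family UNIV (\<lambda>(w, v). abs_L2 (wigner lam (cohvec lam (w::complex^'n)) (cohvec lam v)))"
  unfolding total_family_def
proof (intro allI impI)
  fix F :: "((real^'n) \<times> (real^'n)) L2"
  assume z: "\<forall>i\<in>UNIV. cinner F (case i of (w, v) \<Rightarrow> abs_L2 (wigner lam (cohvec lam w) (cohvec lam v))) = 0"
  have "cinner F (abs_L2 (gauss lam P Q)) = 0" for P Q
  proof -
    \<comment> \<open>S and D are the values that \<open>cnjv w + v\<close> and
      \<open>cnjv w - v\<close> must take for the Gaussian with coefficients P and Q. Solving for w
      and v shows that this Gaussian is a multiple of a Wigner function, so
      \<open>total_gauss\<close> applies.\<close>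
    define S where "S = (\<chi> k. Complex (fst P $ k / lam) (fst Q $ k / lam))"
    define D where "D = (\<chi> k. Complex (snd Q $ k / lam) (- snd P $ k / lam))"
    define w where "w = cnjv ((1/2) *\<^sub>R (S + D))"
    define v where "v = (1/2) *\<^sub>R (S - D)"
    have sd: "cnjv w + v = S" "cnjv w - v = D"
      by (simp_all add: w_def v_def vec_eq_iff complex_eq_iff field_simps)
    have PQ: "(lam *\<^sub>R re_vec (cnjv w + v), - (lam *\<^sub>R im_vec (cnjv w - v))) = P"
       "(lam *\<^sub>R im_vec (cnjv w + v), lam *\<^sub>R re_vec (cnjv w - v)) = Q"
      unfolding sd using lam by (simp_all add: S_def D_def prod_eq_iff vec_eq_iff)
    have "cinner F (abs_L2 (wigner lam (cohvec lam w) (cohvec lam v))) = 0" using z[rule_format, of "(w, v)"] by simp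
    then show ?thesis
      unfolding wigner_cohvec_gauss PQ abs_L2_scaleC[OF sqint_gauss[OF lam]] cinner_scaleC_right by simp
  qed
  then show "F = 0"
    using total_familyD[OF total_gauss[where 'a="(real^'n) \<times> (real^'n)", OF lam], of F 0] by (auto simp: split_beta)
qed

text \<open>The orthogonality relation is extended from coherent vectors one argument at a time.\<close>

lemma bounded_linear_abs_wigner:
  assumes s: "\<And>\<phi>. wigner lam \<phi> \<psi> \<in> sqint lborel"
    and i: "\<And>x y. cinner (abs_L2 (wigner lam x \<psi>)) (abs_L2 (wigner lam y \<psi>)) = complex_of_real k * cinner x y"
  shows "abs_L2 (wigner lam (x + y) \<psi>) = abs_L2 (wigner lam x \<psi>) + abs_L2 (wigner lam y \<psi>)"
    "abs_L2 (wigner lam (scaleC c x) \<psi>) = scaleC c (abs_L2 (wigner lam x \<psi>))"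
    "bounded_linear (\<lambda>x. abs_L2 (wigner lam x \<psi>))"
proof -
  show a: "abs_L2 (wigner lam (x + y) \<psi>) = abs_L2 (wigner lam x \<psi>) + abs_L2 (wigner lam y \<psi>)" for x y
    by (subst abs_L2_add[OF s s, symmetric]) (simp add: wigner_simps[abs_def])
  show c: "abs_L2 (wigner lam (scaleC c x) \<psi>) = scaleC c (abs_L2 (wigner lam x \<psi>))" for c x
    by (subst abs_L2_scaleC[OF s, symmetric]) (simp add: wigner_simps[abs_def])
  have "(norm (abs_L2 (wigner lam x \<psi>)))\<^sup>2 = k * (norm x)\<^sup>2" for x
  proof -
    have "complex_of_real ((norm (abs_L2 (wigner lam x \<psi>)))\<^sup>2) = complex_of_real (k * (norm x)\<^sup>2)"
      unfolding cinner_self[symmetric] i by (simp add: cinner_self)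
    then show ?thesis using of_real_eq_iff by blast
  qed
  then have "norm (abs_L2 (wigner lam x \<psi>)) = sqrt (k * (norm x)\<^sup>2)" for x
    by (metis norm_ge_zero real_sqrt_unique)
  then have "norm (abs_L2 (wigner lam x \<psi>)) = norm x * sqrt k" for x
    by (simp add: real_sqrt_mult mult.commute)
  then show "bounded_linear (\<lambda>x. abs_L2 (wigner lam x \<psi>))"
    by (intro bounded_linear_intro[of _ "sqrt k"]) (simp_all add: a c scaleR_scaleC)
qed

text \<open>With \<psi> and \<psi>' fixed, the left side is continuous and linear in x; once x is
  general, conjugation makes the same argument available for y.\<close>

lemma wigner_extend:
  fixes \<psi> \<psi>' :: "(real^'n) L2"
  assumes s: "\<And>\<phi>. wigner lam \<phi> \<psi> \<in> sqint lborel" "\<And>\<phi>. wigner lam \<phi> \<psi>' \<in> sqint lborel"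
    and i: "\<And>x y. cinner (abs_L2 (wigner lam x \<psi>)) (abs_L2 (wigner lam y \<psi>)) = complex_of_real k * cinner x y"
      "\<And>x y. cinner (abs_L2 (wigner lam x \<psi>')) (abs_L2 (wigner lam y \<psi>')) = complex_of_real k' * cinner x y"
    and b: "\<And>w w'. cinner (abs_L2 (wigner lam (cohvec lam w) \<psi>)) (abs_L2 (wigner lam (cohvec lam w') \<psi>'))
      = c * cinner (cohvec lam w) (cohvec lam w')"
  shows "cinner (abs_L2 (wigner lam x \<psi>)) (abs_L2 (wigner lam y \<psi>')) = c * cinner x y"
proof -
  note w = bounded_linear_abs_wigner[OF s(1) i(1)] and w' = bounded_linear_abs_wigner[OF s(2) i(2)]
  have 1: "cinner (abs_L2 (wigner lam x \<psi>)) (abs_L2 (wigner lam (cohvec lam w') \<psi>')) = c * cinner x (cohvec lam w')" for x w'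
  proof (rule total_linear_eq[OF total_cohvec[OF lam], of "\<lambda>x. cinner (abs_L2 (wigner lam x \<psi>)) (abs_L2 (wigner lam (cohvec lam w') \<psi>'))"])
    show "bounded_linear (\<lambda>x. cinner (abs_L2 (wigner lam x \<psi>)) (abs_L2 (wigner lam (cohvec lam w') \<psi>')))"
      by (rule bounded_linear_compose[OF bounded_linear_cinner_left w(3)])
    show "bounded_linear (\<lambda>x. c * cinner x (cohvec lam w'))"
      by (rule bounded_linear_compose[OF bounded_linear_mult_right bounded_linear_cinner_left])
  qed (simp_all add: w(2) cinner_scaleC_left b)
  have "cnj (cinner (abs_L2 (wigner lam x \<psi>)) (abs_L2 (wigner lam y \<psi>'))) = cnj (c * cinner x y)"
  proof -
    have "cinner (abs_L2 (wigner lam y \<psi>')) (abs_L2 (wigner lam x \<psi>)) = cnj c * cinner y x"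
    proof (rule total_linear_eq[OF total_cohvec[OF lam], of "\<lambda>y. cinner (abs_L2 (wigner lam y \<psi>')) (abs_L2 (wigner lam x \<psi>))"])
      show "bounded_linear (\<lambda>y. cinner (abs_L2 (wigner lam y \<psi>')) (abs_L2 (wigner lam x \<psi>)))"
        by (rule bounded_linear_compose[OF bounded_linear_cinner_left w'(3)])
      show "bounded_linear (\<lambda>y. cnj c * cinner y x)"
        by (rule bounded_linear_compose[OF bounded_linear_mult_right bounded_linear_cinner_left])
      show "cinner (abs_L2 (wigner lam (cohvec lam w) \<psi>')) (abs_L2 (wigner lam x \<psi>)) = cnj c * cinner (cohvec lam w) x" for w
        by (metis 1 cinner_commute complex_cnj_mult)
    qed (simp_all add: w'(2) cinner_scaleC_left)
    then show ?thesis by (metis cinner_commute complex_cnj_mult)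
  qed
  then show ?thesis by (simp only: complex_cnj_cancel_iff)
qed

lemma vol_pos: "vol lam n > 0"
  using lam by simp

text \<open>Square integrability has to precede every inner product, which dictates the order: a
  general first argument against a coherent second one, then the exchange of arguments, then two
  general arguments.\<close>

lemma
  fixes \<phi> \<psi> \<phi>' \<psi>' :: "(real^'n) L2"
  shows sqint_wigner: "wigner lam \<phi> \<psi> \<in> sqint lborel"
    and cinner_wigner: "cinner (abs_L2 (wigner lam \<phi> \<psi>)) (abs_L2 (wigner lam \<phi>' \<psi>'))
      = complex_of_real (vol lam CARD('n)) * cinner \<psi>' \<psi> * cinner \<phi> \<phi>'"
proof -
  note lim = bounded_linear.tendsto[OF bounded_linear_wigner]
  have A: "wigner lam \<phi> (cohvec lam v) \<in> sqint lborel \<and>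
     cinner (abs_L2 (wigner lam \<phi> (cohvec lam v))) (abs_L2 (wigner lam \<phi>' (cohvec lam v)))
       = complex_of_real (vol lam CARD('n) * (norm (cohvec lam v))\<^sup>2) * cinner \<phi> \<phi>'" for v :: "complex^'n" and \<phi> \<phi>' :: "(real^'n) L2"
  proof -
    have "(norm (cohvec lam v))\<^sup>2 \<noteq> 0"
    proof
      assume "(norm (cohvec lam v))\<^sup>2 = 0"
      then have "cinner (cohvec lam v) (cohvec lam v) = 0" by (simp add: cinner_self)
      then show False by (simp add: cinner_cohvec[OF lam])
    qed
    then have K: "vol lam CARD('n) * (norm (cohvec lam v))\<^sup>2 > 0" using vol_pos by simp
    show ?thesis
      by (rule conjI; rule pointwise_isometry[OF total_cohvec[OF lam] K, of "\<lambda>\<phi>. wigner lam \<phi> (cohvec lam v)"])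
        (auto simp: wigner_simps lim sqint_wigner_cohvec cinner_wigner_cohvec cinner_self mult_ac)
  qed
  have B: "cinner (abs_L2 (wigner lam \<phi> (cohvec lam v))) (abs_L2 (wigner lam \<phi>' (cohvec lam v')))
      = (complex_of_real (vol lam CARD('n)) * cinner (cohvec lam v') (cohvec lam v)) * cinner \<phi> \<phi>'" for v v' :: "complex^'n" and \<phi> \<phi>' :: "(real^'n) L2"
    by (rule wigner_extend[OF A[THEN conjunct1] A[THEN conjunct1] A[THEN conjunct2] A[THEN conjunct2]])
      (rule cinner_wigner_cohvec)
  \<comment> \<open>Conjugation exchanges the arguments, so what is known for a coherent second
    argument transfers to a coherent first one.\<close>
  have cw: "wigner lam (cohvec lam v) \<phi> = (\<lambda>p. cnj (wigner lam \<phi> (cohvec lam v) p))" for v :: "complex^'n" and \<phi>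
    by (simp add: cnj_wigner fun_eq_iff)
  have C1: "wigner lam (cohvec lam v) \<phi> \<in> sqint lborel" for v :: "complex^'n" and \<phi>
    unfolding cw using A by (intro sqint_cnj) blast
  have C2: "cinner (abs_L2 (wigner lam (cohvec lam v) \<phi>)) (abs_L2 (wigner lam (cohvec lam v') \<phi>'))
     = (complex_of_real (vol lam CARD('n)) * cinner \<phi>' \<phi>) * cinner (cohvec lam v) (cohvec lam v')" for v v' :: "complex^'n" and \<phi> \<phi>' :: "(real^'n) L2"
    unfolding cw cinner_abs_L2_cnj[OF A[THEN conjunct1] A[THEN conjunct1]] B
    by (simp add: cinner_commute[of \<phi>' \<phi>] cinner_commute[of "cohvec lam v" "cohvec lam v'"])
  \<comment> \<open>For \<psi> = 0 the factor is zero, while \<open>pointwise_isometry\<close> asks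
    for a positive one; hence the case distinction.\<close>
  have D: "wigner lam \<phi> \<psi> \<in> sqint lborel \<and>
     cinner (abs_L2 (wigner lam \<phi> \<psi>)) (abs_L2 (wigner lam \<phi>' \<psi>))
       = complex_of_real (vol lam CARD('n) * (norm \<psi>)\<^sup>2) * cinner \<phi> \<phi>'" for \<phi> \<phi>' \<psi> :: "(real^'n) L2"
  proof (cases "\<psi> = 0")
    case True
    have "wigner lam \<phi> 0 = (\<lambda>p. 0)" for \<phi> :: "(real^'n) L2" by (simp add: wigner_def fun_eq_iff)
    then show ?thesis using True by (simp add: sqint_zero cinner_abs_L2)
  next
    case False
    then have K: "vol lam CARD('n) * (norm \<psi>)\<^sup>2 > 0" using vol_pos by simp
    show ?thesis
      by (rule conjI; rule pointwise_isometry[OF total_cohvec[OF lam] K, of "\<lambda>\<phi>. wigner lam \<phi> \<psi>"])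
        (auto simp: wigner_simps lim C1 C2 cinner_self mult_ac)
  qed
  show "wigner lam \<phi> \<psi> \<in> sqint lborel" using D by blast
  show "cinner (abs_L2 (wigner lam \<phi> \<psi>)) (abs_L2 (wigner lam \<phi>' \<psi>'))
      = complex_of_real (vol lam CARD('n)) * cinner \<psi>' \<psi> * cinner \<phi> \<phi>'"
    by (rule wigner_extend[OF D[THEN conjunct1] D[THEN conjunct1] D[THEN conjunct2] D[THEN conjunct2]]) (rule C2)
qed

end

section \<open>The Weyl correspondence\<close>

context
  fixes lam :: real
  assumes lam: "lam > 0"
begin

text \<open>By the orthogonality relation, this is what a multiple of an isometry must satisfy if it maps
  rank one operators to their Wigner functions.\<close>

definition is_symbol :: "((real^'n) L2 \<Rightarrow> (real^'n) L2) \<Rightarrow> ((real^'n) \<times> (real^'n)) L2 \<Rightarrow> bool" where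
  "is_symbol A F \<longleftrightarrow> (\<forall>\<phi> \<psi>. cinner F (abs_L2 (wigner lam \<psi> \<phi>)) = complex_of_real (vol lam CARD('n)) * cinner (A \<phi>) \<psi>)"

lemma abs_L2_wigner_simps:
  fixes x y \<psi> :: "(real^'n) L2"
  shows "abs_L2 (wigner lam (x + y) \<psi>) = abs_L2 (wigner lam x \<psi>) + abs_L2 (wigner lam y \<psi>)"
    "abs_L2 (wigner lam \<psi> (x + y)) = abs_L2 (wigner lam \<psi> x) + abs_L2 (wigner lam \<psi> y)"
    "abs_L2 (wigner lam (scaleC c x) \<psi>) = scaleC c (abs_L2 (wigner lam x \<psi>))"
    "abs_L2 (wigner lam \<psi> (scaleC c x)) = scaleC (cnj c) (abs_L2 (wigner lam \<psi> x))"
  by (simp_all add: abs_L2_add[symmetric] abs_L2_scaleC[symmetric] sqint_wigner[OF lam] wigner_simps[abs_def])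

lemma norm_abs_L2_wigner:
  fixes \<phi> \<psi> :: "(real^'n) L2"
  shows "norm (abs_L2 (wigner lam \<phi> \<psi>)) = sqrt (vol lam CARD('n)) * (norm \<phi> * norm \<psi>)"
proof -
  have "complex_of_real ((norm (abs_L2 (wigner lam \<phi> \<psi>)))\<^sup>2) = complex_of_real (vol lam CARD('n) * (norm \<psi>)\<^sup>2 * (norm \<phi>)\<^sup>2)"
    unfolding cinner_self[symmetric] cinner_wigner[OF lam] by (simp add: cinner_self)
  then have "(norm (abs_L2 (wigner lam \<phi> \<psi>)))\<^sup>2 = vol lam CARD('n) * (norm \<psi>)\<^sup>2 * (norm \<phi>)\<^sup>2"
    using of_real_eq_iff by blast
  then have "norm (abs_L2 (wigner lam \<phi> \<psi>)) = sqrt (vol lam CARD('n) * (norm \<psi>)\<^sup>2 * (norm \<phi>)\<^sup>2)"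
    by (metis norm_ge_zero real_sqrt_unique)
  then show ?thesis by (simp add: real_sqrt_mult mult_ac)
qed

text \<open>A determines F because Wigner functions are total, and F determines A because the
  constant is nonzero.\<close>

lemma is_symbol_unique:
  fixes A B :: "(real^'n) L2 \<Rightarrow> (real^'n) L2"
  shows "is_symbol A F \<Longrightarrow> is_symbol A G \<Longrightarrow> F = G" "is_symbol A F \<Longrightarrow> is_symbol B F \<Longrightarrow> A = B"
proof -
  show "F = G" if "is_symbol A F" "is_symbol A G"
    by (rule total_familyD[OF total_wigner_cohvec[OF lam]]) (use that in \<open>auto simp: is_symbol_def\<close>)
  have "vol lam CARD('n) \<noteq> 0" using lam by simp
  then show "A = B" if "is_symbol A F" "is_symbol B F"
    using that unfolding is_symbol_def by (intro ext cinner_eqI) (metis mult_cancel_left of_real_eq_0_iff)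
qed

lemma is_symbol_lincomb:
  "is_symbol A F \<Longrightarrow> is_symbol B G \<Longrightarrow> is_symbol (\<lambda>\<phi>. scaleC a (A \<phi>) + scaleC b (B \<phi>)) (scaleC a F + scaleC b G)"
  by (simp add: is_symbol_def cinner_add_left cinner_scaleC_left algebra_simps)

lemma is_symbol_diff: "is_symbol A F \<Longrightarrow> is_symbol B G \<Longrightarrow> is_symbol (\<lambda>\<phi>. A \<phi> - B \<phi>) (F - G)"
  by (simp add: is_symbol_def cinner_diff_left algebra_simps)

lemma is_symbol_cadjoint:
  fixes A :: "(real^'n) L2 \<Rightarrow> (real^'n) L2"
  assumes A: "bounded_clinear A" and f: "f \<in> sqint lborel" "is_symbol A (abs_L2 f)"
  shows "is_symbol (cadjoint A) (abs_L2 (\<lambda>p. cnj (f p)))"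
  unfolding is_symbol_def
proof (intro allI)
  fix \<phi> \<psi> :: "(real^'n) L2"
  have "wigner lam \<psi> \<phi> = (\<lambda>p. cnj (wigner lam \<phi> \<psi> p))" by (simp add: cnj_wigner fun_eq_iff)
  then have "cinner (abs_L2 (\<lambda>p. cnj (f p))) (abs_L2 (wigner lam \<psi> \<phi>)) = cnj (cinner (abs_L2 f) (abs_L2 (wigner lam \<phi> \<psi>)))"
    using cinner_abs_L2_cnj[OF f(1) sqint_wigner[OF lam]] by simp
  also have "\<dots> = complex_of_real (vol lam CARD('n)) * cnj (cinner (A \<psi>) \<phi>)"
    using f(2) by (simp add: is_symbol_def)
  also have "cnj (cinner (A \<psi>) \<phi>) = cinner (cadjoint A \<phi>) \<psi>"
    by (metis cadjoint[OF A] cinner_commute)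
  finally show "cinner (abs_L2 (\<lambda>p. cnj (f p))) (abs_L2 (wigner lam \<psi> \<phi>)) = complex_of_real (vol lam CARD('n)) * cinner (cadjoint A \<phi>) \<psi>" .
qed

text \<open>The matrix coefficients that F prescribes are sesquilinear, and bounded because the norm
  of a Wigner function is a multiple of the product of the norms of its arguments.\<close>

lemma ex_operator_of_symbol:
  fixes F :: "((real^'n) \<times> (real^'n)) L2"
  obtains A where "bounded_clinear A" "is_symbol A F"
proof -
  let ?K = "vol lam CARD('n)"
  have K: "?K > 0" by (rule vol_pos[OF lam])
  define s where "s \<phi> \<psi> = cinner F (abs_L2 (wigner lam \<psi> \<phi>)) / complex_of_real ?K" for \<phi> \<psi> :: "(real^'n) L2"
  obtain A where A: "\<And>x y. s x y = cinner (A x) y" "\<And>x y. A (x + y) = A x + A y"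
    "\<And>c x. A (scaleC c x) = scaleC c (A x)" "bounded_linear A"
  proof (rule ex_sesquilinear_operator[of s "norm F * sqrt ?K / ?K"])
    show "cmod (s x y) \<le> norm F * sqrt ?K / ?K * norm x * norm y" for x y
    proof -
      have "cmod (s x y) \<le> norm F * norm (abs_L2 (wigner lam y x)) / ?K"
        unfolding s_def norm_divide norm_of_real abs_of_pos[OF K]
        by (intro divide_right_mono cinner_cauchy_schwarz less_imp_le[OF K])
      then show ?thesis by (simp add: norm_abs_L2_wigner mult_ac)
    qed
    show "0 \<le> norm F * sqrt ?K / ?K" using K by simp
  qed (auto simp: s_def abs_L2_wigner_simps cinner_add_right cinner_scaleC_right add_divide_distrib)
  have "is_symbol A F"
    unfolding is_symbol_def using lam by (simp add: A(1)[symmetric] s_def)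
  moreover have "bounded_clinear A" using A by (simp add: bounded_clinear_def)
  ultimately show ?thesis using that by blast
qed

text \<open>The pair (f, e) stands for the rank one operator taking f to e, so that the coefficients
  of a symbol are the matrix entries of its operator, up to normalization.\<close>

definition wigner_basis :: "(real^'n) L2 \<times> (real^'n) L2 \<Rightarrow> ((real^'n) \<times> (real^'n)) L2" where
  "wigner_basis = (\<lambda>(f, e). scaleC (complex_of_real (1 / sqrt (vol lam CARD('n)))) (abs_L2 (wigner lam e f)))"

lemma cinner_wigner_basis:
  fixes F :: "((real^'n) \<times> (real^'n)) L2"
  assumes "is_symbol A F"
  shows "cinner F (wigner_basis (f, e)) = complex_of_real (sqrt (vol lam CARD('n))) * cinner (A f) e"
proof -
  have K: "vol lam CARD('n) > 0" by (rule vol_pos[OF lam])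
  have "cinner F (wigner_basis (f, e)) = complex_of_real (1 / sqrt (vol lam CARD('n)) * vol lam CARD('n)) * cinner (A f) e"
    using assms by (simp add: wigner_basis_def cinner_scaleC_right is_symbol_def)
  also have "1 / sqrt (vol lam CARD('n)) * vol lam CARD('n) = sqrt (vol lam CARD('n))"
    using K by (simp add: real_div_sqrt)
  finally show ?thesis .
qed

lemma orthonormal_wigner_basis:
  assumes E: "is_onb (E :: (real^'n) L2 set)"
  shows "orthonormal_on (E \<times> E) wigner_basis"
proof -
  define r where "r = 1 / sqrt (vol lam CARD('n))"
  have r: "r * r * vol lam CARD('n) = 1"
  proof -
    have "1 / sqrt k * (1 / sqrt k) * k = 1" if "k > 0" for k :: real using that by (simp add: field_simps)
    then show ?thesis unfolding r_def using vol_pos[OF lam] by blast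
  qed
  have "cinner (wigner_basis (f, e)) (wigner_basis (f', e')) = cinner f' f * cinner e e'" for e e' f f' :: "(real^'n) L2"
  proof -
    have "cinner (wigner_basis (f, e)) (wigner_basis (f', e')) =
      complex_of_real (r * r * vol lam CARD('n)) * (cinner f' f * cinner e e')"
      unfolding wigner_basis_def r_def[symmetric]
      by (simp add: cinner_scaleC_left cinner_scaleC_right cinner_wigner[OF lam] mult_ac)
    then show ?thesis unfolding r by simp
  qed
  then show ?thesis using E unfolding orthonormal_on_def is_onb_def by auto
qed

text \<open>A class orthogonal to the whole family is the symbol of an operator with vanishing
  matrix entries, hence of zero.\<close>

lemma total_wigner_basis:
  assumes E: "is_onb (E :: (real^'n) L2 set)"
  shows "total_family (E \<times> E) wigner_basis"
  unfolding total_family_def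
proof (intro allI impI)
  fix F :: "((real^'n) \<times> (real^'n)) L2"
  assume z: "\<forall>i\<in>E \<times> E. cinner F (wigner_basis i) = 0"
  obtain A where A: "bounded_clinear A" "is_symbol A F" by (rule ex_operator_of_symbol)
  have K: "sqrt (vol lam CARD('n)) \<noteq> 0" using lam by simp
  have "A f = 0" if f: "f \<in> E" for f
  proof (rule total_familyD[OF onb_total[OF E]])
    fix e assume "e \<in> E"
    then have "cinner F (wigner_basis (f, e)) = 0" using z f by blast
    then show "cinner (A f) e = cinner 0 e" using K unfolding cinner_wigner_basis[OF A(2)] by simp
  qed
  then have "A = (\<lambda>x. 0)"
    by (intro bounded_clinear_eqI[OF onb_total[OF E] A(1)]) (auto simp: bounded_clinear_def bounded_linear_zero)
  moreover have "is_symbol (\<lambda>x. 0) (0 :: ((real^'n) \<times> (real^'n)) L2)" by (simp add: is_symbol_def)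
  ultimately show "F = 0" using is_symbol_unique(1) A(2) by blast
qed

text \<open>Parseval in the basis of Wigner functions gives a double sum over matrix entries;
  summing over e first collapses it by Parseval in E.\<close>

lemma is_symbol_has_sum:
  fixes A B :: "(real^'n) L2 \<Rightarrow> (real^'n) L2"
  assumes "is_symbol A F" "is_symbol B G" and E: "is_onb E"
  shows "((\<lambda>f. cinner (A f) (B f)) has_sum (cinner F G / complex_of_real (vol lam CARD('n)))) E"
proof (rule has_sum_SigmaD)
  have K: "vol lam CARD('n) > 0" by (rule vol_pos[OF lam])
  have "((\<lambda>i. cinner F (wigner_basis i) * cnj (cinner G (wigner_basis i))) has_sum cinner F G) (E \<times> E)"
    by (rule parseval[OF orthonormal_wigner_basis[OF E] total_wigner_basis[OF E]])
  then have "((\<lambda>i. cinner F (wigner_basis i) * cnj (cinner G (wigner_basis i)) / complex_of_real (vol lam CARD('n)))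
      has_sum cinner F G / complex_of_real (vol lam CARD('n))) (E \<times> E)"
    using has_sum_cmult_left[of _ _ _ "1 / complex_of_real (vol lam CARD('n))"] by fastforce
  moreover have "cinner F (wigner_basis (f, e)) * cnj (cinner G (wigner_basis (f, e))) / complex_of_real (vol lam CARD('n))
      = cinner (A f) e * cnj (cinner (B f) e)" for f e
  proof -
    have "complex_of_real (sqrt (vol lam CARD('n))) * complex_of_real (sqrt (vol lam CARD('n))) = complex_of_real (vol lam CARD('n))"
      using K by (simp only: of_real_mult[symmetric] real_sqrt_mult_self) simp
    moreover have "complex_of_real (vol lam CARD('n)) \<noteq> 0" using lam by simp
    ultimately show ?thesis
      unfolding cinner_wigner_basis[OF assms(1)] cinner_wigner_basis[OF assms(2)]
      by (simp add: field_simps)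
  qed
  ultimately show "((\<lambda>(f, e). cinner (A f) e * cnj (cinner (B f) e)) has_sum (cinner F G / complex_of_real (vol lam CARD('n)))) (E \<times> E)"
    by (rule_tac has_sum_cong[THEN iffD1]) auto
  show "((\<lambda>e. case (f, e) of (f, e) \<Rightarrow> cinner (A f) e * cnj (cinner (B f) e)) has_sum cinner (A f) (B f)) E" for f
    using parseval[OF onb_orthonormal[OF E] onb_total[OF E], of "A f" "B f"] by simp
qed

lemma is_symbol_norm_has_sum:
  fixes A :: "(real^'n) L2 \<Rightarrow> (real^'n) L2"
  assumes "is_symbol A F" and E: "is_onb E"
  shows "((\<lambda>f. (norm (A f))\<^sup>2) has_sum ((norm F)\<^sup>2 / vol lam CARD('n))) E"
proof -
  have "((\<lambda>f. complex_of_real ((norm (A f))\<^sup>2)) has_sum complex_of_real ((norm F)\<^sup>2 / vol lam CARD('n))) E"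
    using is_symbol_has_sum[OF assms(1) assms(1) E] by (simp add: cinner_self)
  then show ?thesis by (simp only: has_sum_of_real_iff)
qed

lemma is_symbol_hs_norm:
  fixes A :: "(real^'n) L2 \<Rightarrow> (real^'n) L2"
  assumes "is_symbol A F"
  shows "(norm F)\<^sup>2 = vol lam CARD('n) * (hs_norm A)\<^sup>2"
proof -
  define k where "k = vol lam CARD('n)"
  have k: "k > 0" unfolding k_def by (rule vol_pos[OF lam])
  have "hs_norm A = sqrt ((norm F)\<^sup>2 / k)"
    unfolding hs_norm_def k_def using infsumI[OF is_symbol_norm_has_sum[OF assms is_onb_some_onb]] by simp
  then show ?thesis unfolding k_def[symmetric] using k by (simp add: real_sqrt_divide power_divide)
qed

lemma ex_hilbert_schmidt_of_symbol:
  fixes F :: "((real^'n) \<times> (real^'n)) L2"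
  obtains A where "hilbert_schmidt A" "is_symbol A F"
proof -
  obtain A where A: "bounded_clinear A" "is_symbol A F" by (rule ex_operator_of_symbol)
  have "hilbert_schmidt A"
    by (rule hilbert_schmidtI[OF A(1) is_onb_some_onb has_sum_imp_summable[OF is_symbol_norm_has_sum[OF A(2) is_onb_some_onb]]])
  then show ?thesis using that A by blast
qed

text \<open>The symbol is the series with the matrix entries of A as coefficients, which are square
  summable because A is Hilbert-Schmidt. The operator recovered from the series has the same entries
  as A.\<close>

lemma ex_symbol:
  fixes A :: "(real^'n) L2 \<Rightarrow> (real^'n) L2"
  assumes A: "hilbert_schmidt A"
  obtains F where "is_symbol A F"
proof -
  let ?E = "some_onb :: (real^'n) L2 set"
  note E = is_onb_some_onb[where 'h="(real^'n) L2"]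
  have K: "sqrt (vol lam CARD('n)) \<noteq> 0" using lam by simp
  define c where "c = (\<lambda>(f, e). complex_of_real (sqrt (vol lam CARD('n))) * cinner (A f) e)"
  have "(\<lambda>(f, e). (cmod (cinner (A f) e))\<^sup>2) summable_on ?E \<times> ?E"
    using bounded_clinear_matrix_has_sum[OF E hs_norm_has_sum[OF A E]] has_sum_imp_summable by blast
  then have "(\<lambda>i. (sqrt (vol lam CARD('n)))\<^sup>2 * (case i of (f, e) \<Rightarrow> (cmod (cinner (A f) e))\<^sup>2)) summable_on ?E \<times> ?E"
    by (rule summable_on_cmult_right)
  then have c: "(\<lambda>i. (cmod (c i))\<^sup>2) summable_on ?E \<times> ?E"
    by (rule summable_on_cong[THEN iffD1, rotated]) (auto simp: c_def norm_mult power_mult_distrib)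
  define F where "F = (\<Sum>\<^sub>\<infinity>i\<in>?E \<times> ?E. scaleC (c i) (wigner_basis i))"
  obtain B where B: "bounded_clinear B" "is_symbol B F" by (rule ex_operator_of_symbol)
  have "A f = B f" if f: "f \<in> ?E" for f
  proof (rule total_familyD[OF onb_total[OF E]])
    fix e assume "e \<in> ?E"
    then have "cinner F (wigner_basis (f, e)) = c (f, e)"
      unfolding F_def using f by (intro cinner_infsum_orthonormal[OF orthonormal_wigner_basis[OF E] c]) auto
    then show "cinner (A f) e = cinner (B f) e"
      using K unfolding cinner_wigner_basis[OF B(2)] c_def by simp
  qed
  then have "A = B"
    by (intro bounded_clinear_eqI[OF onb_total[OF E] hilbert_schmidt_bounded_clinear[OF A] B(1)])
  then show ?thesis using that B(2) by blast
qed

subsection \<open>Trace class operators\<close>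

text \<open>A factorization of A into B and C expands the trace into a series of Wigner functions.
  It converges absolutely both at every point and in \<open>L2\<close>, and
  \<open>L2_pointwise_limit\<close> identifies the two sums.\<close>

lemma W1_trace_class_symbol:
  fixes A :: "(real^'n) L2 \<Rightarrow> (real^'n) L2"
  assumes "trace_class A"
  shows "W1_trace_class lam A \<in> sqint lborel" "is_symbol A (abs_L2 (W1_trace_class lam A))"
proof -
  let ?E = "some_onb :: (real^'n) L2 set" and ?K = "vol lam CARD('n)"
  note E = is_onb_some_onb[where 'h="(real^'n) L2"]
  obtain B C where BC: "hilbert_schmidt B" "hilbert_schmidt C" "A = B \<circ> C"
    using assms by (auto simp: trace_class_def)
  note bB = hilbert_schmidt_bounded_clinear[OF BC(1)] and bC = hilbert_schmidt_bounded_clinear[OF BC(2)]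
  let ?w = "\<lambda>f p. wigner lam (B f) (cadjoint C f) p" and ?W = "\<lambda>f. abs_L2 (wigner lam (B f) (cadjoint C f))"
  \<comment> \<open>Cyclicity moves B inside, and the adjoint of C goes to the other side of the
    inner product; each term becomes a Wigner function.\<close>
  have pt: "((\<lambda>f. ?w f p) has_sum W1_trace_class lam A p) ?E" for p
  proof -
    have "hilbert_schmidt (C \<circ> Omega1 lam p)"
      by (rule hilbert_schmidt_comp_right[OF BC(2) bounded_clinear_Omega1])
    from trace_hilbert_schmidt_swap[OF BC(1) this E] obtain t where
      "((\<lambda>e. cinner (B ((C \<circ> Omega1 lam p) e)) e) has_sum t) ?E"
      "((\<lambda>e. cinner ((C \<circ> Omega1 lam p) (B e)) e) has_sum t) ?E" by blast
    then show ?thesis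
      by (simp add: W1_trace_class_def trace_def BC(3) infsumI wigner_def cadjoint[OF bC])
  qed
  define g where "g f = norm (B f) * norm (cadjoint C f)" for f
  have gs: "g summable_on ?E"
  proof (rule summable_on_comparison_test)
    show "(\<lambda>f. (norm (B f))\<^sup>2 + (norm (cadjoint C f))\<^sup>2) summable_on ?E"
      by (intro summable_on_add hilbert_schmidt_summable BC hilbert_schmidt_cadjoint E)
    show "g f \<le> (norm (B f))\<^sup>2 + (norm (cadjoint C f))\<^sup>2" for f
    proof -
      have "0 \<le> norm (B f) * norm (cadjoint C f)" by simp
      then show ?thesis
        unfolding g_def using sum_squares_bound[of "norm (B f)" "norm (cadjoint C f)"] by linarith
    qed
  qed (simp add: g_def)
  define S where "S = infsum g ?E"
  have S: "(g has_sum S) ?E" using gs by (simp add: S_def)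
  \<comment> \<open>A sequence of finite sets is chosen for the majorant g alone. It serves the
    series at every point p and the series in \<open>L2\<close> at once, and so feeds
    \<open>L2_pointwise_limit\<close>, which speaks about sequences.\<close>
  have "\<exists>F. finite F \<and> F \<subseteq> ?E \<and> dist (sum g F) S \<le> 1 / real (Suc i)" for i
    by (rule has_sum_finite_approximation[OF S]) simp
  then obtain F where F: "\<And>i. finite (F i)" "\<And>i. F i \<subseteq> ?E" "\<And>i. dist (sum g (F i)) S \<le> 1 / real (Suc i)" by metis
  have tail: "(\<lambda>i. C' * (S - sum g (F i))) \<longlonglongrightarrow> 0" for C'
  proof -
    have "(\<lambda>i. sum g (F i)) \<longlonglongrightarrow> S"
      by (rule tendsto_dist_iff[THEN iffD2])
        (rule tendsto_sandwich[OF _ _ tendsto_const LIMSEQ_Suc[OF lim_1_over_n]], use F(3) in auto)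
    then have "(\<lambda>i. C' * (S - sum g (F i))) \<longlonglongrightarrow> C' * (S - S)" by (intro tendsto_intros)
    then show ?thesis by simp
  qed
  have lim: "(\<lambda>i. sum h (F i)) \<longlonglongrightarrow> H" if h: "(h has_sum H) ?E" "\<And>f. norm (h f) \<le> C' * g f"
    for h :: "(real^'n) L2 \<Rightarrow> 'z::banach" and H C'
  proof -
    have "(\<lambda>i. H - sum h (F i)) \<longlonglongrightarrow> 0"
      by (rule Lim_null_comparison[OF _ tail[of C']])
        (use has_sum_finite_remainder[OF h(1) S h(2) F(1,2)] in auto)
    from tendsto_diff[OF tendsto_const[of H] this] show ?thesis by simp
  qed
  have Ws: "?W summable_on ?E"
  proof (rule abs_summable_summable, rule summable_on_comparison_test)
    show "(\<lambda>f. sqrt ?K * g f) summable_on ?E" using gs by (rule summable_on_cmult_right)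
  qed (use lam in \<open>auto simp: norm_abs_L2_wigner g_def\<close>)
  define G where "G = infsum ?W ?E"
  have G: "(?W has_sum G) ?E" using Ws by (simp add: G_def)
  have s: "(\<lambda>p. \<Sum>f\<in>F' . ?w f p) \<in> sqint lborel \<and> abs_L2 (\<lambda>p. \<Sum>f\<in>F'. ?w f p) = sum ?W F'" if "finite F'" for F'
    using that
  proof induction
    case (insert f F')
    then show ?case by (simp add: sqint_add abs_L2_add sqint_wigner[OF lam])
  qed (simp add: sqint_zero zero_L2_def)
  have L: "W1_trace_class lam A \<in> sqint lborel \<and> abs_L2 (W1_trace_class lam A) = G"
  proof -
    have 1: "(\<lambda>i. \<Sum>f\<in>F i. ?w f p) \<longlonglongrightarrow> W1_trace_class lam A p" for p
      by (rule lim[OF pt]) (unfold g_def, rule cmod_wigner_le)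
    have "(\<lambda>i. sum ?W (F i)) \<longlonglongrightarrow> G"
      by (rule lim[OF G]) (unfold g_def norm_abs_L2_wigner, rule order_refl)
    then have 2: "(\<lambda>i. abs_L2 (\<lambda>p. \<Sum>f\<in>F i. ?w f p)) \<longlonglongrightarrow> G" using s F(1) by simp
    show ?thesis using L2_pointwise_limit[OF _ 2 1] s F(1) by blast
  qed
  then show "W1_trace_class lam A \<in> sqint lborel" by blast
  have "is_symbol A G"
    unfolding is_symbol_def
  proof (intro allI)
    fix \<phi> \<psi> :: "(real^'n) L2"
    have 1: "((\<lambda>f. cinner (?W f) (abs_L2 (wigner lam \<psi> \<phi>))) has_sum cinner G (abs_L2 (wigner lam \<psi> \<phi>))) ?E"
      by (rule has_sum_bounded_linear[OF bounded_linear_cinner_left G])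
    \<comment> \<open>Applying B to the expansion of \<open>C \<phi>\<close> reproduces, term by
      term, the inner products that the orthogonality relation gives.\<close>
    have "((\<lambda>f. scaleC (cinner (C \<phi>) f) f) has_sum C \<phi>) ?E"
      by (rule fourier_expansion[OF onb_orthonormal[OF E] onb_total[OF E]])
    from has_sum_bounded_linear[OF bounded_linear_compose[OF bounded_linear_mult_right[of "complex_of_real ?K"]
        bounded_linear_compose[OF bounded_linear_cinner_left[of \<psi>] bounded_clinear_bounded_linear[OF bB]]] this]
    have "((\<lambda>f. complex_of_real ?K * cinner (B (scaleC (cinner (C \<phi>) f) f)) \<psi>) has_sum complex_of_real ?K * cinner (B (C \<phi>)) \<psi>) ?E" .
    moreover have "complex_of_real ?K * cinner (B (scaleC (cinner (C \<phi>) f) f)) \<psi> = cinner (?W f) (abs_L2 (wigner lam \<psi> \<phi>))" for f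
      by (simp add: bounded_clinear_scaleC[OF bB] cinner_scaleC_left cinner_wigner[OF lam] cadjoint[OF bC] del: of_real_power)
    ultimately show "cinner G (abs_L2 (wigner lam \<psi> \<phi>)) = complex_of_real ?K * cinner (A \<phi>) \<psi>"
      using has_sum_unique[OF 1] by (simp add: BC(3))
  qed
  then show "is_symbol A (abs_L2 (W1_trace_class lam A))" using L by simp
qed

subsection \<open>The map on Hilbert-Schmidt operators\<close>

lemma mu_real_const_pos: "(lam / (2 * pi)) ^ n > 0"
  using lam by simp

lemma sqint_mu_real: "f \<in> sqint (mu_real lam) \<longleftrightarrow> f \<in> sqint lborel"
proof -
  have "integrable (mu_real lam) (\<lambda>p. (cmod (f p))\<^sup>2) \<longleftrightarrow> integrable lborel (\<lambda>p. (cmod (f p))\<^sup>2)" if "f \<in> borel_measurable borel"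
    unfolding mu_real_def using that lam by (subst integrable_density) auto
  moreover have "f \<in> borel_measurable (mu_real lam) \<longleftrightarrow> f \<in> borel_measurable borel"
    by (simp add: mu_real_def)
  ultimately show ?thesis by (auto simp: sqint_def)
qed

lemma AE_mu_real: "(AE p in mu_real lam. P p) \<longleftrightarrow> (AE p in lborel. P (p :: (real^'n) \<times> (real^'n)))"
  unfolding mu_real_def using lam by (subst AE_density) auto

lemma integral_mu_real:
  fixes f :: "(real^'n) \<times> (real^'n) \<Rightarrow> complex"
  assumes "f \<in> borel_measurable borel"
  shows "(\<integral>p. f p \<partial>mu_real lam) = (\<integral>p. f p \<partial>lborel) / complex_of_real (vol lam CARD('n))"
proof -
  have "(\<integral>p. f p \<partial>mu_real lam) = (\<integral>p. (lam / (2 * pi)) ^ CARD('n) *\<^sub>R f p \<partial>lborel)"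
    unfolding mu_real_def using assms less_imp_le[OF mu_real_const_pos] by (subst integral_density) auto
  also have "\<dots> = (lam / (2 * pi)) ^ CARD('n) *\<^sub>R (\<integral>p. f p \<partial>lborel)" by simp
  also have "\<dots> = (\<integral>p. f p \<partial>lborel) / complex_of_real (vol lam CARD('n))"
    using lam by (simp add: scaleR_conv_of_real power_divide field_simps)
  finally show ?thesis .
qed

lemma nn_integral_mu_real_diff:
  fixes f g :: "(real^'n) \<times> (real^'n) \<Rightarrow> complex"
  assumes f: "f \<in> sqint lborel" and g: "g \<in> sqint lborel"
  shows "(\<integral>\<^sup>+p. ennreal ((cmod (f p - g p))\<^sup>2) \<partial>mu_real lam) = ennreal ((norm (abs_L2 f - abs_L2 g))\<^sup>2 / vol lam CARD('n))"
proof -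
  note s = sqint_diff[OF f g]
  have [measurable]: "f \<in> borel_measurable borel" "g \<in> borel_measurable borel" using f g by (simp_all add: sqint_def)
  have "(\<integral>\<^sup>+p. ennreal ((cmod (f p - g p))\<^sup>2) \<partial>mu_real lam)
      = ennreal ((lam / (2 * pi)) ^ CARD('n)) * (\<integral>\<^sup>+p. ennreal ((cmod (f p - g p))\<^sup>2) \<partial>lborel)"
    unfolding mu_real_def by (subst nn_integral_density) (auto simp: nn_integral_cmult)
  also have "(\<integral>\<^sup>+p. ennreal ((cmod (f p - g p))\<^sup>2) \<partial>lborel) = ennreal ((norm (abs_L2 f - abs_L2 g))\<^sup>2)"
    using s norm_sq_abs_L2[OF s] abs_L2_diff[OF f g] by (simp add: sqint_def nn_integral_eq_integral)
  also have "ennreal ((lam / (2 * pi)) ^ CARD('n)) * \<dots> = ennreal ((lam / (2 * pi)) ^ CARD('n) * (norm (abs_L2 f - abs_L2 g))\<^sup>2)"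
    using less_imp_le[OF mu_real_const_pos] by (simp add: ennreal_mult)
  also have "(lam / (2 * pi)) ^ CARD('n) * (norm (abs_L2 f - abs_L2 g))\<^sup>2 = (norm (abs_L2 f - abs_L2 g))\<^sup>2 / vol lam CARD('n)"
    using lam by (simp add: power_divide field_simps)
  finally show ?thesis .
qed

text \<open>A representative of the symbol of A satisfies the property in the choice, since
  differences of symbols are symbols of differences. Conversely, along one approximating sequence
  the property determines the class, so the chosen function represents the same symbol.\<close>

lemma W1_hilbert_schmidt_symbol:
  fixes A :: "(real^'n) L2 \<Rightarrow> (real^'n) L2"
  assumes A: "hilbert_schmidt A"
  shows "W1_hilbert_schmidt lam A \<in> sqint lborel \<and> is_symbol A (abs_L2 (W1_hilbert_schmidt lam A))"
proof -
  have K: "vol lam CARD('n) > 0" by (rule vol_pos[OF lam])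
  define P where "P F \<longleftrightarrow> F \<in> sqint (mu_real lam) \<and>
     (\<forall>X :: nat \<Rightarrow> (real^'n) L2 \<Rightarrow> (real^'n) L2. (\<forall>i. trace_class (X i)) \<longrightarrow>
        (\<lambda>i. hs_norm (\<lambda>\<phi>. X i \<phi> - A \<phi>)) \<longlonglongrightarrow> 0 \<longrightarrow>
        (\<lambda>i. \<integral>\<^sup>+p. ennreal ((cmod (W1_trace_class lam (X i) p - F p))\<^sup>2) \<partial>mu_real lam) \<longlonglongrightarrow> 0)" for F
  obtain F0 where F0: "is_symbol A F0" using ex_symbol[OF A] by blast
  define f0 where "f0 = rep_L2 F0"
  have f0: "f0 \<in> sqint lborel" "abs_L2 f0 = F0" by (simp_all add: f0_def rep_L2_sqint)
  have d: "(norm (abs_L2 (W1_trace_class lam X) - F0))\<^sup>2 / vol lam CARD('n) = (hs_norm (\<lambda>\<phi>. X \<phi> - A \<phi>))\<^sup>2"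
    if "trace_class X" for X
    using is_symbol_hs_norm[OF is_symbol_diff[OF W1_trace_class_symbol(2)[OF that] F0]] lam by simp
  have P0: "P f0"
    unfolding P_def sqint_mu_real
  proof (intro conjI allI impI f0(1))
    fix X :: "nat \<Rightarrow> (real^'n) L2 \<Rightarrow> (real^'n) L2"
    assume X: "\<forall>i. trace_class (X i)" and lim: "(\<lambda>i. hs_norm (\<lambda>\<phi>. X i \<phi> - A \<phi>)) \<longlonglongrightarrow> 0"
    have "(\<lambda>i. ennreal ((hs_norm (\<lambda>\<phi>. X i \<phi> - A \<phi>))\<^sup>2)) \<longlonglongrightarrow> ennreal (0\<^sup>2)"
      by (intro tendsto_intros lim)
    then show "(\<lambda>i. \<integral>\<^sup>+p. ennreal ((cmod (W1_trace_class lam (X i) p - f0 p))\<^sup>2) \<partial>mu_real lam) \<longlonglongrightarrow> 0"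
      using X by (simp add: nn_integral_mu_real_diff W1_trace_class_symbol(1) f0 d)
  qed
  define F where "F = W1_hilbert_schmidt lam A"
  have PF: "P F"
    unfolding F_def W1_hilbert_schmidt_def P_def[symmetric] by (rule someI[of P, OF P0])
  then have Fs: "F \<in> sqint lborel" by (simp add: P_def sqint_mu_real)
  \<comment> \<open>The existence of such a sequence keeps the property from holding
    vacuously.\<close>
  obtain X where X: "\<And>i. trace_class (X i)" "(\<lambda>i. hs_norm (\<lambda>\<phi>. X i \<phi> - A \<phi>)) \<longlonglongrightarrow> 0"
    using trace_class_approximation[OF A] by blast
  have lim: "(\<lambda>i. abs_L2 (W1_trace_class lam (X i))) \<longlonglongrightarrow> abs_L2 f" if Pf: "P f" and f: "f \<in> sqint lborel" for f
  proof -
    have "(\<lambda>i. ennreal ((norm (abs_L2 (W1_trace_class lam (X i)) - abs_L2 f))\<^sup>2 / vol lam CARD('n))) \<longlonglongrightarrow> 0"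
      using Pf X unfolding P_def by (simp add: nn_integral_mu_real_diff W1_trace_class_symbol(1) f)
    then have "(\<lambda>i. (norm (abs_L2 (W1_trace_class lam (X i)) - abs_L2 f))\<^sup>2 / vol lam CARD('n)) \<longlonglongrightarrow> 0"
      by (rule ennreal_tendsto_0_iff[THEN iffD1, rotated]) (use K in simp)
    from tendsto_mult_right_zero[OF this, of "vol lam CARD('n)"]
    have "(\<lambda>i. (norm (abs_L2 (W1_trace_class lam (X i)) - abs_L2 f))\<^sup>2) \<longlonglongrightarrow> 0" using lam by simp
    then have "(\<lambda>i. sqrt ((norm (abs_L2 (W1_trace_class lam (X i)) - abs_L2 f))\<^sup>2)) \<longlonglongrightarrow> sqrt 0"
      by (rule tendsto_real_sqrt)
    then have "(\<lambda>i. norm (abs_L2 (W1_trace_class lam (X i)) - abs_L2 f)) \<longlonglongrightarrow> 0" by simp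
    then show ?thesis by (simp add: tendsto_norm_zero_iff LIM_zero_iff)
  qed
  have "abs_L2 F = F0"
    using LIMSEQ_unique[OF lim[OF PF Fs] lim[OF P0 f0(1)]] f0(2) by simp
  then show ?thesis using Fs F0 by (simp add: F_def)
qed

lemma
  fixes A :: "(real^'n) L2 \<Rightarrow> (real^'n) L2"
  assumes A: "hilbert_schmidt A"
  shows sqint_W1: "W1 lam A \<in> sqint lborel" and is_symbol_W1: "is_symbol A (abs_L2 (W1 lam A))"
  using W1_hilbert_schmidt_symbol[OF A] W1_trace_class_symbol[of A] A by (auto simp: W1_def)

text \<open>The entry point for the axioms on Hilbert-Schmidt operators: it leaves only the symbol
  of a candidate function to be checked.\<close>

lemma W1_eqI:
  assumes A: "hilbert_schmidt A" and f: "f \<in> sqint lborel" "is_symbol A (abs_L2 f)"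
  shows "AE p in mu_real lam. W1 lam A p = f p"
  unfolding AE_mu_real using abs_L2_eq_iff[OF sqint_W1[OF A] f(1)] is_symbol_unique(1)[OF is_symbol_W1[OF A] f(2)]
  by simp

text \<open>The integrand carries no conjugate, so the first factor is read as the conjugate of the
  symbol of the adjoint of A. The resulting sum over a basis is the trace once the adjoint is moved
  back.\<close>

lemma integral_W1_mult:
  fixes A B :: "(real^'n) L2 \<Rightarrow> (real^'n) L2"
  assumes A: "hilbert_schmidt A" and B: "hilbert_schmidt B"
  shows "(\<integral>p. W1 lam A p * W1 lam B p \<partial>mu_real lam) = trace (A \<circ> B)"
proof -
  note bA = hilbert_schmidt_bounded_clinear[OF A]
  let ?cA = "\<lambda>p. cnj (W1 lam A p)"
  have cA: "?cA \<in> sqint lborel" by (rule sqint_cnj[OF sqint_W1[OF A]])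
  have sy: "is_symbol (cadjoint A) (abs_L2 ?cA)" by (rule is_symbol_cadjoint[OF bA sqint_W1[OF A] is_symbol_W1[OF A]])
  have "(\<lambda>p. W1 lam A p * W1 lam B p) \<in> borel_measurable borel"
    using sqint_measurable[OF sqint_W1[OF A]] sqint_measurable[OF sqint_W1[OF B]] by simp
  then have "(\<integral>p. W1 lam A p * W1 lam B p \<partial>mu_real lam) = (\<integral>p. W1 lam B p * cnj (?cA p) \<partial>lborel) / complex_of_real (vol lam CARD('n))"
    by (simp add: integral_mu_real mult.commute)
  also have "\<dots> = cinner (abs_L2 (W1 lam B)) (abs_L2 ?cA) / complex_of_real (vol lam CARD('n))"
    by (simp add: cinner_abs_L2[OF sqint_W1[OF B] cA])
  also have "\<dots> = trace (A \<circ> B)"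
    using is_symbol_has_sum[OF is_symbol_W1[OF B] sy is_onb_some_onb]
    unfolding trace_def o_def cadjoint[OF bA, symmetric] by (rule infsumI[symmetric])
  finally show ?thesis .
qed

subsection \<open>The identity operator\<close>

text \<open>This selects the branch of \<open>W1\<close> at the identity. If the squared norms of a
  basis had a finite sum S, then Bessel for N orthonormal vectors, summed over the basis, would
  bound every N by S.\<close>

lemma not_hilbert_schmidt_id: "\<not> hilbert_schmidt (id :: (real^'n) L2 \<Rightarrow> _)"
proof
  assume "hilbert_schmidt (id :: (real^'n) L2 \<Rightarrow> _)"
  define E where "E = (some_onb :: (real^'n) L2 set)"
  have E: "is_onb E" unfolding E_def by (rule is_onb_some_onb)
  define S where "S = (hs_norm (id :: (real^'n) L2 \<Rightarrow> _))\<^sup>2"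
  have S: "((\<lambda>e. (norm e)\<^sup>2) has_sum S) E"
    unfolding S_def using hs_norm_has_sum[OF \<open>hilbert_schmidt id\<close> E] by simp
  \<comment> \<open>Disjoint unit cubes along the diagonal; their indicators form an explicit
    infinite orthonormal family.\<close>
  define B where "B j = box (real j *\<^sub>R One) ((real j + 1) *\<^sub>R One :: real^'n)" for j :: nat
  define u where "u j = (indicator (B j) :: real^'n \<Rightarrow> complex)" for j
  have [measurable]: "B j \<in> sets borel" for j by (simp add: B_def)
  have em: "emeasure lborel (B j) = 1" for j
  proof -
    have "((real j + 1) *\<^sub>R One - real j *\<^sub>R One) \<bullet> b = (1::real)" if "b \<in> Basis" for b :: "real^'n"
      using that by (simp add: inner_diff_left algebra_simps)
    moreover have "(real j *\<^sub>R One) \<bullet> b \<le> ((real j + 1) *\<^sub>R One) \<bullet> b" if "b \<in> Basis" for b :: "real^'n"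
      using that by simp
    ultimately show ?thesis unfolding B_def by (subst emeasure_lborel_box) (assumption, simp only: prod.neutral_const cong: prod.cong, simp)
  qed
  have us: "u j \<in> sqint lborel" for j
  proof -
    have "(\<lambda>x. (cmod (u j x))\<^sup>2) = indicator (B j)" by (auto simp: u_def indicator_def)
    moreover have "integrable lborel (indicator (B j) :: real^'n \<Rightarrow> real)"
      using em[of j] by (intro integrable_real_indicator) auto
    moreover have "u j \<in> borel_measurable lborel" unfolding u_def by measurable
    ultimately show ?thesis by (simp add: sqint_def)
  qed
  have disj: "B i \<inter> B j = {}" if "i < j" for i j
  proof -
    obtain b :: "real^'n" where b: "b \<in> Basis" using nonempty_Basis by blast
    have "x \<bullet> b < real i + 1" if "x \<in> B i" for x
      using that b by (auto simp: B_def mem_box inner_sum_left_Basis)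
    moreover have "real j < x \<bullet> b" if "x \<in> B j" for x
      using that b by (auto simp: B_def mem_box inner_sum_left_Basis)
    moreover have "real i + 1 \<le> real j" using \<open>i < j\<close> by simp
    ultimately show ?thesis by fastforce
  qed
  have o: "cinner (abs_L2 (u i)) (abs_L2 (u j)) = (if i = j then 1 else 0)" for i j
  proof (cases "i = j")
    case True
    have "u i x * cnj (u i x) = complex_of_real (indicator (B i) x)" for x by (simp add: u_def indicator_def)
    then have "cinner (abs_L2 (u i)) (abs_L2 (u i)) = complex_of_real (measure lborel (B i))"
      by (simp add: cinner_abs_L2[OF us us])
    then show ?thesis using True em[of i] by (simp add: measure_def)
  next
    case False
    then have "B i \<inter> B j = {}" using disj[of i j] disj[of j i] by (cases "i < j") auto
    then have *: "u i x * cnj (u j x) = 0" for x by (auto simp: u_def indicator_def)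
    show ?thesis unfolding cinner_abs_L2[OF us us] * using False by simp
  qed
  then have ou: "orthonormal_on UNIV (\<lambda>j. abs_L2 (u j))" by (simp add: orthonormal_on_def)
  have bound: "real N \<le> S" for N
  proof (rule has_sum_mono[OF _ S])
    have "((\<lambda>e. \<Sum>j<N. (cmod (cinner (abs_L2 (u j)) e))\<^sup>2) has_sum (\<Sum>j<N. (norm (abs_L2 (u j)))\<^sup>2)) E"
    proof (induction N)
      case (Suc N)
      from has_sum_add[OF Suc parseval_norm[OF onb_orthonormal[OF E] onb_total[OF E]]] show ?case by simp
    qed simp
    moreover have "(norm (abs_L2 (u j)))\<^sup>2 = 1" for j
      using o[of j j] cinner_self[of "abs_L2 (u j)"] by (metis of_real_1 of_real_eq_iff)
    ultimately show "((\<lambda>e. \<Sum>j<N. (cmod (cinner (abs_L2 (u j)) e))\<^sup>2) has_sum real N) E" by simp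
    fix e
    have "(\<Sum>j<N. (cmod (cinner e (abs_L2 (u j))))\<^sup>2) \<le> (norm e)\<^sup>2" by (rule bessel_finite[OF ou]) auto
    then show "(\<Sum>j<N. (cmod (cinner (abs_L2 (u j)) e))\<^sup>2) \<le> (norm e)\<^sup>2"
      by (subst cinner_commute) simp
  qed
  obtain N where "S < real N" using reals_Archimedean2 by blast
  then show False using bound[of N] by simp
qed

text \<open>The kernel of the identity is the reproducing kernel. In the integral formula all terms
  containing z cancel, which leaves a centred Gaussian in w.\<close>

lemma W1_id: "W1 lam id p = 1"
proof -
  obtain z where z: "z = cplx p" by blast
  have nh: "\<not> hilbert_schmidt (id :: (real^'a) L2 \<Rightarrow> _)" by (rule not_hilbert_schmidt_id)
  then have nt: "\<not> trace_class (id :: (real^'a) L2 \<Rightarrow> _)"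
    using trace_class_hilbert_schmidt by blast
  have k: "fock_kernel lam (to_fock lam id) u w = exp (complex_of_real (lam / 2) * bil (cnjv w) u)" for u w :: "complex^'a"
  proof -
    have "coherent lam w \<in> fock lam" using bargmann_in_fock[OF lam] bargmann_cohvec[OF lam] by metis
    then have "to_fock lam id (coherent lam w) = bargmann lam (inv_into UNIV (bargmann lam) (bargmann lam (cohvec lam w)))"
      by (simp add: to_fock_def bargmann_cohvec[OF lam])
    also have "\<dots> = coherent lam w" unfolding inv_f_f[OF inj_bargmann[OF lam]] by (rule bargmann_cohvec[OF lam])
    finally show ?thesis by (simp add: fock_kernel_def fock_inner_coherent[OF lam])
  qed
  have e: "fock_kernel lam (to_fock lam id) (z + w) (z - w) *
        exp (complex_of_real (lam / 2) *
          (- bil z (cnjv z) - bil w (cnjv w) + bil z (cnjv w) - bil (cnjv z) w)) = gauss lam 0 0 w" for w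
  proof -
    have "gauss lam 0 0 w = exp (- complex_of_real lam * bil (cnjv w) w)"
      by (simp add: gauss_def bil_cnjv_self power2_norm_eq_inner)
    then show ?thesis
      unfolding k by (simp add: bil_simps bil_commute[of z "cnjv z"] bil_commute[of w "cnjv w"] bil_commute[of z "cnjv w"]
          algebra_simps add_divide_distrib flip: exp_add)
  qed
  have hb: "has_bochner_integral lborel (gauss lam 0 (0::complex^'a)) (complex_of_real (sqrt (pi / lam) ^ DIM(complex^'a)))"
    using has_bochner_integral_gauss[OF lam, of 0 "0::complex^'a"] by simp
  have "(\<integral>w. gauss lam 0 0 w \<partial>(mu lam :: (complex^'a) measure)) = (lam / (2 * pi)) ^ CARD('a) *\<^sub>R complex_of_real (sqrt (pi / lam) ^ DIM(complex^'a))"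
    unfolding mu_def using hb less_imp_le[OF mu_real_const_pos]
    by (subst integral_density) (auto simp: has_bochner_integral_iff)
  \<comment> \<open>The factor 2^n, the density (lam/(2 pi))^n and the Gaussian integral (pi/lam)^n
    cancel.\<close>
  moreover have "2 ^ CARD('a) * ((lam / (2 * pi)) ^ CARD('a) * sqrt (pi / lam) ^ DIM(complex^'a)) = 1"
  proof -
    have "DIM(complex^'a) = 2 * CARD('a)" by simp
    then have "sqrt (pi / lam) ^ DIM(complex^'a) = (pi / lam) ^ CARD('a)" using lam by (simp only: power_mult) simp
    then show ?thesis using lam by (simp flip: power_mult_distrib)
  qed
  ultimately have "W0 lam (to_fock lam id) z = 1"
    unfolding W0_def e by (simp add: scaleR_conv_of_real flip: of_real_power of_real_mult) (metis of_real_1 of_real_mult of_real_numeral of_real_power)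
  then show ?thesis
    using nt nh by (simp add: W1_def z)
qed

end

section \<open>Covariance\<close>

context
  fixes \<alpha> :: "'n::finite \<Rightarrow> real^'m::finite \<Rightarrow> real" and \<kappa> :: "real^'m \<Rightarrow> complex" and lam :: real
  assumes \<alpha>: "\<And>k. linear (\<alpha> k)" and \<kappa>: "unitary_character \<kappa>" and lam: "lam > 0"
begin

text \<open>For coherent vectors the differences of p to the labels are rotated, which the Hermitian
  form does not see, and the scalar factors cancel by \<open>rep_factor_unitary\<close>. The
  arguments are then made general one at a time, with conjugation exchanging them.\<close>

lemma wigner_covariant:
  "wigner lam (schrodinger_rep \<alpha> \<kappa> lam g \<phi>) (schrodinger_rep \<alpha> \<kappa> lam g \<psi>) (act_real \<alpha> g p) = wigner lam \<phi> \<psi> p"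
proof -
  let ?S = "schrodinger_rep \<alpha> \<kappa> lam g"
  note bl = bounded_clinear_bounded_linear[OF bounded_clinear_schrodinger_rep[OF \<alpha> \<kappa> lam]]
  note sc = bounded_clinear_scaleC[OF bounded_clinear_schrodinger_rep[OF \<alpha> \<kappa> lam]]
  obtain t z0 c0 where g: "g = (t, z0, c0)" by (metis prod_cases3)
  have 0: "wigner lam (?S (cohvec lam w)) (?S (cohvec lam v)) (act_real \<alpha> g p) = wigner lam (cohvec lam w) (cohvec lam v) p" for w v p
  proof -
    have "act_complex \<alpha> g (cplx p) - act_complex \<alpha> g u = rot \<alpha> t (cplx p - u)" for u by (simp add: g)
    then have "bil (cnjv (cplx (act_real \<alpha> g p) - act_complex \<alpha> g w)) (cplx (act_real \<alpha> g p) - act_complex \<alpha> g v)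
      = bil (cnjv (cplx p - w)) (cplx p - v)"
      by (simp only: cplx_act_real[OF \<alpha>] bil_cnjv_rot)
    moreover note rep_factor_unitary[OF \<alpha> \<kappa> lam, where g = g and w = w and v = v]
    ultimately show ?thesis
      unfolding schrodinger_rep_cohvec[OF \<alpha> \<kappa> lam] wigner_simps wigner_cohvec[OF lam] by (simp add: mult_ac)
  qed
  have 1: "wigner lam (?S \<phi>) (?S (cohvec lam v)) (act_real \<alpha> g p) = wigner lam \<phi> (cohvec lam v) p" for \<phi> v p
    by (rule total_linear_eq[OF total_cohvec[OF lam], of "\<lambda>\<phi>. wigner lam (?S \<phi>) (?S (cohvec lam v)) (act_real \<alpha> g p)"])
      (auto simp: 0 sc wigner_simps intro: bounded_linear_wigner bounded_linear_compose[OF bounded_linear_wigner bl])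
  have "wigner lam (?S \<psi>) (?S \<phi>) (act_real \<alpha> g p) = wigner lam \<psi> \<phi> p"
  proof (rule total_linear_eq[OF total_cohvec[OF lam], of "\<lambda>\<psi>. wigner lam (?S \<psi>) (?S \<phi>) (act_real \<alpha> g p)"])
    show "wigner lam (?S (cohvec lam v)) (?S \<phi>) (act_real \<alpha> g p) = wigner lam (cohvec lam v) \<phi> p" for v
      using 1[of \<phi> v p] by (metis cnj_wigner)
  qed (auto simp: sc wigner_simps intro: bounded_linear_wigner bounded_linear_compose[OF bounded_linear_wigner bl])
  then show ?thesis by (metis cnj_wigner)
qed

lemma sqint_act_real:
  fixes f :: "(real^'n) \<times> (real^'n) \<Rightarrow> complex"
  assumes f: "f \<in> sqint lborel"
  shows "(\<lambda>p. f (act_real \<alpha> g p)) \<in> sqint lborel"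
proof -
  have [measurable]: "f \<in> borel_measurable borel" using f by (simp add: sqint_def)
  have m [measurable]: "act_real \<alpha> g \<in> borel_measurable borel" by (rule borel_measurable_act_real[OF \<alpha>])
  have "integrable (distr lborel borel (act_real \<alpha> g)) (\<lambda>p. (cmod (f p))\<^sup>2)"
    using f unfolding distr_lborel_act_real[OF \<alpha>] by (simp add: sqint_def)
  then have "integrable lborel (\<lambda>p. (cmod (f (act_real \<alpha> g p)))\<^sup>2)"
    by (subst (asm) integrable_distr_eq) auto
  moreover have "(\<lambda>p. f (act_real \<alpha> g p)) \<in> borel_measurable lborel" by measurable
  ultimately show ?thesis by (simp add: sqint_def)
qed

text \<open>The measure preserving substitution by g moves the group element from f onto the Wigner
  function. There covariance turns it into the inverse operator on both arguments, and unitarity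
  wraps the representation around A.\<close>

lemma is_symbol_covariant:
  fixes f :: "(real^'n) \<times> (real^'n) \<Rightarrow> complex"
  assumes f: "f \<in> sqint lborel" and A: "is_symbol lam A (abs_L2 f)"
  shows "is_symbol lam (schrodinger_rep \<alpha> \<kappa> lam g \<circ> A \<circ> inv_into UNIV (schrodinger_rep \<alpha> \<kappa> lam g))
    (abs_L2 (\<lambda>p. f (act_real \<alpha> (inv\<^bsub>diamond \<alpha>\<^esub> g) p)))"
  unfolding is_symbol_def[OF lam]
proof (intro allI)
  fix \<phi> \<psi> :: "(real^'n) L2"
  let ?S = "schrodinger_rep \<alpha> \<kappa> lam g" and ?g' = "inv\<^bsub>diamond \<alpha>\<^esub> g"
  let ?S' = "schrodinger_rep \<alpha> \<kappa> lam ?g'"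
  have "?S \<circ> ?S' = id" by (rule schrodinger_rep_inv(1)[OF \<alpha> \<kappa> lam])
  then have SS: "?S (?S' x) = x" for x by (rule pointfree_idE)
  have [measurable]: "f \<in> borel_measurable borel" "wigner lam \<psi> \<phi> \<in> borel_measurable borel"
    using f sqint_wigner[OF lam, of \<psi> \<phi>] by (simp_all add: sqint_def)
  have [measurable]: "act_real \<alpha> h \<in> borel_measurable borel" for h by (rule borel_measurable_act_real[OF \<alpha>])
  have [measurable]: "(\<lambda>p. cnj (wigner lam \<psi> \<phi> p)) \<in> borel_measurable borel"
    using sqint_cnj[OF sqint_wigner[OF lam, of \<psi> \<phi>]] by (simp add: sqint_def)
  have "cinner (abs_L2 (\<lambda>p. f (act_real \<alpha> ?g' p))) (abs_L2 (wigner lam \<psi> \<phi>))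
     = (\<integral>p. f (act_real \<alpha> ?g' p) * cnj (wigner lam \<psi> \<phi> p) \<partial>lborel)"
    by (rule cinner_abs_L2[OF sqint_act_real[OF f] sqint_wigner[OF lam]])
  also have "\<dots> = (\<integral>p. f (act_real \<alpha> ?g' p) * cnj (wigner lam \<psi> \<phi> p) \<partial>distr lborel borel (act_real \<alpha> g))"
    by (simp only: distr_lborel_act_real[OF \<alpha>])
  also have "\<dots> = (\<integral>p. f (act_real \<alpha> ?g' (act_real \<alpha> g p)) * cnj (wigner lam \<psi> \<phi> (act_real \<alpha> g p)) \<partial>lborel)"
    by (rule integral_distr) auto
  also have "\<dots> = (\<integral>p. f p * cnj (wigner lam (?S' \<psi>) (?S' \<phi>) p) \<partial>lborel)"
  proof (rule Bochner_Integration.integral_cong[OF refl])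
    fix p
    have "act_real \<alpha> ?g' (act_real \<alpha> g p) = p"
      by (subst act_real_eq[OF \<alpha>]) (simp add: cplx_act_real[OF \<alpha>] act_complex_inv[OF \<alpha>])
    moreover have "wigner lam (?S (?S' \<psi>)) (?S (?S' \<phi>)) (act_real \<alpha> g p) = wigner lam (?S' \<psi>) (?S' \<phi>) p"
      by (rule wigner_covariant)
    ultimately show "f (act_real \<alpha> ?g' (act_real \<alpha> g p)) * cnj (wigner lam \<psi> \<phi> (act_real \<alpha> g p))
        = f p * cnj (wigner lam (?S' \<psi>) (?S' \<phi>) p)"
      by (simp add: SS)
  qed
  also have "\<dots> = cinner (abs_L2 f) (abs_L2 (wigner lam (?S' \<psi>) (?S' \<phi>)))"
    by (rule cinner_abs_L2[OF f sqint_wigner[OF lam], symmetric])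
  also have "\<dots> = complex_of_real ((2 * pi / lam) ^ CARD('n)) * cinner (A (?S' \<phi>)) (?S' \<psi>)"
    using A by (simp add: is_symbol_def[OF lam])
  also have "cinner (A (?S' \<phi>)) (?S' \<psi>) = cinner (?S (A (?S' \<phi>))) \<psi>"
  proof -
    have "cinner (?S (A (?S' \<phi>))) (?S (?S' \<psi>)) = cinner (A (?S' \<phi>)) (?S' \<psi>)"
      by (rule cinner_schrodinger_rep[OF \<alpha> \<kappa> lam])
    then show ?thesis by (simp add: SS)
  qed
  finally show "cinner (abs_L2 (\<lambda>p. f (act_real \<alpha> ?g' p))) (abs_L2 (wigner lam \<psi> \<phi>))
      = complex_of_real ((2 * pi / lam) ^ CARD('n)) * cinner ((?S \<circ> A \<circ> inv_into UNIV ?S) \<phi>) \<psi>"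
    by (simp add: inv_schrodinger_rep[OF \<alpha> \<kappa> lam])
qed

theorem stratonovich_weyl_W1:
  "stratonovich_weyl (diamond \<alpha>) (schrodinger_rep \<alpha> \<kappa> lam) (act_real \<alpha>) (mu_real lam) (W1 lam)"
  unfolding stratonovich_weyl_def
proof (intro conjI allI impI ballI)
  show "topological_group (diamond \<alpha>)" by (rule topological_group_diamond[OF \<alpha>])
  show "unitary_representation (diamond \<alpha>) (schrodinger_rep \<alpha> \<kappa> lam)"
    by (rule unitary_representation_schrodinger[OF \<alpha> \<kappa> lam])
  show "homogeneous_space_invariant_measure (diamond \<alpha>) (act_real \<alpha>) (mu_real lam)"
    by (rule homogeneous_space_act_real[OF \<alpha>])
  show "W1 lam A \<in> sqint (mu_real lam)" if "hilbert_schmidt A" for A :: "(real^'n) L2 \<Rightarrow> _"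
    using sqint_W1[OF lam that] by (simp add: sqint_mu_real[OF lam])
  show "AE x in mu_real lam. W1 lam (\<lambda>\<phi>. scaleC a (A \<phi>) + scaleC b (B \<phi>)) x = a * W1 lam A x + b * W1 lam B x"
    if A: "hilbert_schmidt A" and B: "hilbert_schmidt B" for A B :: "(real^'n) L2 \<Rightarrow> _" and a b
  proof (rule W1_eqI[OF lam hilbert_schmidt_lincomb[OF A B]])
    note s = sqint_scale[OF sqint_W1[OF lam A], of a] sqint_scale[OF sqint_W1[OF lam B], of b]
    show "(\<lambda>x. a * W1 lam A x + b * W1 lam B x) \<in> sqint lborel" by (rule sqint_add[OF s])
    show "is_symbol lam (\<lambda>\<phi>. scaleC a (A \<phi>) + scaleC b (B \<phi>)) (abs_L2 (\<lambda>x. a * W1 lam A x + b * W1 lam B x))"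
      unfolding abs_L2_add[OF s] abs_L2_scaleC[OF sqint_W1[OF lam A]] abs_L2_scaleC[OF sqint_W1[OF lam B]]
      by (rule is_symbol_lincomb[OF lam is_symbol_W1[OF lam A] is_symbol_W1[OF lam B]])
  qed
  show "A = B" if A: "hilbert_schmidt A" and B: "hilbert_schmidt B"
    and e: "AE x in mu_real lam. W1 lam A x = W1 lam B x" for A B :: "(real^'n) L2 \<Rightarrow> _"
  proof (rule is_symbol_unique(2)[OF lam is_symbol_W1[OF lam A]])
    have "abs_L2 (W1 lam A) = abs_L2 (W1 lam B)"
      using e abs_L2_eq_iff[OF sqint_W1[OF lam A] sqint_W1[OF lam B]] by (simp add: AE_mu_real[OF lam])
    then show "is_symbol lam B (abs_L2 (W1 lam A))" using is_symbol_W1[OF lam B] by simp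
  qed
  show "\<exists>A. hilbert_schmidt A \<and> (AE x in mu_real lam. W1 lam A x = F x)" if "F \<in> sqint (mu_real lam)" for F :: "(real^'n) \<times> (real^'n) \<Rightarrow> complex"
  proof -
    obtain A where A: "hilbert_schmidt A" "is_symbol lam A (abs_L2 F)" by (rule ex_hilbert_schmidt_of_symbol[OF lam])
    then show ?thesis using W1_eqI[OF lam A(1) _ A(2)] that by (auto simp: sqint_mu_real[OF lam])
  qed
  show "AE x in mu_real lam. W1 lam (id :: (real^'n) L2 \<Rightarrow> _) x = 1" by (simp add: W1_id[OF lam])
  show "AE x in mu_real lam. W1 lam (cadjoint A) x = cnj (W1 lam A x)" if A: "hilbert_schmidt A" for A :: "(real^'n) L2 \<Rightarrow> _"
    by (intro W1_eqI[OF lam] hilbert_schmidt_cadjoint A sqint_cnj sqint_W1[OF lam]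
        is_symbol_cadjoint[OF lam] hilbert_schmidt_bounded_clinear is_symbol_W1[OF lam])
  show "AE x in mu_real lam. W1 lam (schrodinger_rep \<alpha> \<kappa> lam g \<circ> A \<circ> inv_into UNIV (schrodinger_rep \<alpha> \<kappa> lam g)) x
      = W1 lam A (act_real \<alpha> (inv\<^bsub>diamond \<alpha>\<^esub> g) x)" if A: "hilbert_schmidt A" for A :: "(real^'n) L2 \<Rightarrow> _" and g
  proof (rule W1_eqI[OF lam])
    show "hilbert_schmidt (schrodinger_rep \<alpha> \<kappa> lam g \<circ> A \<circ> inv_into UNIV (schrodinger_rep \<alpha> \<kappa> lam g))"
      unfolding inv_schrodinger_rep[OF \<alpha> \<kappa> lam]
      by (intro hilbert_schmidt_comp_right hilbert_schmidt_comp_left A bounded_clinear_schrodinger_rep[OF \<alpha> \<kappa> lam])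
    show "(\<lambda>p. W1 lam A (act_real \<alpha> (inv\<^bsub>diamond \<alpha>\<^esub> g) p)) \<in> sqint lborel"
      by (rule sqint_act_real[OF sqint_W1[OF lam A]])
    show "is_symbol lam (schrodinger_rep \<alpha> \<kappa> lam g \<circ> A \<circ> inv_into UNIV (schrodinger_rep \<alpha> \<kappa> lam g))
      (abs_L2 (\<lambda>p. W1 lam A (act_real \<alpha> (inv\<^bsub>diamond \<alpha>\<^esub> g) p)))"
      by (rule is_symbol_covariant[OF sqint_W1[OF lam A] is_symbol_W1[OF lam A]])
  qed
  show "(\<integral>x. W1 lam A x * W1 lam B x \<partial>mu_real lam) = trace (A \<circ> B)"
    if "hilbert_schmidt A" "hilbert_schmidt B" for A B :: "(real^'n) L2 \<Rightarrow> _"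
    by (rule integral_W1_mult[OF lam that])
qed

end

section \<open>Transport of correspondences\<close>

text \<open>A homeomorphism onto its range, with inverse \<Psi>, carries over action, topology and
  measure. Since M is in turn the image of the new measure under \<Psi>, almost everywhere
  statements pass in both directions.\<close>

lemma stratonovich_weyl_transport:
  fixes \<Phi> :: "'x::topological_space \<Rightarrow> 'y::topological_space" and G (structure)
  assumes SW: "stratonovich_weyl G \<rho> act M W" and M: "space M = UNIV"
    and \<Phi>: "continuous_on UNIV \<Phi>" and \<Psi>: "continuous_on (range \<Phi>) \<Psi>" and inv: "\<And>x. \<Psi> (\<Phi> x) = x"
    and act': "\<And>g x. g \<in> carrier G \<Longrightarrow> act' g (\<Phi> x) = \<Phi> (act g x)"
    and ext: "\<And>g. g \<in> carrier G \<Longrightarrow> act' g \<in> extensional (range \<Phi>)"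
  shows "stratonovich_weyl G \<rho> act' (distr M (restrict_space borel (range \<Phi>)) \<Phi>) (\<lambda>A. W A \<circ> inv_into UNIV \<Phi>)"
proof -
  note SW' = SW[unfolded stratonovich_weyl_def]
  define N where "N = distr M (restrict_space borel (range \<Phi>)) \<Phi>"
  have tg: "topological_group G" and ur: "unitary_representation G \<rho>"
    and hs: "homogeneous_space_invariant_measure G act M" using SW' by blast+
  have ta: "transitive_action G UNIV act" and ca: "continuous_on (carrier G \<times> UNIV) (\<lambda>(g, x). act g x)"
    and sM: "sets M = sets borel" and iM: "\<And>g. g \<in> carrier G \<Longrightarrow> distr M M (act g) = M"
    using hs by (auto simp: homogeneous_space_invariant_measure_def M)
  interpret transitive_action G UNIV act by (rule ta)
  have gG: "group G" using tg by (simp add: topological_group_def)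
  interpret group G by (rule gG)
  have iv: "inv_into UNIV \<Phi> (\<Phi> x) = x" for x
    by (metis inv inv_f_f injI)
  have spN: "space N = range \<Phi>" and seN: "sets N = sets (restrict_space borel (range \<Phi>))"
    by (simp_all add: N_def space_restrict_space)
  have mb: "f \<in> borel_measurable M \<longleftrightarrow> f \<in> borel_measurable borel" for f :: "'x \<Rightarrow> complex"
    using sM by (simp cong: measurable_cong_sets)
  have mP: "\<Phi> \<in> measurable M N"
  proof -
    have "\<Phi> \<in> measurable borel (restrict_space borel (range \<Phi>))"
      by (intro measurable_restrict_space2 borel_measurable_continuous_onI \<Phi>) auto
    then show ?thesis using sM seN by (simp cong: measurable_cong_sets)
  qed
  have mQ: "\<Psi> \<in> measurable N M"
    using borel_measurable_continuous_on_restrict[OF \<Psi>] sM seN by (simp cong: measurable_cong_sets)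
  have mA: "act g \<in> measurable M M" if g: "g \<in> carrier G" for g
  proof -
    have "continuous_on UNIV (\<lambda>x. (\<lambda>(g, x). act g x) (g, x))"
      by (rule continuous_on_compose2[OF ca]) (use g in \<open>auto intro!: continuous_intros\<close>)
    then have "act g \<in> borel_measurable borel" by (intro borel_measurable_continuous_onI) simp
    then show ?thesis using sM by (simp cong: measurable_cong_sets)
  qed
  have N: "N = distr M N \<Phi>" unfolding N_def by (rule distr_cong) simp_all
  have MN: "M = distr N M \<Psi>"
  proof -
    have "distr N M \<Psi> = distr M M (\<Psi> \<circ> \<Phi>)"
      by (subst N) (rule distr_distr[OF mQ mP])
    also have "\<Psi> \<circ> \<Phi> = (\<lambda>x. x)" by (simp add: fun_eq_iff inv)
    finally show ?thesis by (simp add: distr_id2)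
  qed
  \<comment> \<open>\<open>inv_into\<close> agrees with \<Psi> on the range only, which is the space
    of N; hence the appeal to \<open>AE_space\<close>.\<close>
  have AEt: "AE y in N. P (inv_into UNIV \<Phi> y)" if "AE x in M. P x" for P
  proof -
    have "AE x in distr N M \<Psi>. P x" unfolding MN[symmetric] by (rule that)
    then have "AE y in N. P (\<Psi> y)" by (rule AE_distrD[OF mQ])
    then show ?thesis
      using AE_space[of N] by eventually_elim (auto simp: spN iv inv)
  qed
  have AEt': "AE x in M. P x" if "AE y in N. P (inv_into UNIV \<Phi> y)" for P
  proof -
    have "AE y in distr M N \<Phi>. P (inv_into UNIV \<Phi> y)" unfolding N[symmetric] by (rule that)
    from AE_distrD[OF mP this] show ?thesis by (simp add: iv)
  qed
  have mI: "f \<circ> inv_into UNIV \<Phi> \<in> borel_measurable N" if "f \<in> borel_measurable M" for f :: "'x \<Rightarrow> complex"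
  proof -
    have "f \<circ> \<Psi> \<in> borel_measurable N" using that mQ by (rule measurable_comp[rotated])
    moreover have "(f \<circ> \<Psi>) y = (f \<circ> inv_into UNIV \<Phi>) y" if "y \<in> space N" for y
      using that by (auto simp: spN iv inv)
    ultimately show ?thesis by (simp cong: measurable_cong)
  qed
  have sq: "F \<circ> inv_into UNIV \<Phi> \<in> sqint N" if F: "F \<in> sqint M" for F
  proof -
    have m: "F \<circ> inv_into UNIV \<Phi> \<in> borel_measurable N" using F by (intro mI sqint_measurable)
    have "integrable M (\<lambda>x. (cmod ((F \<circ> inv_into UNIV \<Phi>) (\<Phi> x)))\<^sup>2)" using F by (simp add: sqint_def iv)
    moreover have "(\<lambda>y. (cmod ((F \<circ> inv_into UNIV \<Phi>) y))\<^sup>2) \<in> borel_measurable N"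
      by (intro borel_measurable_power borel_measurable_norm m measurable_compose[OF m])
    ultimately have "integrable (distr M N \<Phi>) (\<lambda>y. (cmod ((F \<circ> inv_into UNIV \<Phi>) y))\<^sup>2)"
      by (subst integrable_distr_eq[OF mP]) auto
    then have "integrable N (\<lambda>y. (cmod ((F \<circ> inv_into UNIV \<Phi>) y))\<^sup>2)" using N by simp
    then show ?thesis using m by (simp add: sqint_def)
  qed
  have hN: "homogeneous_space_invariant_measure G act' N"
    unfolding homogeneous_space_invariant_measure_def
  proof (intro conjI ballI)
    show "transitive_action G (space N) act'"
    proof (rule transitive_actionI[OF gG])
      show "act' g \<in> extensional (space N)" if "g \<in> carrier G" for g using ext[OF that] by (simp add: spN)
      show "act' g y \<in> space N" if "g \<in> carrier G" "y \<in> space N" for g y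
        using that by (auto simp: spN act')
      show "act' \<one> y = y" if "y \<in> space N" for y
        using that fun_cong[OF id_eq_one] by (auto simp: spN act')
      show "act' (g \<otimes> h) y = act' g (act' h y)" if "g \<in> carrier G" "h \<in> carrier G" "y \<in> space N" for g h y
        using that by (auto simp: spN act' composition_rule)
      show "\<exists>g\<in>carrier G. act' g x = y" if "x \<in> space N" "y \<in> space N" for x y
      proof -
        obtain a b where ab: "x = \<Phi> a" "y = \<Phi> b" using \<open>x \<in> space N\<close> \<open>y \<in> space N\<close> by (auto simp: spN)
        obtain g where "g \<in> carrier G" "act g a = b" using unique_orbit[of a b] by auto
        then show ?thesis by (intro bexI[of _ g]) (auto simp: ab act')
      qed
    qed
    have "continuous_on (carrier G \<times> range \<Phi>) (\<lambda>p. \<Phi> ((\<lambda>(g, x). act g x) (fst p, \<Psi> (snd p))))"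
      by (intro continuous_on_compose2[OF \<Phi>] continuous_on_compose2[OF ca] continuous_on_compose2[OF \<Psi>] continuous_intros) auto
    then show "continuous_on (carrier G \<times> space N) (\<lambda>(g, x). act' g x)"
      unfolding spN by (rule continuous_on_cong[THEN iffD1, rotated -1]) (auto simp: act' inv)
    show "sets N = sets (restrict_space borel (space N))" by (simp add: seN spN)
    fix g assume g: "g \<in> carrier G"
    have mA': "act' g \<in> measurable N N"
    proof -
      have "\<Phi> \<circ> act g \<circ> \<Psi> \<in> measurable N N"
        by (intro measurable_comp[OF mQ] measurable_comp[OF mA[OF g]] mP)
      moreover have "(\<Phi> \<circ> act g \<circ> \<Psi>) y = act' g y" if "y \<in> space N" for y
        using that g by (auto simp: spN inv act')
      ultimately show ?thesis by (simp cong: measurable_cong)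
    qed
    have "distr N N (act' g) = distr M N (act' g \<circ> \<Phi>)"
      by (subst (1) N) (rule distr_distr[OF mA' mP])
    also have "act' g \<circ> \<Phi> = \<Phi> \<circ> act g" using g by (simp add: fun_eq_iff act')
    also have "distr M N (\<Phi> \<circ> act g) = distr (distr M M (act g)) N \<Phi>"
      by (rule distr_distr[OF mP mA[OF g], symmetric])
    also have "\<dots> = N" using iM[OF g] N by simp
    finally show "distr N N (act' g) = N" .
  qed
  have "stratonovich_weyl G \<rho> act' N (\<lambda>A. W A \<circ> inv_into UNIV \<Phi>)"
    unfolding stratonovich_weyl_def o_def
  proof (intro conjI allI impI ballI tg ur hN)
    show "(\<lambda>x. W A (inv_into UNIV \<Phi> x)) \<in> sqint N" if "hilbert_schmidt A" for A
      using sq[of "W A"] SW' that unfolding o_def by blast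
    show "AE x in N. W (\<lambda>\<phi>. scaleC a (A \<phi>) + scaleC b (B \<phi>)) (inv_into UNIV \<Phi> x)
        = a * W A (inv_into UNIV \<Phi> x) + b * W B (inv_into UNIV \<Phi> x)" if "hilbert_schmidt A" "hilbert_schmidt B" for A B a b
      using SW' that by (intro AEt) blast
    show "A = B" if "hilbert_schmidt A" "hilbert_schmidt B" "AE x in N. W A (inv_into UNIV \<Phi> x) = W B (inv_into UNIV \<Phi> x)" for A B
      using AEt'[OF that(3)] SW' that by blast
    show "\<exists>A. hilbert_schmidt A \<and> (AE x in N. W A (inv_into UNIV \<Phi> x) = F x)" if F: "F \<in> sqint N" for F
    proof -
      have "integrable (distr M N \<Phi>) (\<lambda>y. (cmod (F y))\<^sup>2)" using F N by (simp add: sqint_def)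
      then have "integrable M (\<lambda>x. (cmod (F (\<Phi> x)))\<^sup>2)"
        using F by (subst (asm) integrable_distr_eq[OF mP]) (auto simp: sqint_def)
      moreover have "(\<lambda>x. F (\<Phi> x)) \<in> borel_measurable M"
        using measurable_compose[OF mP sqint_measurable[OF F]] .
      ultimately have F\<Phi>: "(\<lambda>x. F (\<Phi> x)) \<in> sqint M" by (simp add: sqint_def)
      have "\<forall>F\<in>sqint M. \<exists>A. hilbert_schmidt A \<and> (AE x in M. W A x = F x)" using SW' by (elim conjE)
      from bspec[OF this F\<Phi>] obtain A where A: "hilbert_schmidt A" "AE x in M. W A x = F (\<Phi> x)" by blast
      from AEt[OF A(2)] have "AE y in N. W A (inv_into UNIV \<Phi> y) = F y"
        using AE_space[of N] by eventually_elim (auto simp: spN iv)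
      then show ?thesis using A(1) by blast
    qed
    show "AE x in N. W id (inv_into UNIV \<Phi> x) = 1" using SW' by (intro AEt) blast
    show "AE x in N. W (cadjoint A) (inv_into UNIV \<Phi> x) = cnj (W A (inv_into UNIV \<Phi> x))" if "hilbert_schmidt A" for A
      using SW' that by (intro AEt) blast
    show "AE x in N. W (\<lambda>x. \<rho> g (A (inv_into UNIV (\<rho> g) x))) (inv_into UNIV \<Phi> x) = W A (inv_into UNIV \<Phi> (act' (inv g) x))"
      if A: "hilbert_schmidt A" and g: "g \<in> carrier G" for A g
    proof -
      have "AE x in M. W (\<rho> g \<circ> A \<circ> inv_into UNIV (\<rho> g)) x = W A (act (inv g) x)" using SW' A g by blast
      from AEt[OF this] show ?thesis
        using AE_space[of N] by eventually_elim (use g in \<open>auto simp: spN iv act' o_def\<close>)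
    qed
    show "(\<integral>x. W A (inv_into UNIV \<Phi> x) * W B (inv_into UNIV \<Phi> x) \<partial>N) = trace (\<lambda>x. A (B x))"
      if A: "hilbert_schmidt A" and B: "hilbert_schmidt B" for A B
    proof -
      have s: "W A \<in> sqint M" "W B \<in> sqint M" using SW' A B by blast+
      have "(\<lambda>x. W A x * W B x) \<in> borel_measurable M"
        using sqint_measurable[OF s(1)] sqint_measurable[OF s(2)] by simp
      from mI[OF this] have m: "(\<lambda>y. W A (inv_into UNIV \<Phi> y) * W B (inv_into UNIV \<Phi> y)) \<in> borel_measurable N"
        by (simp add: o_def)
      have "(\<integral>y. W A (inv_into UNIV \<Phi> y) * W B (inv_into UNIV \<Phi> y) \<partial>N)
          = (\<integral>y. W A (inv_into UNIV \<Phi> y) * W B (inv_into UNIV \<Phi> y) \<partial>distr M N \<Phi>)" using N by simp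
      also have "\<dots> = (\<integral>x. W A x * W B x \<partial>M)"
        by (subst integral_distr[OF mP m]) (simp add: iv)
      also have "\<dots> = trace (\<lambda>x. A (B x))" using SW' A B unfolding o_def by blast
      finally show ?thesis .
    qed
  qed
  then show ?thesis by (simp add: N_def)
qed

section \<open>Characters are smooth\<close>

text \<open>Some modulation of the character has a nonzero integral against a Gaussian, and convolving it
  with the Gaussian only multiplies it by that integral.\<close>

lemma unitary_character_has_derivative:
  fixes \<kappa> :: "real^'m \<Rightarrow> complex"
  assumes \<kappa>: "unitary_character \<kappa>"
  shows "\<exists>D. (\<kappa> has_derivative D) (at 0)"
proof -
  have k: "continuous_on UNIV \<kappa>" "\<And>s t. \<kappa> (s + t) = \<kappa> s * \<kappa> t" "\<And>t. cmod (\<kappa> t) = 1"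
    using \<kappa> by (auto simp: unitary_character_def)
  have [measurable]: "\<kappa> \<in> borel_measurable borel" by (rule borel_measurable_continuous_onI[OF k(1)])
  have gi: "integrable lborel (gauss 1 0 0 :: real^'m \<Rightarrow> complex)"
    using has_bochner_integral_gauss[of 1] by (auto simp: has_bochner_integral_iff)
  \<comment> \<open>If all these integrals vanished, Fourier uniqueness would make a function
    without zeros vanish almost everywhere.\<close>
  have "\<exists>q. (\<integral>s. \<kappa> s * gauss 1 0 0 s * exp (\<i> * complex_of_real (q \<bullet> s)) \<partial>lborel) \<noteq> 0"
  proof (rule ccontr)
    assume "\<not> ?thesis"
    moreover have "integrable lborel (\<lambda>s. \<kappa> s * gauss 1 0 0 s)"
      by (rule Bochner_Integration.integrable_bound[OF gi]) (auto simp: norm_mult k(3))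
    ultimately have "AE s in lborel. \<kappa> s * gauss 1 0 0 s = 0" by (intro fourier_unique) auto
    moreover have "\<kappa> s * gauss 1 0 0 s \<noteq> 0" for s using k(3)[of s] by (auto simp: gauss_def)
    ultimately have "AE s::real^'m in lborel. False" by simp
    then have "emeasure lborel (UNIV :: (real^'m) set) = 0" by (simp add: AE_iff_null null_sets_def)
    then show False by simp
  qed
  then obtain q where q: "(\<integral>s. \<kappa> s * gauss 1 0 0 s * exp (\<i> * complex_of_real (q \<bullet> s)) \<partial>lborel) \<noteq> 0" by blast
  define f where "f s = \<kappa> s * exp (\<i> * complex_of_real (q \<bullet> s))" for s
  define J where "J = (\<integral>s. f s * gauss 1 0 0 s \<partial>lborel)"
  have J: "J \<noteq> 0" using q by (simp add: J_def f_def mult_ac)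
  have [measurable]: "f \<in> borel_measurable borel" unfolding f_def by measurable
  have fadd: "f (s + t) = f s * f t" for s t
    by (simp add: f_def k(2) inner_add_right distrib_left exp_add mult_ac)
  have nf: "cmod (f s) = 1" for s by (simp add: f_def norm_mult k(3))
  \<comment> \<open>The Gaussian is split: one half makes this function square-integrable, the other
    is the kernel in \<Theta>, so that \<open>has_derivative_gauss_integral\<close> applies with
    parameter 1.\<close>
  define \<phi> where "\<phi> s = f s * gauss (1/2) 0 0 s" for s
  have \<phi>: "\<phi> \<in> sqint lborel"
  proof -
    have "gauss (1/2) 0 0 \<in> sqint (lborel :: (real^'m) measure)" by (rule sqint_gauss) simp
    moreover have "\<phi> \<in> borel_measurable lborel" unfolding \<phi>_def by measurable
    ultimately show ?thesis by (simp add: sqint_def \<phi>_def norm_mult nf)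
  qed
  define \<Theta> where "\<Theta> z = (\<integral>s. gauss (1 / 2) (1 *\<^sub>R re_vec z) (1 *\<^sub>R im_vec z) s * \<phi> s \<partial>lborel)" for z :: "complex^'m"
  obtain D where D: "(\<Theta> has_derivative D) (at (cvec (2 *\<^sub>R 0)))"
    unfolding \<Theta>_def using has_derivative_gauss_integral[OF _ \<phi>, of 1 "cvec (2 *\<^sub>R 0)"] by auto
  \<comment> \<open>At 2t the exponent is a square centred at t. Shifting by t and multiplicativity
    pull out \<open>f t\<close>, with the constant J left over.\<close>
  have T: "\<Theta> (cvec (2 *\<^sub>R t)) = exp (complex_of_real (t \<bullet> t)) * f t * J" for t
  proof -
    have c: "re_vec (cvec (2 *\<^sub>R t)) = 2 *\<^sub>R t" "im_vec (cvec (2 *\<^sub>R t)) = 0" by (simp_all add: vec_eq_iff)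
    have e: "gauss (1/2) (2 *\<^sub>R t) 0 (t + s) * \<phi> (t + s) = exp (complex_of_real (t \<bullet> t)) * f t * (f s * gauss 1 0 0 s)" for s
      by (simp add: \<phi>_def fadd gauss_def inner_add inner_commute mult_ac algebra_simps flip: exp_add)
    have "\<Theta> (cvec (2 *\<^sub>R t)) = (\<integral>s. gauss (1/2) (2 *\<^sub>R t) 0 s * \<phi> s \<partial>lborel)"
      unfolding \<Theta>_def c by simp
    also have "\<dots> = (\<integral>s. gauss (1/2) (2 *\<^sub>R t) 0 (t + s) * \<phi> (t + s) \<partial>lborel)"
      using integral_lborel_affine[of "\<lambda>s. gauss (1/2) (2 *\<^sub>R t) 0 s * \<phi> s" 1 t] sqint_measurable[OF \<phi>] by simp
    finally show ?thesis unfolding e J_def by simp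
  qed
  have ex: "(exp has_derivative (\<lambda>h. exp w * h)) (at w)" for w :: complex
    using DERIV_exp[of w] by (simp add: has_field_derivative_def)
  have lc: "((\<lambda>t::real^'m. cvec (2 *\<^sub>R t)) has_derivative (\<lambda>t. cvec (2 *\<^sub>R t))) (at 0)"
  proof (rule bounded_linear_imp_has_derivative)
    have "linear (\<lambda>t::real^'m. cvec (2 *\<^sub>R t))" 
      by (rule linearI) (simp_all add: vec_eq_iff distrib_left scaleR_conv_of_real[where 'a=complex])
    then show "bounded_linear (\<lambda>t::real^'m. cvec (2 *\<^sub>R t))" by (simp add: linear_conv_bounded_linear)
  qed
  define r where "r t = - complex_of_real (t \<bullet> t) - \<i> * complex_of_real (q \<bullet> t)" for t
  have "\<exists>R. (r has_derivative R) (at 0)"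
    unfolding r_def by (rule exI) (auto intro!: derivative_eq_intros)
  then obtain R where R: "(r has_derivative R) (at 0)" by blast
  have "\<kappa> t = \<Theta> (cvec (2 *\<^sub>R t)) * exp (r t) * (1 / J)" for t
    unfolding T f_def r_def using J by (simp flip: exp_add)
  then have \<kappa>_eq: "\<kappa> = (\<lambda>t. \<Theta> (cvec (2 *\<^sub>R t)) * exp (r t) * (1 / J))" by blast
  have d1: "((\<lambda>t. \<Theta> (cvec (2 *\<^sub>R t))) has_derivative (\<lambda>h. D (cvec (2 *\<^sub>R h)))) (at 0)"
    by (rule has_derivative_compose[OF lc D])
  have d2: "((\<lambda>t. exp (r t)) has_derivative (\<lambda>h. exp (r 0) * R h)) (at 0)"
    by (rule has_derivative_compose[OF R ex])
  show ?thesis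
    by (subst \<kappa>_eq) (rule exI, rule has_derivative_mult_left[OF has_derivative_mult[OF d1 d2]])
qed

section \<open>The coadjoint orbit\<close>

text \<open>The infinitesimal rotation: the derivative of \<open>rot \<alpha> t z\<close> in t at
  0.\<close>

definition lie_act :: "('n::finite \<Rightarrow> real^'m \<Rightarrow> real) \<Rightarrow> real^'m \<Rightarrow> complex^'n \<Rightarrow> complex^'n" where
  "lie_act \<alpha> t z = (\<chi> k. \<i> * complex_of_real (\<alpha> k t) * z $ k)"

lemma lie_act_nth [simp]: "lie_act \<alpha> t z $ k = \<i> * complex_of_real (\<alpha> k t) * z $ k"
  by (simp add: lie_act_def)

lemma omegaR_lie_act: "omegaR z (lie_act \<alpha> t w) = (\<Sum>k\<in>UNIV. \<alpha> k t * Re (cnj (z $ k) * w $ k))"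
  by (simp add: omegaR_eq bil_def algebra_simps)

lemma bounded_bilinear_omegaR: "bounded_bilinear (omegaR :: complex^'n \<Rightarrow> complex^'n \<Rightarrow> real)"
  unfolding bilinear_conv_bounded_bilinear[symmetric] bilinear_def
  by (auto intro!: linearI simp: omegaR_simps)

context
  fixes \<alpha> :: "'n::finite \<Rightarrow> real^'m::finite \<Rightarrow> real"
  assumes \<alpha>: "\<And>k. linear (\<alpha> k)"
begin

lemma has_derivative_rot_at_0: "((\<lambda>t. rot \<alpha> t z) has_derivative (\<lambda>t. lie_act \<alpha> t z)) (at 0)"
  unfolding has_derivative_componentwise_within[of "\<lambda>t. rot \<alpha> t z"]
proof
  fix b :: "complex^'n" assume "b \<in> Basis"
  then obtain k c where b: "b = axis k c" by (auto simp: Basis_vec_def)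
  have l: "((\<lambda>t. \<i> * complex_of_real (\<alpha> k t)) has_derivative (\<lambda>t. \<i> * complex_of_real (\<alpha> k t))) (at 0)"
    by (intro has_derivative_mult_right bounded_linear.has_derivative[OF bounded_linear_of_real]
        bounded_linear_imp_has_derivative) (simp add: linear_conv_bounded_linear[symmetric] \<alpha>)
  have "(exp has_derivative (\<lambda>h. exp (\<i> * complex_of_real (\<alpha> k 0)) * h)) (at (\<i> * complex_of_real (\<alpha> k 0)))"
    using DERIV_exp[of "\<i> * complex_of_real (\<alpha> k 0)"] by (simp add: has_field_derivative_def)
  from has_derivative_compose[OF l this]
  have "((\<lambda>t. exp (\<i> * complex_of_real (\<alpha> k t)) * z $ k) has_derivative (\<lambda>t. \<i> * complex_of_real (\<alpha> k t) * z $ k)) (at 0)"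
    by (intro has_derivative_mult_left) (simp add: linear_0[OF \<alpha>])
  from has_derivative_inner_left[OF this, of c]
  show "((\<lambda>t. rot \<alpha> t z \<bullet> b) has_derivative (\<lambda>t. lie_act \<alpha> t z \<bullet> b)) (at 0)"
    by (simp add: b inner_axis)
qed

text \<open>Conjugation is brought to the closed form \<open>?f\<close> and differentiated at the
  identity. Rotating z0 by the first component contributes the \<open>lie_act\<close> terms, and the
  product rule handles the symplectic form.\<close>

lemma Ad_eq: "Ad \<alpha> (t0, z0, c0) (t, u, c) = (t, rot \<alpha> t0 u - lie_act \<alpha> t z0,
    c + 1 / 2 * omegaR z0 (rot \<alpha> t0 u) - 1 / 2 * (omegaR z0 (lie_act \<alpha> t z0) + omegaR (rot \<alpha> t0 u) z0))"
proof -
  let ?f = "\<lambda>h :: ('m, 'n) diamond. (fst h, z0 + rot \<alpha> t0 (fst (snd h)) - rot \<alpha> (fst h) z0,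
    snd (snd h) + 1 / 2 * omegaR z0 (rot \<alpha> t0 (fst (snd h)))
     - 1 / 2 * omegaR (z0 + rot \<alpha> t0 (fst (snd h))) (rot \<alpha> (fst h) z0))"
  let ?D = "\<lambda>h :: ('m, 'n) diamond. (fst h, rot \<alpha> t0 (fst (snd h)) - lie_act \<alpha> (fst h) z0,
    snd (snd h) + 1 / 2 * omegaR z0 (rot \<alpha> t0 (fst (snd h)))
     - 1 / 2 * (omegaR z0 (lie_act \<alpha> (fst h) z0) + omegaR (rot \<alpha> t0 (fst (snd h))) z0))"
  have "(\<lambda>h. (t0, z0, c0) \<otimes>\<^bsub>diamond \<alpha>\<^esub> h \<otimes>\<^bsub>diamond \<alpha>\<^esub> inv\<^bsub>diamond \<alpha>\<^esub> (t0, z0, c0)) = ?f"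
  proof
    fix h :: "('m, 'n) diamond"
    obtain t z c where h: "h = (t, z, c)" by (metis prod_cases3)
    have "rot \<alpha> (t0 + t) (rot \<alpha> (- t0) z0) = rot \<alpha> t z0"
      by (subst add.commute) (simp add: rot_add[OF \<alpha>] rot_minus[OF \<alpha>])
    then show "(t0, z0, c0) \<otimes>\<^bsub>diamond \<alpha>\<^esub> h \<otimes>\<^bsub>diamond \<alpha>\<^esub> inv\<^bsub>diamond \<alpha>\<^esub> (t0, z0, c0) = ?f h"
      by (simp add: h inv_diamond[OF \<alpha>] omegaR_simps algebra_simps)
  qed
  note eq = this
  have "(?f has_derivative ?D) (at (0, 0, 0))"
  proof -
    have r: "((\<lambda>h::('m, 'n) diamond. rot \<alpha> t0 (fst (snd h))) has_derivative (\<lambda>h. rot \<alpha> t0 (fst (snd h)))) (at (0, 0, 0))"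
    proof (rule bounded_linear_imp_has_derivative)
      show "bounded_linear (\<lambda>h::('m, 'n) diamond. rot \<alpha> t0 (fst (snd h)))"
        using bounded_linear_compose[OF linear_conv_bounded_linear[THEN iffD1, OF linear_rot[OF \<alpha>]]
            bounded_linear_compose[OF bounded_linear_fst bounded_linear_snd]] .
    qed
    have a: "((\<lambda>h::('m, 'n) diamond. rot \<alpha> (fst h) z0) has_derivative (\<lambda>h. lie_act \<alpha> (fst h) z0)) (at (0, 0, 0))"
      by (rule has_derivative_compose[of fst fst]) (auto intro: has_derivative_fst[OF has_derivative_ident] has_derivative_rot_at_0)
    note o = bounded_bilinear.FDERIV[OF bounded_bilinear_omegaR]
    have "(?f has_derivative (\<lambda>h. (fst h, 0 + rot \<alpha> t0 (fst (snd h)) - lie_act \<alpha> (fst h) z0,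
      snd (snd h) + 1 / 2 * (omegaR z0 (rot \<alpha> t0 (fst (snd h))) + omegaR 0 (rot \<alpha> t0 (fst (snd (0::real^'m, 0::complex^'n, 0::real)))))
     - 1 / 2 * (omegaR (z0 + rot \<alpha> t0 (fst (snd (0::real^'m, 0::complex^'n, 0::real)))) (lie_act \<alpha> (fst h) z0)
        + omegaR (0 + rot \<alpha> t0 (fst (snd h))) (rot \<alpha> (fst (0::real^'m, 0::complex^'n, 0::real)) z0))))) (at (0, 0, 0))"
      by (intro has_derivative_Pair has_derivative_add has_derivative_diff has_derivative_mult_right o r a
          has_derivative_const has_derivative_fst has_derivative_snd has_derivative_ident)
    then show ?thesis by (simp add: omegaR_simps rot_zero[OF \<alpha>])
  qed
  then have "Ad \<alpha> (t0, z0, c0) = ?D"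
    unfolding Ad_def diamond_simps(2) eq by (rule frechet_derivative_at[symmetric])
  then show ?thesis by simp
qed

context
  fixes \<kappa> :: "real^'m \<Rightarrow> complex" and lam :: real
  assumes \<kappa>: "unitary_character \<kappa>" and lam: "lam > 0"
begin

text \<open>\<open>Blinfun\<close> returns the intended functional only for a bounded linear map, so
  the Frechet derivative of the character has to exist. This is where smoothness of characters
  enters.\<close>

lemma psi_apply: "blinfun_apply (psi \<alpha> \<kappa> lam z) (t, u, c) =
   Re (- \<i> * frechet_derivative \<kappa> (at 0) t) + 1 / 2 * (\<Sum>k\<in>UNIV. (1 - lam * (cmod (z $ k))\<^sup>2) * \<alpha> k t)
   + omegaR (- lam *\<^sub>R z) u + c * lam"
proof -
  obtain D where "(\<kappa> has_derivative D) (at 0)" using unitary_character_has_derivative[OF \<kappa>] by blast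
  then have D: "linear (frechet_derivative \<kappa> (at 0))"
    by (metis frechet_derivative_at has_derivative_linear)
  define S where "S t = (\<Sum>k\<in>UNIV. (1 - lam * (cmod (z $ k))\<^sup>2) * \<alpha> k t)" for t
  have S: "S (t + t') = S t + S t'" "S (r *\<^sub>R t) = r * S t" for t t' r
    by (simp add: S_def linear_add[OF \<alpha>] distrib_left sum.distrib)
      (simp add: S_def linear_scale[OF \<alpha>] sum_distrib_left mult_ac)
  have "linear (\<lambda>(t, u, c). Re (- \<i> * frechet_derivative \<kappa> (at 0) t)
      + 1 / 2 * S t + omegaR (- lam *\<^sub>R z) u + c * lam)"
    by (rule linearI)
      (auto simp: linear_add[OF D] linear_scale[OF D] S omegaR_simps algebra_simps)
  then show ?thesis
    unfolding psi_def dual_elt_def S_def by (subst bounded_linear_Blinfun_apply) (auto simp: linear_conv_bounded_linear)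
qed

lemma coad_psi: "coad \<alpha> g (psi \<alpha> \<kappa> lam z) = psi \<alpha> \<kappa> lam (act_complex \<alpha> g z)"
proof -
  obtain t0 z0 c0 where g: "g = (t0, z0, c0)" by (metis prod_cases3)
  \<comment> \<open>The point that g moves to 0, and also the vector component of the inverse of g.
    In terms of it g translates by -\<zeta> and then rotates.\<close>
  define \<zeta> where "\<zeta> = - rot \<alpha> (- t0) z0"
  have r: "act_complex \<alpha> g z = rot \<alpha> t0 (z - \<zeta>)"
    by (simp add: g \<zeta>_def rot_minus[OF \<alpha>])
  have cm: "(cmod (act_complex \<alpha> g z $ k))\<^sup>2 = (cmod (z $ k))\<^sup>2 - 2 * Re (cnj (z $ k) * \<zeta> $ k) + (cmod (\<zeta> $ k))\<^sup>2" for k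
  proof -
    have "act_complex \<alpha> g z $ k = exp (\<i> * complex_of_real (\<alpha> k t0)) * (z $ k - \<zeta> $ k)"
      by (simp add: r right_diff_distrib)
    then have "cmod (act_complex \<alpha> g z $ k) = cmod (z $ k - \<zeta> $ k)"
      by (simp add: norm_mult)
    then show ?thesis by (simp add: cmod_power2 power2_diff algebra_simps)
  qed
  have ap: "blinfun_apply (psi \<alpha> \<kappa> lam z) (Ad \<alpha> (inv\<^bsub>diamond \<alpha>\<^esub> g) (t, u, c)) =
     Re (- \<i> * frechet_derivative \<kappa> (at 0) t)
     + 1 / 2 * (\<Sum>k\<in>UNIV. (1 - lam * (cmod (act_complex \<alpha> g z $ k))\<^sup>2) * \<alpha> k t)
     + omegaR (- lam *\<^sub>R act_complex \<alpha> g z) u + c * lam" for t u c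
  proof -
    have A: "Ad \<alpha> (inv\<^bsub>diamond \<alpha>\<^esub> g) (t, u, c) = (t, rot \<alpha> (- t0) u - lie_act \<alpha> t \<zeta>,
       c + omegaR \<zeta> (rot \<alpha> (- t0) u) - 1 / 2 * omegaR \<zeta> (lie_act \<alpha> t \<zeta>))"
      using omegaR_commute[of "rot \<alpha> (- t0) u" \<zeta>]
      by (simp add: g inv_diamond[OF \<alpha>] Ad_eq \<zeta>_def[symmetric] field_simps)
    have w: "omegaR (- lam *\<^sub>R act_complex \<alpha> g z) u = - lam * omegaR (z - \<zeta>) (rot \<alpha> (- t0) u)"
      unfolding r using omegaR_rot[of \<alpha> t0 "z - \<zeta>" "rot \<alpha> (- t0) u"] by (simp add: rot_minus[OF \<alpha>] omegaR_simps)
    have q: "omegaR \<zeta> (lie_act \<alpha> t \<zeta>) = (\<Sum>k\<in>UNIV. \<alpha> k t * (cmod (\<zeta> $ k))\<^sup>2)"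
    proof -
      have "Re (cnj w * w) = (cmod w)\<^sup>2" for w by (simp only: cmod_power2) (simp add: power2_eq_square)
      then show ?thesis unfolding omegaR_lie_act by simp
    qed
    \<comment> \<open>The mixed and the pure \<zeta> terms in the squared moduli are exactly the
      \<open>lie_act\<close> terms of the adjoint action; this match forces the quadratic component
      of \<open>psi\<close>.\<close>
    have "(\<Sum>k\<in>UNIV. (1 - lam * (cmod (act_complex \<alpha> g z $ k))\<^sup>2) * \<alpha> k t)
      = (\<Sum>k\<in>UNIV. (1 - lam * (cmod (z $ k))\<^sup>2) * \<alpha> k t) + 2 * lam * omegaR z (lie_act \<alpha> t \<zeta>) - lam * omegaR \<zeta> (lie_act \<alpha> t \<zeta>)"
      unfolding q unfolding omegaR_lie_act cm sum_distrib_left sum.distrib[symmetric] sum_subtractf[symmetric]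
      by (intro sum.cong refl) (simp add: algebra_simps)
    then show ?thesis
      unfolding A psi_apply w by (simp add: omegaR_simps algebra_simps)
  qed
  have "(\<lambda>X. blinfun_apply (psi \<alpha> \<kappa> lam z) (Ad \<alpha> (inv\<^bsub>diamond \<alpha>\<^esub> g) X)) = blinfun_apply (psi \<alpha> \<kappa> lam (act_complex \<alpha> g z))"
    by (auto simp: fun_eq_iff ap psi_apply)
  then show ?thesis by (simp add: coad_def blinfun_apply_inverse)
qed

lemma coadjoint_orbit_eq: "coadjoint_orbit \<alpha> \<kappa> lam = range (psi \<alpha> \<kappa> lam)"
proof -
  have "psi \<alpha> \<kappa> lam z = coad \<alpha> (0, z, 0) (psi \<alpha> \<kappa> lam 0)" for z by (simp add: coad_psi)
  then show ?thesis
    unfolding coadjoint_orbit_def Group_Action.orbit_def by (auto simp: coad_psi)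
qed

text \<open>Evaluation on the directions i and 1 of each coordinate reads off the real and imaginary
  parts of z. Being defined by evaluations on the whole dual, it is visibly continuous, as the
  transport requires.\<close>

definition psi_inverse :: "('m, 'n) diamond_dual \<Rightarrow> (real^'n) \<times> (real^'n)" where
  "psi_inverse \<xi> = (\<chi> k. - blinfun_apply \<xi> (0, axis k \<i>, 0) / lam, \<chi> k. blinfun_apply \<xi> (0, axis k 1, 0) / lam)"

lemma psi_inverse: "psi_inverse (psi \<alpha> \<kappa> lam (cplx p)) = p"
proof -
  have f0: "frechet_derivative \<kappa> (at 0) 0 = 0"
  proof -
    obtain D where "(\<kappa> has_derivative D) (at 0)" using unitary_character_has_derivative[OF \<kappa>] by blast
    then have "linear (frechet_derivative \<kappa> (at 0))"
      by (metis frechet_derivative_at has_derivative_linear)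
    then show ?thesis by (rule linear_0)
  qed
  have b: "bil w (axis k c) = w $ k * c" for w :: "complex^'n" and k c
    by (simp add: bil_def axis_def if_distrib cong: if_cong)
  have "blinfun_apply (psi \<alpha> \<kappa> lam (cplx p)) (0, axis k c, 0) = - lam * Im (cnj (cplx p $ k) * c)" for k c
    by (simp add: psi_apply f0 linear_0[OF \<alpha>] omegaR_simps omegaR_eq b)
  then show ?thesis using lam by (simp add: psi_inverse_def prod_eq_iff vec_eq_iff)
qed

lemma continuous_on_psi: "continuous_on UNIV (psi \<alpha> \<kappa> lam)"
proof (rule continuous_on_blinfun_componentwise)
  fix X :: "('m, 'n) diamond"
  obtain t u c where X: "X = (t, u, c)" by (metis prod_cases3)
  show "continuous_on UNIV (\<lambda>z. blinfun_apply (psi \<alpha> \<kappa> lam z) X)"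
    unfolding X psi_apply by (intro continuous_intros)
qed

lemma continuous_on_psi_inverse: "continuous_on S psi_inverse"
  unfolding psi_inverse_def using lam by (intro continuous_intros) auto

lemma stratonovich_weyl_W1':
  "stratonovich_weyl (diamond \<alpha>) (schrodinger_rep \<alpha> \<kappa> lam) (act_orbit \<alpha> \<kappa> lam) (nu \<alpha> \<kappa> lam) (W1' \<alpha> \<kappa> lam)"
proof -
  let ?\<Phi> = "psi \<alpha> \<kappa> lam \<circ> cplx"
  have R: "range ?\<Phi> = coadjoint_orbit \<alpha> \<kappa> lam"
    unfolding coadjoint_orbit_eq image_comp[symmetric] bij_is_surj[OF bij_cplx] ..
  have \<Phi>: "continuous_on UNIV ?\<Phi>"
    unfolding o_def by (intro continuous_on_compose2[OF continuous_on_psi] continuous_intros) auto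
  \<comment> \<open>\<open>nu\<close> is the image of the measure on complex space; passing through
    \<open>cplx\<close> gives it the form of a transported measure.\<close>
  have nu: "nu \<alpha> \<kappa> lam = distr (mu_real lam) (restrict_space borel (range ?\<Phi>)) ?\<Phi>"
  proof -
    have "psi \<alpha> \<kappa> lam \<in> measurable borel (restrict_space borel (coadjoint_orbit \<alpha> \<kappa> lam))"
      by (intro measurable_restrict_space2 borel_measurable_continuous_onI continuous_on_psi)
        (auto simp: coadjoint_orbit_eq)
    moreover have "cplx \<in> measurable (mu_real lam) borel"
      using borel_measurable_continuous_onI[OF continuous_on_cplx[OF continuous_on_id]] by (simp add: mu_real_def)
    ultimately show ?thesis
      unfolding nu_def R distr_mu_real_cplx[symmetric] by (rule distr_distr)
  qed
  have "stratonovich_weyl (diamond \<alpha>) (schrodinger_rep \<alpha> \<kappa> lam) (act_orbit \<alpha> \<kappa> lam)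
    (distr (mu_real lam) (restrict_space borel (range ?\<Phi>)) ?\<Phi>) (\<lambda>A. W1 lam A \<circ> inv_into UNIV ?\<Phi>)"
  proof (rule stratonovich_weyl_transport[OF stratonovich_weyl_W1[OF \<alpha> \<kappa> lam] _ \<Phi> continuous_on_psi_inverse])
    show "space (mu_real lam) = UNIV" by (simp add: mu_real_def)
    show "psi_inverse (?\<Phi> x) = x" for x by (simp add: psi_inverse)
    show "act_orbit \<alpha> \<kappa> lam g (?\<Phi> x) = ?\<Phi> (act_real \<alpha> g x)" for g x
      by (simp add: act_orbit_def coadjoint_orbit_eq coad_psi cplx_act_real[OF \<alpha>])
    show "act_orbit \<alpha> \<kappa> lam g \<in> extensional (range ?\<Phi>)" for g
      unfolding R by (simp add: act_orbit_def)
  qed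
  moreover have "(\<lambda>A. W1 lam A \<circ> inv_into UNIV ?\<Phi>) = W1' \<alpha> \<kappa> lam"
    by (simp add: W1'_def fun_eq_iff)
  ultimately show ?thesis by (simp only: nu)
qed

end

end

theorem proposition8p3:
  fixes \<alpha> :: "'n::finite \<Rightarrow> real^'m::finite \<Rightarrow> real"
    and \<kappa> :: "real^'m \<Rightarrow> complex"
    and lam :: real
  assumes "\<And>k. linear (\<alpha> k)"
    and "lam > 0"
    and "unitary_character \<kappa>"
  shows "stratonovich_weyl (diamond \<alpha>) (schrodinger_rep \<alpha> \<kappa> lam) (act_real \<alpha>) (mu_real lam) (W1 lam)
    \<and> stratonovich_weyl (diamond \<alpha>) (schrodinger_rep \<alpha> \<kappa> lam) (act_orbit \<alpha> \<kappa> lam) (nu \<alpha> \<kappa> lam)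
        (W1' \<alpha> \<kappa> lam)"
  using assms by (intro conjI stratonovich_weyl_W1 stratonovich_weyl_W1')

end
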